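(* Let $N\ge 1$ be an integer and let $V:\mathbb{R}\times\mathbb{R}^d\to\mathbb{R}$ satisfy $\partial_t^k\partial_x^\alpha V\in C^0_b(\mathbb{R},M^{\infty,1}(\mathbb{R}^d))$ for all $k\in\mathbb{N}$, $\alpha\in\mathbb{N}^d$ with $2k+|\alpha|\le 2N$. For every $T>0$ there exists a constant $C=C(T)>0$ such that, for all $0<\hbar\le 1$, all $s<t$ with $0<t-s\le T\hbar$, and any subdivision $\Omega: s=t_0<t_1<\dots<t_L=t$ of $[s,t]$, with $\omega(\Omega):=\sup\{t_j-t_{j-1}: j=1,\dots,L\}$, $$\|E^{(N)}(\Omega,t,s)-U(t,s)\|_{L^2(\mathbb{R}^d)\to L^2(\mathbb{R}^d)}\le C\,\omega(\Omega)^N .$$ Here $U(t,s)$ is the propagator of the Schr\"odinger equation with potential $V$, and $E^{(N)}(\Omega,t,s)=E^{(N)}(t,t_{L-1})E^{(N)}(t_{L-1},t_{L-2})\cdots E^{(N)}(t_1,s)$ is the composition of the short-time approximate propagators $E^{(N)}$ defined in the context.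
   Context: $\mathbb{N}=\{0,1,2,\dots\}$. For a Banach space $X$, $C^0_b(\mathbb{R},X)$ is the space of continuous bounded functions $\mathbb{R}\to X$. Sj\"ostrand class: fix $g\in\mathcal{S}(\mathbb{R}^n)\setminus\{0\}$; for $f\in\mathcal{S}'(\mathbb{R}^n)$ let $V_gf(x,\omega)=\int_{\mathbb{R}^n} f(y)\overline{g(y-x)}e^{-2\pi i y\cdot\omega}\,dy$ (in the distributional sense). $M^{\infty,1}(\mathbb{R}^n)$ is the Banach space of $f\in\mathcal{S}'(\mathbb{R}^n)$ with $\|f\|_{M^{\infty,1}}=\int_{\mathbb{R}^n}\sup_{x\in\mathbb{R}^n}|V_gf(x,\omega)|\,d\omega<\infty$; different $g$ give equivalent norms, and $M^{\infty,1}(\mathbb{R}^n)\subset L^\infty(\mathbb{R}^n)$. Propagator: $U(t,s)$ is the unitary operator on $L^2(\mathbb{R}^d)$ sending $u_0$ to the value at time $t$ of the solution of $i\hbar\partial_t u=-\tfrac12\hbar^2\Delta u+V(t,x)u$, $u(s,\cdot)=u_0$ (the Cauchy problem is globally well-posed in $L^2$). Approximate action: for fixed $s\in\mathbb{R}$ and $\hbar\in(0,1]$ define recursively $W_0=0$ and, for $1\le k\le N$, $x,y\in\mathbb{R}^d$, $$F_k(x,y)=-\frac12\sum_{j+\ell=k-1,\ j\ge1,\ \ell\ge1}\nabla_xW_j\cdot\nabla_xW_\ell-\frac{1}{(k-1)!}\partial_t^{k-1}V(s,x)+\frac{i\hbar}{2}\Delta_xW_{k-1},$$ $$W_k(x,y)=\int_0^1\tau^{k-1}F_k(\tau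 x+(1-\tau)y,y)\,d\tau .$$ ($W_k$ depends also on $s$ and $\hbar$; it is complex-valued in general, and the dot is the bilinear product.) Set $$S^{(N)}(t,s,x,y)=\frac{|x-y|^2}{2(t-s)}+\sum_{k=1}^N W_k(x,y)(t-s)^k .$$ Short-time approximate propagator: for $s<t$, $$E^{(N)}(t,s)f(x)=\frac{1}{(2\pi i(t-s)\hbar)^{d/2}}\int_{\mathbb{R}^d}e^{\frac{i}{\hbar}S^{(N)}(t,s,x,y)}f(y)\,dy,$$ defined first for $f\in\mathcal{S}(\mathbb{R}^d)$ and extended by density to a bounded operator on $L^2(\mathbb{R}^d)$; here $i^{d/2}=e^{i\pi d/4}$. *)

theory Defs
  imports "HOL-Analysis.Analysis"
begin

section \<open>The Hilbert space \<open>L\<^sup>2(\<real>\<^sup>d)\<close>\<close>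

definition sq_integrable :: "(real^'n \<Rightarrow> complex) \<Rightarrow> bool" where
  "sq_integrable f \<longleftrightarrow>
     f \<in> borel_measurable lborel \<and> integrable lborel (\<lambda>x. (cmod (f x))\<^sup>2)"

definition l2_rel :: "(real^'n \<Rightarrow> complex) \<Rightarrow> (real^'n \<Rightarrow> complex) \<Rightarrow> bool" where
  "l2_rel f g \<longleftrightarrow> sq_integrable f \<and> sq_integrable g \<and> (AE x in lborel. f x = g x)"

lemma sq_integrable_zero: "sq_integrable (\<lambda>x. 0)"
  by (simp add: sq_integrable_def)

lemma sq_integrable_scaleR: "sq_integrable f \<Longrightarrow> sq_integrable (\<lambda>x. c *\<^sub>R f x)"
  by (auto simp: sq_integrable_def power_mult_distrib)

lemma sq_integrable_add:
  assumes "sq_integrable f" "sq_integrable g"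
  shows "sq_integrable (\<lambda>x. f x + g x)"
proof -
  have m: "f \<in> borel_measurable borel" "g \<in> borel_measurable borel"
    using assms by (auto simp: sq_integrable_def)
  have i: "integrable lborel (\<lambda>x. 2 * (cmod (f x))\<^sup>2 + 2 * (cmod (g x))\<^sup>2)"
    using assms by (auto simp: sq_integrable_def)
  have b: "(cmod (f x + g x))\<^sup>2 \<le> 2 * (cmod (f x))\<^sup>2 + 2 * (cmod (g x))\<^sup>2" for x
  proof -
    have "(cmod (f x + g x))\<^sup>2 \<le> (cmod (f x) + cmod (g x))\<^sup>2"
      by (intro power_mono norm_triangle_ineq norm_ge_zero)
    also have "\<dots> \<le> 2 * (cmod (f x))\<^sup>2 + 2 * (cmod (g x))\<^sup>2"
      using sum_squares_bound[of "cmod (f x)" "cmod (g x)"] by (simp add: power2_sum)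
    finally show ?thesis .
  qed
  have "integrable lborel (\<lambda>x. (cmod (f x + g x))\<^sup>2)"
  proof (rule Bochner_Integration.integrable_bound[OF i])
    show "(\<lambda>x. (cmod (f x + g x))\<^sup>2) \<in> borel_measurable lborel"
      using m by measurable
    show "AE x in lborel. norm ((cmod (f x + g x))\<^sup>2)
        \<le> norm (2 * (cmod (f x))\<^sup>2 + 2 * (cmod (g x))\<^sup>2)"
      using b by (intro AE_I2) (simp add: abs_of_nonneg)
  qed
  moreover have "(\<lambda>x. f x + g x) \<in> borel_measurable lborel" using m by measurable
  ultimately show ?thesis by (simp add: sq_integrable_def)
qed

lemma integrable_inner_sq_integrable:
  assumes "sq_integrable f" "sq_integrable g"
  shows "integrable lborel (\<lambda>x. f x \<bullet> g x)"
proof -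
  have m: "f \<in> borel_measurable borel" "g \<in> borel_measurable borel"
    using assms by (auto simp: sq_integrable_def)
  have i: "integrable lborel (\<lambda>x. (cmod (f x))\<^sup>2 + (cmod (g x))\<^sup>2)"
    using assms unfolding sq_integrable_def by (intro Bochner_Integration.integrable_add) auto
  have b: "\<bar>f x \<bullet> g x\<bar> \<le> (cmod (f x))\<^sup>2 + (cmod (g x))\<^sup>2" for x
  proof -
    have "\<bar>f x \<bullet> g x\<bar> \<le> cmod (f x) * cmod (g x)" by (rule Cauchy_Schwarz_ineq2)
    moreover have "2 * (cmod (f x) * cmod (g x)) \<le> (cmod (f x))\<^sup>2 + (cmod (g x))\<^sup>2"
      using sum_squares_bound[of "cmod (f x)" "cmod (g x)"] by (simp add: mult.assoc)
    moreover have "0 \<le> cmod (f x) * cmod (g x)" by simp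
    ultimately show ?thesis by linarith
  qed
  show ?thesis
  proof (rule Bochner_Integration.integrable_bound[OF i])
    show "(\<lambda>x. f x \<bullet> g x) \<in> borel_measurable lborel" using m by measurable
    show "AE x in lborel. norm (f x \<bullet> g x) \<le> norm ((cmod (f x))\<^sup>2 + (cmod (g x))\<^sup>2)"
      using b by (intro AE_I2) (simp add: abs_of_nonneg)
  qed
qed

quotient_type (overloaded) 'n L2 = "real^('n::finite) \<Rightarrow> complex" / partial: l2_rel
proof (rule part_equivpI)
  show "\<exists>f::real^'n \<Rightarrow> complex. l2_rel f f"
    using sq_integrable_zero by (auto simp: l2_rel_def)
  show "symp (l2_rel :: (real^'n \<Rightarrow> complex) \<Rightarrow> _)"
    by (auto simp: symp_def l2_rel_def)
  show "transp (l2_rel :: (real^'n \<Rightarrow> complex) \<Rightarrow> _)"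
    unfolding transp_def l2_rel_def by (auto elim: AE_mp)
qed

instantiation L2 :: (finite) real_inner
begin

lift_definition zero_L2 :: "'a L2" is "\<lambda>x. 0"
  by (simp add: l2_rel_def sq_integrable_zero)

lift_definition scaleR_L2 :: "real \<Rightarrow> 'a L2 \<Rightarrow> 'a L2" is "\<lambda>c f x. c *\<^sub>R f x"
  by (auto simp: l2_rel_def sq_integrable_scaleR)

lift_definition plus_L2 :: "'a L2 \<Rightarrow> 'a L2 \<Rightarrow> 'a L2" is "\<lambda>f g x. f x + g x"
  unfolding l2_rel_def by (auto simp: sq_integrable_add)

definition uminus_L2 :: "'a L2 \<Rightarrow> 'a L2" where "uminus_L2 u = (-1) *\<^sub>R u"

definition minus_L2 :: "'a L2 \<Rightarrow> 'a L2 \<Rightarrow> 'a L2" where "minus_L2 u v = u + (- v)"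

text \<open>The real part of the usual complex inner product.\<close>
lift_definition inner_L2 :: "'a L2 \<Rightarrow> 'a L2 \<Rightarrow> real"
  is "\<lambda>f g. integral\<^sup>L lborel (\<lambda>x. f x \<bullet> g x)"
  unfolding l2_rel_def
  by (rule integral_cong_AE) (auto simp: sq_integrable_def intro: borel_measurable_inner)

lift_definition norm_L2 :: "'a L2 \<Rightarrow> real"
  is "\<lambda>f. sqrt (integral\<^sup>L lborel (\<lambda>x. (cmod (f x))\<^sup>2))"
  unfolding l2_rel_def
  by (intro arg_cong[where f = sqrt] integral_cong_AE) (auto simp: sq_integrable_def)

definition dist_L2 :: "'a L2 \<Rightarrow> 'a L2 \<Rightarrow> real" where "dist_L2 u v = norm (u - v)"

definition sgn_L2 :: "'a L2 \<Rightarrow> 'a L2" where "sgn_L2 u = inverse (norm u) *\<^sub>R u"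

definition uniformity_L2 :: "('a L2 \<times> 'a L2) filter" where
  "uniformity_L2 = (INF e\<in>{0 <..}. principal {(u, v). dist u v < e})"

definition open_L2 :: "'a L2 set \<Rightarrow> bool" where
  "open_L2 S \<longleftrightarrow> (\<forall>u\<in>S. \<forall>\<^sub>F (u', v) in uniformity. u' = u \<longrightarrow> v \<in> S)"

instance
proof
  fix u v w :: "'a L2" and a b :: real
  show assoc: "u + v + w = u + (v + w)" for u v w :: "'a L2"
    by transfer (auto simp: l2_rel_def sq_integrable_add add.assoc)
  show "u + v = v + u"
    by transfer (auto simp: l2_rel_def sq_integrable_add add.commute)
  show "0 + u = u"
    by transfer (auto simp: l2_rel_def)
  show "- u + u = 0" unfolding uminus_L2_def
    by transfer (auto simp: l2_rel_def sq_integrable_zero)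
  show "u - v = u + - v" by (simp add: minus_L2_def)
  show "a *\<^sub>R (u + v) = a *\<^sub>R u + a *\<^sub>R v"
    by transfer (auto simp: l2_rel_def scaleR_add_right
        intro!: sq_integrable_scaleR sq_integrable_add)
  show "(a + b) *\<^sub>R u = a *\<^sub>R u + b *\<^sub>R u"
    by transfer (auto simp: l2_rel_def scaleR_add_left
        intro!: sq_integrable_scaleR sq_integrable_add)
  show "a *\<^sub>R b *\<^sub>R u = (a * b) *\<^sub>R u"
    by transfer (auto simp: l2_rel_def intro!: sq_integrable_scaleR)
  show "1 *\<^sub>R u = u"
    by transfer (auto simp: l2_rel_def)
  show "dist u v = norm (u - v)" by (simp add: dist_L2_def)
  show "sgn u = inverse (norm u) *\<^sub>R u" by (simp add: sgn_L2_def)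
  show "uniformity = (INF e\<in>{0 <..}. principal {(u, v :: 'a L2). dist u v < e})"
    by (simp add: uniformity_L2_def)
  show "open S \<longleftrightarrow> (\<forall>u\<in>S. \<forall>\<^sub>F (u', v) in uniformity. u' = u \<longrightarrow> v \<in> S)" for S :: "'a L2 set"
    by (simp add: open_L2_def)
  show "u \<bullet> v = v \<bullet> u"
    by transfer (simp add: inner_commute)
  show "(u + v) \<bullet> w = u \<bullet> w + v \<bullet> w"
    by transfer (simp add: l2_rel_def inner_add_left integrable_inner_sq_integrable)
  show "a *\<^sub>R u \<bullet> v = a * (u \<bullet> v)"
    by transfer (simp add: inner_scaleR_left)
  show "0 \<le> u \<bullet> u"
    by transfer simp
  show "u \<bullet> u = 0 \<longleftrightarrow> u = 0"
  proof transfer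
    fix f :: "real^'a \<Rightarrow> complex"
    assume "l2_rel f f"
    then have f: "sq_integrable f" by (simp add: l2_rel_def)
    have "integral\<^sup>L lborel (\<lambda>x. f x \<bullet> f x) = 0 \<longleftrightarrow> (AE x in lborel. f x \<bullet> f x = 0)"
      by (rule integral_nonneg_eq_0_iff_AE[OF integrable_inner_sq_integrable[OF f f]]) simp
    then show "integral\<^sup>L lborel (\<lambda>x. f x \<bullet> f x) = 0 \<longleftrightarrow> l2_rel f (\<lambda>x. 0)"
      using f by (simp add: l2_rel_def sq_integrable_zero)
  qed
  show "norm u = sqrt (u \<bullet> u)"
    by transfer (simp add: power2_norm_eq_inner)
qed

end


section \<open>Schwartz functions and tempered distributions\<close>

definition pd :: "'n \<Rightarrow> (real^'n \<Rightarrow> 'b::real_normed_vector) \<Rightarrow> real^'n \<Rightarrow> 'b" where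
  "pd i f x = vector_derivative (\<lambda>h. f (x + h *\<^sub>R axis i 1)) (at 0)"

definition laplacian :: "(real^'n \<Rightarrow> complex) \<Rightarrow> real^'n \<Rightarrow> complex" where
  "laplacian f x = (\<Sum>i\<in>UNIV. pd i (pd i f) x)"

text \<open>The derivatives \<open>\<partial>\<^sup>\<alpha> f\<close> are enumerated by lists of coordinate indices instead of multi-indices
  \<open>\<alpha>\<close>: the list \<open>[i\<^sub>1, \<dots>, i\<^sub>k]\<close> gives \<open>\<partial>\<^bsub>i\<^sub>1\<^esub> \<dots> \<partial>\<^bsub>i\<^sub>k\<^esub> f\<close>.\<close>
definition pds :: "'n list \<Rightarrow> (real^'n \<Rightarrow> complex) \<Rightarrow> real^'n \<Rightarrow> complex" where
  "pds is f = foldr pd is f"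

definition schwartz :: "(real^'n \<Rightarrow> complex) set" where
  "schwartz = {f. \<forall>is. (\<forall>x. pds is f differentiable (at x)) \<and>
                       (\<forall>m::nat. \<exists>B. \<forall>x. norm x ^ m * cmod (pds is f x) \<le> B)}"

definition schwartz_seminorm :: "nat \<Rightarrow> (real^'n \<Rightarrow> complex) \<Rightarrow> real" where
  "schwartz_seminorm m f =
     (\<Sum>is\<in>{is. length is \<le> m}. SUP x. (1 + norm x) ^ m * cmod (pds is f x))"

text \<open>A distribution is a functional on all functions, of which only the values on
  \<open>schwartz\<close> are relevant.\<close>
definition tempered :: "((real^'n \<Rightarrow> complex) \<Rightarrow> complex) set" where
  "tempered = {F.
     (\<forall>\<phi>\<in>schwartz. \<forall>\<psi>\<in>schwartz. F (\<lambda>x. \<phi> x + \<psi> x) = F \<phi> + F \<psi>) \<and>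
     (\<forall>c. \<forall>\<phi>\<in>schwartz. F (\<lambda>x. c * \<phi> x) = c * F \<phi>) \<and>
     (\<exists>C m. \<forall>\<phi>\<in>schwartz. cmod (F \<phi>) \<le> C * schwartz_seminorm m \<phi>)}"

definition distr_of :: "(real^'n \<Rightarrow> complex) \<Rightarrow> (real^'n \<Rightarrow> complex) \<Rightarrow> complex" where
  "distr_of f \<phi> = integral\<^sup>L lborel (\<lambda>x. f x * \<phi> x)"


section \<open>The Sjoestrand class\<close>

definition stft ::
  "(real^'n \<Rightarrow> complex) \<Rightarrow> ((real^'n \<Rightarrow> complex) \<Rightarrow> complex) \<Rightarrow> real^'n \<Rightarrow> real^'n \<Rightarrow> complex" where
  "stft g F x \<omega> = F (\<lambda>y. cnj (g (y - x)) * exp (- 2 * of_real pi * \<i> * of_real (y \<bullet> \<omega>)))"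

definition sjostrand_norm ::
  "(real^'n \<Rightarrow> complex) \<Rightarrow> ((real^'n \<Rightarrow> complex) \<Rightarrow> complex) \<Rightarrow> ennreal" where
  "sjostrand_norm g F = (\<integral>\<^sup>+\<omega>. (SUP x. ennreal (cmod (stft g F x \<omega>))) \<partial>lborel)"

definition sjostrand :: "(real^'n \<Rightarrow> complex) \<Rightarrow> ((real^'n \<Rightarrow> complex) \<Rightarrow> complex) set" where
  "sjostrand g = {F \<in> tempered. sjostrand_norm g F < \<infinity>}"

text \<open>\<open>f \<in> C\<^sup>0\<^sub>b(\<real>, M\<^sup>\<infinity>\<^sup>,\<^sup>1)\<close> for a function \<open>f\<close> of \<open>(t, x)\<close>. Elements of \<open>M\<^sup>\<infinity>\<^sup>,\<^sup>1\<close> are bounded and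
  have a continuous representative, and \<open>f t\<close> is required to be this representative.\<close>
definition cb_sjostrand :: "(real^'n \<Rightarrow> complex) \<Rightarrow> (real \<Rightarrow> real^'n \<Rightarrow> real) \<Rightarrow> bool" where
  "cb_sjostrand g f \<longleftrightarrow>
     (\<forall>t. continuous_on UNIV (f t) \<and> bounded (range (f t)) \<and>
          distr_of (\<lambda>x. of_real (f t x)) \<in> sjostrand g) \<and>
     (\<forall>t. ((\<lambda>t'. sjostrand_norm g (distr_of (\<lambda>x. of_real (f t' x - f t x)))) \<longlongrightarrow> 0) (at t)) \<and>
     (\<exists>B::real. \<forall>t. sjostrand_norm g (distr_of (\<lambda>x. of_real (f t x))) \<le> ennreal B)"

text \<open>\<open>D k \<alpha>\<close> is the derivative \<open>\<partial>\<^sub>t\<^sup>k \<partial>\<^sub>x\<^sup>\<alpha> V\<close>; the two derivative conditions determine it uniquely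
  for \<open>2k + |\<alpha>| \<le> 2N\<close>.\<close>
definition admissible_potential ::
  "(real^'n \<Rightarrow> complex) \<Rightarrow> nat \<Rightarrow> (real \<Rightarrow> real^'n \<Rightarrow> real) \<Rightarrow> bool" where
  "admissible_potential g N V \<longleftrightarrow> (\<exists>D :: nat \<Rightarrow> ('n \<Rightarrow> nat) \<Rightarrow> real \<Rightarrow> real^'n \<Rightarrow> real.
     D 0 (\<lambda>_. 0) = V \<and>
     (\<forall>k \<alpha> t x. 2 * Suc k + (\<Sum>i\<in>UNIV. \<alpha> i) \<le> 2 * N \<longrightarrow>
        ((\<lambda>\<tau>. D k \<alpha> \<tau> x) has_real_derivative D (Suc k) \<alpha> t x) (at t)) \<and>
     (\<forall>k \<alpha> j t x. 2 * k + Suc (\<Sum>i\<in>UNIV. \<alpha> i) \<le> 2 * N \<longrightarrow>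
        ((\<lambda>h. D k \<alpha> t (x + h *\<^sub>R axis j 1)) has_real_derivative D k (\<alpha>(j := Suc (\<alpha> j))) t x)
          (at 0)) \<and>
     (\<forall>k \<alpha>. 2 * k + (\<Sum>i\<in>UNIV. \<alpha> i) \<le> 2 * N \<longrightarrow> cb_sjostrand g (D k \<alpha>)))"


section \<open>The Schroedinger propagator\<close>

definition l2_pairing :: "('n::finite) L2 \<Rightarrow> (real^'n \<Rightarrow> complex) \<Rightarrow> complex" where
  "l2_pairing u \<phi> = integral\<^sup>L lborel (\<lambda>x. rep_L2 u x * \<phi> x)"

text \<open>\<open>u \<in> C(\<real>, L\<^sup>2)\<close> with \<open>u(s) = u\<^sub>0\<close> solves \<open>i \<hbar> \<partial>\<^sub>t u = - \<hbar>\<^sup>2 / 2 \<Delta>u + V u\<close> in the sense of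
  distributions. For continuous \<open>u\<close> this is the equation tested against functions of \<open>x\<close> alone.\<close>
definition schrodinger_solution ::
  "real \<Rightarrow> (real \<Rightarrow> real^'n \<Rightarrow> real) \<Rightarrow> real \<Rightarrow> ('n::finite) L2 \<Rightarrow> (real \<Rightarrow> 'n L2) \<Rightarrow> bool" where
  "schrodinger_solution hbar V s u\<^sub>0 u \<longleftrightarrow>
     continuous_on UNIV u \<and> u s = u\<^sub>0 \<and>
     (\<forall>\<phi>\<in>schwartz. \<forall>t. \<exists>D.
        ((\<lambda>\<tau>. l2_pairing (u \<tau>) \<phi>) has_vector_derivative D) (at t) \<and>
        \<i> * of_real hbar * D =
          l2_pairing (u t) (\<lambda>x. - of_real (hbar\<^sup>2 / 2) * laplacian \<phi> x + of_real (V t x) * \<phi> x))"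

definition propagator ::
  "real \<Rightarrow> (real \<Rightarrow> real^'n \<Rightarrow> real) \<Rightarrow> real \<Rightarrow> real \<Rightarrow> ('n::finite) L2 \<Rightarrow> 'n L2" where
  "propagator hbar V t s u\<^sub>0 = (THE u. schrodinger_solution hbar V s u\<^sub>0 u) t"


section \<open>The approximate action and the approximate propagators\<close>

text \<open>\<open>action_F\<close> and \<open>action_W\<close> are the functions \<open>F\<^sub>k\<close> and \<open>W\<^sub>k\<close>; the value \<open>F\<^sub>0 = 0\<close> is never used.\<close>

function action_F ::
    "real \<Rightarrow> (real \<Rightarrow> real^'n \<Rightarrow> real) \<Rightarrow> real \<Rightarrow> nat \<Rightarrow> real^'n \<Rightarrow> real^'n \<Rightarrow> complex"
  and action_W ::
    "real \<Rightarrow> (real \<Rightarrow> real^'n \<Rightarrow> real) \<Rightarrow> real \<Rightarrow> nat \<Rightarrow> real^'n \<Rightarrow> real^'n \<Rightarrow> complex" where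
  "action_F hbar V s 0 x y = 0"
| "action_F hbar V s (Suc m) x y =
     - (1 / 2) * (\<Sum>(j, l)\<in>{(j, l). j + l = m \<and> 1 \<le> j \<and> 1 \<le> l}. \<Sum>i\<in>UNIV.
          pd i (\<lambda>z. action_W hbar V s j z y) x * pd i (\<lambda>z. action_W hbar V s l z y) x)
     - of_real (1 / fact m * (deriv ^^ m) (\<lambda>\<tau>. V \<tau> x) s)
     + \<i> * of_real hbar / 2 * laplacian (\<lambda>z. action_W hbar V s m z y) x"
| "action_W hbar V s 0 x y = 0"
| "action_W hbar V s (Suc m) x y =
     integral {0..1} (\<lambda>\<tau>::real.
       of_real (\<tau> ^ m) * action_F hbar V s (Suc m) (\<tau> *\<^sub>R x + (1 - \<tau>) *\<^sub>R y) y)"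
  by pat_completeness auto
termination
  by (relation "Wellfounded.measure (case_sum (\<lambda>(hbar, V, s, k, x, y). 2 * k)
        (\<lambda>(hbar, V, s, k, x, y). 2 * k + 1))") auto

definition action ::
  "nat \<Rightarrow> real \<Rightarrow> (real \<Rightarrow> real^'n \<Rightarrow> real) \<Rightarrow> real \<Rightarrow> real \<Rightarrow> real^'n \<Rightarrow> real^'n \<Rightarrow> complex" where
  "action N hbar V t s x y =
     of_real ((norm (x - y))\<^sup>2 / (2 * (t - s)))
     + (\<Sum>k=1..N. action_W hbar V s k x y * of_real ((t - s) ^ k))"

definition approx_propagator_schwartz ::
  "nat \<Rightarrow> real \<Rightarrow> (real \<Rightarrow> real^'n \<Rightarrow> real) \<Rightarrow> real \<Rightarrow> real \<Rightarrow>
     (real^'n \<Rightarrow> complex) \<Rightarrow> real^'n \<Rightarrow> complex" where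
  "approx_propagator_schwartz N hbar V t s f x =
     1 / (of_real ((2 * pi * (t - s) * hbar) powr (real CARD('n) / 2))
            * exp (\<i> * of_real (pi * real CARD('n) / 4)))
       * integral\<^sup>L lborel (\<lambda>y. exp (\<i> / of_real hbar * action N hbar V t s x y) * f y)"

text \<open>The bounded extension to \<open>L\<^sup>2\<close> of the previous operator; it is unique since Schwartz functions
  are dense. \<open>bounded_linear\<close> refers to real scalars, but uniqueness forces complex linearity.\<close>
definition approx_propagator ::
  "nat \<Rightarrow> real \<Rightarrow> (real \<Rightarrow> real^'n \<Rightarrow> real) \<Rightarrow> real \<Rightarrow> real \<Rightarrow> ('n::finite) L2 \<Rightarrow> 'n L2" where
  "approx_propagator N hbar V t s = (THE A. bounded_linear A \<and>
     (\<forall>f\<in>schwartz. AE x in lborel.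
        rep_L2 (A (abs_L2 f)) x = approx_propagator_schwartz N hbar V t s f x))"

definition is_subdivision :: "(nat \<Rightarrow> real) \<Rightarrow> nat \<Rightarrow> real \<Rightarrow> real \<Rightarrow> bool" where
  "is_subdivision \<Omega> L s t \<longleftrightarrow>
     1 \<le> L \<and> \<Omega> 0 = s \<and> \<Omega> L = t \<and> (\<forall>j\<in>{1..L}. \<Omega> (j - 1) < \<Omega> j)"

definition mesh :: "(nat \<Rightarrow> real) \<Rightarrow> nat \<Rightarrow> real" where
  "mesh \<Omega> L = (SUP j\<in>{1..L}. \<Omega> j - \<Omega> (j - 1))"

text \<open>\<open>E(t\<^sub>L, t\<^sub>L\<^sub>-\<^sub>1) \<cdots> E(t\<^sub>1, t\<^sub>0)\<close> with \<open>t\<^sub>j = \<Omega> j\<close>.\<close>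
primrec composed_propagator ::
  "nat \<Rightarrow> real \<Rightarrow> (real \<Rightarrow> real^'n \<Rightarrow> real) \<Rightarrow> (nat \<Rightarrow> real) \<Rightarrow> nat \<Rightarrow> ('n::finite) L2 \<Rightarrow> 'n L2" where
  "composed_propagator N hbar V \<Omega> 0 = id"
| "composed_propagator N hbar V \<Omega> (Suc L) =
     approx_propagator N hbar V (\<Omega> (Suc L)) (\<Omega> L) \<circ> composed_propagator N hbar V \<Omega> L"

end

(* Locally, a function in the Sjoestrand class is an absolutely convergent superposition of exponentials. Call an
 amplitude a(x, y) admissible if it lies in the bipolar of the functions that are exponential in the position inside
 cells of side comparable to sqrt(hbar (t - s)). This class is stable under sums, products, exponentials and the averages
 along segments in the transport equations, so it contains the action W_k and exp(i (S - |x - y|^2 / (2 (t - s))) / hbar),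
 and Bessel's inequality for trigonometric functions on the cells shows that oscillatory integrals with quadratic
 phase and such amplitudes are bounded on L^2. The transport equations make the approximate kernel a solution of the
 Schroedinger equation up to an amplitude of size O((t - s)^N).
 The exact propagator is obtained by a contraction in the interaction picture. Pairing the difference of the two
 evolutions with free Gaussian waves, which are dense and evolve explicitly, Gronwall's inequality bounds one short
 step by O((t - s)^(N + 1) / hbar). The short steps telescope because the exact propagator is unitary. *)

theory Submission
 imports Defs "HOL-Probability.Probability"
begin

text \<open>An amplitude enters only through estimates that are linear in it, so no representing
  measure for W_k or for its exponential is constructed: membership in the bipolar is tested against
  functionals. The cell size is dictated by the phase. With l = hbar (t - s) and cells of side r,
  writing points as corner plus offset leaves in exp(i |x - y|^2 / (2 l)) factors with frequencies
  in the lattice (r / l) Z^d, orthogonal on boxes of side 2 pi l / r, and a factor exp(-i off x .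
  off y / l) whose power series is controlled while r^2 / l is bounded. The choice r^2 <= 2 pi l
  serves both, since a cell then fits into a period box; r <= 1 keeps the real exponents of the
  atoms bounded. The regime t - s <= T hbar bounds the phase divided by hbar. The loss of 1 / hbar
  in a short step is recovered in the sum: the errors add up to at most a multiple of omega^N (t -
  s) / hbar <= T omega^N. Each transport equation costs two space derivatives of the potential and
  the kernel needs two derivatives of W_N, which exhausts the 2 N available.\<close>

notation has_vector_derivative (infix "hvd" 50)
notation scaleR (infixr "*R" 75)
abbreviation (input) "bm f \<equiv> f \<in> borel_measurable borel"
abbreviation (input) "lint \<equiv> integrable lborel"
abbreviation (input) "cts \<equiv> continuous_on UNIV"
abbreviation (input) seqlim ("((_)/ ----> (_))" [60, 60] 60) where "X ----> L \<equiv> X \<longlonglongrightarrow> L"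
lemmas ibound = Bochner_Integration.integrable_bound
lemmas icong = Bochner_Integration.integral_cong

section \<open>Gaussian integrals and the heat kernel\<close>

lemma prod_Basis_vec: "(\<Prod>b\<in>(Basis::(real^'n) set). f b) = (\<Prod>i\<in>UNIV. f (axis i 1))"
proof -
 have *: "(Basis::(real^'n) set) = range (%i. axis i 1)" by (auto simp: Basis_vec_def)
 have "inj (%i. axis i (1::real) :: real^'n)" by (auto simp: inj_on_def axis_eq_axis)
 thus ?thesis unfolding * by (subst prod.reindex) auto
qed

lemma
 fixes f :: "'n::finite => real => 'b::{real_normed_field,banach,second_countable_topology}"
 assumes "!!i. lint (f i)"
 shows integrable_lborel_vec_prod: "lint (%x::real^'n. \<Prod>i\<in>UNIV. f i (x$i))"
  and integral_lborel_vec_prod: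
   "integral\<^sup>L lborel (%x::real^'n. \<Prod>i\<in>UNIV. f i (x$i)) = (\<Prod>i\<in>UNIV. integral\<^sup>L lborel (f i))"
proof -
 \<comment> \<open>The product measure is indexed by \<open>Basis\<close>; \<open>k\<close>
   translates a basis vector back into its coordinate index.\<close>
 define k :: "real^'n => 'n" where "k b = (THE i. b = axis i 1)" for b
 have k: "k (axis i 1) = i" for i unfolding k_def by (auto simp: axis_eq_axis)
 interpret product_sigma_finite "%b::real^'n. lborel::real measure" ..
 have m[measurable]: "bm (f i)" for i using assms[of i] by (auto dest: borel_measurable_integrable)
 have meas: "(%f. \<Sum>b\<in>(Basis::(real^'n) set). f b *R b) \<in> measurable (Pi\<^sub>M Basis (%b. lborel)) borel" by measurable
 have e: "(\<Prod>i\<in>UNIV. f i ((\<Sum>b\<in>Basis. x b *R b)$i)) = (\<Prod>b\<in>Basis. f (k b) (x b))" for x :: "real^'n => real"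
 proof -
  have "(\<Sum>b\<in>Basis. x b *R b)$i = x (axis i 1)" for i
  proof -
   have "(\<Sum>b\<in>Basis. x b *R b)$i = (\<Sum>b\<in>Basis. x b *R b) \<bullet> axis i 1" by (simp add: inner_axis)
   also have "... = x (axis i 1)" by (subst inner_sum_left_Basis) (auto simp: Basis_vec_def)
   finally show ?thesis .
  qed
  thus ?thesis by (simp add: prod_Basis_vec k)
 qed
 let ?A = "%x::real^'n. \<Prod>i\<in>UNIV. f i (x$i)"
 have bm: "bm ?A" by measurable
 show "lint ?A"
  unfolding lborel_eq[where 'a="real^'n"] using product_integrable_prod[of Basis "%b. f (k b)"] assms meas bm
  by (subst integrable_distr_eq) (simp_all add: e del: sum_component)
 show "integral\<^sup>L lborel ?A = (\<Prod>i\<in>UNIV. integral\<^sup>L lborel (f i))"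
  unfolding lborel_eq[where 'a="real^'n"] using meas bm assms by (subst integral_distr, simp_all add: e del: sum_component, subst product_integral_prod)
   (simp_all add: prod_Basis_vec k)
qed

lemma
 fixes f :: "'a::euclidean_space => 'b::{banach,second_countable_topology}"
 assumes "bm f"
 shows integrable_lborel_shift: "lint (%x. f (c + x)) \<longleftrightarrow> lint f"
  and integral_lborel_shift: "(LBINT x. f (c + x)) = (LBINT x. f x)"
proof -
 show "lint (%x. f (c + x)) \<longleftrightarrow> lint f"
  using assms by (subst (2) lborel_distr_plus[of c, symmetric]) (simp add: integrable_distr_eq)
 show "(LBINT x. f (c + x)) = (LBINT x. f x)" using assms by (subst (2) lborel_distr_plus[of c, symmetric]) (simp add: integral_distr)
qed

lemma lborel_distr_reflect:
 fixes c :: "'a::euclidean_space"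
 shows "distr lborel borel (%x. c - x) = lborel" by (subst lborel_affine[of "-1" c]) (auto simp: density_1)

lemma
 fixes f :: "'a::euclidean_space => 'b::{banach,second_countable_topology}"
 assumes "bm f"
 shows integrable_lborel_reflect: "lint (%x. f (c - x)) \<longleftrightarrow> lint f"
  and integral_lborel_reflect: "(LBINT x. f (c - x)) = (LBINT x. f x)"
proof -
 show "lint (%x. f (c - x)) \<longleftrightarrow> lint f"
  using assms by (subst (2) lborel_distr_reflect[of c, symmetric]) (simp add: integrable_distr_eq)
 show "(LBINT x. f (c - x)) = (LBINT x. f x)" using assms by (subst (2) lborel_distr_reflect[of c, symmetric]) (simp add: integral_distr)
qed

text \<open>Dominated convergence speaks about sequences, so derivatives of parameter integrals are
  treated as limits of difference quotients along null sequences. Keeping the increments below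
  \<open>d\<close> lets a merely local derivative bound dominate the whole sequence.\<close>

lemma has_vector_derivative_iff_sequentially:
 fixes f :: "real => 'b::real_normed_vector"
 assumes "0 < d"
 shows "(f hvd D) (at r) \<longleftrightarrow> (\<forall>h. (\<forall>n::nat. h n \<noteq> 0 \<and> \<bar>h n\<bar> < d) \<longrightarrow> h ----> 0 \<longrightarrow>
  (%n. inverse (h n) *R (f (r + h n) - f r)) ----> D)"
proof -
 let ?A = "%h. norm (inverse h *R (f (r + h) - f r) - D)"
 have "norm (f (r + h) - f r - h *R D) / norm h = ?A h" if "h \<noteq> 0" for h
 proof -
  have "inverse h *R (f (r + h) - f r) - D = inverse h *R (f (r + h) - f r - h *R D)" using that by (simp add: scaleR_diff_right)
  thus ?thesis by (simp only: norm_scaleR) (simp add: divide_inverse mult.commute)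
 qed
 hence "((%h. norm (f (r + h) - f r - h *R D) / norm h) \<longlongrightarrow> 0) (at 0) \<longleftrightarrow> ((%h. ?A h) \<longlongrightarrow> 0) (at 0)"
  by (intro filterlim_cong) (auto simp: eventually_at_filter)
 hence "(f hvd D) (at r) \<longleftrightarrow> ((%h. ?A h) \<longlongrightarrow> 0) (at 0)"
  unfolding has_vector_derivative_def has_derivative_at by (simp add: bounded_linear_scaleR_left)
 also have "... \<longleftrightarrow> ((%h. inverse h *R (f (r + h) - f r)) \<longlongrightarrow> D) (at 0 within ball 0 d)"
  using assms by (simp add: at_within_open[of 0 "ball 0 d"] tendsto_norm_zero_iff LIM_zero_iff)
 finally show ?thesis unfolding tendsto_at_iff_sequentially o_def by (auto simp: dist_real_def)
qed

text \<open>The mean value inequality; it turns a bound for the derivative into a dominating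
  function for the difference quotients.\<close>

lemma quotient_bound:
 fixes f f' :: "real => 'b::real_normed_vector"
 assumes der: "!!r. \<bar>r - r0\<bar> < d ==> (f hvd f' r) (at r)"
  and bnd: "!!r. \<bar>r - r0\<bar> < d ==> norm (f' r) <= g" and h: "\<bar>h\<bar> < d"
 shows "norm (f (r0 + h) - f r0) <= g * \<bar>h\<bar>"
proof -
 have "norm (t *R f' r) <= g * norm t" if "\<bar>r - r0\<bar> < d" for r t using mult_left_mono[OF bnd[OF that], of "\<bar>t\<bar>"] by (simp add: mult.commute)
 hence "norm (f (r0 + h) - f r0) <= g * norm (r0 + h - r0)"
  using h by (intro differentiable_bound[OF convex_ball[of r0 d] has_derivative_at_withinI[OF der[unfolded has_vector_derivative_def]] onorm_le])
   (auto simp: dist_real_def abs_minus_commute)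
 thus ?thesis by simp
qed

lemma
 fixes f f' :: "real => 'a => 'b::{banach,second_countable_topology}"
 assumes d: "0 < d"
  and der: "!!r x. \<bar>r - r0\<bar> < d ==> x \<in> space M ==> ((%r. f r x) hvd f' r x) (at r)"
  and int: "!!r. \<bar>r - r0\<bar> < d ==> integrable M (f r)"
  and bnd: "!!r x. \<bar>r - r0\<bar> < d ==> x \<in> space M ==> norm (f' r x) <= g x"
  and g: "integrable M g"
 shows has_vector_derivative_integral: "((%r. \<integral>x. f r x \<partial>M) hvd (\<integral>x. f' r0 x \<partial>M)) (at r0)"
proof -
 let ?q = "%f h. inverse h *R (f (r0 + h) - f r0)"
 have "(%n. ?q (%r. \<integral>x. f r x \<partial>M) (h n)) ----> (\<integral>x. f' r0 x \<partial>M)"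
  if h: "!!n. h n \<noteq> 0" "!!n. \<bar>h n\<bar> < d" "h ----> 0" for h :: "nat => real"
 proof -
  have [measurable]: "f (r0 + h n) \<in> borel_measurable M" "f r0 \<in> borel_measurable M" for n using int h d by (auto intro!: borel_measurable_integrable)
  have lim: "x \<in> space M ==> (%n. ?q (%r. f r x) (h n)) ----> f' r0 x" for x
   using der[of r0 x] h d unfolding has_vector_derivative_iff_sequentially[OF d] by simp
  have b: "x \<in> space M ==> norm (?q (%r. f r x) (h n)) <= g x" for n x
   using mult_left_mono[OF quotient_bound[where f="%r. f r x" and g="g x" and f'="%r. f' r x" and ?r0.0=r0, OF der bnd h(2)], of "inverse \<bar>h n\<bar>" n] h(1)[of n]
   by (simp del: scaleR_right_diff_distrib add: mult.left_commute[of _ "g x"])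
  have "(%n. \<integral>x. ?q (%r. f r x) (h n) \<partial>M) ----> (\<integral>x. f' r0 x \<partial>M)"
   by (rule integral_dominated_convergence[OF borel_measurable_LIMSEQ_metric[OF _ lim] _ g AE_I2[OF lim] AE_I2[OF b]]) measurable
  thus ?thesis using int h d by simp
 qed
 thus ?thesis unfolding has_vector_derivative_iff_sequentially[OF d] by simp
qed

text \<open>Integrating the fundamental theorem over the segments from x to x + e and using
  translation invariance gives the integral of F(x + e) - F(x), which is 0. Integrability takes the
  place of decay at infinity, so this is the form of integration by parts used later.\<close>

lemma integral_partial_derivative_zero:
 fixes F F' :: "'a::euclidean_space => complex"
 assumes der: "!!x. ((%h. F (x + h *R e)) hvd F' x) (at 0)"
  and cont: "cts F'" and int: "lint F" "lint F'"
 shows "(LBINT x. F' x) = 0"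
proof -
 have [measurable]: "bm F'" "bm F" using int by (auto dest: borel_measurable_integrable)
 have der': "((%h. F (x + h *R e)) hvd F' (x + r *R e)) (at r)" for x r
 proof -
  have "((%h. F (x + r *R e + h *R e)) \<circ> (%h. h - r) hvd (1 *R F' (x + r *R e))) (at r)"
   by (rule vector_diff_chain_at) (auto intro!: derivative_eq_intros der)
  thus ?thesis by (simp add: o_def algebra_simps)
 qed
 have ftc: "(LBINT r. indicator {0..1} r *R F' (x + r *R e)) = F (x + e) - F x" for x
 proof -
  have "continuous_on {0..1} (%r. F' (x + r *R e))" by (rule continuous_on_compose2[OF cont]) (auto intro!: continuous_intros)
  from integral_FTC_Icc[OF zero_le_one has_vector_derivative_at_within[OF der'] this]
  show ?thesis by simp
 qed
 have sw: "(LBINT x. F' (x + c)) = (LBINT x. F' x)" "(LBINT x. F (x + c)) = (LBINT x. F x)"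
  "lint (%x. F' (x + c))" "lint (%x. F (x + c))"
  "(LBINT x. norm (F' (x + c))) = (LBINT x. norm (F' x))" for c using integral_lborel_shift[of F' c] integral_lborel_shift[of F c] integrable_lborel_shift[of F c]
   integrable_lborel_shift[of F' c] integral_lborel_shift[of "%x. norm (F' x)" c] int by (simp_all add: add.commute)
 let ?A = "%(r::real, x). indicator {0..1} r *R F' (x + r *R e)"
 have I: "integrable (lborel \<Otimes>\<^sub>M lborel) ?A"
 proof (rule lborel_pair.Fubini_integrable)
  show "?A \<in> borel_measurable (lborel \<Otimes>\<^sub>M lborel)" by measurable
  have "lint (%r::real. indicator {0..1} r *R (LBINT x. norm (F' x)))" by (auto simp: integrable_indicator_iff)
  thus "lint (%r::real. \<integral>y. norm (case (r, y) of (r, x) => indicator {0..1} r *R F' (x + r *R e)) \<partial>lborel)"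
   by (simp add: sw)
 qed (simp add: sw)
 have "(LBINT x. (LBINT r. indicator {0..1} r *R F' (x + r *R e)))
   = (LBINT r. (LBINT x. indicator {0..1} r *R F' (x + r *R e)))" using lborel_pair.Fubini_integral[OF I] by simp
 also have "... = (LBINT r. indicator {0..1::real} r *R (LBINT x. F' x))" by (simp add: sw)
 also have "... = (LBINT x. F' x)" by (subst Bochner_Integration.integral_scaleR_left) (auto simp: integrable_indicator_iff)
 finally have "(LBINT x. F' x) = (LBINT x. F (x + e) - F x)" unfolding ftc ..
 also have "... = 0" using Bochner_Integration.integral_diff[OF sw(4)[of e] int(1)] sw(2)[of e] by simp
 finally show ?thesis .
qed

lemma integrable_exp_quadratic:
 fixes al be :: real
 assumes "0 < al"
 shows "lint (%t. exp (- al * t^2 + be * t))"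
proof -
 define sg where "sg = 1 / sqrt (2 * al)"
 have s: "sg > 0" "sg^2 = 1 / (2 * al)" using assms by (auto simp: sg_def power_divide)
 have "exp (- al * t\<^sup>2 + be * t) = (sqrt (2 * pi * sg\<^sup>2) * exp (be\<^sup>2 / (4 * al))) * normal_density (be / (2 * al)) sg t" for t
 proof -
  have "- al * t\<^sup>2 + be * t = be\<^sup>2 / (4 * al) + - (t - be / (2 * al))\<^sup>2 / (2 * sg\<^sup>2)"
   unfolding s(2) using assms by (simp add: field_simps power2_eq_square)
  thus ?thesis using assms s(1) unfolding normal_density_def by (simp add: exp_add[symmetric])
 qed
 thus ?thesis using integrable_normal_density[OF s(1), of "be / (2 * al)"] by simp
qed

lemma integrable_exp_quadratic_abs:
 fixes al be :: real
 assumes "0 < al"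
 shows "lint (%t. exp (- al * t^2 + be * \<bar>t\<bar>))"
proof (rule ibound)
 let ?A = "%t. exp (- al * t^2 + (- be) * t)"
 let ?B = "%t. exp (- al * t^2 + be * t)"
 show "lint (%t. ?B t + ?A t)"
  by (intro Bochner_Integration.integrable_add integrable_exp_quadratic assms)
 have "exp (- al * t^2 + be * \<bar>t\<bar>) <= ?B t + ?A t" for t
  by (cases "t >= 0") (auto simp: abs_if)
 thus "AE t in lborel. norm (exp (- al * t^2 + be * \<bar>t\<bar>)) <= norm (?B t + ?A t)"
  by (intro AE_I2) (simp only: real_norm_def abs_exp_cancel, smt (verit) exp_gt_zero)
qed measurable

lemma abs_le_exp: "\<bar>t::real\<bar> <= exp \<bar>t\<bar>" "t^2 <= 2 * exp \<bar>t\<bar>"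
proof -
 show "\<bar>t\<bar> <= exp \<bar>t\<bar>" using exp_ge_add_one_self[of "\<bar>t\<bar>"] by linarith
 show "t^2 <= 2 * exp \<bar>t\<bar>" using exp_lower_Taylor_quadratic[of "\<bar>t\<bar>"] by (simp add: power2_abs)
qed

lemma power_le_fact_exp: "0 <= t ==> (t::real) ^ m <= fact m * exp t"
proof -
 assume t: "0 <= t"
 have "t ^ m / fact m <= exp t"
 proof -
  have "(\<Sum>k\<in>{m}. t ^ k / fact k) <= (\<Sum>k. t ^ k / fact k)" using t summable_exp[of t] by (intro sum_le_suminf) (auto simp: divide_inverse mult.commute)
  thus ?thesis by (simp add: exp_def divide_inverse mult.commute)
 qed
 thus ?thesis by (simp add: field_simps)
qed

lemma has_vector_derivative_cexp:
 fixes f :: "real => complex"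
 assumes "(f hvd f') (at r)"
 shows "((%r. exp (f r)) hvd f' * exp (f r)) (at r)" using field_vector_diff_chain_at[OF assms DERIV_exp] by (simp add: o_def)

lemma
 fixes a b :: complex
 assumes "0 < Re a"
 shows integrable_cexp_quadratic: "lint (%t. exp (- a * of_real (t^2) + b * of_real t))"
  and integrable_cexp_quadratic1: "lint (%t. of_real t * exp (- a * of_real (t^2) + b * of_real t))"
  and integrable_cexp_quadratic2: "lint (%t. of_real (t^2) * exp (- a * of_real (t^2) + b * of_real t))"
proof -
 let ?B = "%t. exp (- a * of_real (t^2) + b * of_real t)"
 let ?C = "%t. exp (- Re a * t^2 + \<bar>Re b\<bar> * \<bar>t\<bar>)"
 have e: "cmod (?B t) <= ?C t" for t
  by (simp add: abs_mult[symmetric])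
 show "lint (%t. ?B t)"
  by (rule ibound[OF integrable_exp_quadratic_abs[OF assms, of "\<bar>Re b\<bar>"]])
   (use e in auto)
 let ?A = "\<bar>Re b\<bar> + 1"
 let ?D = "%t. exp (- Re a * t^2 + ?A * \<bar>t\<bar>)"
 have i: "lint (%t. ?D t)" by (rule integrable_exp_quadratic_abs[OF assms])
 have e1: "?D t = exp \<bar>t\<bar> * ?C t" for t
  by (simp add: exp_add[symmetric] algebra_simps)
 show "lint (%t. of_real t * ?B t)"
 proof (rule ibound[OF i])
  have "\<bar>t\<bar> * cmod (?B t) <= exp \<bar>t\<bar> * ?C t" for t
   by (intro mult_mono abs_le_exp e) auto
  thus "AE t in lborel. cmod (t * ?B t)
   <= norm (?D t)"
   unfolding e1 by (intro AE_I2) (simp add: norm_mult norm_power mult.assoc del: norm_exp_eq_Re)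
 qed measurable
 have i: "lint (%t. 2 * ?D t)" using i by simp
 show "lint (%t. of_real (t^2) * ?B t)"
 proof (rule ibound[OF i])
  have "t^2 * cmod (?B t) <= 2 * exp \<bar>t\<bar> * ?C t" for t
   by (intro mult_mono abs_le_exp e) auto
  thus "AE t in lborel. cmod (of_real (t^2) * ?B t)
   <= norm (2 * ?D t)"
   unfolding e1 by (intro AE_I2) (simp add: norm_mult norm_power mult.assoc del: norm_exp_eq_Re)
 qed measurable
qed

text \<open>Integration by parts expresses the first and second moments by the integral itself.
  Differentiation in a parameter therefore gives a first-order linear equation for the Gaussian
  integral.\<close>

lemma cexp_quadratic_parts:
 fixes a b :: complex
 assumes "0 < Re a"
 shows "2 * a * (LBINT t. of_real t * exp (- a * of_real (t^2) + b * of_real t))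
   = b * (LBINT t. exp (- a * of_real (t^2) + b * of_real t))"
  and "2 * a * (LBINT t. of_real (t^2) * exp (- a * of_real (t^2)))
   = (LBINT t. exp (- a * of_real (t^2)))"
proof -
 let ?e = "%t. exp (- a * of_real (t^2) + b * of_real t)"
 have d: "((%h. ?e (t + h *R 1)) hvd (b * ?e t - 2 * a * (t * ?e t))) (at 0)" for t
 proof -
  have "((%h. - a * of_real ((t + h *R 1)^2) + b * of_real (t + h *R 1)) hvd (b - 2 * a * t)) (at 0)"
   unfolding has_vector_derivative_def by (rule derivative_eq_intros refl)+ (auto simp: fun_eq_iff algebra_simps scaleR_conv_of_real)
  from has_vector_derivative_cexp[OF this] show ?thesis by (simp add: algebra_simps)
 qed
 have "(LBINT t. (b * ?e t - 2 * a * (t * ?e t))) = 0" by (rule integral_partial_derivative_zero[where e=1, OF d])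
   (use integrable_cexp_quadratic[OF assms] integrable_cexp_quadratic1[OF assms]
    in \<open>auto intro!: continuous_intros\<close>)
 thus "2 * a * (LBINT t. of_real t * ?e t) = b * (LBINT t. ?e t)" using integrable_cexp_quadratic[OF assms, of b] integrable_cexp_quadratic1[OF assms, of b] by simp
 let ?f = "%t. exp (- a * of_real (t^2))"
 have i: "lint ?f" "lint (%t. of_real t * ?f t)" "lint (%t. of_real (t^2) * ?f t)"
  using integrable_cexp_quadratic[OF assms, of 0] integrable_cexp_quadratic1[OF assms, of 0]
   integrable_cexp_quadratic2[OF assms, of 0] by auto
 have d: "((%h. of_real (t + h *R 1) * ?f (t + h *R 1)) hvd (?f t - 2 * a * (of_real (t^2) * ?f t))) (at 0)" for t
 proof -
  have "((%h. - a * of_real ((t + h *R 1)^2)) hvd (- 2 * a * t)) (at 0)" unfolding has_vector_derivative_def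
   by (rule derivative_eq_intros refl)+ (auto simp: fun_eq_iff algebra_simps scaleR_conv_of_real)
  note 1 = has_vector_derivative_cexp[OF this]
  have 2: "((%h. of_real (t + h *R 1)) hvd (1::complex)) (at 0)" unfolding has_vector_derivative_def
   by (rule derivative_eq_intros refl)+ (auto simp: fun_eq_iff algebra_simps scaleR_conv_of_real)
  from has_vector_derivative_mult[OF 2 1] show ?thesis by (simp add: algebra_simps power2_eq_square)
 qed
 have "(LBINT t. (?f t - 2 * a * (of_real (t^2) * ?f t))) = 0" by (rule integral_partial_derivative_zero[where e=1, OF d])
   (use i in \<open>auto intro!: continuous_intros\<close>)
 thus "2 * a * (LBINT t. of_real (t^2) * ?f t) = (LBINT t. ?f t)" using i by simp
qed

lemma constant_of_zero_derivative:
 fixes f :: "real => 'b::real_normed_vector"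
 assumes "!!r. r \<in> {0..1} ==> (f hvd 0) (at r)"
 shows "f 1 = f 0"
proof -
 have "(f has_derivative (%h. 0)) (at r within {0..1})" if "r \<in> {0..1}" for r
  using has_derivative_at_withinI[OF assms[OF that, unfolded has_vector_derivative_def]] by simp
 hence "\<exists>c. \<forall>r\<in>{0..1}. f r = c" by (intro has_derivative_zero_constant) auto
 thus ?thesis by auto
qed

text \<open>On the segment \<open>A\<close> from 1 to a, which stays in the right half-plane,
  \<open>csqrt (A r) * K r\<close> has derivative zero. The real Gaussian integral at r = 0 fixes
  the constant, and the branch of the root is never crossed.\<close>

lemma gaussian_integral_pure:
 fixes a :: complex
 assumes "0 < Re a"
 shows "(LBINT t. exp (- a * of_real (t^2))) = of_real (sqrt pi) / csqrt a"
proof -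
 define A where "A r = 1 + of_real r * (a - 1)" for r :: real
 let ?C = "\<bar>Re a - 1\<bar> + 1"
 \<comment> \<open>On the segment Re (A r) is at least min 1 (Re a), and it has slope Re a - 1, so
   within distance \<open>de\<close> it loses at most one half. The summand 1 in \<open>?C\<close>
   avoids a division by zero at Re a = 1.\<close>
 define de where "de = min 1 (Re a) / (2 * ?C)"
 have d: "de > 0" using assms unfolding de_def by (intro divide_pos_pos mult_pos_pos add_nonneg_pos) auto
 have Apos: "Re (A r) >= min 1 (Re a) / 2" if "r0 \<in> {0..1}" "\<bar>r - r0\<bar> < de" for r r0
 proof -
  have "Re (A r) = (1 - r0) * 1 + r0 * Re a + (r - r0) * (Re a - 1)" by (simp add: A_def algebra_simps)
  moreover have "(1 - r0) * 1 + r0 * Re a >= (1 - r0) * min 1 (Re a) + r0 * min 1 (Re a)" using that by (intro add_mono mult_left_mono) auto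
  moreover have "(1 - r0) * min 1 (Re a) + r0 * min 1 (Re a) = min 1 (Re a)" by (simp add: left_diff_distrib)
  moreover have "\<bar>(r - r0) * (Re a - 1)\<bar> <= de * ?C" unfolding abs_mult using that d by (intro mult_mono) auto
  moreover have "de * ?C = min 1 (Re a) / 2"
  proof -
   have "\<bar>Re a - 1\<bar> + 1 \<noteq> 0" by linarith
   thus ?thesis unfolding de_def by (simp add: divide_simps)
  qed
  ultimately show ?thesis by linarith
 qed
 have m: "min 1 (Re a) / 2 > 0" using assms by auto
 let ?D = "%t. of_real (t^2)"
 define K where "K r = (LBINT t. exp (- A r * ?D t))" for r
 let ?B = "min 1 (Re a) / 2"
 have K': "(K hvd (LBINT t. - (a - 1) * ?D t * exp (- A r0 * ?D t))) (at r0)"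
  if r0: "r0 \<in> {0..1}" for r0 unfolding K_def
 proof (rule has_vector_derivative_integral(1)[OF d])
  fix r x assume r: "\<bar>r - r0\<bar> < de"
  let ?A = "of_real (x^2)"
  show "((%r. exp (- A r * ?A)) hvd - (a - 1) * ?A * exp (- A r * ?A)) (at r)"
  proof -
   have "((%r. - A r * ?A) hvd - (a - 1) * ?A) (at r)" unfolding A_def has_vector_derivative_def
    by (rule derivative_eq_intros refl)+ (auto simp: fun_eq_iff algebra_simps scaleR_conv_of_real)
   from has_vector_derivative_cexp[OF this] show ?thesis .
  qed
  have "exp (- Re (A r) * x^2) <= exp (- ?B * x^2)" using mult_right_mono[OF Apos[OF r0 r], of "x^2"] by simp
  thus "norm (- (a - 1) * ?A * exp (- A r * ?A)) <= cmod (a - 1) * (x^2 * exp (- ?B * x^2))"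
   by (simp add: norm_mult norm_power mult.assoc norm_minus_commute mult_left_mono)
 next
  fix r assume r: "\<bar>r - r0\<bar> < de"
  show "lint (%t. exp (- A r * ?D t))" using integrable_cexp_quadratic[of "A r" 0] Apos[OF r0 r] m by simp
 next
  have "lint (%t. ?D t * exp (- of_real ?B * ?D t) :: complex)"
   using integrable_cexp_quadratic2[of "of_real ?B" 0] m by simp
  from integrable_norm[OF this] show "lint (%x. cmod (a - 1) * (x^2 * exp (- ?B * x^2)))"
   by (simp add: norm_mult norm_power)
 qed
 have K'': "(K hvd (- (a - 1) * (K r / (2 * A r)))) (at r)" if "r \<in> {0..1}" for r
 proof -
  have pos: "Re (A r) > 0" using Apos[OF that, of r] m d by simp
  hence "A r \<noteq> 0" by auto
  hence "(LBINT t. ?D t * exp (- A r * ?D t)) = K r / (2 * A r)"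
   using cexp_quadratic_parts(2)[OF pos] unfolding K_def by (simp add: field_simps)
  thus ?thesis using K'[OF that] by (simp add: mult.assoc)
 qed
 have "csqrt (A 1) * K 1 = csqrt (A 0) * K 0"
 proof (rule constant_of_zero_derivative[of "%r. csqrt (A r) * K r"])
  fix r :: real assume r: "r \<in> {0..1}"
  have pos: "Re (A r) > 0" using Apos[OF r, of r] m d by simp
  have nz: "A r \<noteq> 0" "A r \<notin> \<real>\<^sub>\<le>\<^sub>0" using pos by (auto simp: complex_nonpos_Reals_iff)
  have 1: "(A hvd (a - 1)) (at r)" unfolding A_def has_vector_derivative_def by (auto intro!: derivative_eq_intros ext simp: scaleR_conv_of_real)
  have 2: "((%r. csqrt (A r)) hvd (a - 1) * inverse (2 * csqrt (A r))) (at r)"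
   using field_vector_diff_chain_at[OF 1 has_field_derivative_csqrt[OF nz(2)]] by (simp add: o_def)
  have sq: "csqrt (A r) * csqrt (A r) = A r" by (metis power2_csqrt power2_eq_square)
  have "csqrt (A r) * (- (a - 1) * (K r / (2 * (csqrt (A r) * csqrt (A r))))) + (a - 1) * inverse (2 * csqrt (A r)) * K r = 0"
   using nz(1) by (simp add: divide_simps) (simp add: algebra_simps)
  hence "csqrt (A r) * (- (a - 1) * (K r / (2 * A r))) + (a - 1) * inverse (2 * csqrt (A r)) * K r = 0" unfolding sq .
  thus "((%r. csqrt (A r) * K r) hvd 0) (at r)" using has_vector_derivative_mult[OF 2 K''[OF r]] by simp
 qed
 moreover have "K 0 = of_real (sqrt pi)"
 proof -
  have "has_bochner_integral lborel (%x::real. exp (- x\<^sup>2)) (sqrt pi)" using has_bochner_integral_even_function[OF gaussian_moment_0] by simp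
  hence "(LBINT x. exp (- x\<^sup>2)) = sqrt pi" by (simp add: has_bochner_integral_integral_eq)
  moreover have "K 0 = (LBINT x. complex_of_real (exp (- x\<^sup>2)))" unfolding K_def A_def by (simp add: exp_of_real[symmetric])
  ultimately show ?thesis by (simp only: integral_complex_of_real)
 qed
 moreover have "a \<noteq> 0" using assms by auto
 ultimately show ?thesis unfolding K_def A_def by (simp add: field_simps)
qed

text \<open>With the linear term scaled by r, the moment identity gives J' = (r b^2 / (2 a)) J,
  which the factor exp(- r^2 b^2 / (4 a)) compensates exactly. The case r = 0 is the pure
  Gaussian.\<close>

lemma gaussian_integral:
 fixes a b :: complex
 assumes a: "0 < Re a"
 shows "(LBINT t. exp (- a * of_real (t^2) + b * of_real t)) = of_real (sqrt pi) / csqrt a * exp (b^2 / (4 * a))"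
proof -
 have nz: "a \<noteq> 0" using a by auto
 let ?D = "%t r. exp (- a * of_real (t^2) + of_real r * b * of_real t)"
 define J where "J r = (LBINT t. ?D t r)" for r
 have J': "(J hvd (LBINT t. b * t * ?D t r0)) (at r0)" for r0 unfolding J_def
 proof (rule has_vector_derivative_integral(1)[OF zero_less_one])
  fix r x assume r: "\<bar>r - r0\<bar> < 1"
  let ?C = "of_real (x^2)"
  let ?F = "%r x. exp (- a * ?C + of_real r * b * of_real x)"
  show "((%r. ?F r x) has_vector_derivative
    b * x * ?F r x) (at r)"
  proof -
   have "((%r. - a * ?C + r * b * x) hvd (b * x)) (at r)" unfolding has_vector_derivative_def
    by (rule derivative_eq_intros refl)+ (auto simp: fun_eq_iff algebra_simps scaleR_conv_of_real)
   from has_vector_derivative_cexp[OF this] show ?thesis .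
  qed
  let ?A = "exp (- Re a * x^2 + ((\<bar>r0\<bar> + 1) * \<bar>Re b\<bar> + 1) * \<bar>x\<bar>)"
  let ?B = "exp (- Re a * x^2 + (\<bar>r0\<bar> + 1) * \<bar>Re b\<bar> * \<bar>x\<bar>)"
  have "r * Re b * x <= \<bar>r\<bar> * \<bar>Re b\<bar> * \<bar>x\<bar>" by (simp add: abs_mult[symmetric])
  also have "... <= (\<bar>r0\<bar> + 1) * \<bar>Re b\<bar> * \<bar>x\<bar>" using r by (intro mult_right_mono) auto
  finally have "exp (- Re a * x^2 + r * Re b * x) <= ?B" by simp
  hence "\<bar>x\<bar> * exp (- Re a * x^2 + r * Re b * x) <= exp \<bar>x\<bar> * ?B"
   by (intro mult_mono abs_le_exp) auto
  also have "... = ?A" by (simp add: exp_add[symmetric] algebra_simps)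
  finally show "norm (b * x * ?F r x)
    <= cmod b * ?A" by (simp add: norm_mult mult.assoc mult_left_mono)
 next
  fix r show "lint (%t. ?D t r)"
   using integrable_cexp_quadratic[OF a, of "of_real r * b"] by simp
 next
  show "lint (%x. cmod b * exp (- Re a * x^2 + ((\<bar>r0\<bar> + 1) * \<bar>Re b\<bar> + 1) * \<bar>x\<bar>))"
   using integrable_exp_quadratic_abs[OF a] by simp
 qed
 have J'': "(J hvd (r * b^2 / (2 * a) * J r)) (at r)" for r
 proof -
  have "(LBINT t. of_real t * ?D t r) = of_real r * b * J r / (2 * a)"
   using cexp_quadratic_parts(1)[OF a, of "of_real r * b"] nz unfolding J_def by (simp add: field_simps)
  moreover have "(LBINT t. b * t * ?D t r) =
   b * (LBINT t. of_real t * ?D t r)" by (simp only: mult.assoc integral_mult_right_zero)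
  ultimately show ?thesis using J'[of r] by (simp add: power2_eq_square mult_ac)
 qed
 let ?E = "%r. exp (- (of_real r)\<^sup>2 * b\<^sup>2 / (4 * a))"
 have "exp (- (of_real 1)\<^sup>2 * b\<^sup>2 / (4 * a)) * J 1 = exp (- (of_real 0)\<^sup>2 * b\<^sup>2 / (4 * a)) * J 0"
 proof (rule constant_of_zero_derivative[of "%r. ?E r * J r"])
  fix r :: real
  have 1: "((%r. ?E r) has_vector_derivative
    (- (r * b^2 / (2 * a)) * ?E r)) (at r)"
  proof (rule has_vector_derivative_cexp)
   have "((%r. (of_real r)\<^sup>2 * (- (b\<^sup>2 / (4 * a)))) hvd (2 * r * (- (b\<^sup>2 / (4 * a))))) (at r)"
    unfolding has_vector_derivative_def by (rule derivative_eq_intros refl)+ (auto simp: fun_eq_iff algebra_simps scaleR_conv_of_real)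
   thus "((%r. - (of_real r)\<^sup>2 * b\<^sup>2 / (4 * a)) hvd (- (r * b\<^sup>2 / (2 * a)))) (at r)" by (simp add: field_simps)
  qed
  show "((%r. ?E r * J r) hvd 0) (at r)"
   using has_vector_derivative_mult[OF 1 J''[of r]] by (simp add: algebra_simps)
 qed
 hence "J 1 = exp (b^2 / (4 * a)) * J 0" by (simp add: exp_minus field_simps)
 thus ?thesis unfolding J_def using gaussian_integral_pure[OF a] by simp
qed

text \<open>One argument has modulus at most pi / 2 and the other strictly less, so their sum stays
  inside the principal branch.\<close>

lemma csqrt_mult_right_half_plane:
 assumes "w \<noteq> 0" "0 <= Re w" "0 < Re z"
 shows "csqrt (w * z) = csqrt w * csqrt z"
proof -
 have z: "z \<noteq> 0" using assms by auto
 have "\<bar>Im (Ln w)\<bar> <= pi / 2" "\<bar>Im (Ln z)\<bar> < pi / 2" using Re_Ln_pos_le[OF assms(1)] Re_Ln_pos_lt[OF z] assms by blast+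
 hence "Ln (w * z) = Ln w + Ln z" using assms z by (subst Ln_times) auto
 thus ?thesis using assms z by (simp add: csqrt_exp_Ln add_divide_distrib exp_add)
qed

lemma csqrt_divide_right_half_plane:
 assumes "0 < Re w" "0 < Re z"
 shows "csqrt (w / z) = csqrt w / csqrt z"
proof -
 have z: "z \<noteq> 0" "w \<noteq> 0" using assms by auto
 have "\<bar>Im (Ln w)\<bar> < pi / 2" "\<bar>Im (Ln z)\<bar> < pi / 2" using Re_Ln_pos_lt[OF z(1)] Re_Ln_pos_lt[OF z(2)] assms by blast+
 hence "Ln (w / z) = Ln w - Ln z" using z by (intro Ln_unique) (auto simp: exp_diff)
 thus ?thesis using z by (simp add: csqrt_exp_Ln diff_divide_distrib exp_diff)
qed

text \<open>The quotient is (1 / ze + 1 / ze') / 4, hence its real part is positive even for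
  imaginary \<open>ze\<close>. The second claim is the bookkeeping of branches in
  \<open>hk_conv\<close>.\<close>

lemma csqrt_harmonic:
 assumes "ze \<noteq> 0" "0 <= Re ze" "0 < Re ze'"
 shows "0 < Re ((ze + ze') / (4 * ze * ze'))"
  and "2 * csqrt ze * csqrt ze' * csqrt ((ze + ze') / (4 * ze * ze')) = csqrt (ze + ze')"
proof -
 have nz: "ze' \<noteq> 0" "csqrt ze' \<noteq> 0" using assms by auto
 define A where "A = 1 / ze + 1 / ze'"
 have Re_inv: "Re (1 / z) = Re z / (cmod z)^2" for z by (simp add: Re_divide cmod_power2)
 have A: "Re A > 0" unfolding A_def plus_complex.sel Re_inv using assms nz by (intro add_nonneg_pos) auto
 have e: "(ze + ze') / (4 * ze * ze') = A * (1 / 4)" using assms(1) nz by (simp add: A_def field_simps)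
 let ?A = "(ze + ze') / (4 * ze * ze')"
 show "0 < Re ?A" unfolding e using A by simp
 have "csqrt (1 / 4) = 1 / 2" by (subst csqrt_of_real_nonneg) (auto simp: real_sqrt_divide)
 moreover have "A \<noteq> 0" using A by auto
 ultimately have "csqrt ?A = csqrt A / 2" unfolding e using A by (subst csqrt_mult_right_half_plane) auto
 moreover have "csqrt ze * csqrt A = csqrt (ze * A)" by (rule csqrt_mult_right_half_plane[symmetric]) (use assms A in auto)
 moreover have "ze * A = (ze + ze') / ze'" using assms(1) nz by (simp add: A_def field_simps)
 moreover have "csqrt ((ze + ze') / ze') = csqrt (ze + ze') / csqrt ze'" by (rule csqrt_divide_right_half_plane) (use assms in auto)
 ultimately have "csqrt ze' * (csqrt ze * csqrt A) = csqrt (ze + ze')" using nz by simp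
 thus "2 * csqrt ze * csqrt ze' * csqrt ?A = csqrt (ze + ze')"
  using \<open>csqrt ((ze + ze') / (4 * ze * ze')) = csqrt A / 2\<close> by (simp add: mult_ac)
qed

text \<open>The one-dimensional heat kernel at complex time \<open>ze\<close>. At \<open>ze\<close>
  = i hbar t / 2 it is the free Schroedinger kernel, so Gaussian packets and the free propagator are
  members of one family.\<close>

definition hk :: "complex => real => complex" where
 "hk ze t = exp (- of_real (t\<^sup>2) / (4 * ze)) / (of_real (2 * sqrt pi) * csqrt ze)"

definition heat :: "complex => real^'n => complex" where
 "heat ze x = (\<Prod>i\<in>UNIV. hk ze (x$i))"

text \<open>The semigroup law. One of the two times may be purely imaginary, which is the case of a
  free Schroedinger step applied to a Gaussian packet.\<close>

lemma hk_conv: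
 assumes "ze \<noteq> 0" "0 <= Re ze" "0 < Re ze'"
 shows "lint (%t. hk ze (x - t) * hk ze' t)"
  and "(LBINT t. hk ze (x - t) * hk ze' t) = hk (ze + ze') x"
proof -
 define a where "a = (ze + ze') / (4 * ze * ze')"
 have a: "0 < Re a" using csqrt_harmonic(1)[OF assms] by (simp add: a_def)
 have nz: "ze' \<noteq> 0" "ze + ze' \<noteq> 0" "csqrt ze' \<noteq> 0" "csqrt ze \<noteq> 0" "csqrt a \<noteq> 0"
  using assms a by auto (metis add_nonneg_pos less_irrefl plus_complex.sel(1) zero_complex.sel(1))
 let ?A = "of_real (x^2)"
 define k where "k = exp (- ?A / (4 * ze)) / (of_real (2 * sqrt pi) * csqrt ze) / (of_real (2 * sqrt pi) * csqrt ze')"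
 let ?B = "of_real x / (2 * ze)"
 let ?C = "%t. - a * of_real (t^2) + ?B * of_real t"
 have e: "hk ze (x - t) * hk ze' t = k * exp (?C t)" for t
 proof -
  have "- of_real ((x - t)^2) / (4 * ze) + - of_real (t^2) / (4 * ze') =
   - ?A / (4 * ze) + (?C t)"
   unfolding a_def using assms(1) nz by (simp add: field_simps power2_eq_square)
  hence "exp (- of_real ((x - t)^2) / (4 * ze)) * exp (- of_real (t^2) / (4 * ze')) =
   exp (- ?A / (4 * ze)) * exp (?C t)" by (metis exp_add)
  moreover have "E1 / P * (E2 / Q) = E3 / P / Q * E4" if "E1 * E2 = E3 * E4" for E1 E2 E3 E4 P Q :: complex
  proof -
   have "E1 / P * (E2 / Q) = E1 * E2 / (P * Q)" by simp
   thus ?thesis unfolding that by simp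
  qed
  ultimately show ?thesis unfolding hk_def k_def by blast
 qed
 show "lint (%t. hk ze (x - t) * hk ze' t)" unfolding e by (rule integrable_mult_right, rule integrable_cexp_quadratic[OF a])
 have "(LBINT t. hk ze (x - t) * hk ze' t) = k * (of_real (sqrt pi) / csqrt a * exp (?B^2 / (4 * a)))"
  unfolding e using gaussian_integral[OF a] by (simp only: integral_mult_right_zero)
 also have "... = hk (ze + ze') x"
 proof -
  have "- ?A / (4 * ze) + ?B^2 / (4 * a) = - ?A / (4 * (ze + ze'))"
  proof -
   have "ze * 4 + ze' * 4 \<noteq> 0" using nz(2) by (metis distrib_right mult_eq_0_iff zero_neq_numeral)
   thus ?thesis unfolding a_def using assms(1) nz by (simp add: divide_simps power2_eq_square) (simp add: algebra_simps)
  qed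
  hence 1: "exp (- ?A / (4 * ze)) * exp (?B^2 / (4 * a)) = exp (- ?A / (4 * (ze + ze')))"
   by (metis exp_add)
  have 2: "csqrt (ze + ze') = 2 * csqrt ze * csqrt ze' * csqrt a" using csqrt_harmonic(2)[OF assms] by (simp add: a_def)
  have "of_real (sqrt pi) \<noteq> (0::complex)" by simp
  thus ?thesis unfolding hk_def k_def 2 1[symmetric] using nz by (simp add: divide_simps)
 qed
 finally show "(LBINT t. hk ze (x - t) * hk ze' t) = hk (ze + ze') x" .
qed

lemma heat_conv0:
 assumes "ze \<noteq> 0" "0 <= Re ze" "0 < Re ze'"
 shows "lint (%y::real^'n. heat ze (x - y) * heat ze' y)"
  and "integral\<^sup>L lborel (%y::real^'n. heat ze (x - y) * heat ze' y) = heat (ze + ze') x"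
 unfolding heat_def prod.distrib[symmetric] vector_minus_component using integrable_lborel_vec_prod[of "%i t. hk ze (x$i - t) * hk ze' t"]
  integral_lborel_vec_prod[of "%i t. hk ze (x$i - t) * hk ze' t"] hk_conv[OF assms] by auto

lemma continuous_on_hk [continuous_intros]: "cts (hk ze)" unfolding hk_def divide_inverse by (intro continuous_intros)

lemma borel_measurable_heat [measurable]: "heat ze \<in> borel_measurable borel"
proof -
 have [measurable]: "hk ze \<in> borel_measurable borel" by (rule borel_measurable_continuous_onI[OF continuous_on_hk])
 show ?thesis unfolding heat_def by measurable
qed

lemma heat_closed_form:
 fixes x :: "real^'n"
 shows "heat ze x = exp (- of_real (x \<bullet> x) / (4 * ze)) / (of_real (2 * sqrt pi) * csqrt ze) ^ CARD('n)"
proof -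
 have "(\<Prod>i\<in>UNIV. exp (- of_real ((x$i)^2) / (4 * ze))) = exp (\<Sum>i\<in>UNIV. - of_real ((x$i)^2) / (4 * ze))" by (subst exp_sum) auto
 also have "(\<Sum>i\<in>UNIV. - of_real ((x$i)^2) / (4 * ze)) = - of_real (x \<bullet> x) / (4 * ze)"
  by (simp add: inner_vec_def sum_divide_distrib sum_negf power2_eq_square)
 finally show ?thesis unfolding heat_def hk_def by (simp add: prod_dividef)
qed

lemma heat_minus: "heat ze (- x) = heat ze x" by (simp add: heat_closed_form)

lemma heat_commute: "heat ze (x - y) = heat ze (y - x)" using heat_minus[of ze "x - y"] by simp

lemma heat_conv:
 fixes x y :: "real^'n"
 assumes "ze \<noteq> 0" "0 <= Re ze" "0 < Re ze'"
 shows "lint (%z. heat ze (x - z) * heat ze' (z - y))"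
  and "(LBINT z. heat ze (x - z) * heat ze' (z - y)) = heat (ze + ze') (x - y)"
proof -
 let ?f = "%z. heat ze (x - z) * heat ze' (z - y)"
 have m: "?f \<in> borel_measurable borel" by measurable
 have e: "?f (y + z) = heat ze ((x - y) - z) * heat ze' z" for z by (simp add: algebra_simps)
 show "lint ?f" using integrable_lborel_shift[OF m, of y] heat_conv0(1)[OF assms, of "x - y"] unfolding e by simp
 show "(LBINT z. ?f z) = heat (ze + ze') (x - y)" using integral_lborel_shift[OF m, of y] heat_conv0(2)[OF assms, of "x - y"] unfolding e by simp
qed

lemma cnj_csqrt_right: "0 < Re z ==> cnj (csqrt z) = csqrt (cnj z)"
 by (subst csqrt_exp_Ln) (auto simp: csqrt_exp_Ln exp_cnj cnj_Ln complex_nonpos_Reals_iff complex_eq_iff)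

lemma cnj_heat: "0 < Re ze ==> cnj (heat ze x) = heat (cnj ze) x" by (simp add: heat_closed_form exp_cnj cnj_csqrt_right)

lemma norm_heat:
 fixes x :: "real^'n"
 shows "cmod (heat ze x) = exp (- (norm x)\<^sup>2 * (Re ze / (cmod ze)\<^sup>2 / 4)) / (2 * sqrt (pi * cmod ze)) ^ CARD('n)"
proof -
 have e: "- q / (4 * ze) = of_real (- q / 4) * inverse ze" for q by (cases "ze = 0") (simp_all add: field_simps)
 have "Re (- q / (4 * ze)) = - q * (Re ze / (cmod ze)\<^sup>2 / 4)" for q unfolding e cmod_power2 by simp
 hence "Re (- of_real (x \<bullet> x) / (4 * ze)) = - (norm x)\<^sup>2 * (Re ze / (cmod ze)\<^sup>2 / 4)" by (simp only: power2_norm_eq_inner)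
 moreover have "cmod (csqrt ze) = sqrt (cmod ze)" by (metis norm_power power2_csqrt real_sqrt_abs abs_norm_cancel)
 ultimately show ?thesis unfolding heat_closed_form by (simp add: norm_divide norm_power norm_mult real_sqrt_mult power_mult_distrib del: minus_divide_left)
qed

text \<open>Matches the normalization of \<open>approx_propagator_schwartz\<close>: the principal
  root of i l / 2 has argument pi / 4, so its d-th power carries the prescribed branch of
  i^(d/2).\<close>

lemma heat_imaginary:
 fixes x :: "real^'n"
 assumes "0 < l"
 shows "heat (\<i> * of_real (l / 2)) x =
  exp (\<i> / of_real l * of_real ((norm x)^2 / 2)) / (of_real ((2 * pi * l) powr (real CARD('n) / 2)) * exp (\<i> * of_real (pi * real CARD('n) / 4)))"
proof -
 let ?A = "exp (\<i> * of_real (pi / 4))"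
 let ?B = "of_real (sqrt (l / 2))"
 let ?C = "of_real (l / 2)"
 have 1: "csqrt (\<i> * ?C) = ?B * ?A"
 proof (rule csqrt_unique)
  have "(?B)^2 = (?C :: complex)" using assms by (metis of_real_power real_sqrt_pow2 less_imp_le half_gt_zero)
  moreover have "(?A)^2 = \<i>"
  proof -
   have "(?A)^2 = cis (pi / 4 + pi / 4)" by (simp only: cis_conv_exp[symmetric] power2_eq_square cis_mult)
   also have "pi / 4 + pi / 4 = pi / 2" by simp
   finally show ?thesis by (simp only: cis_pi_half)
  qed
  ultimately show "(?B * ?A)^2 = \<i> * ?C" by (simp add: power_mult_distrib)
  have "0 < Re (?A)" by (simp only: cis_conv_exp[symmetric]) (simp add: cos_45)
  moreover have "Re (r * z) = r * Re z" for r z by simp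
  ultimately have "0 < Re (?B * ?A)" using assms by (metis half_gt_zero mult_pos_pos real_sqrt_gt_zero)
  thus "0 < Re (?B * ?A) \<or> Re (?B * ?A) = 0 \<and> 0 <= Im (?B * ?A)"
   by (rule disjI1)
 qed
 have 2: "(2 * sqrt pi * sqrt (l / 2)) ^ CARD('n) = (2 * pi * l) powr (real CARD('n) / 2)"
 proof -
  have "2 * sqrt pi * sqrt (l / 2) = sqrt (2 * pi * l)" by (simp add: real_sqrt_mult real_sqrt_divide field_simps)
  thus ?thesis using assms by (simp add: powr_half_sqrt[symmetric] powr_powr powr_realpow[symmetric])
 qed
 have 3: "?A ^ CARD('n) = exp (\<i> * of_real (pi * real CARD('n) / 4))"
  using Complex.DeMoivre[of "pi / 4" "CARD('n)"] by (simp only: cis_conv_exp[symmetric]) (simp add: mult_ac)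
 have 4: "- of_real (x \<bullet> x) / (4 * (\<i> * ?C)) = \<i> / l * of_real ((norm x)^2 / 2)"
  using assms by (simp add: power2_norm_eq_inner divide_simps)
 have "(of_real (2 * sqrt pi) * csqrt (\<i> * ?C)) ^ CARD('n)
   = of_real ((2 * sqrt pi * sqrt (l / 2)) ^ CARD('n)) * ?A ^ CARD('n)" unfolding 1 by (simp add: power_mult_distrib)
 thus ?thesis unfolding heat_closed_form 4 2 3 by simp
qed

section \<open>An integrable weight and the decay of Schwartz functions\<close>

definition wt :: "real^'n => real" where "wt x = (\<Prod>i\<in>UNIV. inverse (1 + (x$i)\<^sup>2))"

lemma wt_pos: "0 < wt x" unfolding wt_def by (intro prod_pos) (auto intro!: add_pos_nonneg)

lemma wt_le_1: "wt x <= 1" unfolding wt_def by (intro prod_le_1) (auto simp: inverse_le_1_iff)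

lemma integrable_wt: "lint wt"
proof -
 have "lint (%t::real. inverse (1 + t^2))" using integrable_inverse_1_plus_square unfolding set_integrable_def by simp
 from integrable_lborel_vec_prod[OF this] show ?thesis unfolding wt_def .
qed

lemma borel_measurable_wt [measurable]: "bm wt" using integrable_wt by (auto dest: borel_measurable_integrable)

text \<open>The inverse of \<open>wt\<close> is bounded by a polynomial, so two polynomial decay
  bounds are enough to dominate a function by a multiple of this integrable weight.\<close>

lemma inverse_wt_le:
 fixes x :: "real^'n"
 shows "1 <= wt x * (2 ^ CARD('n) * (1 + norm x ^ (2 * CARD('n))))"
proof -
 let ?A = "1 + norm x ^ (2 * CARD('n))"
 let ?B = "1 + (norm x)^2"
 have "inverse (wt x) = (\<Prod>i\<in>UNIV. 1 + (x$i)^2)" by (simp add: wt_def prod_inversef[symmetric])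
 also have "... <= (\<Prod>i\<in>(UNIV::'n set). 1 + (norm x)^2)" by (intro prod_mono) (auto simp: abs_le_square_iff[symmetric] component_le_norm_cart)
 also have "... = ?B ^ CARD('n)" by simp
 also have "... <= 2 ^ CARD('n) * ?A"
 proof (cases "norm x <= 1")
  case True
  hence "?B ^ CARD('n) <= 2 ^ CARD('n)" by (intro power_mono) (auto simp: power_le_one)
  also have "... <= 2 ^ CARD('n) * ?A" by simp
  finally show ?thesis .
 next
  case False
  hence "1 <= (norm x)^2" by (simp add: one_le_power)
  hence "?B ^ CARD('n) <= (2 * (norm x)^2) ^ CARD('n)" by (intro power_mono) auto
  also have "... <= 2 ^ CARD('n) * ?A" by (simp add: power_mult_distrib power_mult)
  finally show ?thesis .
 qed
 finally have "wt x * inverse (wt x) <= wt x * (2 ^ CARD('n) * ?A)" using wt_pos[of x] by (intro mult_left_mono) auto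
 thus ?thesis using wt_pos[of x] by simp
qed

lemma rapid_decay_wt:
 fixes f :: "real^'n => complex"
 assumes "!!m::nat. \<exists>B. \<forall>x. norm x ^ m * cmod (f x) <= B"
 shows "\<exists>C\<ge>0. \<forall>x. norm x ^ m * cmod (f x) <= C * wt x"
proof -
 obtain A B where A: "!!x. norm x ^ m * cmod (f x) <= A" and B: "!!x. norm x ^ (m + 2 * CARD('n)) * cmod (f x) <= B" using assms by metis
 have "norm x ^ m * cmod (f x) <= (2 ^ CARD('n) * (A + B)) * wt x" for x
 proof -
  have "norm x ^ m * cmod (f x) * 1 <= norm x ^ m * cmod (f x) * (wt x * (2 ^ CARD('n) * (1 + norm x ^ (2 * CARD('n)))))" by (intro mult_left_mono inverse_wt_le) auto
  also have "... = wt x * (2 ^ CARD('n) * (norm x ^ m * cmod (f x) + norm x ^ (m + 2 * CARD('n)) * cmod (f x)))" by (simp add: power_add algebra_simps)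
  also have "... <= wt x * (2 ^ CARD('n) * (A + B))" using wt_pos[of x] A[of x] B[of x] by (intro mult_left_mono add_mono) auto
  finally show ?thesis by (simp add: mult_ac)
 qed
 moreover have "0 <= 2 ^ CARD('n) * (A + B)" by (intro mult_nonneg_nonneg add_nonneg_nonneg order_trans[OF _ A[of 0]] order_trans[OF _ B[of 0]]) auto
 ultimately show ?thesis by blast
qed

lemma schwartz_pds:
 assumes "f \<in> schwartz"
 shows "pds is f \<in> schwartz"
proof -
 have "pds js (pds is f) = pds (js @ is) f" for js by (simp add: pds_def)
 thus ?thesis using assms by (simp add: schwartz_def)
qed

lemma schwartzD:
 assumes "f \<in> schwartz"
 shows "cts f" "\<exists>C\<ge>0. \<forall>x. norm x ^ m * cmod (f x) <= C * wt x"
  "pd i f \<in> schwartz" "((%h. f (x + h *R axis i 1)) hvd pd i f x) (at 0)"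
proof -
 have d: "f differentiable at x" for x using assms unfolding schwartz_def pds_def by (auto dest!: spec[of _ "[]"])
 thus "cts f" by (simp add: continuous_at_imp_continuous_on differentiable_imp_continuous_within)
 show "\<exists>C\<ge>0. \<forall>x. norm x ^ m * cmod (f x) <= C * wt x"
  by (rule rapid_decay_wt) (use assms in \<open>auto simp: schwartz_def pds_def dest!: spec[of _ "[]"]\<close>)
 show "pd i f \<in> schwartz" using schwartz_pds[OF assms, of "[i]"] by (simp add: pds_def)
 let ?A = "%h. f (x + h *R axis i 1)"
 obtain f' where "(f has_derivative f') (at x)" using d by (auto simp: differentiable_def)
 hence "(f has_derivative f') (at (x + 0 *R axis i 1))" by simp
 moreover have "((%h. x + h *R axis i 1) has_derivative (%h. h *R axis i 1)) (at 0)" by (auto intro!: derivative_eq_intros)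
 ultimately have "(?A has_derivative (%h. f' (h *R axis i 1))) (at 0)"
  using diff_chain_at[of "%h. x + h *R axis i 1" _ 0 f f'] by (simp add: o_def)
 hence "?A differentiable (at 0)" by (auto simp: differentiable_def)
 thus "(?A hvd pd i f x) (at 0)" unfolding pd_def by (simp add: vector_derivative_works)
qed

section \<open>The amplitude class\<close>

text \<open>In \<open>(x, y, u, v)\<close> the points \<open>x, y\<close> are corners of cells and \<open>u, v\<close> are offsets in the cells. An atom depends on
 the corners in an arbitrary bounded way and exponentially on the offsets. The set \<open>cls B\<close> is the bipolar of \<open>B\<close> times the
 atoms, so an estimate which is linear in the amplitude need only be proved for atoms.\<close>

type_synonym 'n quad = "(real^'n) \<times> (real^'n) \<times> (real^'n) \<times> (real^'n)"

definition ubox :: "(real^'n) set" where "ubox = {u. \<forall>i. 0 <= u$i \<and> u$i <= 1}"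

definition region :: "('n::finite) quad set" where "region = {(x, y, u, v). u \<in> ubox \<and> v \<in> ubox}"

text \<open>Complex frequencies are allowed because the Gaussian window in
  \<open>sjostrand_cls\<close> produces real exponents. Subtracting the moduli of the real parts
  makes the modulus at most 1 on the unit box for every frequency, so atoms need no bound on their
  frequencies.\<close>

definition pexp :: "('n::finite => complex) => real^'n => complex" where
 "pexp ze u = exp (\<Sum>i\<in>UNIV. ze i * of_real (u$i) - of_real \<bar>Re (ze i)\<bar>)"

definition atom :: "(('n::finite) quad => complex) => bool" where
 "atom e \<longleftrightarrow> (\<exists>c ze ze'. c \<in> borel_measurable borel \<and> (\<forall>z. cmod (c z) <= 1) \<and>
   e = (%(x, y, u, v). c (x, y) * pexp ze u * pexp ze' v))"

text \<open>The functional sends A to the integral of F(z) A(fi z). Leaving the map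
  \<open>fi\<close> free makes the family stable under substitutions of the point, as in
  \<open>cls_slide\<close>, and lets it contain point evaluations, as in
  \<open>testf_const\<close>.\<close>

definition testf :: "((real^'n) \<times> (real^'n) => complex) => ((real^'n) \<times> (real^'n) => ('n::finite) quad) => bool" where
 "testf F fi \<longleftrightarrow> lint F \<and> fi \<in> borel_measurable borel \<and> (\<forall>z. fi z \<in> region) \<and>
   (\<forall>e. atom e \<longrightarrow> cmod (LBINT z. F z * e (fi z)) <= 1)"

definition cls :: "real => (('n::finite) quad => complex) => bool" where
 "cls B A \<longleftrightarrow> A \<in> borel_measurable borel \<and>
   (\<forall>F fi. testf F fi \<longrightarrow> cmod (LBINT z. F z * A (fi z)) <= B)"

lemma testfD:
 assumes "testf F fi"
 shows "lint F" "fi \<in> borel_measurable borel" "fi z \<in> region" "bm F"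
  "atom e ==> cmod (LBINT z. F z * e (fi z)) <= 1"
 using assms unfolding testf_def by (auto dest: borel_measurable_integrable simp del: split_paired_All)

lemma clsD:
 assumes "cls B A" "testf F fi"
 shows "cmod (LBINT z. F z * A (fi z)) <= B" using assms unfolding cls_def by blast

lemma continuous_on_pexp: "cts (pexp ze)" unfolding pexp_def by (intro continuous_intros)

lemma borel_measurable_pexp [measurable]: "pexp ze \<in> borel_measurable borel" by (rule borel_measurable_continuous_onI[OF continuous_on_pexp])

lemma norm_pexp_le: "u \<in> ubox ==> cmod (pexp ze u) <= 1"
proof -
 assume u: "u \<in> ubox"
 have "Re (ze i) * u$i <= \<bar>Re (ze i)\<bar>" for i
 proof -
  have "Re (ze i) * u$i <= \<bar>Re (ze i)\<bar> * \<bar>u$i\<bar>" by (simp add: abs_mult[symmetric])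
  also have "... <= \<bar>Re (ze i)\<bar> * 1" using u by (intro mult_left_mono) (auto simp: ubox_def)
  finally show ?thesis by simp
 qed
 hence "(\<Sum>i\<in>UNIV. Re (ze i) * u$i - \<bar>Re (ze i)\<bar>) <= 0" by (intro sum_nonpos) simp
 thus ?thesis unfolding pexp_def by simp
qed

lemma atom_bound: "atom e ==> p \<in> region ==> cmod (e p) <= 1"
 by (auto simp: atom_def region_def norm_mult intro!: mult_le_one norm_pexp_le)

lemma atom_measurable: "atom e ==> bm e"
proof -
 assume "atom e"
 then obtain c ze ze' where c[measurable]: "bm c" and e: "e = (%(x, y, u, v). c (x, y) * pexp ze u * pexp ze' v)" by (auto simp: atom_def)
 have [measurable]: "c \<in> borel_measurable (borel \<Otimes>\<^sub>M borel)" using c by (simp add: borel_prod)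
 show ?thesis unfolding e case_prod_beta borel_prod[symmetric] by measurable
qed

text \<open>By the triangle inequality for the real parts, renormalizing a product costs a constant
  factor of modulus at most 1, which the coefficient of an atom can absorb.\<close>

lemma pexp_mult: "\<exists>k. cmod k <= 1 \<and> (\<forall>u. pexp ze u * pexp ks u = k * pexp (%i. ze i + ks i) u)"
proof -
 define k where "k = exp (\<Sum>i\<in>UNIV. of_real (\<bar>Re (ze i + ks i)\<bar> - \<bar>Re (ze i)\<bar> - \<bar>Re (ks i)\<bar>) :: complex)"
 have "(\<Sum>i\<in>UNIV. \<bar>Re (ze i + ks i)\<bar> - \<bar>Re (ze i)\<bar> - \<bar>Re (ks i)\<bar>) <= 0"
  by (intro sum_nonpos) (use abs_triangle_ineq in \<open>auto simp: algebra_simps\<close>)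
 hence "cmod k <= 1" unfolding k_def by simp
 moreover have "pexp ze u * pexp ks u = k * pexp (%i. ze i + ks i) u" for u unfolding pexp_def k_def exp_add[symmetric] sum.distrib[symmetric]
  by (intro arg_cong[where f=exp] sum.cong) (auto simp: algebra_simps)
 ultimately show ?thesis by blast
qed

lemma atom_mult:
 assumes "atom e" "atom e'"
 shows "atom (%p. e p * e' p)"
proof -
 obtain c ze ze' where 1: "bm c" "!!z. cmod (c z) <= 1"
   "e = (%(x, y, u, v). c (x, y) * pexp ze u * pexp ze' v)" using assms(1) by (auto simp: atom_def)
 obtain d ks ks' where 2: "bm d" "!!z. cmod (d z) <= 1"
   "e' = (%(x, y, u, v). d (x, y) * pexp ks u * pexp ks' v)" using assms(2) by (auto simp: atom_def)
 obtain k k' where k: "cmod k <= 1" "!!u. pexp ze u * pexp ks u = k * pexp (%i. ze i + ks i) u"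
  "cmod k' <= 1" "!!u. pexp ze' u * pexp ks' u = k' * pexp (%i. ze' i + ks' i) u" using pexp_mult by metis
 show ?thesis unfolding atom_def
 proof (intro exI conjI)
  show "bm (%z. k * k' * c z * d z)" using 1(1) 2(1) by measurable
  show "\<forall>z. cmod (k * k' * c z * d z) <= 1" using k(1,3) 1(2) 2(2) by (auto simp: norm_mult intro!: mult_le_one)
  show "(%p. e p * e' p) = (%(x, y, u, v). (k * k' * c (x,y) * d (x,y)) * pexp (%i. ze i + ks i) u * pexp (%i. ze' i + ks' i) v)"
  proof
   fix p show "e p * e' p = (case p of (x, y, u, v) => (k * k' * c (x,y) * d (x,y)) * pexp (%i. ze i + ks i) u * pexp (%i. ze' i + ks' i) v)"
   proof (cases p)
    case (fields x y u v)
    have "e p * e' p = c (x,y) * d (x,y) * (pexp ze u * pexp ks u) * (pexp ze' v * pexp ks' v)" unfolding fields 1(3) 2(3) by simp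
    thus ?thesis unfolding k(2,4) fields by simp
   qed
  qed
 qed
qed

text \<open>Moves x + u to t (x + u) + (1 - t) (y + v) by acting on corners and offsets separately.
  The new corner need not be a corner of a grid, which is why atoms may depend on the corners
  arbitrarily.\<close>

definition slide :: "real => ('n::finite) quad => 'n quad" where
 "slide t = (%(x, y, u, v). (t *R x + (1 - t) *R y, y, t *R u + (1 - t) *R v, v))"

lemma slide_measurable [measurable]: "bm (slide t)" unfolding slide_def case_prod_beta by (rule borel_measurable_continuous_onI) (intro continuous_intros)

lemma slide_region: "0 <= t ==> t <= 1 ==> p \<in> region ==> slide t p \<in> region"
 by (auto simp: region_def slide_def ubox_def convex_bound_le)

text \<open>For t in [0, 1] the moduli of the real parts scale exactly by t and 1 - t, and these add
  up to 1, so the normalization is preserved without loss.\<close>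

lemma pexp_slide:
 assumes "0 <= t" "t <= 1"
 shows "pexp ze (t *R u + (1 - t) *R v) = pexp (%i. of_real t * ze i) u * pexp (%i. of_real (1 - t) * ze i) v"
 unfolding pexp_def exp_add[symmetric] sum.distrib[symmetric]
proof (intro arg_cong[where f=exp] sum.cong refl)
 fix i
 have "\<bar>Re (t * ze i)\<bar> = t * \<bar>Re (ze i)\<bar>" "\<bar>Re (of_real (1 - t) * ze i)\<bar> = (1 - t) * \<bar>Re (ze i)\<bar>"
  using assms by (simp_all add: abs_mult del: of_real_diff)
 thus "ze i * of_real ((t *R u + (1 - t) *R v) $ i) - of_real \<bar>Re (ze i)\<bar> =
  of_real t * ze i * of_real (u $ i) - of_real \<bar>Re (t * ze i)\<bar> +
  (of_real (1 - t) * ze i * of_real (v $ i) - of_real \<bar>Re (of_real (1 - t) * ze i)\<bar>)" by (simp only:) (simp add: algebra_simps)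
qed

lemma atom_slide:
 assumes "0 <= t" "t <= 1" "atom e"
 shows "atom (%p. e (slide t p))"
proof -
 obtain c ze ze' where 1: "bm c" "!!z. cmod (c z) <= 1"
   "e = (%(x, y, u, v). c (x, y) * pexp ze u * pexp ze' v)" using assms(3) by (auto simp: atom_def)
 let ?A = "of_real (1 - t)"
 obtain k where k: "cmod k <= 1" "!!u. pexp (%i. ?A * ze i) u * pexp ze' u = k * pexp (%i. ?A * ze i + ze' i) u"
  using pexp_mult by metis
 define c' where "c' = (%z. k * c (t *R fst z + (1 - t) *R snd z, snd z))"
 have 2: "bm c'"
 proof -
  have "bm (%z::(real^'a) \<times> (real^'a). (t *R fst z + (1 - t) *R snd z, snd z))"
   by (rule borel_measurable_continuous_onI) (intro continuous_intros)
  from measurable_compose[OF this 1(1)] show ?thesis unfolding c'_def by measurable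
 qed
 show ?thesis unfolding atom_def
 proof (intro exI conjI)
  show "bm c'" by (rule 2)
  show "\<forall>z. cmod (c' z) <= 1" using k(1) 1(2) by (auto simp: norm_mult c'_def intro!: mult_le_one)
  let ?B = "%i. of_real t * ze i"
  show "(%p. e (slide t p)) = (%(x, y, u, v). c' (x,y) * pexp ?B u * pexp (%i. ?A * ze i + ze' i) v)"
  proof
   fix p show "e (slide t p) = (case p of (x, y, u, v) => c' (x,y) * pexp ?B u * pexp (%i. ?A * ze i + ze' i) v)"
   proof (cases p)
    case (fields x y u v)
    have "e (slide t p) = c (t *R x + (1 - t) *R y, y) * pexp ?B u * (pexp (%i. ?A * ze i) v * pexp ze' v)"
     unfolding fields 1(3) slide_def by (simp add: pexp_slide[OF assms(1,2)] mult_ac)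
    thus ?thesis unfolding k(2) fields c'_def by (simp add: mult_ac)
   qed
  qed
 qed
qed

lemma atom_const: "cmod k <= 1 ==> atom (%p. k)"
 unfolding atom_def by (intro exI[of _ "%z. k"] exI[of _ "%i. 0"]) (auto simp: pexp_def)

lemma measure_unit_cbox: "measure lborel (cbox (0::'a::euclidean_space) One) = 1" by (simp add: content_unit del: measure_lborel_cbox)

lemma integrable_unit_cbox: "lint (%z. of_real (indicator (cbox (0::'a::euclidean_space) One) z) :: complex)"
 by (intro integrable_of_real integrable_real_indicator) (auto simp: emeasure_lborel_cbox_finite)

lemma integral_unit_cbox:
 "(LBINT z. of_real (indicator (cbox (0::'a::euclidean_space) One) z) * (k::complex)) = k"
proof -
 have "(LBINT z. of_real (indicator (cbox (0::'a::euclidean_space) One) z)) = (1::complex)" using measure_unit_cbox[where 'a='a] by (simp add: integral_complex_of_real)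
 thus ?thesis by (simp add: integral_mult_left_zero)
qed

text \<open>Evaluation at p written as an integral functional: the unit box has measure 1 and the
  inner map is constant. It makes the class bound control the supremum on
  \<open>region\<close>.\<close>

lemma testf_const:
 fixes p :: "('n::finite) quad"
 assumes "p \<in> region"
 shows "testf (%z. of_real (indicator (cbox 0 One) z)) (%z. p)"
 unfolding testf_def using assms atom_bound[OF _ assms] integrable_unit_cbox by (auto simp: integral_unit_cbox)

lemma cls_bound:
 fixes A :: "('n::finite) quad => complex"
 assumes "cls B A" "p \<in> region"
 shows "cmod (A p) <= B" using clsD[OF assms(1) testf_const[OF assms(2)]] by (simp add: integral_unit_cbox)

lemma zero_in_region: "(0, 0, 0, 0) \<in> region" by (simp add: region_def ubox_def)

lemma cls_nonneg: "cls B A ==> 0 <= B" by (rule order_trans[OF norm_ge_zero cls_bound[OF _ zero_in_region]])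

lemma cls_measurable: "cls B A ==> bm A" by (simp add: cls_def)

lemma testf_integrable:
 assumes F: "testf F fi" and A: "bm A" "!!p. p \<in> region ==> cmod (A p) <= B"
 shows "lint (%z. F z * A (fi z))"
proof (rule ibound)
 have B: "0 <= B" by (rule order_trans[OF norm_ge_zero A(2)[OF zero_in_region]])
 have Fi: "lint F" and [measurable]: "fi \<in> borel_measurable borel" and r: "!!z. fi z \<in> region" using testfD[OF F] by simp_all
 note [measurable] = A(1)
 have [measurable]: "bm F" using testfD[OF F] by simp
 show "lint (%z. B * norm (F z))" using Fi by auto
 show "(%z. F z * A (fi z)) \<in> borel_measurable lborel" by measurable
 show "AE z in lborel. norm (F z * A (fi z)) <= norm (B * norm (F z))"
 proof (rule AE_I2)
  fix z
  show "norm (F z * A (fi z)) <= norm (B * norm (F z))" using mult_right_mono[OF A(2)[OF r[of z]], of "cmod (F z)"] B by (simp add: norm_mult mult.commute)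
 qed
qed

lemmas cls_integrable = testf_integrable[OF _ cls_measurable cls_bound]

lemma cls_mono: "cls B A ==> B <= B' ==> cls B' A" unfolding cls_def by (meson order_trans)

lemma cls_cong:
 assumes "cls B A" "!!p. p \<in> region ==> A p = A' p" "bm A'"
 shows "cls B A'" unfolding cls_def
proof (intro conjI allI impI assms(3))
 fix F and fi :: "_ => 'a quad" assume F: "testf F fi"
 hence "F z * A' (fi z) = F z * A (fi z)" for z using assms(2)[OF testfD(3)[OF F]] by simp
 thus "cmod (LBINT z. F z * A' (fi z)) <= B" using clsD[OF assms(1) F] by (simp only:)
qed

lemma cls_atom: "atom e ==> cls 1 e" unfolding cls_def testf_def using atom_measurable by blast

lemma cls_add:
 assumes "cls B A" "cls B' A'"
 shows "cls (B + B') (%p. A p + A' p)" unfolding cls_def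
proof (intro conjI allI impI)
 show "bm (%p. A p + A' p)" using assms[THEN cls_measurable] by measurable
 fix F and fi :: "_ => 'a quad" assume F: "testf F fi"
 have "(LBINT z. F z * (A (fi z) + A' (fi z))) = (LBINT z. F z * A (fi z)) + (LBINT z. F z * A' (fi z))"
  unfolding distrib_left using F assms by (intro Bochner_Integration.integral_add cls_integrable)
 thus "cmod (LBINT z. F z * (A (fi z) + A' (fi z))) <= B + B'" using F assms unfolding cls_def by (auto intro!: norm_triangle_mono)
qed

lemma cls_scale:
 assumes "cls B A"
 shows "cls (cmod k * B) (%p. k * A p)" unfolding cls_def
proof (intro conjI allI impI)
 show "bm (%p. k * A p)" using assms[THEN cls_measurable] by measurable
 fix F and fi :: "_ => 'a quad" assume F: "testf F fi"
 have "(LBINT z. F z * (k * A (fi z))) = k * (LBINT z. F z * A (fi z))" by (simp add: mult.left_commute)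
 thus "cmod (LBINT z. F z * (k * A (fi z))) <= cmod k * B" using F assms unfolding cls_def by (auto simp: norm_mult intro!: mult_left_mono)
qed

lemma cls_zero: "cls 0 (%p. 0)" unfolding cls_def by simp

lemma cls_sum: "finite I ==> (!!i. i \<in> I ==> cls (B i) (A i)) ==> cls (\<Sum>i\<in>I. B i) (%p. \<Sum>i\<in>I. A i p)"
proof (induction I rule: finite_induct)
 case (insert i I) thus ?case using cls_add[of "B i" "A i" "\<Sum>i\<in>I. B i" "%p. \<Sum>i\<in>I. A i p"] by simp
qed (simp add: cls_zero)

text \<open>If \<open>B' > 0\<close>, then for a fixed atom \<open>e\<close> the functional \<open>A \<mapsto> \<Lambda>(e A')\<close> is bounded by \<open>B'\<close>; hence
 \<open>A \<mapsto> \<Lambda>(A A') / B'\<close> is again an admissible functional.\<close>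

lemma cls_mult:
 assumes A: "cls B A" and A': "cls B' A'"
 shows "cls (B * B') (%p. A p * A' p)"
proof -
 note [measurable] = A[THEN cls_measurable] A'[THEN cls_measurable]
 have main: "cls (B * C) (%p. A p * A' p)" if C: "B' <= C" "0 < C" for C unfolding cls_def
 proof (intro conjI allI impI)
  show "bm (%p. A p * A' p)" by measurable
  fix F and fi :: "_ => 'a quad" assume F: "testf F fi"
  have t1: "testf (%z. F z * e (fi z)) fi" if e: "atom e" for e unfolding testf_def
  proof (intro conjI allI impI)
   show "lint (%z. F z * e (fi z))" using F atom_measurable[OF e] atom_bound[OF e] by (rule testf_integrable)
   show "fi \<in> borel_measurable borel" "fi z \<in> region" for z using testfD[OF F] by simp_all
   fix e' :: "'a quad => complex" assume e': "atom e'"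
   show "cmod (LBINT z. F z * e (fi z) * e' (fi z)) <= 1" using testfD(5)[OF F atom_mult[OF e e']] by (simp add: mult.assoc)
  qed
  have t2: "testf (%z. F z * A' (fi z) / C) fi" unfolding testf_def
  proof (intro conjI allI impI)
   show "lint (%z. F z * A' (fi z) / C)" using cls_integrable[OF F A' A'] by simp
   show "fi \<in> borel_measurable borel" "fi z \<in> region" for z using testfD[OF F] by simp_all
   fix e :: "'a quad => complex" assume e: "atom e"
   let ?A = "LBINT z. F z * A' (fi z) / C * e (fi z)"
   have "?A = (LBINT z. F z * e (fi z) * A' (fi z)) / C" by (simp add: mult_ac)
   moreover have "cmod (LBINT z. F z * e (fi z) * A' (fi z)) <= C" using A' t1[OF e] C unfolding cls_def by (meson order_trans)
   ultimately show "cmod ?A <= 1" using C by (simp add: norm_divide)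
  qed
  have eq: "(LBINT z. F z * (A (fi z) * A' (fi z))) = C * (LBINT z. F z * A' (fi z) / C * A (fi z))" using C by (simp add: mult_ac)
  have "C * cmod (LBINT z. F z * A' (fi z) / C * A (fi z)) <= C * B" using clsD[OF A t2] C by (intro mult_left_mono) auto
  thus "cmod (LBINT z. F z * (A (fi z) * A' (fi z))) <= B * C" unfolding eq norm_mult using C by (simp add: mult.commute)
 qed
 show ?thesis
 proof (cases "B' = 0")
  case False
  thus ?thesis using main[of B'] cls_nonneg[OF A'] by simp
 next
  case True
  hence "A' p = 0" if "p \<in> region" for p using cls_bound[OF A' that] by simp
  hence "cls 0 (%p. A p * A' p)" by (intro cls_cong[OF cls_zero]) auto
  thus ?thesis using True by simp
 qed
qed

lemma cls_slide:
 assumes "0 <= t" "t <= 1" "cls B A"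
 shows "cls B (%p. A (slide t p))" unfolding cls_def
proof (intro conjI allI impI)
 note [measurable] = assms(3)[THEN cls_measurable]
 show "bm (%p. A (slide t p))" by measurable
 fix F and fi :: "_ => 'a quad" assume F: "testf F fi"
 have "testf F (%z. slide t (fi z))" unfolding testf_def
 proof (intro conjI allI impI)
  show "bm (%z. slide t (fi z))" by (rule measurable_compose[OF testfD(2)[OF F] slide_measurable])
  show "slide t (fi z) \<in> region" for z by (rule slide_region[OF assms(1,2) testfD(3)[OF F]])
  show "cmod (LBINT z. F z * e (slide t (fi z))) <= 1" if "atom e" for e using testfD(5)[OF F atom_slide[OF assms(1,2) that]] .
 qed (rule testfD(1)[OF F])
 thus "cmod (LBINT z. F z * A (slide t (fi z))) <= B" using assms(3) unfolding cls_def by blast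
qed

text \<open>Fubini moves the functional inside the integral over the parameter. This is the source
  of all nontrivial members of the class: Fourier superpositions and averages along
  segments.\<close>

lemma cls_integral:
 fixes A :: "'t => ('n::finite) quad => complex"
 assumes M: "sigma_finite_measure M"
  and m: "(%(th, p). A th p) \<in> borel_measurable (M \<Otimes>\<^sub>M borel)"
  and A: "!!th. th \<in> space M ==> cls (b th) (A th)" and b: "integrable M b"
 shows "cls (\<integral>th. b th \<partial>M) (%p. \<integral>th. A th p \<partial>M)" unfolding cls_def
proof (intro conjI allI impI)
 interpret M: sigma_finite_measure M by fact
 interpret P: pair_sigma_finite M "lborel :: ((real^'n) \<times> (real^'n)) measure" ..
 have m2: "(%(p, th). A th p) \<in> borel_measurable (borel \<Otimes>\<^sub>M M)" using measurable_pair_swap[OF m] by (simp add: case_prod_beta)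
 show "bm (%p. \<integral>th. A th p \<partial>M)" using M.borel_measurable_lebesgue_integral[OF m2] by simp
 fix F and fi :: "_ => 'n quad" assume F: "testf F fi"
 have Fi: "lint F" and [measurable]: "fi \<in> borel_measurable borel" and r: "!!z. fi z \<in> region" using testfD[OF F] by simp_all
 have [measurable]: "bm F" using testfD[OF F] by simp
 let ?A = "M \<Otimes>\<^sub>M lborel"
 have mm[measurable]: "(%(th, z). F z * A th (fi z)) \<in> borel_measurable ?A"
 proof -
  have "(%w. (fst w, fi (snd w))) \<in> measurable ?A (M \<Otimes>\<^sub>M borel)" by measurable
  from measurable_compose[OF this m] have [measurable]: "(%w. A (fst w) (fi (snd w))) \<in> borel_measurable ?A" by simp
  show ?thesis unfolding case_prod_beta by measurable
 qed
 have nb: "norm (F z * A th (fi z)) <= b th * norm (F z)" if "th \<in> space M" for th z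
  using mult_right_mono[OF cls_bound[OF A[OF that] r[of z]], of "cmod (F z)"] by (simp add: norm_mult mult.commute)
 have I: "integrable ?A (%(th, z). F z * A th (fi z))"
 proof (rule ibound)
  have bm[measurable]: "b \<in> borel_measurable M" using b by auto
  show "integrable ?A (%(th, z). b th * norm (F z))"
  proof (rule P.Fubini_integrable)
   have "integrable M (%th. norm (b th) * (LBINT z. norm (F z)))" using b by simp
   thus "integrable M (%th. \<integral>z. norm (case (th, z) of (th, z) => b th * norm (F z)) \<partial>lborel)"
    by (simp add: abs_mult)
   show "AE th in M. lint (%z. case (th, z) of (th, z) => b th * norm (F z))" using Fi by simp
  qed measurable
  show "AE w in M \<Otimes>\<^sub>M lborel. norm (case w of (th, z) => F z * A th (fi z)) <= norm (case w of (th, z) => b th * norm (F z))"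
   by (intro AE_I2) (auto simp: space_pair_measure intro: order_trans[OF nb])
 qed (rule mm)
 let ?B = "LBINT z. F z * (\<integral>th. A th (fi z) \<partial>M)"
 let ?C = "%th. LBINT z. F z * A th (fi z)"
 have "?B = (LBINT z. (\<integral>th. F z * A th (fi z) \<partial>M))" by simp
 also have "... = (\<integral>th. (?C th) \<partial>M)" by (rule P.Fubini_integral[OF I])
 also have "cmod ... <= (\<integral>th. cmod (?C th) \<partial>M)" by (rule integral_norm_bound)
 also have "... <= (\<integral>th. b th \<partial>M)"
 proof (rule integral_mono)
  show "integrable M (%th. cmod (?C th))" using P.integrable_fst'[OF I] by (intro integrable_norm) simp
  show "norm (?C th) <= b th" if "th \<in> space M" for th by (rule clsD[OF A[OF that] F])
 qed (rule b)
 finally show "cmod ?B <= (\<integral>th. b th \<partial>M)" .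
qed

text \<open>Bounded pointwise convergence suffices, since every functional is dominated by B
  |F|.\<close>

lemma cls_limit:
 assumes A: "!!k::nat. cls B (A k)" and lim: "!!p. p \<in> region ==> (%k. A k p) ----> A' p"
  and m: "bm A'"
 shows "cls B A'" unfolding cls_def
proof (intro conjI allI impI m)
 fix F and fi :: "_ => 'a quad" assume F: "testf F fi"
 have Fi: "lint F" and [measurable]: "fi \<in> borel_measurable borel" and r: "!!z. fi z \<in> region" using testfD[OF F] by simp_all
 have [measurable]: "bm F" using testfD[OF F] by simp
 note [measurable] = m cls_measurable[OF A]
 have "(%k. \<integral>z. F z * A k (fi z) \<partial>lborel) ----> (LBINT z. F z * A' (fi z))"
 proof (rule integral_dominated_convergence)
  show "lint (%z. B * norm (F z))" using Fi by simp
  show "AE z in lborel. norm (F z * A k (fi z)) <= B * norm (F z)" for k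
  proof (rule AE_I2)
   fix z show "norm (F z * A k (fi z)) <= B * norm (F z)" using mult_right_mono[OF cls_bound[OF A r[of z]], of "cmod (F z)"] by (simp add: norm_mult mult.commute)
  qed
 qed (auto intro!: tendsto_intros lim r)
 thus "cmod (LBINT z. F z * A' (fi z)) <= B" by (intro LIMSEQ_le_const2[OF tendsto_norm]) (use A F in \<open>auto simp: cls_def\<close>)
qed

lemma cls_power: "cls B A ==> cls (B ^ k) (%p. A p ^ k)"
proof (induction k)
 case 0 thus ?case using cls_atom[OF atom_const[of 1]] by simp
next
 case (Suc k) thus ?case using cls_mult[of B A "B ^ k" "%p. A p ^ k"] by simp
qed

text \<open>The term 1 is removed so that the bound tends to 0 with B. This smallness gives the
  initial condition of the approximate kernel in \<open>kern_small\<close>.\<close>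

lemma cls_exp:
 assumes A: "cls B A"
 shows "cls (exp B - 1) (%p. exp (A p) - 1)"
proof (rule cls_limit)
 note [measurable] = cls_measurable[OF A]
 show "bm (%p. exp (A p) - 1)" by measurable
 have s: "(%k. z ^ Suc k /\<^sub>R fact (Suc k)) sums (exp z - 1)" for z :: "'b::{banach,real_normed_algebra_1}"
  using exp_converges[of z] by (subst sums_Suc_iff) simp
 show "(%k. \<Sum>j<k. inverse (of_real (fact (Suc j))) * A p ^ Suc j) ----> exp (A p) - 1" for p
  using s[of "A p"] unfolding sums_def by (simp add: scaleR_conv_of_real)
 fix k :: nat
 let ?A = "\<Sum>j<k. cmod (inverse (of_real (fact (Suc j)))) * B ^ Suc j"
 let ?B = "%p. \<Sum>j<k. inverse (of_real (fact (Suc j))) * A p ^ Suc j"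
 have "cls ?A ?B"
  by (intro cls_sum cls_scale cls_power A) auto
 moreover have "?A = (\<Sum>j<k. B ^ Suc j /\<^sub>R fact (Suc j))"
  by (intro sum.cong) (auto simp: norm_inverse simp del: of_real_fact fact_Suc)
 moreover have "... <= (\<Sum>j. B ^ Suc j /\<^sub>R fact (Suc j))" using s[of B] cls_nonneg[OF A] by (intro sum_le_suminf) (auto simp: sums_iff)
 ultimately show "cls (exp B - 1) ?B" using s[of B] by (auto simp: sums_iff elim: cls_mono)
qed

section \<open>Oscillatory integral operators\<close>

definition l2n :: "('a::euclidean_space => complex) => real" where
 "l2n f = sqrt (LBINT x. (cmod (f x))\<^sup>2)"

text \<open>Integrability makes pairings with bounded kernels absolutely convergent, while the
  estimates are in terms of the L^2 norm; the space is dense in L^2.\<close>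

definition l12 :: "(real^'n => complex) => bool" where
 "l12 f \<longleftrightarrow> lint f \<and> lint (%x. (cmod (f x))\<^sup>2)"

lemma l12D:
 assumes "l12 f"
 shows "lint f" "lint (%x. (cmod (f x))^2)" "bm f" using assms unfolding l12_def by (auto dest: borel_measurable_integrable)

lemma l2n_nonneg: "0 <= l2n f" by (simp add: l2n_def)

lemma l2n_sq: "(l2n f)^2 = (LBINT x. (cmod (f x))^2)" by (simp add: l2n_def)

lemma l12_bounded_mult:
 fixes f p :: "real^'n => complex"
 assumes f: "l12 f" and p: "bm p" "!!x. cmod (p x) <= K"
 shows "l12 (%x. p x * f x)" "l2n (%x. p x * f x) <= K * l2n f"
proof -
 note [measurable] = l12D(3)[OF f] p(1)
 have K: "0 <= K" by (rule order_trans[OF norm_ge_zero p(2)[of undefined]])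
 have b: "(cmod (p x * f x))^2 <= K^2 * (cmod (f x))^2" for x unfolding norm_mult power_mult_distrib by (intro mult_right_mono power_mono p(2)) auto
 have i2: "lint (%x. (cmod (p x * f x))^2)" by (rule ibound[of _ "%x. K^2 * (cmod (f x))^2"])
   (use l12D(2)[OF f] b in auto)
 have i1: "lint (%x. p x * f x)"
 proof (rule ibound[of _ "%x. K * cmod (f x)"])
  show "AE x in lborel. norm (p x * f x) <= norm (K * cmod (f x))" using p(2) K by (intro AE_I2) (simp add: norm_mult mult_right_mono)
 qed (use l12D(1)[OF f] in auto)
 show "l12 (%x. p x * f x)" using i1 i2 by (simp add: l12_def)
 have "(LBINT x. (cmod (p x * f x))^2) <= (LBINT x. K^2 * (cmod (f x))^2)" by (rule integral_mono) (use i2 l12D(2)[OF f] b in auto)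
 hence "(LBINT x. (cmod (p x * f x))^2) <= K^2 * (LBINT x. (cmod (f x))^2)" by simp
 thus "l2n (%x. p x * f x) <= K * l2n f" unfolding l2n_def using real_sqrt_le_mono[of _ "K^2 * (LBINT x. (cmod (f x))^2)"] K
  by (simp add: real_sqrt_mult)
qed

lemma
 fixes f :: "'a::euclidean_space => 'c::{real_normed_field,banach,second_countable_topology}"
  and h :: "'b::euclidean_space => 'c"
 assumes "lint f" "lint h"
 shows integrable_tensor: "lint (%(x, y). h x * f y)"
  and integral_tensor: "(\<integral>(x, y). h x * f y \<partial>lborel) = (LBINT x. h x) * (LBINT y. f y)"
proof -
 have [measurable]: "bm f" "bm h" using assms by (auto dest: borel_measurable_integrable)
 have I: "integrable (lborel \<Otimes>\<^sub>M lborel) (%(x, y). h x * f y)"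
 proof (rule lborel_pair.Fubini_integrable)
  show "lint (%x. \<integral>y. norm (case (x, y) of (x, y) => h x * f y) \<partial>lborel)" using assms by (simp add: norm_mult)
 qed (use assms in auto)
 thus "lint (%(x, y). h x * f y)" by (simp add: lborel_prod)
 show "(\<integral>(x, y). h x * f y \<partial>lborel) = (LBINT x. h x) * (LBINT y. f y)" using lborel_pair.integral_fst'[OF I] by (simp add: lborel_prod)
qed

section \<open>Trigonometric functions on boxes and Bessel's inequality\<close>

definition trig :: "real => ('n::finite => int) => real^'n => complex" where
 "trig w m y = exp (\<i> * of_real (w * (\<Sum>i\<in>UNIV. of_int (m i) * y$i)))"

lemma norm_trig: "cmod (trig w m y) = 1" by (simp add: trig_def)

lemma trig_measurable [measurable]: "bm (trig w m)" unfolding trig_def by measurable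

lemma integral_period:
 fixes L q :: real and k :: int
 assumes L: "0 < L"
 shows "lint (%t. indicator {q..q + L} t *R exp (\<i> * of_real (2 * pi / L * (of_int k * t))))"
  and "(LBINT t. indicator {q..q + L} t *R exp (\<i> * of_real (2 * pi / L * (of_int k * t)))) = (if k = 0 then of_real L else 0)"
proof -
 let ?e = "%t. exp (\<i> * of_real (2 * pi / L * (of_int k * t)))"
 have c: "continuous_on {q..q + L} ?e" by (intro continuous_intros)
 show "lint (%t. indicator {q..q + L} t *R ?e t)"
  using borel_integrable_compact[OF compact_Icc c] by (simp add: indicator_scaleR_eq_if if_distrib cong: if_cong)
 show "(LBINT t. indicator {q..q + L} t *R ?e t) = (if k = 0 then of_real L else 0)"
 proof (cases "k = 0")
  case True
  have "(LBINT t. indicator {q..q + L} t *R (1::complex)) = of_real L"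
   using L by (subst Bochner_Integration.integral_scaleR_left) (auto simp: integrable_indicator_iff scaleR_conv_of_real)
  thus ?thesis using True by simp
 next
  case False
  define w where "w = 2 * pi / L * of_int k"
  have w: "w \<noteq> 0" using False L by (simp add: w_def)
  let ?A = "\<i> * of_real w"
  let ?B = "%t. \<i> * of_real (w * t)"
  have d: "((%t. exp (?B t) / ?A) hvd exp (?B t)) (at t within {q..q + L})" for t
  proof -
   have "((%t. \<i> * of_real (w * t)) hvd ?A) (at t)" unfolding has_vector_derivative_def
    by (rule derivative_eq_intros refl)+ (auto simp: fun_eq_iff algebra_simps scaleR_conv_of_real)
   from has_vector_derivative_divide[OF has_vector_derivative_cexp[OF this], of "\<i> * of_real w"]
   show ?thesis using w by - (rule has_vector_derivative_at_within, simp)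
  qed
  have "continuous_on {q..q + L} (%t. exp (?B t))" by (intro continuous_intros)
  moreover have "q <= q + L" using L by simp
  ultimately have "(LBINT t. indicator {q..q + L} t *R exp (?B t)) = exp (\<i> * of_real (w * (q + L))) / ?A - exp (\<i> * of_real (w * q)) / ?A"
   by (intro integral_FTC_Icc d)
  moreover have "exp (\<i> * of_real (w * (q + L))) = exp (\<i> * of_real (w * q))"
  proof -
   have "w * L = 2 * pi * of_int k" using L by (simp add: w_def)
   hence "\<i> * of_real (w * (q + L)) = \<i> * of_real (w * q) + of_int (2 * k) * pi * \<i>" by (simp only: distrib_left of_real_add) (simp add: mult_ac)
   thus ?thesis by (simp only:) (subst exp_eq, rule exI[of _ k], simp)
  qed
  ultimately show ?thesis using False by (simp add: w_def mult.assoc)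
 qed
qed

definition pbox :: "real => real^'n => (real^'n) set" where
 "pbox L q = {y. \<forall>i. q$i <= y$i \<and> y$i <= q$i + L}"

lemma
 fixes q :: "real^'n"
 assumes "0 < L"
 shows integrable_trig_mult: "lint (%y. indicator (pbox L q) y *R (trig (2 * pi / L) m y * cnj (trig (2 * pi / L) m' y)))"
  and integral_trig_mult: "(LBINT y. indicator (pbox L q) y *R (trig (2 * pi / L) m y * cnj (trig (2 * pi / L) m' y)))
   = (if m = m' then of_real (L ^ CARD('n)) else 0)"
proof -
 define f where "f i t = indicator {q$i..q$i + L} t *R exp (\<i> * of_real (2 * pi / L * (of_int (m i - m' i) * t)))" for i t
 let ?D = "%y. cnj (trig (2 * pi / L) m' y)"
 have e: "indicator (pbox L q) y *R (trig (2 * pi / L) m y * ?D y) = (\<Prod>i\<in>UNIV. f i (y$i))" for y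
 proof -
  let ?B = "\<Prod>i\<in>UNIV. exp (\<i> * of_real (2 * pi / L * (of_int (m i - m' i) * y$i)))"
  have "trig (2 * pi / L) m y * ?D y = exp (\<Sum>i\<in>UNIV. \<i> * of_real (2 * pi / L * (of_int (m i - m' i) * y$i)))"
   unfolding trig_def exp_cnj exp_add[symmetric] by (intro arg_cong[where f=exp]) (simp add: sum_distrib_left left_diff_distrib right_diff_distrib sum_subtractf sum_negf)
  also have "... = ?B" by (rule exp_sum) simp
  finally have 1: "trig (2 * pi / L) m y * ?D y = ?B" .
  have 2: "indicator (pbox L q) y = (\<Prod>i\<in>UNIV. indicator {q$i..q$i + L} (y$i) :: complex)" by (auto simp: pbox_def indicator_def prod_zero_iff)
  show ?thesis unfolding f_def 1 scaleR_conv_of_real prod.distrib by (simp add: 2 of_real_indicator)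
 qed
 have i: "lint (f i)" "(LBINT t. f i t) = (if m i = m' i then of_real L else 0)" for i
  unfolding f_def using integral_period[OF assms, of "q$i" "m i - m' i"] by auto
 show "lint (%y. indicator (pbox L q) y *R (trig (2 * pi / L) m y * ?D y))"
  unfolding e by (rule integrable_lborel_vec_prod[OF i(1)])
 let ?A = "LBINT y. indicator (pbox L q) y *R (trig (2 * pi / L) m y * cnj (trig (2 * pi / L) m' y))"
 let ?C = "if m = m' then of_real (L ^ CARD('n)) else 0"
 have "?A = (\<Prod>i\<in>UNIV. if m i = m' i then of_real L else 0)"
  unfolding e using integral_lborel_vec_prod[OF i(1)] i(2) by simp
 also have "... = ?C" by (auto simp: fun_eq_iff prod_zero_iff)
 finally show "?A
   = ?C" .
qed

lemma borel_measurable_cnj [measurable]: "bm cnj" by (rule borel_measurable_continuous_onI) (intro continuous_intros)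

lemma integrable_trig_weighted:
 fixes f :: "real^'n => complex"
 assumes "lint f"
 shows "lint (%y. cnj (trig w m y) * f y)"
proof -
 have [measurable]: "bm f" using assms by (auto dest: borel_measurable_integrable)
 show ?thesis by (rule ibound[OF assms]) (auto simp: norm_mult norm_trig)
qed

text \<open>Expand the squared norm of f - G, where G is the partial Fourier sum on the box. The
  trigonometric functions have squared norm L^d there, whence the factor.\<close>

lemma bessel_trig:
 fixes f :: "real^'n => complex" and q :: "real^'n"
 assumes L: "0 < L" and f: "l12 f" and supp: "!!y. y \<notin> pbox L q ==> f y = 0" and S: "finite S"
 shows "(\<Sum>m\<in>S. (cmod (LBINT y. cnj (trig (2 * pi / L) m y) * f y))^2) <= L ^ CARD('n) * (l2n f)^2"
proof -
 let ?e = "trig (2 * pi / L)" and ?V = "L ^ CARD('n)"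
 define a where "a m = (LBINT y. cnj (?e m y) * f y)" for m
 let ?F = "%m. a m / of_real ?V"
 define G where "G y = (\<Sum>m\<in>S. (?F m) * (indicator (pbox L q) y *R ?e m y))" for y
 have V: "?V > 0" using L by simp
 have If: "lint (%y. cnj (?e m y) * f y)" for m by (rule integrable_trig_weighted[OF l12D(1)[OF f]])
 have Ifc: "lint (%y. ?e m y * cnj (f y))" for m
 proof -
  have "(%y. cnj (cnj (?e m y) * f y)) = (%y. ?e m y * cnj (f y))" by auto
  thus ?thesis using integrable_cnj[of lborel "%y. cnj (?e m y) * f y"] If[of m] by simp
 qed
 have fc: "(LBINT y. ?e m y * cnj (f y)) = cnj (a m)" for m unfolding a_def Bochner_Integration.integral_cnj[symmetric] by simp
 have fG: "G y * cnj (f y) = (\<Sum>m\<in>S. (?F m) * (?e m y * cnj (f y)))" for y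
  unfolding G_def sum_distrib_right using supp[of y] by (intro sum.cong refl) (cases "y \<in> pbox L q", auto)
 have I1: "lint (%y. G y * cnj (f y))" unfolding fG by (intro Bochner_Integration.integrable_sum integrable_mult_right Ifc)
 let ?A = "\<Sum>m\<in>S. (cmod (a m))^2"
 let ?D = "of_real (?A / ?V)"
 have "(LBINT y. G y * cnj (f y)) = (\<Sum>m\<in>S. (?F m) * cnj (a m))" unfolding fG using Ifc by (subst Bochner_Integration.integral_sum) (auto simp: fc)
 also have "... = ?D"
  by (simp add: sum_divide_distrib complex_norm_square[symmetric] times_divide_eq_left del: of_real_power)
 finally have i1: "(LBINT y. G y * cnj (f y)) = ?D" .
 let ?E = "%y m m'. indicator (pbox L q) y *R (?e m y * cnj (?e m' y))"
 have GG: "G y * cnj (G y) = (\<Sum>m\<in>S. \<Sum>m'\<in>S. (a m / of_real ?V * cnj (?F m')) * (?E y m m'))" for y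
  unfolding G_def cnj_sum sum_product by (intro sum.cong refl) (cases "y \<in> pbox L q", auto)
 have I2: "lint (%y. G y * cnj (G y))" unfolding GG by (intro Bochner_Integration.integrable_sum integrable_mult_right integrable_trig_mult[OF L])
 let ?B = "\<Sum>m\<in>S. \<Sum>m'\<in>S. (a m / of_real ?V * cnj (a m' / of_real ?V)) * (if m = m' then of_real ?V else 0)"
 let ?C = "LBINT y. G y * cnj (G y)"
 have "?C = ?B"
 proof -
  have J: "lint (%y. c * (?E y m m'))" for c m m'
   by (rule integrable_mult_right, rule integrable_trig_mult[OF L])
  have "?C = (\<Sum>m\<in>S. \<Sum>m'\<in>S. \<integral>y. (a m / of_real ?V * cnj (?F m')) * (?E y m m') \<partial>lborel)"
   unfolding GG by (subst Bochner_Integration.integral_sum, intro Bochner_Integration.integrable_sum J,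
    intro sum.cong refl Bochner_Integration.integral_sum J)
  also have "... = ?B"
   by (intro sum.cong refl) (simp only: integral_mult_right_zero integral_trig_mult[OF L])
  finally show ?thesis .
 qed
 also have "... = (\<Sum>m\<in>S. (a m / of_real ?V * cnj (?F m)) * of_real ?V)"
  using S by (simp add: if_distrib[of "%x. _ * x"] sum.delta cong: if_cong)
 also have "... = ?D" unfolding of_real_divide of_real_sum sum_divide_distrib using V
  by (intro sum.cong refl) (simp add: complex_norm_square del: of_real_power)
 finally have i2: "?C = ?D" .
 have r: "(cmod (f y - G y))^2 = (cmod (f y))^2 - 2 * Re (G y * cnj (f y)) + Re (G y * cnj (G y))" for y
 proof -
  have "(cmod (f y - G y))^2 = (Re (f y) - Re (G y))^2 + (Im (f y) - Im (G y))^2" "(cmod (f y))^2 = (Re (f y))^2 + (Im (f y))^2"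
   by (simp_all add: cmod_power2)
  thus ?thesis by (simp add: power2_eq_square algebra_simps)
 qed
 have "0 <= (LBINT y. (cmod (f y - G y))^2)" by simp
 also have "... = (LBINT y. (cmod (f y))^2) - 2 * (LBINT y. Re (G y * cnj (f y))) + (LBINT y. Re (G y * cnj (G y)))"
 proof -
  have "(LBINT y. A y - 2 * B y + C y) = (LBINT y. A y) - 2 * (LBINT y. B y) + (LBINT y. C y)"
   if "lint A" "lint B" "lint C" for A B C :: "real^'n => real" using that by simp
  from this[OF l12D(2)[OF f] integrable_Re[OF I1] integrable_Re[OF I2]] show ?thesis unfolding r .
 qed
 also have "(LBINT y. Re (G y * cnj (f y))) = ?A / ?V" using integral_Re[OF I1] i1 by simp
 also have "(LBINT y. Re (G y * cnj (G y))) = ?A / ?V" using integral_Re[OF I2] i2 by simp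
 finally have "?A / ?V <= (l2n f)^2" by (simp add: l2n_sq)
 thus ?thesis using V unfolding a_def by (simp add: pos_divide_le_eq mult.commute)
qed

section \<open>Oscillatory kernels on a grid of cells\<close>

lemma borel_measurable_vec_lambda:
 fixes g :: "'n::finite => 'a => real"
 assumes [measurable]: "!!i. g i \<in> borel_measurable M"
 shows "(%x. \<chi> i. g i x) \<in> borel_measurable M"
proof -
 have "(\<chi> i. g i x) = (\<Sum>i\<in>UNIV. g i x *R axis i 1)" for x by (simp add: vec_eq_iff axis_def if_distrib[of "%t. _ * t"] cong: if_cong)
 thus ?thesis by simp
qed

lemma borel_measurable_vec_nth [measurable (raw)]:
 fixes f :: "'a => real^'n"
 assumes "f \<in> borel_measurable M"
 shows "(%x. f x $ i) \<in> borel_measurable M" by (rule measurable_compose[OF assms borel_measurable_continuous_onI]) (intro continuous_intros)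

text \<open>\<open>l\<close> is the parameter of the phase |x - y|^2 / (2 l) and \<open>r\<close>
  the side of the cells. The condition on r^2 says that r is at most L = 2 pi l / r, the period
  belonging to the frequency lattice with spacing r / l.\<close>

locale grid =
 fixes l r :: real and dummy :: "'n::finite itself"
 assumes l: "0 < l" and r: "0 < r" "r\<^sup>2 <= 2 * pi * l"
begin

definition idx :: "real^'n => 'n => int" where "idx x i = \<lfloor>x$i / r\<rfloor>"
definition base :: "real^'n => real^'n" where "base x = (\<chi> i. r * of_int (idx x i))"
definition off :: "real^'n => real^'n" where "off x = x - base x"
definition L :: real where "L = 2 * pi * l / r"

lemma L_pos: "0 < L" and r_le_L: "r <= L" and w_eq: "2 * pi / L = r / l" using l r by (auto simp: L_def pos_le_divide_eq power2_eq_square)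

lemma base_measurable [measurable]: "bm base" unfolding base_def idx_def by (rule borel_measurable_vec_lambda) measurable

lemma off_measurable [measurable]: "bm off" unfolding off_def by measurable

lemma off_bounds: "0 <= off x $ i" "off x $ i <= r"
proof -
 have "of_int \<lfloor>x$i / r\<rfloor> <= x$i / r" "x$i / r < of_int \<lfloor>x$i / r\<rfloor> + 1" by linarith+
 thus "0 <= off x $ i" "off x $ i <= r" using mult_left_mono[OF of_int_floor_le[of "x$i / r"], of r] r
  by (auto simp: off_def base_def idx_def pos_divide_less_eq algebra_simps)
qed

lemma idx_pbox: "idx y = m ==> y \<in> pbox L (\<chi> i. r * of_int (m i))"
 using off_bounds[of y] r_le_L by (auto simp: pbox_def off_def base_def) (smt (verit))

lemma idx_set_measurable [measurable]: "{y. idx y = m} \<in> sets borel"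
proof -
 have "{y. idx y = m} = {y \<in> space borel. \<forall>i. \<lfloor>y$i / r\<rfloor> = m i}" by (auto simp: idx_def fun_eq_iff)
 also have "... \<in> sets borel" by measurable
 finally show ?thesis .
qed

text \<open>What couples x and y in the quadratic phase once the coupling of the offsets is split
  off: each variable meets the other only through the corner of its cell, as a lattice
  frequency.\<close>

definition ker :: "(('n => int) => ('n => int) => complex) => (real^'n) \<times> (real^'n) => complex" where
 "ker c z = c (idx (fst z)) (idx (snd z)) * cnj (trig (r / l) (idx (fst z)) (snd z)) * cnj (trig (r / l) (idx (snd z)) (fst z))"

lemma norm_ker: "(!!m m'. cmod (c m m') <= 1) ==> cmod (ker c z) <= 1" by (simp add: ker_def norm_mult norm_trig)

lemma ker_measurable:
 assumes [measurable]: "bm (%z. c (idx (fst z)) (idx (snd z)))"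
 shows "bm (ker c)"
proof -
 have "bm (%z::(real^'n) \<times> (real^'n). trig (r / l) (idx (fst z)) (snd z))"
   "bm (%z::(real^'n) \<times> (real^'n). trig (r / l) (idx (snd z)) (fst z))" unfolding trig_def idx_def borel_prod[symmetric] by measurable
 thus ?thesis unfolding ker_def by measurable
qed

lemma integrable_ker:
 fixes f h :: "real^'n => complex"
 assumes f: "lint f" and h: "lint h" and K: "bm K" "!!z. cmod (K z) <= B"
 shows "lint (%z. K z * (f (snd z) * h (fst z)))"
proof (rule ibound)
 have B: "0 <= B" by (rule order_trans[OF norm_ge_zero K(2)[of undefined]])
 have i: "lint (%z. f (snd z) * h (fst z))" using integrable_tensor[OF f h] by (subst mult.commute) (simp add: case_prod_unfold)
 note [measurable] = K(1) borel_measurable_integrable[OF i]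
 let ?A = "%z. f (snd z) * h (fst z)"
 show "lint (%z. B * norm (?A z))" using i by (intro integrable_mult_right integrable_norm)
 show "(%z. K z * (?A z)) \<in> borel_measurable lborel" by measurable
 show "AE z in lborel. norm (K z * (?A z)) <= norm (B * norm (?A z))"
 proof (rule AE_I2)
  fix z show "norm (K z * (?A z)) <= norm (B * norm (?A z))"
   using mult_right_mono[OF K(2)[of z], of "norm (?A z)"] B by (simp add: norm_mult)
 qed
qed

text \<open>On a pair of cells the kernel is a tensor product, so the pairing becomes a sum of
  products of Fourier coefficients of pieces of \<open>f\<close> and \<open>h\<close>.
  Cauchy-Schwarz over all pairs of cells reduces it to Bessel's inequality in each cell, and the
  pieces are orthogonal.\<close>

lemma ker_bound0:
 fixes f h :: "real^'n => complex"
 assumes c: "!!m m'. cmod (c m m') <= 1" and f: "l12 f" and h: "l12 h" and S: "finite S"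
  and sf: "!!y. f y \<noteq> 0 ==> idx y \<in> S" and sh: "!!y. h y \<noteq> 0 ==> idx y \<in> S"
 shows "cmod (LBINT z. ker c z * (f (snd z) * h (fst z))) <= L ^ CARD('n) * l2n f * l2n h"
proof -
 define P where "P g m y = of_real (indicator {y. idx y = m} y) * g y" for g :: "real^'n => complex" and m y
 have P12: "l12 (P g m)" if "l12 g" for g m unfolding P_def
 proof (rule l12_bounded_mult(1)[OF that, of _ 1])
  show "bm (%y. complex_of_real (indicator {y. idx y = m} y))" by measurable
 qed (simp add: indicator_def)
 have Psum: "g y = (\<Sum>m\<in>S. P g m y)" if "!!y. g y \<noteq> 0 ==> idx y \<in> S" for g y
 proof (cases "idx y \<in> S")
  case True
  hence "(\<Sum>m\<in>S. P g m y) = (\<Sum>m\<in>S. if m = idx y then g y else 0)" by (intro sum.cong refl) (auto simp: P_def)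
  also have "... = g y" using True S by simp
  finally show ?thesis by simp
 next
  case False
  hence "g y = 0" using that by blast
  thus ?thesis by (simp add: P_def)
 qed
 have Psq: "(\<Sum>m\<in>S. (l2n (P g m))^2) = (l2n g)^2" if g: "l12 g" and s: "!!y. g y \<noteq> 0 ==> idx y \<in> S" for g
 proof -
  have pt: "(\<Sum>m\<in>S. (cmod (P g m y))^2) = (cmod (g y))^2" for y
  proof (cases "idx y \<in> S")
   case True
   hence "(\<Sum>m\<in>S. (cmod (P g m y))^2) = (\<Sum>m\<in>S. if m = idx y then (cmod (g y))\<^sup>2 else 0)" by (intro sum.cong refl) (auto simp: P_def)
   also have "... = (cmod (g y))^2" using True S by simp
   finally show ?thesis .
  next
   case False
   hence "g y = 0" using s by blast
   thus ?thesis by (simp add: P_def)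
  qed
  have "(\<Sum>m\<in>S. (l2n (P g m))^2) = (LBINT y. (\<Sum>m\<in>S. (cmod (P g m y))^2))"
   unfolding l2n_sq by (rule Bochner_Integration.integral_sum[symmetric]) (rule l12D(2)[OF P12[OF g]])
  also have "... = (LBINT y. (cmod (g y))^2)" unfolding pt ..
  finally show ?thesis by (simp add: l2n_sq)
 qed
 \<comment> \<open>The coefficient at the frequency of cell m of the piece of g in cell m'; the
   frequency and the position are independent.\<close>
 define A where "A g m m' = (LBINT y. cnj (trig (r / l) m y) * P g m' y)" for g m m'
 have A: "(\<Sum>m\<in>S. \<Sum>m'\<in>S. (cmod (A g m m'))^2) <= L ^ CARD('n) * (l2n g)^2" if g: "l12 g" and s: "!!y. g y \<noteq> 0 ==> idx y \<in> S" for g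
 proof -
  have "(\<Sum>m\<in>S. \<Sum>m'\<in>S. (cmod (A g m m'))^2) = (\<Sum>m'\<in>S. \<Sum>m\<in>S. (cmod (A g m m'))^2)" by (rule sum.swap)
  also have "... <= (\<Sum>m'\<in>S. L ^ CARD('n) * (l2n (P g m'))^2)"
  proof (rule sum_mono)
   fix m'
   have "P g m' y = 0" if "y \<notin> pbox L (\<chi> i. r * of_int (m' i))" for y using idx_pbox[of y m'] that by (auto simp: P_def indicator_def)
   thus "(\<Sum>m\<in>S. (cmod (A g m m'))^2) <= L ^ CARD('n) * (l2n (P g m'))^2" unfolding A_def w_eq[symmetric] by (intro bessel_trig L_pos P12 g S)
  qed
  also have "... = L ^ CARD('n) * (l2n g)^2" using Psq[OF g] s by (simp add: sum_distrib_left[symmetric])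
  finally show ?thesis .
 qed
 let ?H = "%m' z m. (cnj (trig (r / l) m' (fst z)) * P h m (fst z)) * (cnj (trig (r / l) m (snd z)) * P f m' (snd z))"
 have T: "lint (%z. c m m' * (?H m' z m))"
  "(LBINT z. c m m' * (?H m' z m)) = c m m' * (A h m' m * A f m m')" for m m'
 proof -
  note t = integrable_tensor[OF integrable_trig_weighted[OF l12D(1)[OF P12[OF f]]] integrable_trig_weighted[OF l12D(1)[OF P12[OF h]]], of "r/l" m' m "r/l" m m']
   integral_tensor[OF integrable_trig_weighted[OF l12D(1)[OF P12[OF f]]] integrable_trig_weighted[OF l12D(1)[OF P12[OF h]]], of "r/l" m' m "r/l" m m', folded A_def]
  show "lint (%z. c m m' * (?H m' z m))"
   using t(1) by (intro integrable_mult_right) (simp add: case_prod_unfold)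
  show "(LBINT z. c m m' * (?H m' z m)) = c m m' * (A h m' m * A f m m')"
   unfolding integral_mult_right_zero t(2)[symmetric] by (simp add: case_prod_unfold)
 qed
 have e: "ker c z * (f (snd z) * h (fst z)) = (\<Sum>m\<in>S. \<Sum>m'\<in>S. c m m' * (?H m' z m))" for z
 proof -
  have "ker c z * (f (snd z) * h (fst z)) = ker c z * ((\<Sum>m\<in>S. P h m (fst z)) * (\<Sum>m'\<in>S. P f m' (snd z)))"
  proof -
   have "f (snd z) = (\<Sum>m\<in>S. P f m (snd z))" "h (fst z) = (\<Sum>m\<in>S. P h m (fst z))" by (rule Psum, rule sf, simp) (rule Psum, rule sh, simp)
   thus ?thesis by (simp only: mult.commute)
  qed
  also have "... = (\<Sum>m\<in>S. \<Sum>m'\<in>S. ker c z * (P h m (fst z) * P f m' (snd z)))" unfolding sum_product by (simp add: sum_distrib_left)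
  also have "... = (\<Sum>m\<in>S. \<Sum>m'\<in>S. c m m' * (?H m' z m))"
   by (intro sum.cong refl) (auto simp: P_def indicator_def ker_def)
  finally show ?thesis .
 qed
 let ?A = "\<Sum>p\<in>S \<times> S. cmod (A h (snd p) (fst p)) * cmod (A f (fst p) (snd p))"
 let ?D = "L ^ CARD('n) * (l2n h)^2"
 let ?E = "L ^ CARD('n) * (l2n f)^2"
 have "(LBINT z. ker c z * (f (snd z) * h (fst z))) = (\<Sum>m\<in>S. \<Sum>m'\<in>S. c m m' * (A h m' m * A f m m'))"
  unfolding e T(2)[symmetric] by (subst Bochner_Integration.integral_sum, intro Bochner_Integration.integrable_sum T(1),
    intro sum.cong refl Bochner_Integration.integral_sum T(1))
 also have "cmod ... <= (\<Sum>m\<in>S. \<Sum>m'\<in>S. cmod (A h m' m) * cmod (A f m m'))"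
 proof (intro sum_norm_le)
  fix m m'
  have "cmod (c m m') * (cmod (A h m' m) * cmod (A f m m')) <= 1 * (cmod (A h m' m) * cmod (A f m m'))" by (rule mult_right_mono[OF c]) simp
  thus "cmod (c m m' * (A h m' m * A f m m')) <= cmod (A h m' m) * cmod (A f m m')" by (simp add: norm_mult)
 qed
 also have "... = ?A" by (simp add: sum.cartesian_product case_prod_unfold)
 also have "... <= sqrt (?D * ?E)"
 proof (rule real_le_rsqrt)
  let ?B = "\<Sum>p\<in>S \<times> S. (cmod (A h (snd p) (fst p)))^2"
  let ?C = "\<Sum>p\<in>S \<times> S. (cmod (A f (fst p) (snd p)))^2"
  let ?F = "\<Sum>m'\<in>S. \<Sum>m\<in>S. (cmod (A h m' m))^2"
  let ?G = "\<Sum>m\<in>S. \<Sum>m'\<in>S. (cmod (A f m m'))^2"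
  have "?A^2 \<le>
   ?B * ?C" by (rule Cauchy_Schwarz_ineq_sum)
  also have "?B = ?F"
   by (subst sum.swap) (simp add: sum.cartesian_product case_prod_unfold)
  also have "?C = ?G"
   by (simp add: sum.cartesian_product case_prod_unfold)
  also have "?F * ?G <= ?D * ?E"
   using L_pos by (intro mult_mono A h f sh sf) (auto intro!: sum_nonneg)
  finally show "?A^2 <= ?D * ?E" .
 qed
 also have "... = L ^ CARD('n) * l2n f * l2n h" using L_pos l2n_nonneg[of f] l2n_nonneg[of h] by (simp add: real_sqrt_mult)
 finally show ?thesis .
qed

lemma off_inner_le: "\<bar>off x \<bullet> off y\<bar> <= real CARD('n) * r^2"
proof -
 have "\<bar>off x \<bullet> off y\<bar> <= (\<Sum>i\<in>(UNIV::'n set). \<bar>off x $ i * off y $ i\<bar>)" unfolding inner_vec_def inner_real_def by (rule sum_abs)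
 also have "... <= (\<Sum>i\<in>(UNIV::'n set). r^2)" using off_bounds r unfolding power2_eq_square abs_mult by (intro sum_mono mult_mono) auto
 finally show ?thesis by simp
qed

lemma off_inner_measurable [measurable]: "bm (%z. off (fst z) \<bullet> off (snd z))" unfolding borel_prod[symmetric] by measurable

text \<open>Each factor off x . off y is a sum over the coordinates, and every summand is absorbed
  into \<open>f\<close> and \<open>h\<close> at the cost r for each. One power thus costs CARD('n)
  r^2.\<close>

lemma ker_bound_power:
 fixes f h :: "real^'n => complex"
 assumes c: "!!m m'. cmod (c m m') <= 1" and cm: "bm (%z. c (idx (fst z)) (idx (snd z)))"
  and S: "finite S"
 shows "l12 f ==> l12 h ==> (!!y. f y \<noteq> 0 ==> idx y \<in> S) ==> (!!y. h y \<noteq> 0 ==> idx y \<in> S) ==>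
  cmod (LBINT z. ker c z * of_real ((off (fst z) \<bullet> off (snd z)) ^ k) * (f (snd z) * h (fst z)))
   <= (real CARD('n) * r^2) ^ k * (L ^ CARD('n) * l2n f * l2n h)"
proof (induction k arbitrary: f h)
 case 0
 thus ?case using ker_bound0[OF c _ _ S, of f h] by simp
next
 case (Suc k)
 let ?f = "%i y. of_real (off y $ i) * f y" and ?h = "%i x. of_real (off x $ i) * h x"
 have m: "bm (%y. complex_of_real (off y $ i))" for i by measurable
 have b: "cmod (of_real (off y $ i)) <= r" for y i using off_bounds[of y i] by simp
 note F = l12_bounded_mult[OF Suc.prems(1) m b] and H = l12_bounded_mult[OF Suc.prems(2) m b]
 note [measurable] = ker_measurable[OF cm]
 let ?A = "real CARD('n) * r^2"
 let ?D = "%z. off (fst z) \<bullet> off (snd z)"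
 let ?E = "%z. of_real ((?D z) ^ k)"
 let ?F = "%i z. ?f i (snd z) * ?h i (fst z)"
 have I: "lint (%z. ker c z * ?E z * (?F i z))" for i
 proof (rule integrable_ker[OF l12D(1)[OF F(1)] l12D(1)[OF H(1)]])
  show "bm (%z. ker c z * ?E z)" by measurable
  fix z
  have "cmod (ker c z) * \<bar>off (fst z) \<bullet> off (snd z)\<bar> ^ k <= 1 * ?A ^ k"
   by (intro mult_mono norm_ker c power_mono off_inner_le) auto
  thus "cmod (ker c z * ?E z) <= ?A ^ k" by (simp add: norm_mult norm_power)
 qed
 have e: "ker c z * of_real ((?D z) ^ Suc k) * (f (snd z) * h (fst z)) =
  (\<Sum>i\<in>UNIV. ker c z * ?E z * (?F i z))" for z
 proof -
  have "of_real (?D z) = (\<Sum>i\<in>UNIV. of_real (off (fst z) $ i) * of_real (off (snd z) $ i) :: complex)"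
   unfolding inner_vec_def by simp
  hence "ker c z * of_real ((?D z) ^ Suc k) * (f (snd z) * h (fst z)) =
   ker c z * ?E z * (f (snd z) * h (fst z)) * (\<Sum>i\<in>UNIV. of_real (off (fst z) $ i) * of_real (off (snd z) $ i))"
   by (simp add: mult_ac)
  also have "... = (\<Sum>i\<in>UNIV. ker c z * ?E z * (?F i z))"
   unfolding sum_distrib_left by (intro sum.cong refl) (simp add: mult_ac)
  finally show ?thesis .
 qed
 let ?C = "L ^ CARD('n) * (r * l2n f) * (r * l2n h)"
 have "cmod (LBINT z. ker c z * of_real ((?D z) ^ Suc k) * (f (snd z) * h (fst z)))
  = cmod (\<Sum>i\<in>UNIV. \<integral>z. ker c z * ?E z * (?F i z) \<partial>lborel)"
  unfolding e by (subst Bochner_Integration.integral_sum) (rule I, rule refl)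
 also have "... <= (\<Sum>i\<in>(UNIV::'n set). ?A ^ k * ?C)"
 proof (rule sum_norm_le)
  fix i :: 'n
  let ?B = "cmod (LBINT z. ker c z * of_real ((off (fst z) \<bullet> off (snd z)) ^ k) * (?f i (snd z) * ?h i (fst z)))"
  have "?B <= ?A ^ k * (L ^ CARD('n) * l2n (?f i) * l2n (?h i))"
   by (rule Suc.IH[OF F(1) H(1)]) (use Suc.prems(3,4) in auto)
  also have "... <= ?A ^ k * ?C"
   using L_pos r by (intro mult_left_mono mult_mono F(2) H(2)) (auto simp: l2n_nonneg)
  finally show "?B <= ?A ^ k * ?C" .
 qed
 also have "... = ?A ^ Suc k * (L ^ CARD('n) * l2n f * l2n h)" by (simp add: power2_eq_square mult_ac)
 finally show ?case .
qed

text \<open>The exponential series is summed termwise with \<open>ker_bound_power\<close>. The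
  constant stays bounded when |kp| r^2 does, and \<open>kp\<close> has modulus 1 / l in the
  application.\<close>

lemma ker_bound_exp:
 fixes f h :: "real^'n => complex"
 assumes c: "!!m m'. cmod (c m m') <= 1" and cm: "bm (%z. c (idx (fst z)) (idx (snd z)))"
  and S: "finite S" and f: "l12 f" and h: "l12 h"
  and s: "!!y. f y \<noteq> 0 ==> idx y \<in> S" "!!y. h y \<noteq> 0 ==> idx y \<in> S"
 shows "cmod (LBINT z. ker c z * exp (kp * of_real (off (fst z) \<bullet> off (snd z))) * (f (snd z) * h (fst z)))
   <= exp (cmod kp * (real CARD('n) * r^2)) * (L ^ CARD('n) * l2n f * l2n h)"
proof -
 let ?t = "%z. off (fst z) \<bullet> off (snd z)" and ?N = "real CARD('n) * r^2" and ?D = "L ^ CARD('n) * l2n f * l2n h"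
 note [measurable] = ker_measurable[OF cm]
 have D: "0 <= ?D" using L_pos by (simp add: l2n_nonneg)
 define p where "p k z = (\<Sum>j<k. (kp * of_real (?t z)) ^ j /\<^sub>R fact j)" for k z
 let ?A = "cmod kp * ?N"
 have pb: "cmod (p k z) <= exp ?A" for k z
 proof -
  have "cmod (p k z) <= (\<Sum>j<k. (cmod kp * \<bar>?t z\<bar>) ^ j /\<^sub>R fact j)"
   unfolding p_def by (rule sum_norm_le) (simp add: norm_mult norm_power power_mult_distrib)
  also have "... <= exp (cmod kp * \<bar>?t z\<bar>)" unfolding exp_def by (intro sum_le_suminf summable_exp_generic) auto
  also have "... <= exp ?A" using mult_left_mono[OF off_inner_le[of "fst z" "snd z"], of "cmod kp"] by simp
  finally show ?thesis .
 qed
 have lim: "(%k. p k z) ----> exp (kp * of_real (?t z))" for z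
  unfolding p_def using exp_converges[of "kp * of_real (?t z)"] by (simp add: sums_def)
 have [measurable]: "bm (p k)" for k unfolding p_def by measurable
 have i: "lint (%z. f (snd z) * h (fst z))"
  using integrable_tensor[OF l12D(1)[OF f] l12D(1)[OF h]] by (subst mult.commute) (simp add: case_prod_unfold)
 note [measurable] = borel_measurable_integrable[OF i]
 let ?C = "%z. f (snd z) * h (fst z)"
 have "(%k. \<integral>z. ker c z * p k z * (?C z) \<partial>lborel) ----> (LBINT z. ker c z * exp (kp * of_real (?t z)) * (?C z))"
 proof (rule integral_dominated_convergence[where w="%z. exp ?A * norm (?C z)"])
  show "lint (%z. exp ?A * norm (?C z))" by (intro integrable_mult_right integrable_norm i)
  show "AE z in lborel. norm (ker c z * p k z * (?C z)) <= exp ?A * norm (?C z)" for k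
  proof (rule AE_I2)
   fix z
   have "cmod (ker c z) * cmod (p k z) <= 1 * exp ?A" by (intro mult_mono norm_ker c pb) auto
   thus "norm (ker c z * p k z * (?C z)) <= exp ?A * norm (?C z)"
    unfolding norm_mult[of "ker c z * p k z"] norm_mult[of "ker c z"] by (intro mult_right_mono) auto
  qed
  show "AE z in lborel. (%k. ker c z * p k z * (?C z)) ----> ker c z * exp (kp * of_real (?t z)) * (?C z)"
   by (intro AE_I2 tendsto_intros lim)
 qed measurable
 moreover have "cmod (LBINT z. ker c z * p k z * (?C z)) <= exp ?A * ?D" for k
 proof -
  have I: "lint (%z. ker c z * of_real (?t z ^ j) * (?C z))" for j
  proof (rule integrable_ker[OF l12D(1)[OF f] l12D(1)[OF h]])
   fix z
   have "cmod (ker c z) * \<bar>?t z\<bar> ^ j <= 1 * ?N ^ j" by (intro mult_mono norm_ker c power_mono off_inner_le) auto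
   thus "cmod (ker c z * of_real (?t z ^ j)) <= ?N ^ j" by (simp add: norm_mult norm_power)
  qed measurable
  let ?E = "%j. kp ^ j / of_real (fact j)"
  have "(LBINT z. ker c z * p k z * (?C z)) = (LBINT z. (\<Sum>j<k. (?E j) * (ker c z * of_real (?t z ^ j) * (?C z))))"
   unfolding p_def sum_distrib_left sum_distrib_right
   by (intro icong refl sum.cong) (simp add: scaleR_conv_of_real power_mult_distrib field_simps)
  also have "... = (\<Sum>j<k. (?E j) * (LBINT z. ker c z * of_real (?t z ^ j) * (?C z)))"
   by (subst Bochner_Integration.integral_sum) (rule integrable_mult_right, rule I, simp only: integral_mult_right_zero)
  also have "cmod ... <= (\<Sum>j<k. ?A ^ j /\<^sub>R fact j * ?D)"
  proof (rule sum_norm_le)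
   fix j
   let ?B = "LBINT z. ker c z * of_real (?t z ^ j) * (f (snd z) * h (fst z))"
   have "cmod (?E j) * cmod ?B <= (cmod kp ^ j / fact j) * (?N ^ j * ?D)"
    by (intro mult_mono ker_bound_power[OF c cm S f h s]) (auto simp: norm_divide norm_power)
   thus "cmod ((?E j) * ?B) <= ?A ^ j /\<^sub>R fact j * ?D"
    unfolding norm_mult[of "kp ^ j / of_real (fact j)"] by (simp add: power_mult_distrib field_simps)
  qed
  also have "... = (\<Sum>j<k. ?A ^ j /\<^sub>R fact j) * ?D" by (simp add: sum_distrib_right)
  also have "... <= exp ?A * ?D" unfolding exp_def using D by (intro mult_right_mono sum_le_suminf summable_exp_generic) auto
  finally show ?thesis .
 qed
 ultimately show ?thesis by (intro LIMSEQ_le_const2[OF tendsto_norm]) auto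
qed

end

lemma l12_weight:
 fixes f :: "real^'n => complex"
 assumes f: "l12 f" and p: "bm p" "!!x. cmod (p x) <= 1"
 shows "l12 (%x. p x * f x)" "l2n (%x. p x * f x) <= l2n f" using l12_bounded_mult[OF assms] by auto

context grid
begin

lemma off_ubox: "r <= 1 ==> off x \<in> ubox" using off_bounds[of x] by (auto simp: ubox_def intro: order_trans)

definition cell :: "(real^'n) \<times> (real^'n) => 'n quad" where
 "cell z = (base (fst z), base (snd z), off (fst z), off (snd z))"

lemma cell_measurable [measurable]: "bm cell" unfolding cell_def borel_prod[symmetric] by measurable

lemma trig_idx: "trig (r / l) (idx x) y = exp (\<i> / of_real l * of_real (base x \<bullet> y))"
proof -
 have "r / l * (\<Sum>i\<in>UNIV. of_int (idx x i) * y$i) = (base x \<bullet> y) / l"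
  unfolding base_def inner_vec_def by (simp add: sum_distrib_left sum_divide_distrib mult_ac)
 thus ?thesis unfolding trig_def by (simp only:) (simp add: field_simps)
qed

text \<open>With x and y written as corner plus offset, - x . y = - base x . y - base y . x + base x
  . base y - off x . off y. The third term goes into the coefficient and the last into
  \<open>ker_bound_exp\<close>.\<close>

lemma phase_split:
 "exp (\<i> / of_real l * of_real ((norm (x - y))^2 / 2)) =
  exp (\<i> / of_real l * of_real ((norm x)^2 / 2)) * exp (\<i> / of_real l * of_real ((norm y)^2 / 2)) *
  (cnj (trig (r / l) (idx x) y) * cnj (trig (r / l) (idx y) x) * exp (\<i> / of_real l * of_real (base x \<bullet> base y)) *
   exp (- \<i> / of_real l * of_real (off x \<bullet> off y)))"
proof -
 have 1: "(norm (x - y))^2 / 2 = (norm x)^2 / 2 + (norm y)^2 / 2 - base x \<bullet> y - base y \<bullet> x + base x \<bullet> base y - off x \<bullet> off y"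
  unfolding power2_norm_eq_inner off_def by (simp add: inner_diff_left inner_diff_right inner_commute)
 have c: "cnj (exp (\<i> / of_real l * of_real t)) = exp (- (\<i> / of_real l * of_real t))" for t by (simp add: exp_cnj)
 show ?thesis unfolding trig_idx c 1 exp_add[symmetric] by (rule arg_cong[where f=exp]) (simp add: algebra_simps)
qed

text \<open>The exponentials in the offsets and the phases of one variable have modulus at most 1
  and are absorbed into \<open>f\<close> and \<open>h\<close>; the coefficient of the atom depends
  on the two cells and is absorbed into \<open>c\<close>. The bound is thus independent of the
  atom.\<close>

lemma atom_kernel_bound:
 fixes f h :: "real^'n => complex"
 assumes r1: "r <= 1" and e: "atom e" and f: "l12 f" and h: "l12 h" and S: "finite S"
  and s: "!!y. f y \<noteq> 0 ==> idx y \<in> S" "!!y. h y \<noteq> 0 ==> idx y \<in> S"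
 shows "cmod (LBINT z. exp (\<i> / of_real l * of_real ((norm (fst z - snd z))^2 / 2)) * e (cell z) * (f (snd z) * h (fst z)))
  <= exp (1 / l * (real CARD('n) * r^2)) * (L ^ CARD('n) * l2n f * l2n h)"
proof -
 obtain c0 ze ze' where c0: "bm c0" "!!z. cmod (c0 z) <= 1"
   "e = (%(x, y, u, v). c0 (x, y) * pexp ze u * pexp ze' v)" using e by (auto simp: atom_def)
 define bs where "bs m = (\<chi> i. r * of_int (m i))" for m :: "'n => int"
 have bs: "bs (idx x) = base x" for x by (simp add: bs_def base_def)
 define c where "c m m' = c0 (bs m, bs m') * exp (\<i> / of_real l * of_real (bs m \<bullet> bs m'))" for m m'
 have c1: "cmod (c m m') <= 1" for m m' using c0(2) by (simp add: c_def norm_mult)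
 have cm: "bm (%z. c (idx (fst z)) (idx (snd z)))"
 proof -
  have 1: "bm (%z::(real^'n) \<times> (real^'n). (base (fst z), base (snd z)))" unfolding borel_prod[symmetric] by measurable
  have 2: "bm (%z::(real^'n) \<times> (real^'n). base (fst z) \<bullet> base (snd z))" unfolding borel_prod[symmetric] by measurable
  note [measurable] = measurable_compose[OF 1 c0(1)] 2
  show ?thesis unfolding c_def bs by measurable
 qed
 define ph where "ph x = exp (\<i> / of_real l * of_real ((norm x)^2 / 2))" for x :: "real^'n"
 have ph: "bm ph" "cmod (ph x) = 1" for x unfolding ph_def by measurable
 note [measurable] = ph(1)
 define f' where "f' y = pexp ze' (off y) * ph y * f y" for y
 define h' where "h' y = pexp ze (off y) * ph y * h y" for y
 have m: "bm (%y. pexp ze (off y) * ph y)" for ze by measurable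
 have b: "cmod (pexp ze (off y) * ph y) <= 1" for ze y using norm_pexp_le[OF off_ubox[OF r1]] by (simp add: norm_mult ph)
 have f': "l12 f'" "l2n f' <= l2n f" and h': "l12 h'" "l2n h' <= l2n h" unfolding f'_def h'_def by (auto intro!: l12_weight f h m b)
 let ?A = "%z. exp (- \<i> / of_real l * of_real (off (fst z) \<bullet> off (snd z)))"
 have eq: "exp (\<i> / l * of_real ((norm (fst z - snd z))^2 / 2)) * e (cell z) * (f (snd z) * h (fst z))
  = ker c z * ?A z * (f' (snd z) * h' (fst z))" for z
  unfolding phase_split cell_def c0(3) ker_def c_def bs f'_def h'_def ph_def by (simp add: mult_ac)
 have "cmod (LBINT z. ker c z * ?A z * (f' (snd z) * h' (fst z)))
  <= exp (cmod (- \<i> / l) * (real CARD('n) * r^2)) * (L ^ CARD('n) * l2n f' * l2n h')"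
  by (rule ker_bound_exp[OF c1 cm S f'(1) h'(1)]) (use s in \<open>auto simp: f'_def h'_def\<close>)
 also have "... <= exp (1 / l * (real CARD('n) * r^2)) * (L ^ CARD('n) * l2n f * l2n h)"
  using L_pos l f' h' by (intro mult_mono) (auto simp: l2n_nonneg norm_divide)
 finally show ?thesis unfolding eq .
qed

text \<open>The bound for atoms says that the normalized kernel together with the map
  \<open>cell\<close> is a test functional, so the definition of the class applies.\<close>

lemma cls_kernel_bound_finite:
 fixes f h :: "real^'n => complex"
 assumes r1: "r <= 1" and a: "cls B (%(x, y, u, v). a (x + u, y + v))" and f: "l12 f" and h: "l12 h" and S: "finite S"
  and s: "!!y. f y \<noteq> 0 ==> idx y \<in> S" "!!y. h y \<noteq> 0 ==> idx y \<in> S"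
 shows "cmod (LBINT z. exp (\<i> / of_real l * of_real ((norm (fst z - snd z))^2 / 2)) * a z * (f (snd z) * h (fst z)))
  <= B * (exp (1 / l * (real CARD('n) * r^2)) * (L ^ CARD('n) * l2n f * l2n h))"
  (is "?X <= B * ?D")
proof (rule field_le_epsilon)
 fix ep :: real assume ep: "0 < ep"
 have B: "0 <= B" by (rule cls_nonneg[OF a])
 have D: "0 <= ?D" using L_pos by (simp add: l2n_nonneg)
 \<comment> \<open>Normalization needs a positive constant, but \<open>?D\<close> may vanish. The
   increment is divided by B + 1 so that it contributes at most \<open>ep\<close> after
   multiplication by B.\<close>
 define D' where "D' = ?D + ep / (B + 1)"
 have D': "?D <= D'" "0 < D'" using ep B D by (auto simp: D'_def add_nonneg_pos)
 define K where "K z = exp (\<i> / of_real l * of_real ((norm (fst z - snd z))^2 / 2))" for z :: "(real^'n) \<times> (real^'n)"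
 define F where "F z = K z * (f (snd z) * h (fst z)) / of_real D'" for z
 have K: "bm K" "cmod (K z) <= 1" for z unfolding K_def borel_prod[symmetric] by measurable
 have "testf F cell" unfolding testf_def
 proof (intro conjI allI impI)
  show "lint F" unfolding F_def by (intro integrable_divide integrable_ker[OF l12D(1)[OF f] l12D(1)[OF h] K])
  show "cell z \<in> region" for z by (simp add: cell_def region_def off_ubox r1)
  fix e :: "'n quad => complex" assume e: "atom e"
  have "(LBINT z. F z * e (cell z)) = (LBINT z. K z * e (cell z) * (f (snd z) * h (fst z))) / D'" unfolding F_def by (simp add: mult_ac)
  thus "cmod (LBINT z. F z * e (cell z)) <= 1" using atom_kernel_bound[OF r1 e f h S s, folded K_def] D' by (simp add: norm_divide)
 qed measurable
 from clsD[OF a this] have "cmod (LBINT z. F z * a z) <= B" by (simp add: cell_def off_def)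
 moreover have "(LBINT z. F z * a z) = (LBINT z. K z * a z * (f (snd z) * h (fst z))) / D'" unfolding F_def by (simp add: mult_ac)
 ultimately have "?X <= B * D'" using D' by (simp add: norm_divide K_def pos_divide_le_eq)
 also have "... = B * ?D + ep * (B / (B + 1))" by (simp add: D'_def distrib_left)
 also have "... <= B * ?D + ep * 1" using B ep by (intro add_left_mono mult_left_mono) auto
 finally show "?X <= B * ?D + ep" by simp
qed

end

lemma cls_fun_measurable:
 assumes "cls B (%(x, y, u, v). a (x + u, y + v))"
 shows "bm a"
proof -
 have "(%z. (fst z, snd z, 0, 0)) \<in> borel_measurable (borel :: ((real^'a) \<times> (real^'a)) measure)"
  by (rule borel_measurable_continuous_onI) (intro continuous_intros)
 from measurable_compose[OF this cls_measurable[OF assms]] show ?thesis by simp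
qed

lemma cls_fun_bound:
 assumes "cls B (%(x, y, u, v). a (x + u, y + v))"
 shows "cmod (a z) <= B" using cls_bound[OF assms, of "(fst z, snd z, 0, 0)"] by (simp add: region_def ubox_def)

lemma integrable_kernel:
 fixes f h :: "real^'n => complex"
 assumes f: "lint f" and h: "lint h" and K: "bm K" "!!z. cmod (K z) <= B"
 shows "lint (%z. K z * (f (snd z) * h (fst z)))"
proof -
 \<comment> \<open>Any admissible grid serves here; it gives access to
   \<open>integrable_ker\<close>.\<close>
 interpret grid 1 1 "TYPE('n)" using pi_gt3 by unfold_locales auto
 show ?thesis by (rule integrable_ker[OF assms])
qed

text \<open>The L^2 bound for quadratic phase and amplitude in the class, uniform for 0 < l <= T.
  The normalization of the heat kernel is what compensates the factor L^d from Bessel's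
  inequality.\<close>

lemma cls_kernel_bound:
 fixes f h :: "real^'n => complex"
 assumes lT: "0 < l" "l <= T" and a: "cls B (%(x, y, u, v). a (x + u, y + v))" and f: "l12 f" and h: "l12 h"
 shows "cmod (LBINT z. heat (\<i> * of_real (l / 2)) (fst z - snd z) * a z * (f (snd z) * h (fst z)))
  <= exp (2 * pi * CARD('n)) * (max 1 (sqrt (2 * pi * T))) ^ CARD('n) * B * l2n f * l2n h"
proof -
 define q where "q = sqrt (2 * pi * l)"
 have q: "0 < q" "q^2 = 2 * pi * l" using lT by (auto simp: q_def)
 \<comment> \<open>The natural side is q = sqrt (2 pi l); the cap at 1 keeps the offsets in the unit
   box.\<close>
 define r where "r = min 1 q"
 have rr: "0 < r" "r <= 1" "r <= q" using q by (auto simp: r_def)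
 have r2: "r^2 <= 2 * pi * l" using power_mono[OF rr(3), of 2] rr(1) q by simp
 interpret grid l r "TYPE('n)" using lT rr r2 by unfold_locales auto
 define K where "K z = exp (\<i> / of_real l * of_real ((norm (fst z - snd z))^2 / 2))" for z :: "(real^'n) \<times> (real^'n)"
 have K: "bm K" "cmod (K z) = 1" for z unfolding K_def borel_prod[symmetric] by measurable
 note am[measurable] = cls_fun_measurable[OF a]
 have Ka: "bm (%z. K z * a z)" "cmod (K z * a z) <= B" for z using K(1) am cls_fun_bound[OF a, of z] by (auto simp: norm_mult K(2))
 \<comment> \<open>The estimate so far concerns finitely many cells; \<open>f\<close> and
   \<open>h\<close> are cut off to growing blocks of cells and the bound passes to the
   limit.\<close>
 define S where "S k = {m :: 'n => int. \<forall>i. m i \<in> {- int k..int k}}" for k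
 have S: "finite (S k)" for k
 proof -
  have "S k = PiE UNIV (%i. {- int k..int k})" by (auto simp: S_def)
  thus ?thesis by (simp add: finite_PiE)
 qed
 define cut where "cut k y = (of_real (indicator {y. idx y \<in> S k} y) :: complex)" for k y
 have cut_m: "bm (cut k)" for k
 proof -
  have "{y. idx y \<in> S k} = (\<Union>m\<in>S k. {y. idx y = m})" by auto
  also have "... \<in> sets borel" using S by (intro sets.finite_UN) auto
  finally have [measurable]: "{y. idx y \<in> S k} \<in> sets borel" .
  show ?thesis unfolding cut_def by measurable
 qed
 have cut_b: "cmod (cut k y) <= 1" for k y by (simp add: cut_def indicator_def)
 have cut_lim: "(%k. cut k y) ----> 1" for y
 proof -
  define k0 where "k0 = nat (\<Sum>i\<in>UNIV. \<bar>idx y i\<bar>)"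
  have k0: "\<bar>idx y i\<bar> <= int k0" for i unfolding k0_def using member_le_sum[of i UNIV "%i. \<bar>idx y i\<bar>"] by (simp add: sum_nonneg)
  have "idx y \<in> S k" if "k >= k0" for k
  proof -
   have "- int k <= idx y i \<and> idx y i <= int k" for i using k0[of i] that by linarith
   thus ?thesis by (simp add: S_def)
  qed
  hence "\<forall>\<^sub>F k in sequentially. cut k y = 1" unfolding eventually_sequentially by (intro exI[of _ k0]) (auto simp: cut_def)
  thus ?thesis by (rule tendsto_eventually)
 qed
 let ?C = "exp (1 / l * (real CARD('n) * r^2))"
 define D where "D = ?C * (L ^ CARD('n) * l2n f * l2n h)"
 have B: "0 <= B" by (rule cls_nonneg[OF a])
 let ?D = "%k z. cut k (snd z) * f (snd z) * (cut k (fst z) * h (fst z))"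
 have bk: "cmod (LBINT z. K z * a z * (?D k z)) <= B * D" for k
 proof -
  have "cmod (LBINT z. K z * a z * (?D k z)) \<le>
   B * (?C * (L ^ CARD('n) * l2n (%y. cut k y * f y) * l2n (%y. cut k y * h y)))" unfolding K_def
   by (rule cls_kernel_bound_finite[OF rr(2) a l12_weight(1)[OF f cut_m cut_b] l12_weight(1)[OF h cut_m cut_b] S])
    (auto simp: cut_def indicator_def split: if_splits)
  also have "... <= B * D" unfolding D_def using L_pos B by (intro mult_left_mono mult_mono l12_weight(2) f h cut_m cut_b) (auto simp: l2n_nonneg)
  finally show ?thesis .
 qed
 let ?E = "%z. f (snd z) * h (fst z)"
 have I: "lint (%z. K z * a z * (?E z))" by (rule integrable_kernel[OF l12D(1)[OF f] l12D(1)[OF h] Ka])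
 have Ik: "lint (%z. K z * a z * (?D k z))" for k
  by (rule integrable_kernel[OF l12D(1)[OF l12_weight(1)[OF f cut_m cut_b]] l12D(1)[OF l12_weight(1)[OF h cut_m cut_b]] Ka])
 let ?B = "LBINT z. K z * a z * (f (snd z) * h (fst z))"
 have "(%k. \<integral>z. K z * a z * (?D k z) \<partial>lborel) ----> (LBINT z. K z * a z * (?E z))"
 proof (rule integral_dominated_convergence[where w="%z. norm (K z * a z * (?E z))"])
  show "lint (%z. norm (K z * a z * (?E z)))" by (rule integrable_norm[OF I])
  show "AE z in lborel. norm (K z * a z * (?D k z)) <= norm (K z * a z * (?E z))" for k
   by (intro AE_I2) (auto simp: cut_def indicator_def)
  have "(%k. K z * a z * (?D k z)) ----> K z * a z * (1 * f (snd z) * (1 * h (fst z)))" for z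
   by (intro tendsto_intros cut_lim)
  thus "AE z in lborel. (%k. K z * a z * (?D k z)) ----> K z * a z * (?E z)"
   by simp
 qed (rule borel_measurable_integrable[OF I] borel_measurable_integrable[OF Ik])+
 hence X: "cmod ?B <= B * D" by (intro LIMSEQ_le_const2[OF tendsto_norm]) (use bk in auto)
 define N where "N = (2 * pi * l) powr (real CARD('n) / 2)"
 have N: "N = q ^ CARD('n)" unfolding N_def q_def using lT by (simp add: powr_half_sqrt[symmetric] powr_powr powr_realpow[symmetric])
 let ?A = "LBINT z. heat (\<i> * of_real (l / 2)) (fst z - snd z) * a z * (f (snd z) * h (fst z))"
 have "?A =
   ?B / (N * exp (\<i> * of_real (pi * real CARD('n) / 4)))"
  unfolding heat_imaginary[OF lT(1)] K_def N_def by (simp add: mult_ac)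
 hence "cmod ?A =
   cmod ?B / N" using N q by (simp add: norm_divide norm_mult norm_power)
 also have "... <= B * D / N" using X N q by (intro divide_right_mono) auto
 \<comment> \<open>The prefactor is q^(-d), so what remains of L^d is (L / q)^d = (q / r)^d. This
   quotient is 1 unless the cap on \<open>r\<close> is active, and then it is q.\<close>
 also have "... = ?C * (L / q) ^ CARD('n) * B * l2n f * l2n h" unfolding D_def N by (simp add: power_divide)
 also have "... <= exp (2 * pi * CARD('n)) * (max 1 (sqrt (2 * pi * T))) ^ CARD('n) * B * l2n f * l2n h"
 proof -
  have "1 / l * (real CARD('n) * r^2) <= 2 * pi * CARD('n)" using mult_left_mono[OF r2, of "real CARD('n)"] lT by (simp add: field_simps)
  moreover have "L / q = q / r" using q by (simp add: L_def power2_eq_square[symmetric] q(2)[symmetric]) (simp add: power2_eq_square)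
  moreover have "q / r <= max 1 (sqrt (2 * pi * T))"
  proof (cases "q <= 1")
   case True thus ?thesis using q by (simp add: r_def min_def)
  next
   case False
   have "q <= sqrt (2 * pi * T)" unfolding q_def using lT by simp
   thus ?thesis using False by (simp add: r_def min_def)
  qed
  ultimately show ?thesis using B L_pos q rr by (intro mult_right_mono mult_mono power_mono) (auto simp: l2n_nonneg)
 qed
 finally show ?thesis .
qed

section \<open>Approximate identity and Fourier transform of the heat kernel\<close>

lemma heat_nonzero: "ze \<noteq> 0 ==> heat ze x \<noteq> 0" by (simp add: heat_closed_form)

lemma
 assumes "0 < Re ze"
 shows integrable_hk: "lint (hk ze)" and integral_hk: "(LBINT t. hk ze t) = 1"
proof -
 have nz: "ze \<noteq> 0" using assms by auto
 have a: "0 < Re (1 / (4 * ze))" using assms nz by (auto simp: Re_divide intro!: divide_pos_pos add_pos_nonneg)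
 have e: "hk ze t = (1 / (of_real (2 * sqrt pi) * csqrt ze)) * exp (- (1 / (4 * ze)) * of_real (t^2) + 0 * of_real t)" for t by (simp add: hk_def)
 show "lint (hk ze)" unfolding e by (rule integrable_mult_right, rule integrable_cexp_quadratic[OF a])
 have "csqrt (1 / 4) = 1 / 2" by (subst csqrt_of_real_nonneg) (auto simp: real_sqrt_divide)
 moreover have "csqrt (1 / 4 / ze) = csqrt (1 / 4) / csqrt ze" by (rule csqrt_divide_right_half_plane) (use assms in auto)
 moreover have "1 / (4 * ze) = 1 / 4 / ze" by simp
 ultimately have c: "csqrt (1 / (4 * ze)) = 1 / 2 / csqrt ze" by (simp only:)
 have "(LBINT t. hk ze t) = (1 / (of_real (2 * sqrt pi) * csqrt ze)) * (of_real (sqrt pi) / csqrt (1 / (4 * ze)))"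
  unfolding e integral_mult_right_zero using gaussian_integral[OF a, of 0] by simp
 thus "(LBINT t. hk ze t) = 1" unfolding c using nz by simp
qed

lemma
 assumes "0 < Re ze"
 shows integrable_heat: "lint (heat ze :: real^'n => complex)"
  and integral_heat: "integral\<^sup>L lborel (heat ze :: real^'n => complex) = 1"
proof -
 let ?A = "heat ze :: real^'n => complex"
 have e: "?A = (%x. \<Prod>i\<in>UNIV. hk ze (x$i))" by (rule ext) (simp add: heat_def)
 show "lint ?A" unfolding e by (rule integrable_lborel_vec_prod[OF integrable_hk[OF assms]])
 show "integral\<^sup>L lborel ?A = 1"
  unfolding e using integral_lborel_vec_prod[OF integrable_hk[OF assms]] integral_hk[OF assms] by simp
qed

lemma heat_real: "0 < e ==> heat (of_real e) x = of_real (cmod (heat (of_real e) x))"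
 for x :: "real^'n"
proof -
 assume e: "0 < e"
 have "csqrt e = of_real (sqrt e)" using e by (subst csqrt_of_real_nonneg) auto
 hence "heat e x = of_real (exp (- (x \<bullet> x) / (4 * e)) / (2 * sqrt pi * sqrt e) ^ CARD('n))"
  unfolding heat_closed_form by (simp add: exp_of_real[symmetric])
 moreover have "0 <= exp (- (x \<bullet> x) / (4 * e)) / (2 * sqrt pi * sqrt e) ^ CARD('n)" using e by simp
 ultimately show ?thesis by (metis abs_of_nonneg norm_of_real)
qed

lemma
 assumes e: "0 < e"
 shows integrable_norm_heat: "lint (%x::real^'n. cmod (heat (of_real e) x))"
  and integral_norm_heat: "integral\<^sup>L lborel (%x::real^'n. cmod (heat (of_real e) x)) = 1"
proof -
 let ?A = "%x::real^'n. cmod (heat (of_real e) x)"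
 have i: "lint (heat e :: real^'n => complex)" using e by (intro integrable_heat) simp
 thus "lint ?A" by (rule integrable_norm)
 have "of_real (integral\<^sup>L lborel ?A) = integral\<^sup>L lborel (%x::real^'n. complex_of_real (cmod (heat e x)))"
  by (rule integral_complex_of_real[symmetric])
 also have "... = integral\<^sup>L lborel (heat e :: real^'n => complex)"
  by (intro icong refl heat_real[OF e, symmetric])
 also have "... = 1" using e by (intro integral_heat) simp
 finally show "integral\<^sup>L lborel ?A = 1" by (simp only: of_real_eq_1_iff)
qed

text \<open>Substituting y = x + sqrt(e) z turns the kernel into the fixed integrable
  \<open>heat 1\<close>, and dominated convergence uses continuity of \<open>h\<close> only at
  x.\<close>

lemma heat_approximate_identity:
 fixes h :: "real^'n => complex"
 assumes m: "bm h" and b: "!!y. cmod (h y) <= M" and c: "isCont h x"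
 shows "((%e. \<integral>y. h y * heat (of_real e) (x - y) \<partial>lborel) \<longlongrightarrow> h x) (at_right 0)" unfolding tendsto_at_iff_sequentially o_def
proof (intro allI impI)
 fix X :: "nat => real" assume X: "\<forall>i. X i \<in> {0<..} - {0}" "X ----> 0"
 note [measurable] = m
 have r: "(LBINT y. h y * heat e (x - y)) = (LBINT z. h (x + sqrt e *R z) * heat 1 z)" if e: "0 < e" for e
 proof -
  have "of_real (sqrt e) ^ CARD('n) * heat e (- sqrt e *R z) = heat 1 z" for z :: "real^'n"
   using e unfolding hk_def heat_def prod_constant[symmetric] prod.distrib[symmetric] by (intro prod.cong) (simp_all add: csqrt_of_real_nonneg power_mult_distrib)
  thus ?thesis using e by (subst lborel_affine[of "sqrt e" x], simp, subst integral_density)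
    (simp_all add: integral_distr scaleR_conv_of_real[where 'a=complex] mult.left_commute)
 qed
 have i: "lint (%z::real^'n. cmod (heat 1 z))" using integrable_norm_heat[of 1] by simp
 have "(%k. \<integral>z. h (x + sqrt (X k) *R z) * heat 1 z \<partial>lborel) ----> integral\<^sup>L lborel (%z::real^'n. h x * heat 1 z)"
 proof (rule integral_dominated_convergence[where w="%z::real^'n. M * cmod (heat 1 z)"])
  have "(%k. x + sqrt (X k) *R z) ----> x + sqrt 0 *R z" for z by (intro tendsto_intros X)
  thus "AE z in lborel. (%k. h (x + sqrt (X k) *R z) * heat 1 z) ----> h x * heat 1 z"
   using isCont_tendsto_compose[OF c, of "%k. x + sqrt (X k) *R z" sequentially for z] by (intro AE_I2 tendsto_intros) force
 qed (use i b in \<open>auto simp: norm_mult intro!: mult_right_mono\<close>)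
 thus "(%k. \<integral>y. h y * heat (of_real (X k)) (x - y) \<partial>lborel) ----> h x" using X(1) by (simp add: r integral_heat)
qed

lemma hk_fourier:
 assumes e: "0 < e"
 shows "lint (%t. exp (- of_real (4 * pi^2 * e * t^2) + \<i> * of_real (2 * pi * s * t)))"
  and "(LBINT t. exp (- of_real (4 * pi^2 * e * t^2) + \<i> * of_real (2 * pi * s * t))) = hk (of_real e) s"
proof -
 let ?A = "of_real (4 * pi^2 * e)"
 have a: "0 < Re (?A)" using e by simp
 let ?B = "%t. exp (- of_real (4 * pi^2 * e * t^2) + \<i> * of_real (2 * pi * s * t))"
 have eq: "?B t = exp (- ?A * of_real (t^2) + (\<i> * of_real (2 * pi * s)) * t)" for t
  by (simp add: mult_ac)
 show "lint (%t. ?B t)"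
  unfolding eq by (rule integrable_cexp_quadratic[OF a])
 have c: "csqrt (?A) = of_real (2 * pi * sqrt e)" "csqrt e = of_real (sqrt e)"
  using e by (subst csqrt_of_real_nonneg; simp add: real_sqrt_mult real_sqrt_abs)+
 have x: "(\<i> * of_real (2 * pi * s))^2 / (4 * ?A) = - of_real (s^2) / (4 * e)"
  using e by (simp add: power_mult_distrib field_simps)
 have p: "of_real (sqrt pi) / of_real (2 * pi * sqrt e) = 1 / (of_real (2 * sqrt pi) * of_real (sqrt e) :: complex)"
 proof -
  have "sqrt pi / (2 * pi * sqrt e) = sqrt pi / (2 * (sqrt pi * sqrt pi) * sqrt e)" by simp
  also have "... = 1 / (2 * sqrt pi * sqrt e)" by (simp del: real_sqrt_mult_self)
  finally show ?thesis by (metis of_real_1 of_real_divide of_real_mult)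
 qed
 show "(LBINT t. ?B t) = hk e s"
  unfolding eq gaussian_integral[OF a] c x p hk_def by simp
qed

lemma heat_fourier:
 fixes x :: "real^'n"
 assumes e: "0 < e"
 shows "lint (%w::real^'n. exp (- of_real (4 * pi^2 * e * (norm w)^2) + \<i> * of_real (2 * pi * (x \<bullet> w))))"
  and "(LBINT w. exp (- of_real (4 * pi^2 * e * (norm w)^2) + \<i> * of_real (2 * pi * (x \<bullet> w)))) = heat (of_real e) x"
proof -
 let ?g = "%i t. exp (- of_real (4 * pi^2 * e * t^2) + \<i> * of_real (2 * pi * x$i * t))"
 let ?A = "%w. exp (- of_real (4 * pi^2 * e * (norm w)^2) + \<i> * of_real (2 * pi * (x \<bullet> w)))"
 have eq: "?A w = (\<Prod>i\<in>UNIV. ?g i (w$i))" for w :: "real^'n"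
 proof -
  have "- of_real (4 * pi^2 * e * (norm w)^2) + \<i> * of_real (2 * pi * (x \<bullet> w)) = (\<Sum>i\<in>UNIV. - of_real (4 * pi^2 * e * (w$i)^2) + \<i> * of_real (2 * pi * x$i * w$i) :: complex)"
   unfolding power2_norm_eq_inner inner_vec_def by (simp add: sum.distrib sum_negf sum_subtractf sum_distrib_left power2_eq_square mult_ac)
  thus ?thesis by (simp only: exp_sum[OF finite])
 qed
 show "lint (%w::real^'n. ?A w)"
  unfolding eq by (rule integrable_lborel_vec_prod[OF hk_fourier(1)[OF e]])
 show "(LBINT w. ?A w) = heat e x"
  unfolding eq using integral_lborel_vec_prod[OF hk_fourier(1)[OF e], of "%i. x$i"] hk_fourier(2)[OF e] by (simp add: heat_def)
qed

section \<open>The Sjoestrand class\<close>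

definition fourier :: "(real^'n => complex) => real^'n => complex" where
 "fourier h w = (LBINT y. h y * exp (- (\<i> * of_real (2 * pi * (y \<bullet> w)))))"

text \<open>Both sides are limits of the convolution of \<open>h\<close> with \<open>heat e\<close>
  as e tends to 0: directly by the approximate identity, and after Fubini with the Gaussian Fourier
  integral by integrability of the transform.\<close>

lemma fourier_inversion:
 fixes h :: "real^'n => complex"
 assumes h: "lint h" "cts h" "!!y. cmod (h y) <= M"
  and H: "lint (fourier h)"
 shows "h x = (LBINT w. fourier h w * exp (\<i> * of_real (2 * pi * (x \<bullet> w))))"
proof (rule tendsto_unique)
 have hm[measurable]: "bm h" using borel_measurable_integrable[OF h(1)] by simp
 have Hm[measurable]: "bm (fourier h)" using borel_measurable_integrable[OF H] by simp
 let ?G = "%e (w::real^'n). exp (- of_real (4 * pi^2 * e * (norm w)^2)) :: complex"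
 show "at_right (0::real) \<noteq> bot" by simp
 let ?A = "%e. \<integral>y. h y * heat (of_real e) (x - y) \<partial>lborel"
 show "(?A \<longlongrightarrow> h x) (at_right 0)"
  by (rule heat_approximate_identity[OF hm h(3)]) (use h(2) in \<open>simp add: continuous_on_eq_continuous_at\<close>)
 let ?B = "%w. exp (\<i> * of_real (2 * pi * (x \<bullet> w)))"
 have eq: "(LBINT y. h y * heat e (x - y)) = (LBINT w. fourier h w * ?B w * ?G e w)" if e: "0 < e" for e
 proof -
  let ?k = "%y w. h y * exp (- of_real (4 * pi^2 * e * (norm w)^2) + \<i> * of_real (2 * pi * ((x - y) \<bullet> w)))"
  let ?C = "%e w. of_real (4 * pi^2 * e * (norm w)^2)"
  have I: "integrable (lborel \<Otimes>\<^sub>M lborel) (%(y, w). ?k y w)"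
  proof (rule lborel_pair.Fubini_integrable)
   show "(%(y, w). ?k y w) \<in> borel_measurable (lborel \<Otimes>\<^sub>M lborel)" by measurable
   have n: "norm (?k y w) = cmod (h y) * cmod (exp (- ?C e w + \<i> * of_real (2 * pi * (0 \<bullet> w))))" for y w
    by (simp add: norm_mult)
   show "lint (%y. \<integral>w. norm (case (y, w) of (y, w) => ?k y w) \<partial>lborel)"
    using h(1) by (simp only: n prod.case integral_mult_right_zero) (intro integrable_mult_left integrable_norm)
   show "AE y in lborel. lint (%w. case (y, w) of (y, w) => ?k y w)"
    using heat_fourier(1)[OF e] by (intro AE_I2) (simp only: prod.case, rule integrable_mult_right)
  qed
  have "(LBINT y. h y * heat e (x - y)) = (LBINT y. (LBINT w. ?k y w))" by (simp only: integral_mult_right_zero heat_fourier(2)[OF e])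
  also have "... = (LBINT w. (LBINT y. ?k y w))" by (rule lborel_pair.Fubini_integral[OF I, symmetric])
  also have "... = (LBINT w. fourier h w * ?B w * ?G e w)"
  proof (intro icong refl)
   fix w
   have k: "?k y w = (?B w * ?G e w) * (h y * exp (- (\<i> * of_real (2 * pi * (y \<bullet> w)))))" for y
   proof -
    have "- ?C e w + \<i> * of_real (2 * pi * ((x - y) \<bullet> w)) =
     \<i> * of_real (2 * pi * (x \<bullet> w)) + - ?C e w + - (\<i> * of_real (2 * pi * (y \<bullet> w)))"
     by (simp add: inner_diff_left algebra_simps)
    thus ?thesis by (simp only: exp_add) (simp add: mult_ac)
   qed
   show "(LBINT y. ?k y w) = fourier h w * ?B w * ?G e w"
    unfolding k integral_mult_right_zero fourier_def by (simp add: mult_ac)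
  qed
  finally show ?thesis .
 qed
 have "((%e. \<integral>w. fourier h w * ?B w * ?G e w \<partial>lborel) \<longlongrightarrow> (LBINT w. fourier h w * ?B w)) (at_right 0)"
  unfolding tendsto_at_iff_sequentially o_def
 proof (intro allI impI)
  fix E :: "nat => real" assume E: "\<forall>i. E i \<in> {0<..} - {0}" "E ----> 0"
  show "(%k. \<integral>w. fourier h w * ?B w * ?G (E k) w \<partial>lborel) ----> (LBINT w. fourier h w * ?B w)"
  proof (rule integral_dominated_convergence[where w="%w. norm (fourier h w)"])
   show "lint (%w. norm (fourier h w))" using H by (rule integrable_norm)
   have "(%k. fourier h w * ?B w * ?G (E k) w) ----> fourier h w * ?B w * exp (- of_real (4 * pi^2 * 0 * (norm w)^2))" for w
    by (intro tendsto_intros E)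
   thus "AE w in lborel. (%k. fourier h w * ?B w * ?G (E k) w) ----> fourier h w * ?B w"
    by simp
   show "AE w in lborel. norm (fourier h w * ?B w * ?G (E k) w) <= norm (fourier h w)" for k
   proof (rule AE_I2)
    fix w
    have "0 < E k" using E(1) by auto
    hence "cmod (?G (E k) w) <= 1" by simp
    thus "norm (fourier h w * ?B w * ?G (E k) w) <= norm (fourier h w)" unfolding norm_mult by (simp add: mult_left_le)
   qed
  qed measurable
 qed
 thus "(?A \<longlongrightarrow> (LBINT w. fourier h w * ?B w)) (at_right 0)"
  by (rule Lim_transform_eventually) (use eventually_at_right_less[of 0] in \<open>auto elim!: eventually_mono simp: eq\<close>)
qed

section \<open>From the short-time Fourier transform to the amplitude class\<close>

lemma schwartz_basic:
 assumes "f \<in> schwartz"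
 shows "lint f" "bm f" "\<exists>M. \<forall>x. cmod (f x) <= M" "l12 f"
proof -
 show m[measurable]: "bm f" by (rule borel_measurable_continuous_onI[OF schwartzD(1)[OF assms]])
 obtain C where C: "0 <= C" "!!x. norm x ^ 0 * cmod (f x) <= C * wt x" using schwartzD(2)[OF assms, of 0] by blast
 have C': "cmod (f x) <= C * wt x" for x using C(2)[of x] by simp
 have C1: "cmod (f x) <= C" for x using C'[of x] mult_left_mono[OF wt_le_1[of x] C(1)] by simp
 thus "\<exists>M. \<forall>x. cmod (f x) <= M" by blast
 show i: "lint f"
 proof (rule ibound)
  show "lint (%x. C * wt x)" by (intro integrable_mult_right integrable_wt)
  show "AE x in lborel. norm (f x) <= norm (C * wt x)" using order_trans[OF C' abs_ge_self] by (intro AE_I2) simp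
 qed simp
 have "lint (%x. (cmod (f x))^2)"
 proof (rule ibound)
  show "lint (%x. C * cmod (f x))" using i by simp
  show "AE x in lborel. norm ((cmod (f x))^2) <= norm (C * cmod (f x))" using C1 C(1) by (intro AE_I2) (simp add: power2_eq_square mult_right_mono)
 qed simp
 thus "l12 f" using i by (simp add: l12_def)
qed

lemma continuous_on_integral_dominated:
 fixes F :: "'p::metric_space => 'a => 'b::{banach,second_countable_topology}"
 assumes c: "!!y. y \<in> space M ==> cts (%p. F p y)" and m: "!!p. F p \<in> borel_measurable M"
  and b: "!!p y. y \<in> space M ==> norm (F p y) <= w y" and w: "integrable M w"
 shows "cts (%p. \<integral>y. F p y \<partial>M)" unfolding continuous_on_sequentially
proof (intro allI ballI impI, elim conjE)
 fix q :: "nat => 'p" and a assume q: "\<forall>n. q n \<in> UNIV" "q ----> a"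
 show "((%p. \<integral>y. F p y \<partial>M) \<circ> q) ----> (\<integral>y. F a y \<partial>M)" unfolding o_def
 proof (rule integral_dominated_convergence[OF m m w])
  show "AE y in M. (%n. F (q n) y) ----> F a y"
  proof (rule AE_I2)
   fix y assume "y \<in> space M"
   from c[OF this] show "(%n. F (q n) y) ----> F a y" using q(2) unfolding continuous_on_sequentially by (auto simp: o_def)
  qed
  show "AE y in M. norm (F (q n) y) <= w y" for n using b by (intro AE_I2)
 qed
qed

lemma stft_eq_fourier:
 "stft g (distr_of f) a w = fourier (%y. f y * cnj (g (y - a))) w" unfolding stft_def distr_of_def fourier_def
 by (intro icong refl) (simp add: mult_ac)

lemma continuous_on_heat:
 fixes f :: "'a::topological_space => real^'n"
 assumes "continuous_on S f"
 shows "continuous_on S (%x. heat ze (f x))"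
proof (cases "ze = 0")
 case True thus ?thesis by (simp add: heat_closed_form)
next
 case False thus ?thesis unfolding heat_closed_form using assms by (intro continuous_intros) auto
qed

text \<open>A shifted Gaussian factors into functions of u and of b and the coupling exp(u . b / (2
  e)), which for fixed b is exponential in u and hence fits into an atom.\<close>

lemma heat_diff:
 fixes u b :: "real^'n"
 assumes "0 < e"
 shows "heat (of_real e) (b - u) * heat (of_real e) (0::real^'n) = heat (of_real e) u * (heat (of_real e) b * of_real (exp (u \<bullet> b / (2 * e))))"
proof -
 let ?A = "4 * of_real e"
 have "- of_real ((b - u) \<bullet> (b - u)) / ?A = - of_real (u \<bullet> u) / ?A + (- of_real (b \<bullet> b) / ?A + of_real (u \<bullet> b / (2 * e)) :: complex)"
  using assms by (simp add: inner_diff_left inner_diff_right inner_commute field_simps)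
 hence "exp (- of_real ((b - u) \<bullet> (b - u)) / ?A) = exp (- of_real (u \<bullet> u) / ?A) * (exp (- of_real (b \<bullet> b) / ?A) * of_real (exp (u \<bullet> b / (2 * e))) :: complex)"
  by (simp only: exp_add exp_of_real)
 thus ?thesis unfolding heat_closed_form by simp
qed

text \<open>The growing factor is the price of the normalization in \<open>pexp\<close> for the real
  frequency b / (2 e); the Gaussian absorbs it.\<close>

lemma integrable_heat_exp:
 assumes e: "0 < e"
 shows "lint (%b::real^'n. cmod (heat (of_real e) b) * exp (\<Sum>i\<in>UNIV. \<bar>b$i\<bar> / (2 * e)))"
proof -
 have eq: "cmod (heat e b) * exp (\<Sum>i\<in>UNIV. \<bar>b$i\<bar> / (2 * e)) = (\<Prod>i\<in>UNIV. cmod (hk e (b$i)) * exp (\<bar>b$i\<bar> / (2 * e)))" for b :: "real^'n"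
  by (simp add: heat_def prod_norm[symmetric] exp_sum prod.distrib)
 let ?A = "1 / cmod (of_real (2 * sqrt pi) * csqrt (of_real e))"
 let ?B = "%t. exp (- (1 / (4 * e)) * t^2 + (1 / (2 * e)) * \<bar>t\<bar>)"
 have "cmod (hk e t) * exp (\<bar>t\<bar> / (2 * e)) = ?A * ?B t" for t
  unfolding hk_def norm_divide using e by (simp add: Re_divide mult_exp_exp power2_eq_square)
 moreover have "lint (%t. ?A * ?B t)"
  by (intro integrable_mult_right integrable_exp_quadratic_abs) (use e in simp)
 ultimately have "lint (%t. cmod (hk e t) * exp (\<bar>t\<bar> / (2 * e)))" by simp
 thus ?thesis unfolding eq by (rule integrable_lborel_vec_prod)
qed

lemma borel_measurable_pair_lborel:
 fixes f :: "'a::euclidean_space \<times> 'b::second_countable_topology => 'c::topological_space"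
 assumes "bm f"
 shows "f \<in> borel_measurable (lborel \<Otimes>\<^sub>M borel)"
proof -
 have "sets (lborel \<Otimes>\<^sub>M borel) = sets (borel :: ('a \<times> 'b) measure)" unfolding borel_prod[symmetric] by (rule sets_pair_measure_cong) simp_all
 thus ?thesis using assms measurable_cong_sets by blast
qed

lemma cls_pexp_coefficient:
 assumes c: "bm c" "!!z. cmod (c z) <= B"
 shows "cls B (%(x, y, u, v). c (x, y) * pexp ze u)"
proof (cases "B = 0")
 case True
 hence "c z = 0" for z using c(2)[of z] by simp
 thus ?thesis using cls_zero True by (simp add: case_prod_unfold)
next
 case False
 have B: "0 <= B" by (rule order_trans[OF norm_ge_zero c(2)[of undefined]])
 have "atom (%(x, y, u, v). (c (x, y) / B) * pexp ze u * pexp (%i. 0) v)" unfolding atom_def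
  by (intro exI[of _ "%z. c z / of_real B"] exI[of _ ze] exI[of _ "%i. 0"])
   (use c B False in \<open>auto simp: norm_divide pos_divide_le_eq\<close>)
 from cls_scale[OF cls_atom[OF this], of "of_real B"] show ?thesis using False B by (simp add: case_prod_unfold pexp_def)
qed

text \<open>By its Fourier integral, the Gaussian in the offset is an absolutely convergent
  superposition of exponentials in the offset.\<close>

lemma cls_heat_offset:
 assumes e: "0 < e"
 shows "\<exists>K\<ge>0. cls K (%(x, y, u, v). heat (of_real e) (u :: real^'n))"
proof -
 let ?A = "%w. of_real (4 * pi^2 * e * (norm w)^2)"
 define b where "b w = cmod (exp (- ?A w))" for w :: "real^'n"
 define A where "A w = (%(x::real^'n, y::real^'n, u::real^'n, v::real^'n). exp (- ?A w) * pexp (%i. \<i> * of_real (2 * pi * w$i)) u)" for w :: "real^'n"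
 have "cls (LBINT w. b w) (%p. \<integral>w. A w p \<partial>lborel)"
 proof (rule cls_integral)
  show "sigma_finite_measure (lborel :: (real^'n) measure)" by (rule sigma_finite_lborel)
  show "lint b" unfolding b_def using integrable_norm[OF heat_fourier(1)[OF e, of 0]] by simp
  show "cls (b w) (A w)" for w unfolding A_def b_def by (rule cls_pexp_coefficient[where c="%z. exp (- ?A w)"]) auto
  have "cts (%(w, p). A w p)" unfolding A_def case_prod_beta pexp_def by (intro continuous_intros)
  thus "(%(w, p). A w p) \<in> borel_measurable (lborel \<Otimes>\<^sub>M borel)" by (intro borel_measurable_pair_lborel borel_measurable_continuous_onI)
 qed
 moreover have "(LBINT w. A w p) = (case p of (x, y, u, v) => heat e u)" for p
 proof -
  obtain x y u v where p: "p = (x, y, u, v)" by (cases p)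
  have "A w p = exp (- ?A w + \<i> * of_real (2 * pi * (u \<bullet> w)))" for w unfolding A_def p pexp_def exp_add
   by (simp add: inner_vec_def sum_distrib_left sum_distrib_right mult_ac)
  thus ?thesis using heat_fourier(2)[OF e, of u] by (simp add: p)
 qed
 ultimately have "cls (LBINT w. b w) (%(x, y, u, v). heat e (u :: real^'n))" by (simp add: case_prod_unfold)
 thus ?thesis using cls_nonneg by blast
qed

text \<open>The supremum runs over an uncountable set; it is measurable because it is lower
  semicontinuous.\<close>

lemma ennreal_SUP_measurable:
 fixes F :: "'x::t2_space => 'w::topological_space => real"
 assumes "!!x. cts (F x)"
 shows "bm (%w. SUP x. ennreal (F x w))"
proof (rule borel_measurableI_greater)
 fix a :: ennreal
 have "{w \<in> space borel. a < (SUP x. ennreal (F x w))} = (\<Union>x. {w. a < ennreal (F x w)})" by (auto simp: less_SUP_iff)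
 moreover have o: "open {w. a < ennreal (F x w)}" for x
 proof -
  have "cts (%w. ennreal (F x w))" using assms[of x] by (intro continuous_on_ennreal)
  hence "open ((%w. ennreal (F x w)) -` {a<..})" by (rule open_vimage[rotated]) simp
  thus ?thesis by (simp add: vimage_def)
 qed
 moreover have "(\<Union>x. {w. a < ennreal (F x w)}) \<in> sets borel" by (rule borel_open, rule open_UN, rule ballI, rule o)
 ultimately show "{w \<in> space borel. a < (SUP x. ennreal (F x w))} \<in> sets borel" by (simp only:)
qed

lemma stft_continuous:
 fixes f :: "real^'n => real"
 assumes f: "cts f" "!!x. \<bar>f x\<bar> <= M" and g: "g \<in> schwartz"
 shows "cts (%(a, w). stft g (distr_of (%x. of_real (f x))) a w)"
  and "cmod (stft g (distr_of (%x. of_real (f x))) a w) <= M * (LBINT y. cmod (g y))"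
proof -
 let ?F = "%p y. of_real (f (fst p + y)) * cnj (g y) * exp (- (\<i> * of_real (2 * pi * ((fst p + y) \<bullet> snd p))))"
 have gc: "cts g" by (rule schwartzD(1)[OF g])
 have [measurable]: "bm f" "bm g" using f(1) gc by (auto intro: borel_measurable_continuous_onI)
 let ?A = "distr_of (%x. of_real (f x))"
 have eq: "stft g ?A a w = (LBINT y. ?F (a, w) y)" for a w unfolding stft_eq_fourier fourier_def
  by (subst integral_lborel_shift[of _ a, symmetric]) auto
 have b: "norm (?F p y) <= M * cmod (g y)" for p y using f(2) by (simp add: norm_mult mult_right_mono)
 have w: "lint (%y. M * cmod (g y))" using schwartz_basic(1)[OF g] by simp
 have m: "?F p \<in> borel_measurable lborel" for p by measurable
 have "cts (%p. \<integral>y. ?F p y \<partial>lborel)"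
 proof (rule continuous_on_integral_dominated[OF _ m b w])
  fix y
  have "cts (%p::(real^'n) \<times> (real^'n). f (fst p + y))" by (rule continuous_on_compose2[OF f(1)]) (auto intro!: continuous_intros)
  thus "cts (%p. ?F p y)" by (intro continuous_intros)
 qed
 thus "cts (%(a, w). stft g ?A a w)" by (simp add: eq case_prod_beta)
 have "cmod (stft g ?A a w) <= (LBINT y. norm (?F (a, w) y))" unfolding eq by (rule integral_norm_bound)
 also have "... <= (LBINT y. M * cmod (g y))" by (rule integral_mono[OF integrable_norm[OF ibound[OF w m]] w b])
   (use b in \<open>auto intro!: AE_I2 order_trans[OF _ abs_ge_self]\<close>)
 finally show "cmod (stft g ?A a w) <= M * (LBINT y. cmod (g y))" by simp
qed

text \<open>Averaging the inversion formula for \<open>f \<cdot> cnj (g (\<cdot> - a))\<close> over \<open>a\<close> against a Gaussian which is not orthogonal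
 to the window \<open>g\<close> replaces \<open>g\<close> by that Gaussian, whose dependence on the offset \<open>u\<close> is explicit.\<close>

lemma sjostrand_cls:
 fixes g :: "real^'n => complex"
 assumes g: "g \<in> schwartz" "g \<noteq> (%x. 0)"
 shows "\<exists>C>0. \<forall>f b. cts f \<and> bounded (range f) \<and> 0 <= b \<and>
   sjostrand_norm g (distr_of (%x. of_real (f x))) <= ennreal b \<longrightarrow>
   cls (C * b) (%(x, y, u, v). of_real (f (x + u)))"
proof -
 obtain x1 where x1: "g x1 \<noteq> 0" using g(2) by auto
 have gc: "cts g" by (rule schwartzD(1)[OF g(1)])
 obtain Mg where Mg: "!!x. cmod (g x) <= Mg" using schwartz_basic(3)[OF g(1)] by blast
 have gm[measurable]: "bm g" by (rule schwartz_basic(2)[OF g(1)])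
 let ?I = "%e y. heat (of_real e) (x1 - y)"
 \<comment> \<open>At a point \<open>x1\<close> where the window does not vanish, its pairing with a
   narrow Gaussian is close to cnj (g x1), hence nonzero for small e. This fixes the Gaussian that
   replaces the window.\<close>
 have "((%e. \<integral>y. cnj (g y) * ?I e y \<partial>lborel) \<longlongrightarrow> cnj (g x1)) (at_right 0)"
 proof (rule heat_approximate_identity)
  show "isCont (%y. cnj (g y)) x1" using gc by (auto simp: continuous_on_eq_continuous_at)
 qed (use Mg in auto)
 hence "\<forall>\<^sub>F e in at_right 0. (LBINT y. cnj (g y) * ?I e y) \<noteq> 0" by (rule tendsto_imp_eventually_ne) (use x1 in simp)
 moreover have "\<forall>\<^sub>F e in at_right 0. (0::real) < e" by (rule eventually_at_right_less)
 ultimately obtain e where e: "0 < e" "(LBINT y. cnj (g y) * ?I e y) \<noteq> 0"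
  using eventually_happens'[OF _ eventually_conj] by (metis (mono_tags, lifting) trivial_limit_at_right_real)
 define kp where "kp = (LBINT y. cnj (g y) * ?I e y)"
 have kp: "kp \<noteq> 0" using e by (simp add: kp_def)
 let ?G = "%e b. heat (of_real e) b"
 define H where "H b = cmod (?G e b) * exp (\<Sum>i\<in>UNIV. \<bar>b$i\<bar> / (2 * e))" for b :: "real^'n"
 have H: "lint H" unfolding H_def by (rule integrable_heat_exp[OF e(1)])
 have H0: "0 <= H b" for b by (simp add: H_def)
 obtain K where K: "K >= 0" "cls K (%(x, y, u, v). heat e (u :: real^'n))" using cls_heat_offset[OF e(1)] by blast
 have h0: "heat e (0 :: real^'n) \<noteq> 0" using e(1) by (intro heat_nonzero) simp
 let ?B = "cmod (1 / (kp * heat (of_real e) (0 :: real^'n)))"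
 define C where "C = ?B * (K * (LBINT b. H b)) + 1"
 have C: "C > 0" unfolding C_def using K(1) H0 by (intro add_nonneg_pos mult_nonneg_nonneg integral_nonneg) auto
 let ?F = "%f x u. of_real (f (x + u))"
 have "cls (C * b) (%(x, y, u, v). ?F f x u)"
  if f: "cts f" "bounded (range f)" and b: "0 <= b" "sjostrand_norm g (distr_of (%x. of_real (f x))) <= ennreal b"
  for f :: "real^'n => real" and b
 proof -
  obtain M where M: "!!x. \<bar>f x\<bar> <= M" using f(2) by (auto simp: bounded_iff)
  have fm[measurable]: "bm f" using f(1) by (rule borel_measurable_continuous_onI)
  define V where "V a w = stft g (distr_of (%x. of_real (f x))) a w" for a w
  have Vc: "cts (%(a, w). V a w)" unfolding V_def by (rule stft_continuous[OF f(1) M g(1)])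
  have Vc1: "cts (%w. V a w)" for a
  proof -
   have "cts (%w. (%(a, w). V a w) (a, w))"
    by (rule continuous_on_compose2[OF Vc]) (rule continuous_on_Pair continuous_on_const continuous_on_id subset_UNIV)+
   thus ?thesis by simp
  qed
  define M' where "M' = M * (LBINT y. cmod (g y))"
  have VM: "cmod (V a w) <= M'" for a w unfolding V_def M'_def by (rule stft_continuous(2)[OF f(1) M g(1)])
  define S where "S w = (SUP a. ennreal (cmod (V a w)))" for w
  \<comment> \<open>The frequency profile of f: it bounds \<open>V\<close> uniformly in the position
    of the window and has integral at most b.\<close>
  define B where "B w = enn2real (S w)" for w
  have "S w <= ennreal M'" for w unfolding S_def using VM by (intro SUP_least ennreal_leI)
  hence SB: "ennreal (B w) = S w" for w unfolding B_def by (metis ennreal_enn2real ennreal_less_top le_less_trans)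
  have VB: "cmod (V a w) <= B w" for a w
  proof -
   have "ennreal (cmod (V a w)) <= ennreal (B w)" unfolding SB unfolding S_def by (rule SUP_upper) simp
   thus ?thesis by (simp add: B_def ennreal_le_iff)
  qed
  have Sm: "bm S" unfolding S_def by (rule ennreal_SUP_measurable) (intro continuous_intros Vc1)
  have Bm[measurable]: "bm B" unfolding B_def using Sm by measurable
  have nB: "(\<integral>\<^sup>+w. ennreal (B w) \<partial>lborel) <= ennreal b" using b(2) unfolding SB S_def sjostrand_norm_def V_def .
  have B0: "0 <= B w" for w by (simp add: B_def)
  have Bi: "lint B" by (rule integrableI_nonneg) (use B0 nB in \<open>auto intro: le_less_trans\<close>)
  have Bb: "(LBINT w. B w) <= b" using nB nn_integral_eq_integral[OF Bi] B0 b(1) by (simp add: ennreal_le_iff)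
  have inv: "of_real (f y) * cnj (g (y - a)) = (LBINT w. V a w * exp (\<i> * of_real (2 * pi * (y \<bullet> w))))" for y a
  proof -
   let ?h = "%y. of_real (f y) * cnj (g (y - a))"
   have F: "fourier ?h = V a" by (rule ext) (simp add: V_def stft_eq_fourier)
   have M0: "0 <= M" by (rule order_trans[OF abs_ge_zero M])
   have gi: "lint (%y. g (y - a))" using integrable_lborel_shift[OF gm, of "- a"] schwartz_basic(1)[OF g(1)] by simp
   have "lint ?h"
   proof (rule ibound)
    show "lint (%y. M * cmod (g (y - a)))" using gi by simp
    show "AE y in lborel. norm (?h y) <= norm (M * cmod (g (y - a)))" using M M0 by (intro AE_I2) (simp add: norm_mult mult_right_mono)
   qed measurable
   moreover have "cts ?h" by (intro continuous_intros f(1) continuous_on_compose2[OF gc]) auto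
   moreover have "cmod (?h y) <= M * Mg" for y unfolding norm_mult using M Mg M0 by (intro mult_mono) auto
   moreover have "lint (V a)" by (rule ibound[OF Bi])
     (use VB B0 Vc1 in \<open>auto intro!: borel_measurable_continuous_onI AE_I2 order_trans[OF VB abs_ge_self]\<close>)
   ultimately show ?thesis using fourier_inversion[of ?h "M * Mg" y] unfolding F by blast
  qed
  \<comment> \<open>\<open>th\<close> is the pair of a window shift a and a frequency w. The factor
    exp (sum |a_i| / (2 e)) undoes the normalization of \<open>pexp\<close> for the exponent u . a /
    (2 e).\<close>
  define A where "A th = (%(x, y::real^'n, u, v::real^'n). (V (x - x1 + fst th) (snd th) * exp (\<i> * of_real (2 * pi * (x \<bullet> snd th))) *
    (heat (of_real e) (fst th) * of_real (exp (\<Sum>i\<in>UNIV. \<bar>fst th$i\<bar> / (2 * e))))) *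
    pexp (%i. of_real (fst th$i / (2 * e)) + \<i> * of_real (2 * pi * snd th$i)) u)" for th :: "(real^'n) \<times> (real^'n)"
  define be where "be th = H (fst th) * B (snd th)" for th
  let ?C = "LBINT th. be th"
  have bei: "lint be" and beb: "?C = (LBINT x. H x) * (LBINT w. B w)"
   unfolding be_def using integrable_tensor[OF Bi H] integral_tensor[OF Bi H] by (simp_all add: case_prod_unfold)
  have Ac: "cts (%(th, p). A th p)"
  proof -
   have "cts (%z::((real^'n) \<times> (real^'n)) \<times> 'n quad. V (fst (snd z) - x1 + fst (fst z)) (snd (fst z)))"
   proof -
    have "cts (%z::((real^'n) \<times> (real^'n)) \<times> 'n quad. (fst (snd z) - x1 + fst (fst z), snd (fst z)))" by (intro continuous_intros)
    from continuous_on_compose2[OF Vc this] show ?thesis by simp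
   qed
   thus ?thesis unfolding A_def case_prod_beta pexp_def by (intro continuous_intros continuous_on_heat) (use e in auto)
  qed
  have Acls: "cls (be th) (A th)" for th
  proof -
   let ?c = "%z::(real^'n) \<times> (real^'n). V (fst z - x1 + fst th) (snd th) * exp (\<i> * of_real (2 * pi * (fst z \<bullet> snd th))) *
    (heat (of_real e) (fst th) * of_real (exp (\<Sum>i\<in>UNIV. \<bar>fst th$i\<bar> / (2 * e))))"
   have "cts (%z::(real^'n) \<times> (real^'n). V (fst z - x1 + fst th) (snd th))"
   proof -
    have "cts (%z::(real^'n) \<times> (real^'n). (fst z - x1 + fst th, snd th))" by (intro continuous_intros)
    from continuous_on_compose2[OF Vc this] show ?thesis by simp
   qed
   hence "cts ?c" by (intro continuous_intros)
   hence "?c \<in> borel_measurable borel" by (rule borel_measurable_continuous_onI)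
   moreover have "cmod (?c z) <= be th" for z
    using mult_right_mono[OF VB[of "fst z - x1 + fst th" "snd th"], of "H (fst th)"] H0[of "fst th"] by (simp add: norm_mult be_def H_def mult_ac)
   ultimately show ?thesis unfolding A_def using cls_pexp_coefficient[of ?c "be th"] by simp
  qed
  have AI: "cls ?C (%p. \<integral>th. A th p \<partial>lborel)"
   by (rule cls_integral[OF sigma_finite_lborel _ Acls bei])
    (intro borel_measurable_pair_lborel borel_measurable_continuous_onI Ac)
  let ?A = "heat (of_real e) (0::real^'n)"
  have main: "kp * ?F f x u * ?A = ?G e u * (LBINT th. A th (x, y, u, v))"
   if uv: "u \<in> ubox" "v \<in> ubox" for x y u v
  proof -
   let ?p = "(x, y, u, v)"
   have p: "?p \<in> region" using uv by (simp add: region_def)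
   let ?H = "%x u w. exp (\<i> * of_real (2 * pi * ((x + u) \<bullet> w)))"
   have Ap: "A (a, w) ?p = (V (x - x1 + a) w * ?H x u w) * (?G e a * of_real (exp (u \<bullet> a / (2 * e))))" for a w
   proof -
    let ?E = "exp (\<i> * of_real (2 * pi * (u \<bullet> w)))"
    have "pexp (%i. of_real (a$i / (2 * e)) + \<i> * of_real (2 * pi * w$i)) u * of_real (exp (\<Sum>i\<in>UNIV. \<bar>a$i\<bar> / (2 * e)))
     = ?E * of_real (exp (u \<bullet> a / (2 * e)))"
     unfolding pexp_def exp_of_real[symmetric] exp_add[symmetric] of_real_sum sum.distrib[symmetric] using e(1) by (intro arg_cong[where f=exp])
      (simp add: inner_vec_def sum_subtractf sum.distrib sum_distrib_left sum_divide_distrib algebra_simps)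
    moreover have "?H x u w = exp (\<i> * of_real (2 * pi * (x \<bullet> w))) * ?E"
     by (simp add: exp_add[symmetric] inner_add_left algebra_simps)
    ultimately show ?thesis unfolding A_def by (simp add: mult_ac)
   qed
   have Aint: "lint (%th. A th ?p)"
   proof (rule ibound[OF bei])
    have "cts (%th. A th ?p)"
    proof -
     have "cts (%th. (%(th, p). A th p) (th, ?p))"
      by (rule continuous_on_compose2[OF Ac]) (rule continuous_on_Pair continuous_on_const continuous_on_id subset_UNIV)+
     thus ?thesis by simp
    qed
    thus "(%th. A th ?p) \<in> borel_measurable lborel" by (simp add: borel_measurable_continuous_onI)
    show "AE th in lborel. norm (A th ?p) <= norm (be th)" using order_trans[OF cls_bound[OF Acls p] abs_ge_self] by (intro AE_I2) simp
   qed
   let ?J = "%a. LBINT w. A (a, w) ?p"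
   have "kp * ?F f x u * ?A = (LBINT z. ?F f x u * (cnj (g z) * ?I e z) * ?A)"
    unfolding kp_def integral_mult_left_zero integral_mult_right_zero by (simp only: mult_ac)
   \<comment> \<open>The substitution z = u + x1 - a places the window at x - x1 + a, which no
     longer depends on the offset u. The offset survives in the exponential of the inversion formula
     and in the Gaussian at a - u, which \<open>heat_diff\<close> splits.\<close>
   also have "... = (LBINT a. ?F f x u * (cnj (g (u + x1 - a)) * heat e (x1 - (u + x1 - a))) * ?A)"
    by (rule integral_lborel_reflect[symmetric]) measurable
   also have "... = (LBINT a. ?G e u * (?J a))"
   proof (intro icong refl)
    fix a
    have 1: "?F f x u * cnj (g (u + x1 - a)) = (LBINT w. V (x - x1 + a) w * ?H x u w)"
     using inv[of "x + u" "x - x1 + a"] by (simp add: algebra_simps)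
    have 2: "x1 - (u + x1 - a) = a - u" by simp
    let ?D = "cnj (g (u + x1 - a)) * heat (of_real e) (x1 - (u + x1 - a))"
    have "?F f x u * ?D * ?A =
     (?F f x u * cnj (g (u + x1 - a))) * (heat e (a - u) * ?A)" unfolding 2 by simp
    also have "... = ?G e u * (?J a)" unfolding 1 heat_diff[OF e(1)] Ap integral_mult_left_zero by (simp add: mult_ac)
    finally show "?F f x u * ?D * ?A = ?G e u * (?J a)" .
   qed
   also have "... = ?G e u * (LBINT a. (?J a))" by simp
   also have "(LBINT a. (?J a)) = (LBINT th. A th ?p)"
    using lborel_pair.integral_fst'[of "%th. A th ?p"] Aint by (simp add: lborel_prod)
   finally show ?thesis .
  qed
  have "cls (K * ?C) (%p. (case p of (x, y, u, v) => ?G e u) * (LBINT th. A th p))"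
   by (rule cls_mult[OF K(2) AI])
  from cls_scale[OF this, of "1 / (kp * heat (of_real e) (0 :: real^'n))"]
  have "cls (?B * (K * ?C)) (%(x, y, u, v). ?F f x u)"
  proof (rule cls_cong)
   fix p :: "'n quad" assume p: "p \<in> region"
   obtain x y u v where pe: "p = (x, y, u, v)" by (cases p)
   show "1 / (kp * ?A) * ((case p of (x, y, u, v) => ?G e u) * (LBINT th. A th p)) = (case p of (x, y, u, v) => ?F f x u)"
    using main[of u v x y] p h0 kp unfolding pe region_def by (simp add: divide_simps) (metis mult.commute mult.left_commute)
  next
   have "bm (%p::'n quad. f (fst p + fst (snd (snd p))))"
    by (rule borel_measurable_continuous_onI, rule continuous_on_compose2[OF f(1)]) (auto intro!: continuous_intros)
   thus "bm (%(x, y::real^'n, u, v::real^'n). complex_of_real (f (x + u)))" unfolding case_prod_beta by measurable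
  qed
  moreover have "?B * (K * ?C) <= C * b"
  proof -
   have "?B * (K * ?C) <= ?B * (K * ((LBINT x. H x) * b))"
    unfolding beb using K(1) H0 Bb by (intro mult_left_mono integral_nonneg) auto
   also have "... <= C * b" unfolding C_def using b(1) by (simp add: algebra_simps)
   finally show ?thesis .
  qed
  ultimately show ?thesis by (rule cls_mono)
 qed
 thus ?thesis using C by blast
qed

section \<open>The transport equations\<close>

text \<open>Every splitting of the two points into corner and offset is allowed, so membership
  refers to no particular grid and serves all time steps at once.\<close>

definition ccls :: "real => ((real^'n) \<times> (real^'n) => complex) => bool" where
 "ccls B a \<longleftrightarrow> cts a \<and> cls B (%(x, y, u, v). a (x + u, y + v))"

lemma cclsI:
 assumes "cts a" "cls B A" "!!x y u v. A (x, y, u, v) = a (x + u, y + v)"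
 shows "ccls B a"
proof -
 have "A = (%(x, y, u, v). a (x + u, y + v))" using assms(3) by auto
 thus ?thesis using assms(1,2) unfolding ccls_def by simp
qed

lemma ccls_bound: "ccls B a ==> cmod (a z) <= B" unfolding ccls_def by (rule cls_fun_bound) simp

lemma ccls_nonneg: "ccls B a ==> 0 <= B" unfolding ccls_def using cls_nonneg by blast

lemma ccls_mono: "ccls B a ==> B <= B' ==> ccls B' a" unfolding ccls_def using cls_mono by blast

lemma ccls_add: "ccls B a ==> ccls C b ==> ccls (B + C) (%z. a z + b z)" unfolding ccls_def by (intro conjI continuous_on_add)
  (auto dest: cls_add simp: case_prod_unfold)

lemma ccls_mult: "ccls B a ==> ccls C b ==> ccls (B * C) (%z. a z * b z)" unfolding ccls_def by (intro conjI continuous_on_mult)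
  (auto dest: cls_mult simp: case_prod_unfold)

lemma ccls_scale: "ccls B a ==> ccls (cmod k * B) (%z. k * a z)" unfolding ccls_def by (intro conjI continuous_on_mult continuous_on_const)
  (auto dest: cls_scale[where k=k] simp: case_prod_unfold)

lemma ccls_exp: "ccls B a ==> ccls (exp B - 1) (%z. exp (a z) - 1)"
 unfolding ccls_def by (intro conjI continuous_on_diff continuous_on_exp continuous_on_const)
  (auto dest: cls_exp simp: case_prod_unfold)

lemma ccls_zero: "ccls 0 (%z. 0)" unfolding ccls_def using cls_zero by (simp add: case_prod_unfold)

lemma ccls_one: "ccls 1 (%z. 1)" unfolding ccls_def using cls_atom[OF atom_const[of 1]] by (simp add: case_prod_unfold)

text \<open>Counts derivatives in the first variable, all of them within the same bound. The
  derivatives are existentially quantified, so iterated partial derivatives of any mixed order need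
  no multi-index notation.\<close>

primrec good :: "nat => real => ((real^'n) \<times> (real^'n) => complex) => bool" where
 "good 0 B a \<longleftrightarrow> ccls B a"
| "good (Suc m) B a \<longleftrightarrow> ccls B a \<and> (\<exists>a'. \<forall>i. good m B (a' i) \<and>
   (\<forall>x y. ((%h. a (x + h *R axis i 1, y)) hvd a' i (x, y)) (at 0)))"

lemma good_ccls: "good m B a ==> ccls B a" by (cases m) auto

lemma good_Suc_imp: "good (Suc m) B a ==> good m B a"
proof (induction m arbitrary: a)
 case (Suc m) thus ?case by (subst good.simps, subst (asm) good.simps) blast
qed simp

lemma good_le: "good m B a ==> m' <= m ==> good m' B a" by (induction m) (auto simp: le_Suc_eq simp del: good.simps dest: good_Suc_imp)

lemma good_mono: "good m B a ==> B <= B' ==> good m B' a"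
proof (induction m arbitrary: a)
 case (Suc m) thus ?case by (auto intro: ccls_mono) blast
qed (auto intro: ccls_mono)

lemma goodE:
 assumes "good (Suc m) B a"
 obtains a' where "!!i. good m B (a' i)"
  "!!i x y. ((%h. a (x + h *R axis i 1, y)) hvd a' i (x, y)) (at 0)" using assms unfolding good.simps by blast

lemma goodI:
 assumes "ccls B a" "!!i. good m B (a' i)"
  "!!i x y. ((%h. a (x + h *R axis i 1, y)) hvd a' i (x, y)) (at 0)"
 shows "good (Suc m) B a" unfolding good.simps using assms by blast

lemma good_zero: "good m 0 (%z. 0)"
proof (induction m)
 case (Suc m) show ?case by (rule goodI[where a'="%i z. 0"]) (auto intro: ccls_zero Suc)
qed (simp add: ccls_zero)

lemma good_add: "good m B a ==> good m C b ==> good m (B + C) (%z. a z + b z)"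
proof (induction m arbitrary: a b)
 case (Suc m)
 obtain a' where a': "!!i. good m B (a' i)" "!!i x y. ((%h. a (x + h *R axis i 1, y)) hvd a' i (x, y)) (at 0)"
  using Suc.prems(1) by (rule goodE) blast
 obtain b' where b': "!!i. good m C (b' i)" "!!i x y. ((%h. b (x + h *R axis i 1, y)) hvd b' i (x, y)) (at 0)"
  using Suc.prems(2) by (rule goodE) blast
 show ?case
 proof (rule goodI[where a'="%i z. a' i z + b' i z"])
  show "ccls (B + C) (%z. a z + b z)" by (rule ccls_add[OF good_ccls[OF Suc.prems(1)] good_ccls[OF Suc.prems(2)]])
  show "good m (B + C) (%z. a' i z + b' i z)" for i by (rule Suc.IH[OF a'(1) b'(1)])
 qed (rule has_vector_derivative_add[OF a'(2) b'(2)])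
qed (simp add: ccls_add)

lemma good_scale: "good m B a ==> good m (cmod k * B) (%z. k * a z)"
proof (induction m arbitrary: a)
 case (Suc m)
 obtain a' where a': "!!i. good m B (a' i)" "!!i x y. ((%h. a (x + h *R axis i 1, y)) hvd a' i (x, y)) (at 0)"
  using Suc.prems(1) by (rule goodE) blast
 show ?case by (rule goodI[where a'="%i z. k * a' i z"])
   (rule ccls_scale[OF good_ccls[OF Suc.prems]] Suc.IH[OF a'(1)] has_vector_derivative_mult_right[OF a'(2)])+
qed (simp add: ccls_scale)

lemma good_sum:
 "finite I ==> (!!i. i \<in> I ==> good m (B i) (a i)) ==> good m (\<Sum>i\<in>I. B i) (%z. \<Sum>i\<in>I. a i z)"
proof (induction I rule: finite_induct)
 case (insert i I)
 have "good m (B i + (\<Sum>i\<in>I. B i)) (%z. a i z + (\<Sum>i\<in>I. a i z))" by (rule good_add) (use insert in auto)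
 thus ?case using insert by simp
qed (simp add: good_zero)

text \<open>The product rule doubles the number of terms with every derivative, hence the factor
  2^m.\<close>

lemma good_mult: "good m B a ==> good m C b ==> good m (2 ^ m * (B * C)) (%z. a z * b z)"
proof (induction m arbitrary: a b)
 case (Suc m)
 obtain a' where a': "!!i. good m B (a' i)" "!!i x y. ((%h. a (x + h *R axis i 1, y)) hvd a' i (x, y)) (at 0)"
  using Suc.prems(1) by (rule goodE) blast
 obtain b' where b': "!!i. good m C (b' i)" "!!i x y. ((%h. b (x + h *R axis i 1, y)) hvd b' i (x, y)) (at 0)"
  using Suc.prems(2) by (rule goodE) blast
 have BC: "0 <= B * C" using ccls_nonneg[OF good_ccls[OF Suc.prems(1)]] ccls_nonneg[OF good_ccls[OF Suc.prems(2)]] by simp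
 show ?case
 proof (rule goodI[where a'="%i z. a z * b' i z + a' i z * b z"])
  show "ccls (2 ^ Suc m * (B * C)) (%z. a z * b z)"
  proof (rule ccls_mono[OF ccls_mult[OF good_ccls[OF Suc.prems(1)] good_ccls[OF Suc.prems(2)]]])
   have "1 * (B * C) <= 2 ^ Suc m * (B * C)" by (rule mult_right_mono[OF one_le_power BC]) simp
   thus "B * C <= 2 ^ Suc m * (B * C)" by (simp only: mult_1_left)
  qed
  have "2 ^ m * (B * C) + 2 ^ m * (B * C) = 2 ^ Suc m * (B * C)" by simp
  thus "good m (2 ^ Suc m * (B * C)) (%z. a z * b' i z + a' i z * b z)" for i
   using good_add[OF Suc.IH[OF good_Suc_imp[OF Suc.prems(1)] b'(1)] Suc.IH[OF a'(1) good_Suc_imp[OF Suc.prems(2)]]] by (simp only:)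
  show "((%h. a (x + h *R axis i 1, y) * b (x + h *R axis i 1, y)) hvd (a (x, y) * b' i (x, y) + a' i (x, y) * b (x, y))) (at 0)" for i x y
   using has_vector_derivative_mult[OF a'(2)[of x i y] b'(2)[of x i y]] by simp
 qed
qed (simp add: ccls_mult)

lemma good_pd:
 assumes "good (Suc m) B a"
 shows "good m B (%z. pd i (%x. a (x, snd z)) (fst z))"
  and "((%h. a (x + h *R axis i 1, y)) hvd pd i (%x. a (x, y)) x) (at 0)"
proof -
 obtain a' where a': "!!i. good m B (a' i)" "!!i x y. ((%h. a (x + h *R axis i 1, y)) hvd a' i (x, y)) (at 0)"
  using assms by (rule goodE) blast
 have e: "pd i (%x. a (x, y)) x = a' i (x, y)" for x y unfolding pd_def using a'(2) by (rule vector_derivative_at)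
 show "good m B (%z. pd i (%x. a (x, snd z)) (fst z))" unfolding e using a'(1) by simp
 show "((%h. a (x + h *R axis i 1, y)) hvd pd i (%x. a (x, y)) x) (at 0)" unfolding e by (rule a'(2))
qed

lemma good_laplacian:
 fixes a :: "(real^'n) \<times> (real^'n) => complex"
 assumes "good (Suc (Suc m)) B a"
 shows "good m (real CARD('n) * B) (%z. laplacian (%x. a (x, snd z)) (fst z))"
proof -
 have "good m (\<Sum>i\<in>(UNIV::'n set). B) (%z. \<Sum>i\<in>UNIV. pd i (%x. pd i (%x. a (x, snd z)) x) (fst z))"
 proof (rule good_sum)
  fix i :: 'n
  show "good m B (%z. pd i (%x. pd i (%x. a (x, snd z)) x) (fst z))" using good_pd(1)[OF good_pd(1)[OF assms], of i i] by simp
 qed simp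
 thus ?thesis by (simp add: laplacian_def)
qed

lemma line_derivative_shift:
 fixes a :: "real^'n => complex"
 assumes "!!x. ((%h. a (x + h *R e)) hvd a' x) (at 0)"
 shows "((%h. a (x + h *R e)) hvd a' (x + r *R e)) (at r)"
proof -
 have "((%h. a (x + r *R e + h *R e)) \<circ> (%h. h - r) hvd (1 *R a' (x + r *R e))) (at r)"
 proof (rule vector_diff_chain_at)
  show "((%h. h - r) hvd 1) (at r)" by (auto intro!: derivative_eq_intros)
  show "((%h. a (x + r *R e + h *R e)) hvd a' (x + r *R e)) (at (r - r))" using assms by simp
 qed
 thus ?thesis by (simp add: o_def algebra_simps)
qed

definition segint :: "nat => ((real^'n) \<times> (real^'n) => complex) => (real^'n) \<times> (real^'n) => complex" where
 "segint m a z = (LBINT t. indicator {0..1} t *R (t ^ m *R a (t *R fst z + (1 - t) *R snd z, snd z)))"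

lemma integrable_indicator_unit: "lint (%t::real. indicator {0..1} t * B)" for B :: real
 by (intro integrable_mult_left) (auto simp: integrable_indicator_iff)

lemma integral_indicator_unit: "(LBINT t. indicator {0..1::real} t * B) = B" for B :: real by simp

lemma segint_aux:
 assumes "ccls B a"
 shows "cts (%(t, z). a (t *R fst z + (1 - t) *R snd z, snd z))"
  and "norm (indicator {0..1} t *R (t ^ m *R a w)) <= indicator {0..1} t * B"
proof -
 have "cts (%p::real \<times> (real^'n) \<times> (real^'n). (fst p *R fst (snd p) + (1 - fst p) *R snd (snd p), snd (snd p)))"
  by (intro continuous_intros)
 from continuous_on_compose2[OF _ this, of UNIV a] assms
 show "cts (%(t, z). a (t *R fst z + (1 - t) *R snd z, snd z))" by (simp add: ccls_def case_prod_unfold)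
 have "\<bar>t\<bar> ^ m * cmod (a w) <= 1 * B" if "t \<in> {0..1}" using that by (intro mult_mono ccls_bound[OF assms] power_le_one) auto
 thus "norm (indicator {0..1} t *R (t ^ m *R a w)) <= indicator {0..1} t * B" by (auto simp: indicator_def power_abs[symmetric])
qed

lemma segint_integrable:
 assumes "ccls B a"
 shows "lint (%t. indicator {0..1} t *R (t ^ m *R a (t *R x + (1 - t) *R y, y)))"
proof (rule ibound[OF integrable_indicator_unit[of B]])
 have "cts (%t. (%(t, z). a (t *R fst z + (1 - t) *R snd z, snd z)) (t, (x, y)))"
  by (rule continuous_on_compose2[OF segint_aux(1)[OF assms]]) (rule continuous_on_Pair continuous_on_const continuous_on_id subset_UNIV)+
 hence [measurable]: "bm (%t. a (t *R x + (1 - t) *R y, y))" by (simp add: borel_measurable_continuous_onI)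
 show "(%t. indicator {0..1} t *R (t ^ m *R a (t *R x + (1 - t) *R y, y))) \<in> borel_measurable lborel" by measurable
 show "AE t in lborel. norm (indicator {0..1} t *R (t ^ m *R a (t *R x + (1 - t) *R y, y))) <= norm (indicator {0..1} t * B)"
  by (intro AE_I2 order_trans[OF segint_aux(2)[OF assms]]) simp
qed

text \<open>On the segment the amplitude is composed with \<open>slide t\<close>, so the average is
  a superposition covered by \<open>cls_integral\<close>. The weight t^m is at most 1 and costs
  nothing.\<close>

lemma ccls_segint:
 fixes a :: "(real^'n) \<times> (real^'n) => complex"
 assumes a: "ccls B a"
 shows "ccls B (segint m a)"
proof (rule cclsI)
 have ac: "cts a" using a by (simp add: ccls_def)
 show "cts (segint m a)" unfolding segint_def
 proof (rule continuous_on_integral_dominated[OF _ _ segint_aux(2)[OF a] integrable_indicator_unit])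
  show "(%t. indicator {0..1} t *R (t ^ m *R a (t *R fst z + (1 - t) *R snd z, snd z))) \<in> borel_measurable lborel" for z
   using borel_measurable_integrable[OF segint_integrable[OF a, of m "fst z" "snd z"]] .
  fix t :: real
  have "cts (%z::(real^'n) \<times> (real^'n). (t *R fst z + (1 - t) *R snd z, snd z))" by (intro continuous_intros)
  from continuous_on_compose2[OF ac this]
  show "cts (%z. indicator {0..1} t *R (t ^ m *R a (t *R fst z + (1 - t) *R snd z, snd z)))"
   by (intro continuous_on_scaleR continuous_on_const) simp
 qed
 define A where "A = (%(x, y, u, v). a (x + u, y + v))"
 have Ac: "cls B A" using a by (simp add: ccls_def A_def)
 let ?A = "%t. of_real (indicator {0..1} t * t ^ m)"
 have A1: "cls (indicator {0..1} t * B) (%p. ?A t * A (slide t p))" for t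
  proof (cases "t \<in> {0..1}")
   case True
   have "cls (cmod (of_real (t ^ m)) * B) (%p. of_real (t ^ m) * A (slide t p))" using True by (intro cls_scale cls_slide Ac) auto
   moreover have "cmod (of_real (t ^ m)) * B <= 1 * B" using True cls_nonneg[OF Ac] by (intro mult_right_mono) (auto simp: norm_power power_le_one)
   ultimately show ?thesis using True by (auto elim: cls_mono)
  next
   case False thus ?thesis using cls_zero by simp
  qed
  have "cts (%q::real \<times> 'n quad. (fst q *R fst (snd q) + (1 - fst q) *R fst (snd (snd q)) + (fst q *R fst (snd (snd (snd q))) + (1 - fst q) *R snd (snd (snd (snd q)))), fst (snd (snd q)) + snd (snd (snd (snd q)))))"
   by (intro continuous_intros)
  from continuous_on_compose2[OF ac this] have [measurable]: "(%q. A (slide (fst q) (snd q))) \<in> borel_measurable (borel :: (real \<times> 'n quad) measure)"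
   by (intro borel_measurable_continuous_onI) (simp add: A_def slide_def case_prod_unfold)
  have [measurable]: "bm (%q::real \<times> 'n quad. fst q)" by (intro borel_measurable_continuous_onI continuous_intros)
  have "bm (%q::real \<times> 'n quad. of_real (indicator {0..1} (fst q) * fst q ^ m) * A (slide (fst q) (snd q)))" by measurable
  hence A2: "(%(t, p::'n quad). ?A t * A (slide t p)) \<in> borel_measurable (lborel \<Otimes>\<^sub>M borel)"
   by (intro borel_measurable_pair_lborel) (simp add: case_prod_unfold)
 from cls_integral[OF sigma_finite_lborel A2 A1 integrable_indicator_unit] show "cls B (%p. \<integral>t. ?A t * A (slide t p) \<partial>lborel)"
  by (simp only: integral_indicator_unit)
 show "(LBINT t. ?A t * A (slide t (x, y, u, v))) = segint m a (x + u, y + v)" for x y u v unfolding segint_def A_def slide_def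
  by (intro icong refl) (simp add: scaleR_conv_of_real algebra_simps)
qed

text \<open>The chain rule along the segment gives a factor t, which raises the exponent of the
  weight and leaves the bound unchanged.\<close>

lemma segint_derivative:
 fixes a :: "(real^'n) \<times> (real^'n) => complex"
 assumes a: "ccls B a" "ccls B a'"
  and d: "!!x y. ((%h. a (x + h *R axis i 1, y)) hvd a' (x, y)) (at 0)"
 shows "((%h. segint m a (x + h *R axis i 1, y)) hvd segint (Suc m) a' (x, y)) (at 0)"
proof -
 have "((%h. \<integral>t. indicator {0..1} t *R (t ^ m *R a (t *R (x + h *R axis i 1) + (1 - t) *R y, y)) \<partial>lborel) has_vector_derivative
   (LBINT t. indicator {0..1} t *R (t ^ Suc m *R a' (t *R (x + 0 *R axis i 1) + (1 - t) *R y, y)))) (at 0)"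
 proof (rule has_vector_derivative_integral(1)[OF zero_less_one _ segint_integrable[OF a(1)] segint_aux(2)[OF a(2)] integrable_indicator_unit])
  fix h t :: real
  let ?A = "t *R x + (1 - t) *R y"
  have "((%h. a (?A + h *R axis i 1, y)) hvd a' (?A + (t * h) *R axis i 1, y)) (at (t * h))"
   by (rule line_derivative_shift[where a'="%x. a' (x, y)", OF d])
  moreover have "((%h. t * h) hvd t) (at h)" by (auto intro!: derivative_eq_intros)
  ultimately have 1: "((%h. a (?A + (t * h) *R axis i 1, y)) hvd t *R a' (?A + (t * h) *R axis i 1, y)) (at h)"
   using vector_diff_chain_at[of "%h. t * h" t h] by (simp add: o_def)
  have e: "t *R (x + h *R axis i 1) + (1 - t) *R y = ?A + (t * h) *R axis i 1" for h
   by (simp add: algebra_simps)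
  show "((%h. indicator {0..1} t *R (t ^ m *R a (t *R (x + h *R axis i 1) + (1 - t) *R y, y))) has_vector_derivative
   indicator {0..1} t *R (t ^ Suc m *R a' (t *R (x + h *R axis i 1) + (1 - t) *R y, y))) (at h)"
   unfolding e using bounded_linear.has_vector_derivative[OF bounded_linear_scaleR_right[of "indicator {0..1} t * t ^ m"] 1] by (simp add: mult_ac)
 qed
 thus ?thesis unfolding segint_def by simp
qed

lemma good_segint: "good m B a ==> good m B (segint k a)"
proof (induction m arbitrary: a k)
 case (Suc m)
 obtain a' where a': "!!i. good m B (a' i)" "!!i x y. ((%h. a (x + h *R axis i 1, y)) hvd a' i (x, y)) (at 0)"
  using Suc.prems(1) by (rule goodE) blast
 show ?case by (rule goodI[where a'="%i. segint (Suc k) (a' i)"])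
   (rule ccls_segint[OF good_ccls[OF Suc.prems]] Suc.IH[OF a'(1)] segint_derivative[OF good_ccls[OF Suc.prems] good_ccls[OF a'(1)] a'(2)])+
qed (simp add: ccls_segint)

text \<open>The transport equation differentiates along oblique segments, while \<open>good\<close>
  provides partial derivatives. The increment is built up one coordinate at a time, and continuity
  of the partial derivatives controls each step.\<close>

lemma has_derivative_of_partials:
 fixes f :: "real^'n => complex"
 assumes d: "!!i x. ((%h. f (x + h *R axis i 1)) hvd f' i x) (at 0)"
  and c: "!!i. cts (f' i)"
 shows "(f has_derivative (%h. \<Sum>i\<in>UNIV. h$i *R f' i x)) (at x)"
proof -
 have step: "\<exists>de>0. \<forall>h. norm h < de \<longrightarrow> norm (f (x + (\<Sum>i\<in>J. h$i *R axis i 1)) - f x - (\<Sum>i\<in>J. h$i *R f' i x)) <= e * norm h"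
  if "finite J" "0 < e" for J e using that
 proof (induction J arbitrary: e rule: finite_induct)
  case empty
  thus ?case by (intro exI[of _ 1]) auto
 next
  case (insert j J)
  obtain de1 where de1: "de1 > 0" "!!h. norm h < de1 ==> norm (f (x + (\<Sum>i\<in>J. h$i *R axis i 1)) - f x - (\<Sum>i\<in>J. h$i *R f' i x)) <= e / 2 * norm h"
   using insert.IH[of "e / 2"] insert.prems by auto
  obtain de2 where de2: "de2 > 0" "!!y. dist y x < de2 ==> dist (f' j y) (f' j x) < e / 2"
   using c[of j] insert.prems unfolding continuous_on_eq_continuous_at[OF open_UNIV] continuous_at_eps_delta by (meson UNIV_I half_gt_zero)
  let ?A = "real (card J) + 1"
  \<comment> \<open>An intermediate point is reached by at most card J + 1 coordinate moves, each no
    longer than |h|, so this radius keeps it within \<open>de2\<close> of x.\<close>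
  define de where "de = min de1 (de2 / ?A)"
  have "de > 0" using de1 de2 by (simp add: de_def)
  moreover have "norm (f (x + (\<Sum>i\<in>insert j J. h$i *R axis i 1)) - f x - (\<Sum>i\<in>insert j J. h$i *R f' i x)) <= e * norm h" if h: "norm h < de" for h
  proof -
   let ?y = "x + (\<Sum>i\<in>J. h$i *R axis i 1)"
   let ?G = "%t. ?y + t *R axis j 1"
   have near: "dist (?G t) x < de2" if t: "\<bar>t\<bar> <= \<bar>h$j\<bar>" for t
   proof -
    have "norm ((\<Sum>i\<in>J. h$i *R axis i (1::real)) + t *R axis j 1) <= (\<Sum>i\<in>J. norm h) + norm h"
    proof (intro norm_triangle_le add_mono sum_norm_le)
     show "norm (h$i *R axis i (1::real)) <= norm h" for i using component_le_norm_cart[of h i] by simp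
     show "norm (t *R axis j (1::real)) <= norm h" using component_le_norm_cart[of h j] t by simp
    qed
    also have "... = ?A * norm h" by (simp add: algebra_simps)
    also have "... < ?A * (de2 / ?A)" using h by (intro mult_strict_left_mono) (auto simp: de_def)
    also have "... = de2" by simp
    finally show ?thesis by (simp add: dist_norm add.assoc)
   qed
   let ?B = "f (?y + (h$j) *R axis j 1) - f ?y - (h$j) *R f' j x"
   let ?C = "f ?y - f x - (\<Sum>i\<in>J. h$i *R f' i x)"
   have "norm ((f (?y + (h$j) *R axis j 1) - (h$j) *R f' j x) - (f (?y + 0 *R axis j 1) - 0 *R f' j x)) <= e / 2 * norm (h$j - 0)"
   proof (rule differentiable_bound[where S="{- \<bar>h$j\<bar>..\<bar>h$j\<bar>}" and f'="%t s. s *R (f' j (?G t) - f' j x)"])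
    fix t assume t: "t \<in> {- \<bar>h$j\<bar>..\<bar>h$j\<bar>}"
    let ?D = "%t. f (?y + t *R axis j 1) - t *R f' j x"
    let ?E = "f' j (?y + t *R axis j 1) - f' j x"
    have "((%t. f (?G t)) hvd f' j (?G t)) (at t)" by (rule line_derivative_shift[OF d])
    moreover have "((%t. t *R f' j x) hvd f' j x) (at t)"
     using has_vector_derivative_scaleR[OF DERIV_ident has_vector_derivative_const, of "f' j x" t UNIV] by simp
    ultimately have "(?D hvd f' j (?G t) - f' j x) (at t)"
     by (rule has_vector_derivative_diff)
    thus "(?D has_derivative (%s. s *R ?E)) (at t within {- \<bar>h$j\<bar>..\<bar>h$j\<bar>})"
     unfolding has_vector_derivative_def by (rule has_derivative_at_withinI)
    have "norm ?E <= e / 2" using de2(2)[OF near[of t]] t by (simp add: dist_norm abs_le_iff)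
    thus "onorm (%s. s *R ?E) <= e / 2"
     using mult_left_mono[OF _ abs_ge_zero] by (intro onorm_le) (simp only: norm_scaleR real_norm_def mult.commute[of "e / 2"])
   qed auto
   hence "norm ?B <= e / 2 * norm h"
    using component_le_norm_cart[of h j] insert.prems by (simp add: algebra_simps) (smt (verit) mult_left_mono)
   moreover have "norm ?C <= e / 2 * norm h" using de1(2)[of h] h by (simp add: de_def)
   ultimately have "norm (?B + ?C) <= e / 2 * norm h + e / 2 * norm h"
    by (intro norm_triangle_le add_mono)
   thus ?thesis using insert.hyps by (simp add: algebra_simps)
  qed
  ultimately show ?case by blast
 qed
 have s: "(\<Sum>i\<in>UNIV. h$i *R axis i (1::real)) = h" for h :: "real^'n" by (simp add: vec_eq_iff axis_def if_distrib[of "%t. _ * t"] cong: if_cong)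
 show ?thesis unfolding has_derivative_at_alt
 proof (intro conjI allI impI)
  show "bounded_linear (%h. \<Sum>i\<in>UNIV. h$i *R f' i x)" by (intro bounded_linear_sum bounded_linear_scaleR_const bounded_linear_vec_nth)
  fix e :: real assume "0 < e"
  then obtain de where de: "de > 0" "!!h. norm h < de ==> norm (f (x + h) - f x - (\<Sum>i\<in>UNIV. h$i *R f' i x)) <= e * norm h"
   using step[of UNIV e] unfolding s by auto
  let ?F = "%y. norm (f y - f x - (\<Sum>i\<in>UNIV. (y - x)$i *R f' i x))"
  have "?F y <= e * norm (y - x)" if "norm (y - x) < de" for y using de(2)[OF that] by simp
  thus "\<exists>d>0. \<forall>y. norm (y - x) < d \<longrightarrow> ?F y <= e * norm (y - x)"
   using de(1) by blast
 qed
qed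

text \<open>The fundamental theorem on [0, 1] for the function t^(m + 1) a(t x + (1 - t) y, y),
  whose derivative consists of the two terms on the left.\<close>

lemma transport_equation:
 fixes a :: "(real^'n) \<times> (real^'n) => complex"
 assumes a: "ccls B a" and a': "!!i. ccls B (a' i)"
  and d: "!!i x y. ((%h. a (x + h *R axis i 1, y)) hvd a' i (x, y)) (at 0)"
 shows "of_nat (Suc m) * segint m a (x, y) + (\<Sum>i\<in>UNIV. of_real ((x - y)$i) * segint (Suc m) (a' i) (x, y)) = a (x, y)"
proof -
 let ?p = "%t. t *R x + (1 - t) *R y"
 let ?G = "%t. of_nat (Suc m) * (t ^ m *R a (?p t, y)) + (\<Sum>i\<in>UNIV. of_real ((x - y)$i) * (t ^ Suc m *R a' i (?p t, y)))"
 have c: "cts (%t. b (?p t, y))" if "ccls B b" for b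
 proof -
  have "cts (%t. (%(t, z). b (t *R fst z + (1 - t) *R snd z, snd z)) (t, (x, y)))"
   by (rule continuous_on_compose2[OF segint_aux(1)[OF that]]) (rule continuous_on_Pair continuous_on_const continuous_on_id subset_UNIV)+
  thus ?thesis by simp
 qed
 have cy: "cts (%z. a' i (z, y))" for i using continuous_on_compose2[of UNIV "a' i" UNIV "%z. (z, y)"] a'[of i]
  by (simp add: ccls_def continuous_on_Pair)
 have fr: "((%z. a (z, y)) has_derivative (%h. \<Sum>i\<in>UNIV. h$i *R a' i (z, y))) (at z)" for z
  by (rule has_derivative_of_partials[of "%z. a (z, y)" "%i z. a' i (z, y)", OF d cy])
 let ?B = "%t. \<Sum>i\<in>UNIV. (x - y)$i *R a' i (?p t, y)"
 have d1: "((%t. a (?p t, y)) hvd (?B t)) (at t)" for t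
 proof -
  have "(?p hvd (x - y)) (at t)" unfolding has_vector_derivative_def by (auto intro!: derivative_eq_intros simp: algebra_simps)
  from vector_derivative_diff_chain_within[OF this, of "%z. a (z, y)" "%h. \<Sum>i\<in>UNIV. h$i *R a' i (?p t, y)"]
  show ?thesis using has_derivative_at_withinI[OF fr[of "?p t"]] by (simp add: o_def)
 qed
 have d2: "((%t. t ^ Suc m *R a (?p t, y)) hvd ?G t) (at t)" for t
 proof -
  have "((%t::real. t ^ Suc m) has_field_derivative (real (Suc m) * t ^ m)) (at t)" using DERIV_pow[of "Suc m" t] by simp
  from has_vector_derivative_scaleR[OF this d1[of t]]
  have "((%t. t ^ Suc m *R a (?p t, y)) hvd t ^ Suc m *R (?B t) + (real (Suc m) * t ^ m) *R a (?p t, y)) (at t)" .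
  moreover have "t ^ Suc m *R (?B t) + (real (Suc m) * t ^ m) *R a (?p t, y) = ?G t"
   by (simp add: scaleR_sum_right scaleR_conv_of_real sum_distrib_left mult_ac)
  ultimately show ?thesis by simp
 qed
 have "continuous_on {0..1} ?G" by (intro continuous_intros continuous_on_subset[OF c[OF a]] continuous_on_subset[OF c[OF a']]) auto
 from integral_FTC_Icc[OF zero_le_one has_vector_derivative_at_within[OF d2] this]
 have "(LBINT t. indicator {0..1} t *R ?G t) = a (x, y)" by simp
 moreover have "(LBINT t. indicator {0..1} t *R ?G t) =
   of_nat (Suc m) * segint m a (x, y) + (\<Sum>i\<in>UNIV. of_real ((x - y)$i) * segint (Suc m) (a' i) (x, y))"
 proof -
  have I: "lint (%t. k * (indicator {0..1} t *R (t ^ j *R b (?p t, y))))" if "ccls B b" for b j k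
   by (rule integrable_mult_right, rule segint_integrable[OF that])
  let ?A = "%t. \<Sum>i\<in>UNIV. of_real ((x - y)$i) * (indicator {0..1} t *R (t ^ Suc m *R a' i (?p t, y)))"
  let ?C = "%t. indicator {0..1} t *R (t ^ m *R a (?p t, y))"
  have "indicator {0..1} t *R ?G t = of_nat (Suc m) * (?C t) + (?A t)" for t
   by (cases "t \<in> {0..1}") auto
  hence "(LBINT t. indicator {0..1} t *R ?G t) = (LBINT t. of_nat (Suc m) * (?C t) + (?A t))"
   by presburger
  also have "... = (LBINT t. of_nat (Suc m) * (?C t)) + (\<Sum>i\<in>UNIV. (LBINT t. of_real ((x - y)$i) * (indicator {0..1} t *R (t ^ Suc m *R a' i (?p t, y)))))"
   by (subst Bochner_Integration.integral_add[OF I[OF a] Bochner_Integration.integrable_sum[OF I[OF a']]],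
     subst Bochner_Integration.integral_sum[OF I[OF a']], rule refl)
  finally show ?thesis unfolding segint_def fst_conv snd_conv integral_mult_right_zero .
 qed
 ultimately show ?thesis by simp
qed

text \<open>From here on the Sjoestrand norm is replaced by one class bound \<open>B0\<close> for
  all admissible derivatives of the potential at all times.\<close>

locale potential =
 fixes V :: "real => real^'n => real" and N :: nat
  and D :: "nat => ('n => nat) => real => real^'n => real" and B0 :: real
 assumes N: "1 <= N" and D0: "D 0 (%_. 0) = V"
  and Dt: "!!k al t x. 2 * Suc k + (\<Sum>i\<in>UNIV. al i) <= 2 * N ==>
    ((%ta. D k al ta x) has_real_derivative D (Suc k) al t x) (at t)"
  and Dx: "!!k al j t x. 2 * k + Suc (\<Sum>i\<in>UNIV. al i) <= 2 * N ==>
    ((%h. D k al t (x + h *R axis j 1)) has_real_derivative D k (al(j := Suc (al j))) t x) (at 0)"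
  and Dcls: "!!k al t. 2 * k + (\<Sum>i\<in>UNIV. al i) <= 2 * N ==> ccls B0 (%z. of_real (D k al t (fst z)))"

lemma finite_multiindices: "finite {(k, al :: 'n::finite => nat). 2 * k + (\<Sum>i\<in>UNIV. al i) <= M}"
proof (rule finite_subset)
 show "finite ({..M} \<times> (PiE (UNIV :: 'n set) (%i. {..M})))" by (intro finite_cartesian_product finite_PiE) auto
 have "al i <= M" if "2 * k + (\<Sum>i\<in>UNIV. al i) <= M" for k i and al :: "'n => nat"
  using member_le_sum[of i UNIV al] that by simp
 thus "{(k, al :: 'n => nat). 2 * k + (\<Sum>i\<in>UNIV. al i) <= M} \<subseteq> {..M} \<times> (PiE UNIV (%i. {..M}))" by auto
qed

lemma admissible_imp_potential:
 fixes g :: "real^'n => complex"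
 assumes g: "g \<in> schwartz" "g \<noteq> (%x. 0)" and N: "1 <= N" and V: "admissible_potential g N V"
 shows "\<exists>D B0. potential V N D B0"
proof -
 let ?A = "%al. \<Sum>i\<in>UNIV. al i"
 obtain D :: "nat => ('n => nat) => real => real^'n => real" where D: "D 0 (%_. 0) = V"
   "!!k al t x. 2 * Suc k + (?A al) <= 2 * N ==> ((%ta. D k al ta x) has_real_derivative D (Suc k) al t x) (at t)"
   "!!k al j t x. 2 * k + Suc (?A al) <= 2 * N ==>
    ((%h. D k al t (x + h *R axis j 1)) has_real_derivative D k (al(j := Suc (al j))) t x) (at 0)"
   "!!k al. 2 * k + (?A al) <= 2 * N ==> cb_sjostrand g (D k al)"
  using V unfolding admissible_potential_def by blast
 obtain C where C: "C > 0" "!!f b. cts f ==> bounded (range f) ==> 0 <= b ==>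
   sjostrand_norm g (distr_of (%x. of_real (f x))) <= ennreal b ==> cls (C * b) (%(x, y, u, v). of_real (f (x + u)))"
  using sjostrand_cls[OF g] by blast
 have "\<exists>b. \<forall>t. sjostrand_norm g (distr_of (%x. of_real (D k al t x))) <= ennreal b" if "2 * k + (?A al) <= 2 * N" for k al
  using D(4)[OF that] unfolding cb_sjostrand_def by blast
 then obtain b where b: "!!k al t. 2 * k + (?A al) <= 2 * N ==> sjostrand_norm g (distr_of (%x. of_real (D k al t x))) <= ennreal (b k al)"
  by metis
 \<comment> \<open>Only finitely many pairs (k, \<alpha>) occur, so their bounds merge into one by
   summing absolute values.\<close>
 define bb where "bb = (\<Sum>(k, al)\<in>{(k, al :: 'n => nat). 2 * k + (?A al) <= 2 * N}. \<bar>b k al\<bar>)"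
 have bb: "b k al <= bb" if "2 * k + (?A al) <= 2 * N" for k al
 proof -
  have "\<bar>b k al\<bar> <= bb"
   unfolding bb_def using member_le_sum[of "(k, al)" "{(k, al :: 'n => nat). 2 * k + (?A al) <= 2 * N}" "%(k, al). \<bar>b k al\<bar>"] that finite_multiindices[of "2 * N"]
   by auto
  thus ?thesis by simp
 qed
 have bb0: "0 <= bb" unfolding bb_def by (intro sum_nonneg) auto
 have "potential V N D (C * bb)"
 proof
  fix k t and al :: "'n => nat" assume ka: "2 * k + (?A al) <= 2 * N"
  have f: "cts (D k al t)" "bounded (range (D k al t))" using D(4)[OF ka] unfolding cb_sjostrand_def by auto
  show "ccls (C * bb) (%z. of_real (D k al t (fst z)))"
  proof (rule cclsI)
   show "cts (%z. complex_of_real (D k al t (fst z)))"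
    by (intro continuous_on_of_real continuous_on_compose2[OF f(1)] continuous_intros) auto
   show "cls (C * bb) (%(x, y, u, v). of_real (D k al t (x + u)))"
    by (rule C(2)[OF f bb0]) (use b[OF ka, of t] bb[OF ka] in \<open>auto intro: order_trans ennreal_leI\<close>)
  qed simp
 qed (use N D in auto)
 thus ?thesis by blast
qed

section \<open>Uniform amplitude bounds for the approximate action\<close>

context potential
begin

lemma B0_nonneg: "0 <= B0" using ccls_nonneg[OF Dcls[of 0 "%_. 0" 0]] by simp

lemma D_good: "2 * k + (\<Sum>i\<in>UNIV. al i) + m <= 2 * N ==> good m B0 (%z. of_real (D k al t (fst z)))"
proof (induction m arbitrary: al)
 case 0 thus ?case using Dcls by simp
next
 case (Suc m)
 show ?case
 proof (rule goodI[where a'="%i z. of_real (D k (al(i := Suc (al i))) t (fst z))"])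
  show "ccls B0 (%z. of_real (D k al t (fst z)))" using Suc.prems by (intro Dcls) simp
  fix i
  let ?A = "al(i := Suc (al i))"
  have "(\<Sum>j\<in>UNIV. ?A j) = Suc (\<Sum>j\<in>UNIV. al j)" by (subst (1 2) sum.remove[of UNIV i]) auto
  thus "good m B0 (%z. of_real (D k ?A t (fst z)))" using Suc.prems by (intro Suc.IH) simp
  fix x y :: "real^'n"
  have "((%h. D k al t (x + h *R axis i 1)) has_real_derivative D k ?A t x) (at 0)" using Suc.prems by (intro Dx) simp
  from has_vector_derivative_of_real[OF this]
  show "((%h. of_real (D k al t (fst (x + h *R axis i 1, y)))) hvd of_real (D k ?A t (fst (x, y)))) (at 0)"
   by simp
 qed
qed

lemma deriv_V: "m <= N ==> (deriv ^^ m) (%ta. V ta x) = (%ta. D m (%_. 0) ta x)"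
proof (induction m)
 case 0 thus ?case by (simp add: D0)
next
 case (Suc m)
 have "deriv (%ta. D m (%_. 0) ta x) t = D (Suc m) (%_. 0) t x" for t
  using Dt[of m "%_. 0" x t] Suc.prems by (intro DERIV_imp_deriv) simp
 thus ?case using Suc by auto
qed

definition aW :: "real => real => nat => (real^'n) \<times> (real^'n) => complex" where
 "aW hbar s k z = action_W hbar V s k (fst z) (snd z)"

definition aF :: "real => real => nat => (real^'n) \<times> (real^'n) => complex" where
 "aF hbar s k z = action_F hbar V s k (fst z) (snd z)"

definition pairs :: "nat => (nat \<times> nat) set" where "pairs m = {(j, l). j + l = m \<and> 1 <= j \<and> 1 <= l}"

lemma finite_pairs: "finite (pairs m)" by (rule finite_subset[of _ "{..m} \<times> {..m}"]) (auto simp: pairs_def)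

lemma aF_Suc:
 assumes "m <= N"
 shows "aF hbar s (Suc m) z = - (1 / 2) * (\<Sum>p\<in>pairs m. \<Sum>i\<in>UNIV.
     pd i (%x. aW hbar s (fst p) (x, snd z)) (fst z) * pd i (%x. aW hbar s (snd p) (x, snd z)) (fst z))
   + (- of_real (1 / fact m)) * of_real (D m (%_. 0) s (fst z))
   + (\<i> * of_real hbar / 2) * laplacian (%x. aW hbar s m (x, snd z)) (fst z)"
 unfolding aF_def action_F.simps deriv_V[OF assms] aW_def pairs_def by (simp add: case_prod_unfold)

lemma aW_0: "aW hbar s 0 = (%z. 0)" by (rule ext) (simp add: aW_def)

lemma aW_Suc:
 assumes "ccls B (aF hbar s (Suc m))"
 shows "aW hbar s (Suc m) = segint m (aF hbar s (Suc m))"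
proof
 fix z
 let ?f = "%t. t ^ m *R aF hbar s (Suc m) (t *R fst z + (1 - t) *R snd z, snd z)"
 have "segint m (aF hbar s (Suc m)) z = (LINT t:{0..1}|lborel. ?f t)" by (simp add: segint_def set_lebesgue_integral_def)
 also have "... = integral {0..1} ?f" using segint_integrable[OF assms, of m "fst z" "snd z"] by (intro set_borel_integral_eq_integral) (simp add: set_integrable_def)
 finally show "aW hbar s (Suc m) z = segint m (aF hbar s (Suc m)) z" unfolding aW_def by (simp add: aF_def scaleR_conv_of_real)
qed

text \<open>The count of derivatives: the Laplacian of W_m leaves two fewer than W_m has, the m-th
  time derivative of the potential has 2 N - 2 m space derivatives left, and the gradient products
  leave at least as many. The bound is uniform because hbar <= 1.\<close>

lemma aF_good:
 assumes m: "m < N" and Bf: "!!j. 0 <= Bf j"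
  and W: "!!j. j <= m ==> good (2 * N - 2 * (j - 1)) (Bf j) (aW hbar s j)" and h: "0 < hbar" "hbar <= 1"
 shows "good (2 * N - 2 * m) ((\<Sum>p\<in>pairs m. \<Sum>i\<in>(UNIV::'n set). 2 ^ (2 * N - 2 * m) * (Bf (fst p) * Bf (snd p))) + B0 + real CARD('n) * Bf m) (aF hbar s (Suc m))"
proof -
 let ?M = "2 * N - 2 * m"
 let ?S = "\<Sum>p\<in>pairs m. \<Sum>i\<in>(UNIV::'n set). 2 ^ ?M * (Bf (fst p) * Bf (snd p))"
 have pdW: "good ?M (Bf j) (%z. pd i (%x. aW hbar s j (x, snd z)) (fst z))" if "1 <= j" "j <= m" for i j
  by (rule good_pd(1), rule good_le[OF W]) (use that m in auto)
 have S0: "0 <= ?S" using Bf by (intro sum_nonneg) auto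
 let ?D = "%z. \<Sum>p\<in>pairs m. \<Sum>i\<in>UNIV.
     pd i (%x. aW hbar s (fst p) (x, snd z)) (fst z) * pd i (%x. aW hbar s (snd p) (x, snd z)) (fst z)"
 have 1: "good ?M ?S (%z. - (1 / 2) * (?D z))"
 proof (rule good_mono[OF good_scale])
  show "good ?M ?S (%z. \<Sum>p\<in>pairs m. \<Sum>i\<in>UNIV.
     pd i (%x. aW hbar s (fst p) (x, snd z)) (fst z) * pd i (%x. aW hbar s (snd p) (x, snd z)) (fst z))"
   by (intro good_sum finite_pairs finite good_mult pdW) (auto simp: pairs_def)
  show "cmod (- (1 / 2)) * ?S <= ?S" using S0 by simp
 qed
 let ?C = "- of_real (1 / fact m)"
 have 2: "good ?M B0 (%z. ?C * of_real (D m (%_. 0) s (fst z)))"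
 proof (rule good_mono[OF good_scale[OF D_good]])
  have "1 / fact m <= (1::real)" by simp
  thus "cmod ?C * B0 <= B0" using mult_right_mono[of "1 / fact m" 1 B0] B0_nonneg by (simp add: norm_divide)
 qed (use m in simp)
 have Wm: "good (Suc (Suc ?M)) (Bf m) (aW hbar s m)"
 proof (cases "m = 0")
  case True
  hence "aW hbar s m = (%z. 0)" by (simp add: aW_0)
  thus ?thesis using good_mono[OF good_zero Bf] by metis
 next
  case False thus ?thesis by (intro good_le[OF W]) (use m in auto)
 qed
 let ?A = "real CARD('n) * Bf m"
 let ?B = "\<i> * of_real hbar / 2"
 have 3: "good ?M ?A (%z. ?B * laplacian (%x. aW hbar s m (x, snd z)) (fst z))"
 proof (rule good_mono[OF good_scale[OF good_laplacian[OF Wm]]])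
  have "hbar / 2 * ?A <= 1 * ?A" using Bf h by (intro mult_right_mono) auto
  thus "cmod ?B * ?A <= real CARD('n) * Bf m" using h by (simp add: norm_mult norm_divide)
 qed
 have "aF hbar s (Suc m) = (%z. (- (1 / 2) * (?D z)
   + ?C * of_real (D m (%_. 0) s (fst z)))
   + ?B * laplacian (%x. aW hbar s m (x, snd z)) (fst z))" by (rule ext) (rule aF_Suc, use m in simp)
 thus ?thesis using good_add[OF good_add[OF 1 2] 3] by simp
qed

text \<open>The induction is strong since F_k involves all earlier W_j. At k = 0 truncated
  subtraction asks for 2 N derivatives, which is true because W_0 = 0.\<close>

lemma W_good_ex: "k <= N ==> \<exists>B\<ge>0. \<forall>s hbar. 0 < hbar \<and> hbar <= 1 \<longrightarrow> good (2 * N - 2 * (k - 1)) B (aW hbar s k) \<and> (1 <= k \<longrightarrow> good (2 * N - 2 * (k - 1)) B (aF hbar s k))"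
proof (induction k rule: less_induct)
 case (less k)
 show ?case
 proof (cases k)
  case 0
  thus ?thesis by (intro exI[of _ 0]) (simp add: aW_0 good_zero del: good.simps)
 next
  case (Suc m)
  have "\<forall>j. \<exists>B\<ge>0. j <= m \<longrightarrow> (\<forall>s hbar. 0 < hbar \<and> hbar <= 1 \<longrightarrow> good (2 * N - 2 * (j - 1)) B (aW hbar s j))"
  proof
   fix j show "\<exists>B\<ge>0. j <= m \<longrightarrow> (\<forall>s hbar. 0 < hbar \<and> hbar <= 1 \<longrightarrow> good (2 * N - 2 * (j - 1)) B (aW hbar s j))"
   proof (cases "j <= m")
    case True thus ?thesis using less.IH[of j] less.prems Suc by (metis less_Suc_eq_le less_imp_le order_trans)
   qed auto
  qed
  then obtain Bf where Bf: "!!j. 0 <= Bf j" "!!j s hbar. j <= m ==> 0 < hbar ==> hbar <= 1 ==> good (2 * N - 2 * (j - 1)) (Bf j) (aW hbar s j)"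
   by metis
  define B where "B = (\<Sum>p\<in>pairs m. \<Sum>i\<in>(UNIV::'n set). 2 ^ (2 * N - 2 * m) * (Bf (fst p) * Bf (snd p))) + B0 + real CARD('n) * Bf m"
  have F: "good (2 * N - 2 * m) B (aF hbar s (Suc m))" if "0 < hbar" "hbar <= 1" for hbar s unfolding B_def using less.prems Suc that by (intro aF_good Bf) auto
  have "good (2 * N - 2 * m) B (aW hbar s (Suc m))" if "0 < hbar" "hbar <= 1" for hbar s
   unfolding aW_Suc[OF good_ccls[OF F[OF that]]] by (rule good_segint[OF F[OF that]])
  moreover have "0 <= B" unfolding B_def using Bf(1) B0_nonneg by (intro add_nonneg_nonneg sum_nonneg) auto
  ultimately show ?thesis using F Suc by (intro exI[of _ B]) (simp del: good.simps)
 qed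
qed

lemma W_good:
 obtains B where "0 <= B" "!!k s hbar. k <= N ==> 0 < hbar ==> hbar <= 1 ==> good (2 * N - 2 * (k - 1)) B (aW hbar s k)"
  "!!k s hbar. 1 <= k ==> k <= N ==> 0 < hbar ==> hbar <= 1 ==> good (2 * N - 2 * (k - 1)) B (aF hbar s k)"
proof -
 let ?A = "%k. 2 * N - 2 * (k - 1)"
 have "\<forall>k. \<exists>B\<ge>0. k <= N \<longrightarrow> (\<forall>s hbar. 0 < hbar \<and> hbar <= 1 \<longrightarrow> good (?A k) B (aW hbar s k) \<and> (1 <= k \<longrightarrow> good (?A k) B (aF hbar s k)))"
  using W_good_ex by (metis order_refl)
 then obtain Bf where Bf: "!!k. 0 <= Bf k" "!!k s hbar. k <= N ==> 0 < hbar ==> hbar <= 1 ==> good (?A k) (Bf k) (aW hbar s k) \<and> (1 <= k \<longrightarrow> good (?A k) (Bf k) (aF hbar s k))"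
  by metis
 have le: "Bf k <= (\<Sum>k\<le>N. Bf k)" if "k <= N" for k using member_le_sum[of k "{..N}" Bf] that Bf(1) by auto
 show thesis
 proof (rule that[of "\<Sum>k\<le>N. Bf k"])
  show "0 <= (\<Sum>k\<le>N. Bf k)" using Bf(1) by (intro sum_nonneg) auto
  fix k and s hbar :: real assume k: "k <= N" "0 < hbar" "hbar <= 1"
  show "good (?A k) (\<Sum>k\<le>N. Bf k) (aW hbar s k)" using Bf(2)[OF k] by (intro good_mono[OF _ le[OF k(1)]]) blast
  show "good (?A k) (\<Sum>k\<le>N. Bf k) (aF hbar s k)" if "1 <= k" using Bf(2)[OF k] that by (intro good_mono[OF _ le[OF k(1)]]) blast
 qed
qed

end

section \<open>The space \<open>L\<^sup>2\<close>\<close>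

lemma rep_sq: "sq_integrable (rep_L2 u)"
proof -
 have "l2_rel (rep_L2 u) (rep_L2 u)" using Quotient3_rep_reflp[OF Quotient3_L2] by blast
 thus ?thesis by (simp add: l2_rel_def)
qed

lemma abs_rep [simp]: "abs_L2 (rep_L2 u) = u" by (rule Quotient3_abs_rep[OF Quotient3_L2])

lemma abs_eqI: "sq_integrable f ==> sq_integrable g ==> AE x in lborel. f x = g x ==> abs_L2 f = abs_L2 g"
 using Quotient3_rel_abs[OF Quotient3_L2, of f g] by (simp add: l2_rel_def)

lemma rep_abs: "sq_integrable f ==> AE x in lborel. rep_L2 (abs_L2 f) x = f x" using rep_abs_rsp_left[OF Quotient3_L2, of f f] by (auto simp: l2_rel_def)

lemma abs_rel: "sq_integrable f ==> l2_rel f f" by (simp add: l2_rel_def)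

lemma sq_integrableD:
 assumes "sq_integrable f"
 shows "bm f" "lint (%x. (cmod (f x))^2)" using assms by (auto simp: sq_integrable_def)

lemma norm_abs: "sq_integrable f ==> norm (abs_L2 f) = l2n f" unfolding l2n_def by (simp add: norm_L2.abs_eq abs_rel)

lemma abs_add: "sq_integrable f ==> sq_integrable g ==> abs_L2 f + abs_L2 g = abs_L2 (%x. f x + g x)"
 by (simp add: plus_L2.abs_eq abs_rel)

lemma abs_scaleR: "sq_integrable f ==> c *R abs_L2 f = abs_L2 (%x. c *R f x)" by (simp add: scaleR_L2.abs_eq abs_rel)

lemma abs_zero: "abs_L2 (%x. 0) = 0" by (simp add: zero_L2.abs_eq)

lemma sq_integrable_bounded_mult:
 assumes f: "sq_integrable f" and p: "bm p" "!!x. cmod (p x) <= K"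
 shows "sq_integrable (%x. p x * f x)" "l2n (%x. p x * f x) <= K * l2n f"
proof -
 note [measurable] = sq_integrableD(1)[OF f] p(1)
 have K: "0 <= K" by (rule order_trans[OF norm_ge_zero p(2)[of undefined]])
 have b: "(cmod (p x * f x))^2 <= K^2 * (cmod (f x))^2" for x unfolding norm_mult power_mult_distrib by (intro mult_right_mono power_mono p(2)) auto
 have i2: "lint (%x. (cmod (p x * f x))^2)" by (rule ibound[of _ "%x. K^2 * (cmod (f x))^2"])
   (use sq_integrableD(2)[OF f] b in auto)
 thus "sq_integrable (%x. p x * f x)" by (simp add: sq_integrable_def)
 have "(LBINT x. (cmod (p x * f x))^2) <= (LBINT x. K^2 * (cmod (f x))^2)" by (rule integral_mono) (use i2 sq_integrableD(2)[OF f] b in auto)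
 hence "(LBINT x. (cmod (p x * f x))^2) <= K^2 * (LBINT x. (cmod (f x))^2)" by simp
 thus "l2n (%x. p x * f x) <= K * l2n f" unfolding l2n_def using real_sqrt_le_mono[of _ "K^2 * (LBINT x. (cmod (f x))^2)"] K
  by (simp add: real_sqrt_mult)
qed

lemma abs_diff:
 assumes "sq_integrable f" "sq_integrable g"
 shows "abs_L2 f - abs_L2 g = abs_L2 (%x. f x - g x)" "sq_integrable (%x. f x - g x)"
proof -
 have "abs_L2 f - abs_L2 g = abs_L2 f + (-1) *R abs_L2 g" by simp
 also have "... = abs_L2 (%x. f x + (-1) *R g x)" unfolding abs_scaleR[OF assms(2)] by (rule abs_add[OF assms(1) sq_integrable_scaleR[OF assms(2)]])
 finally show "abs_L2 f - abs_L2 g = abs_L2 (%x. f x - g x)" by simp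
 show "sq_integrable (%x. f x - g x)" using sq_integrable_add[OF assms(1) sq_integrable_scaleR[OF assms(2), of "-1"]] by simp
qed

lemma l2n_cong: "(!!x. cmod (f x) = cmod (g x)) ==> l2n f = l2n g" by (simp add: l2n_def)

lemma l2n_rep [simp]: "l2n (rep_L2 u) = norm u" using norm_abs[OF rep_sq, of u] by simp

section \<open>Pairings, conjugation and multiplication operators\<close>

lemma integrable_l2_mult:
 assumes f: "sq_integrable f" and g: "sq_integrable g"
 shows "lint (%x. f x * g x)" "cmod (LBINT x. f x * g x) <= l2n f * l2n g"
proof -
 note [measurable] = sq_integrableD(1)[OF f] sq_integrableD(1)[OF g]
 let ?f = "%x. complex_of_real (cmod (f x))" and ?g = "%x. complex_of_real (cmod (g x))"
 have s: "sq_integrable ?f" "sq_integrable ?g" using f g by (auto simp: sq_integrable_def)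
 have e: "?f x \<bullet> ?g x = cmod (f x * g x)" for x by (simp add: norm_mult inner_complex_def)
 have i: "lint (%x. cmod (f x * g x))" using integrable_inner_sq_integrable[OF s] unfolding e .
 show "lint (%x. f x * g x)" using i by (subst integrable_norm_iff[symmetric]) auto
 have "cmod (LBINT x. f x * g x) <= (LBINT x. cmod (f x * g x))" by (rule integral_norm_bound)
 also have "... = abs_L2 ?f \<bullet> abs_L2 ?g" using s by (simp only: inner_L2.abs_eq[OF abs_rel abs_rel] e)
 also have "... <= norm (abs_L2 ?f) * norm (abs_L2 ?g)" by (rule norm_cauchy_schwarz)
 also have "... = l2n f * l2n g" using s by (simp add: norm_abs l2n_def)
 finally show "cmod (LBINT x. f x * g x) <= l2n f * l2n g" .
qed

text \<open>Bilinear, without conjugation, to agree with \<open>l2_pairing\<close> on test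
  functions. Multiplication operators and the free evolution are symmetric for it, and
  \<open>cnjL\<close> recovers the inner product.\<close>

definition bl :: "('n::finite) L2 => 'n L2 => complex" where
 "bl u v = (LBINT x. rep_L2 u x * rep_L2 v x)"

lemma integral_cong_rep:
 assumes "sq_integrable f" "bm g"
 shows "(LBINT x. rep_L2 (abs_L2 f) x * g x) = (LBINT x. f x * g x)"
proof (rule integral_cong_AE)
 note [measurable] = sq_integrableD(1)[OF rep_sq] sq_integrableD(1)[OF assms(1)] assms(2)
 show "(%x. rep_L2 (abs_L2 f) x * g x) \<in> borel_measurable lborel" "(%x. f x * g x) \<in> borel_measurable lborel" by measurable
 show "AE x in lborel. rep_L2 (abs_L2 f) x * g x = f x * g x" using rep_abs[OF assms(1)] by auto
qed

lemma bl_abs: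
 assumes "sq_integrable f" "sq_integrable g"
 shows "bl (abs_L2 f) (abs_L2 g) = (LBINT x. f x * g x)"
proof -
 have "bl (abs_L2 f) (abs_L2 g) = (LBINT x. f x * rep_L2 (abs_L2 g) x)" unfolding bl_def by (rule integral_cong_rep[OF assms(1) sq_integrableD(1)[OF rep_sq]])
 also have "... = (LBINT x. rep_L2 (abs_L2 g) x * f x)" by (simp add: mult.commute)
 also have "... = (LBINT x. g x * f x)" by (rule integral_cong_rep[OF assms(2) sq_integrableD(1)[OF assms(1)]])
 finally show ?thesis by (simp add: mult.commute)
qed

lemma bl_commute: "bl u v = bl v u" by (simp add: bl_def mult.commute)

lemma norm_bl: "cmod (bl u v) <= norm u * norm v" unfolding bl_def using integrable_l2_mult(2)[OF rep_sq rep_sq, of u v] by simp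

lemma bl_add_left: "bl (u + v) w = bl u w + bl v w"
proof -
 have "u + v = abs_L2 (%x. rep_L2 u x + rep_L2 v x)" using abs_add[OF rep_sq rep_sq, of u v] by simp
 hence "bl (u + v) w = (LBINT x. (rep_L2 u x + rep_L2 v x) * rep_L2 w x)" using bl_abs[OF sq_integrable_add[OF rep_sq rep_sq] rep_sq, of u v w] by simp
 also have "... = bl u w + bl v w" unfolding bl_def distrib_right by (intro Bochner_Integration.integral_add integrable_l2_mult rep_sq)
 finally show ?thesis .
qed

lemma bl_scaleR_left: "bl (c *R u) w = c *R bl u w"
proof -
 have "c *R u = abs_L2 (%x. c *R rep_L2 u x)" using abs_scaleR[OF rep_sq, of c u] by simp
 hence "bl (c *R u) w = (LBINT x. (c *R rep_L2 u x) * rep_L2 w x)" using bl_abs[OF sq_integrable_scaleR[OF rep_sq] rep_sq, of c u w] by simp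
 thus ?thesis by (simp add: bl_def)
qed

lemma bounded_bilinear_bl: "bounded_bilinear bl"
proof
 show "bl (a + a') b = bl a b + bl a' b" for a a' b :: "('n::finite) L2" by (rule bl_add_left)
 show "bl a (b + b') = bl a b + bl a b'" for a b b' :: "('n::finite) L2" by (simp only: bl_commute[of a] bl_add_left)
 show "bl (r *R a) b = r *R bl a b" for r and a b :: "('n::finite) L2" by (rule bl_scaleR_left)
 show "bl a (r *R b) = r *R bl a b" for r and a b :: "('n::finite) L2" by (simp only: bl_commute[of a] bl_scaleR_left)
 show "\<exists>K. \<forall>a b :: ('n::finite) L2. norm (bl a b) <= norm a * norm b * K" by (intro exI[of _ 1]) (simp add: norm_bl)
qed

interpretation bl: bounded_bilinear bl by (rule bounded_bilinear_bl)

definition cnjL :: "('n::finite) L2 => 'n L2" where "cnjL u = abs_L2 (%x. cnj (rep_L2 u x))"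

lemma sq_integrable_cnj: "sq_integrable f ==> sq_integrable (%x. cnj (f x))" by (auto simp: sq_integrable_def)

lemma cnjL_abs: "sq_integrable f ==> cnjL (abs_L2 f) = abs_L2 (%x. cnj (f x))"
 unfolding cnjL_def using rep_abs[of f] by (intro abs_eqI sq_integrable_cnj rep_sq) auto

lemma inner_bl: "u \<bullet> v = Re (bl u (cnjL v))"
proof -
 have "bl u (cnjL v) = bl (abs_L2 (rep_L2 u)) (abs_L2 (%x. cnj (rep_L2 v x)))" by (simp add: cnjL_def)
 also have "... = (LBINT x. rep_L2 u x * cnj (rep_L2 v x))" by (rule bl_abs[OF rep_sq sq_integrable_cnj[OF rep_sq]])
 finally have "Re (bl u (cnjL v)) = (LBINT x. Re (rep_L2 u x * cnj (rep_L2 v x)))"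
  using integral_Re[OF integrable_l2_mult(1)[OF rep_sq sq_integrable_cnj[OF rep_sq]], of u v] by simp
 also have "... = (LBINT x. rep_L2 u x \<bullet> rep_L2 v x)" by (simp add: inner_complex_def)
 also have "... = u \<bullet> v" using inner_L2.abs_eq[OF abs_rel[OF rep_sq] abs_rel[OF rep_sq], of u v] by simp
 finally show ?thesis by simp
qed

lemma norm_cnjL [simp]: "norm (cnjL u) = norm u"
 unfolding cnjL_def using norm_abs[OF sq_integrable_cnj[OF rep_sq], of u] l2n_cong[of "%x. cnj (rep_L2 u x)" "rep_L2 u"] by simp

lemma linear_cnjL: "bounded_linear cnjL"
proof (rule bounded_linear_intro[where K=1])
 show "cnjL (u + v) = cnjL u + cnjL v" for u v :: "('n::finite) L2"
 proof -
  have "u + v = abs_L2 (%x. rep_L2 u x + rep_L2 v x)" using abs_add[OF rep_sq rep_sq, of u v] by simp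
  hence "cnjL (u + v) = abs_L2 (%x. cnj (rep_L2 u x) + cnj (rep_L2 v x))" using cnjL_abs[OF sq_integrable_add[OF rep_sq rep_sq], of u v] by simp
  also have "... = cnjL u + cnjL v" unfolding cnjL_def by (rule abs_add[symmetric]) (rule sq_integrable_cnj[OF rep_sq])+
  finally show ?thesis .
 qed
 show "cnjL (r *R u) = r *R cnjL u" for r and u :: "('n::finite) L2"
 proof -
  have "r *R u = abs_L2 (%x. r *R rep_L2 u x)" using abs_scaleR[OF rep_sq, of r u] by simp
  hence "cnjL (r *R u) = abs_L2 (%x. r *R cnj (rep_L2 u x))" using cnjL_abs[OF sq_integrable_scaleR[OF rep_sq], of r u] by simp
  also have "... = r *R cnjL u" unfolding cnjL_def by (rule abs_scaleR[symmetric]) (rule sq_integrable_cnj[OF rep_sq])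
  finally show ?thesis .
 qed
qed simp

definition mulL :: "(real^'n => complex) => ('n::finite) L2 => 'n L2" where
 "mulL m u = abs_L2 (%x. m x * rep_L2 u x)"

definition bddm :: "real => (real^'n => complex) => bool" where
 "bddm K m \<longleftrightarrow> m \<in> borel_measurable borel \<and> (\<forall>x. cmod (m x) <= K)"

lemma bddm_sq: "bddm K m ==> sq_integrable f ==> sq_integrable (%x. m x * f x)"
 unfolding bddm_def by (rule sq_integrable_bounded_mult(1)) auto

lemma mulL_abs:
 assumes "bddm K m" "sq_integrable f"
 shows "mulL m (abs_L2 f) = abs_L2 (%x. m x * f x)" unfolding mulL_def using rep_abs[OF assms(2)] by (intro abs_eqI bddm_sq[OF assms(1)] rep_sq assms) auto

lemma norm_mulL: "bddm K m ==> norm (mulL m u) <= K * norm u"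
 unfolding mulL_def using sq_integrable_bounded_mult[OF rep_sq, of m K u] by (simp add: norm_abs bddm_def)

lemma linear_mulL:
 fixes m :: "real^'n => complex"
 assumes "bddm K m"
 shows "bounded_linear (mulL m)"
proof (rule bounded_linear_intro[where K=K])
 show "mulL m (u + v) = mulL m u + mulL m v" for u v
 proof -
  have "u + v = abs_L2 (%x. rep_L2 u x + rep_L2 v x)" using abs_add[OF rep_sq rep_sq, of u v] by simp
  hence "mulL m (u + v) = abs_L2 (%x. m x * rep_L2 u x + m x * rep_L2 v x)"
   using mulL_abs[OF assms sq_integrable_add[OF rep_sq rep_sq], of u v] by (simp add: distrib_left)
  also have "... = mulL m u + mulL m v" unfolding mulL_def by (rule abs_add[symmetric]) (rule bddm_sq[OF assms rep_sq])+
  finally show ?thesis .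
 qed
 show "mulL m (r *R u) = r *R mulL m u" for r u
 proof -
  have "r *R u = abs_L2 (%x. r *R rep_L2 u x)" using abs_scaleR[OF rep_sq, of r u] by simp
  hence "mulL m (r *R u) = abs_L2 (%x. r *R (m x * rep_L2 u x))" using mulL_abs[OF assms sq_integrable_scaleR[OF rep_sq], of r u] by simp
  also have "... = r *R mulL m u" unfolding mulL_def by (rule abs_scaleR[symmetric]) (rule bddm_sq[OF assms rep_sq])
  finally show ?thesis .
 qed
 show "norm (mulL m u) <= norm u * K" for u using norm_mulL[OF assms, of u] by (simp add: mult.commute)
qed

lemma bl_mulL:
 assumes "bddm K m"
 shows "bl (mulL m u) v = bl u (mulL m v)" unfolding mulL_def using bl_abs[OF bddm_sq[OF assms rep_sq] rep_sq, of u v] bl_abs[OF rep_sq bddm_sq[OF assms rep_sq], of u v]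
 by (simp add: mult_ac)

lemma l2_pairing_abs: "sq_integrable f ==> l2_pairing u f = bl u (abs_L2 f)" using bl_abs[OF rep_sq, of f u] by (simp add: l2_pairing_def)

section \<open>Completeness and dominated convergence\<close>

lemma integrable_L2_sq: "ennreal ((norm (u - v))^2) = (\<integral>\<^sup>+x. ennreal ((cmod (rep_L2 u x - rep_L2 v x))^2) \<partial>lborel)"
proof -
 note s = abs_diff[OF rep_sq rep_sq, of u v]
 have "(norm (u - v))^2 = (LBINT x. (cmod (rep_L2 u x - rep_L2 v x))^2)" using s norm_abs[OF s(2)] by (simp add: l2n_sq)
 thus ?thesis using nn_integral_eq_integral[OF sq_integrableD(2)[OF s(2)]] by simp
qed

text \<open>Riesz-Fischer: a rapidly convergent subsequence converges almost everywhere, and Fatou's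
  lemma turns this into norm convergence of the whole sequence.\<close>

lemma L2_complete:
 fixes X :: "nat => ('n::finite) L2"
 assumes X: "Cauchy X"
 shows "convergent X"
proof -
 have "\<exists>M. \<forall>n\<ge>M. \<forall>m\<ge>M. norm (X n - X m) < (1/4) ^ k" for k :: nat
  using X unfolding Cauchy_def dist_norm by (drule_tac x="(1/4) ^ k" in spec) auto
 hence "\<forall>k. \<exists>M. \<forall>n\<ge>M. \<forall>m\<ge>M. norm (X n - X m) < (1/4) ^ k" ..
 then obtain M where "\<forall>k. \<forall>n\<ge>M k. \<forall>m\<ge>M k. norm (X n - X m) < (1/4) ^ k" by (rule choice[THEN exE])
 hence M: "norm (X n - X m) < (1/4) ^ k" if "n >= M k" "m >= M k" for k n m using that by blast
 \<comment> \<open>Each index is forced above the previous one and above the next threshold, so the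
   subsequence is strictly increasing and its k-th step has norm at most (1/4)^k.\<close>
 define r where "r = rec_nat (M 0) (%k p. max (Suc p) (M (Suc k)))"
 have r: "r (Suc k) >= M (Suc k)" "r (Suc k) > r k" "r k >= M k" for k
 proof -
  have s: "r (Suc k) = max (Suc (r k)) (M (Suc k))" for k by (simp add: r_def)
  show "r (Suc k) >= M (Suc k)" "r (Suc k) > r k" by (simp_all add: s)
  show "r k >= M k" by (cases k) (simp_all add: s, simp add: r_def)
 qed
 have sm: "strict_mono r" by (rule strict_monoI_Suc) (rule r)
 define x where "x k = rep_L2 (X (r k))" for k
 have xm[measurable]: "bm (x k)" for k unfolding x_def by (rule sq_integrableD(1)[OF rep_sq])
 let ?E = "%k y. cmod (x (Suc k) y - x k y)"
 let ?H = "%y k. \<integral>\<^sup>+y. ennreal ((?E k y)^2) \<partial>lborel"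
 have st: "(?H y k) <= ennreal ((1/16) ^ k)" for k
 proof -
  have "norm (X (r (Suc k)) - X (r k)) <= (1/4) ^ k" using M[of k "r (Suc k)" "r k"] r[of k] by linarith
  hence "(norm (X (r (Suc k)) - X (r k)))^2 <= ((1/4) ^ k)^2" by (rule power_mono) simp
  also have "((1/4) ^ k)^2 = (1/16 :: real) ^ k" by (simp add: power_mult[symmetric] mult.commute[of k]) (simp add: power_mult power2_eq_square)
  finally show ?thesis unfolding x_def integrable_L2_sq[symmetric] by (rule ennreal_leI)
 qed
 \<comment> \<open>The squared steps have integral at most 16^(-k). The weight 4^k keeps the series
   integrable and still forces pointwise steps of size at most a multiple of 2^(-k).\<close>
 let ?B = "%k y. ennreal (4 ^ k * (cmod (x (Suc k) y - x k y))^2)"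
 have "(\<integral>\<^sup>+y. (\<Sum>k. ?B k y) \<partial>lborel) = (\<Sum>k. \<integral>\<^sup>+y. ?B k y \<partial>lborel)"
  by (rule nn_integral_suminf) measurable
 also have "... <= (\<Sum>k. ennreal ((1/4) ^ k))"
 proof (rule suminf_le)
  fix k
  let ?A = "\<integral>\<^sup>+y. ennreal (4 ^ k * (cmod (x (Suc k) y - x k y))^2) \<partial>lborel"
  have "?A = ennreal (4 ^ k) * (?H y k)"
   by (subst nn_integral_cmult[symmetric]) (auto simp: ennreal_mult'')
  also have "... <= ennreal (4 ^ k) * ennreal ((1/16) ^ k)" by (intro mult_left_mono st) simp
  also have "... = ennreal ((1/4) ^ k)" by (simp add: ennreal_mult''[symmetric] power_mult_distrib[symmetric])
  finally show "?A <= ennreal ((1/4) ^ k)" .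
 qed auto
 also have "... < \<infinity>" by (subst suminf_ennreal2) (auto intro!: summable_geometric)
 finally have "(\<integral>\<^sup>+y. (\<Sum>k. ?B k y) \<partial>lborel) \<noteq> \<infinity>" unfolding infinity_ennreal_def by (rule less_imp_neq)
 hence "AE y in lborel. (\<Sum>k. ?B k y) \<noteq> \<infinity>" by (intro nn_integral_PInf_AE) auto
 hence conv: "AE y in lborel. convergent (%k. x k y)"
 proof eventually_elim
  fix y assume "(\<Sum>k. ?B k y) \<noteq> \<infinity>"
  hence "(\<Sum>k. ?B k y) < \<top>" unfolding infinity_ennreal_def less_top .
  from this[unfolded less_top_ennreal] obtain C where
   C: "(\<Sum>k. ?B k y) = ennreal C" "0 <= C" by blast
  have "4 ^ k * (?E k y)^2 <= C" for k
  proof -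
   have "(\<Sum>j\<in>{k}. ?B j y) <= (\<Sum>k. ?B k y)"
    by (rule sum_le_suminf) auto
   from this[unfolded C(1)] have "?B k y <= ennreal C" by (simp only: sum.insert sum.empty finite.emptyI empty_iff not_False_eq_True add_0_right)
   with C(2) show ?thesis by (simp only: ennreal_le_iff)
  qed
  hence "?E k y <= sqrt C * (1/2) ^ k" for k
  proof -
   have "(2 ^ k * ?E k y)^2 = 4 ^ k * (?E k y)^2"
    by (simp add: power_mult_distrib power_mult[symmetric] mult.commute[of k]) (simp add: power_mult)
   hence "2 ^ k * ?E k y <= sqrt C"
    using \<open>!!k. 4 ^ k * (cmod (x (Suc k) y - x k y))\<^sup>2 <= C\<close>[of k] by (intro real_le_rsqrt) simp
   thus ?thesis by (simp add: field_simps power_divide)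
  qed
  hence "summable (%k. x (Suc k) y - x k y)"
   by (rule summable_comparison_test'[where N=0 and g="%k. sqrt C * (1/2) ^ k", rotated]) (auto intro!: summable_mult summable_geometric)
  hence "convergent (%n. \<Sum>k<n. x (Suc k) y - x k y)" by (simp add: summable_iff_convergent)
  hence "convergent (%n. x n y - x 0 y)" by (simp only: sum_lessThan_telescope[of "%k. x k y"])
  from convergent_add[OF this convergent_const[of "x 0 y"]] show "convergent (%k. x k y)" by simp
 qed
 define f where "f y = lim (%k. x k y)" for y
 have fm[measurable]: "bm f" unfolding f_def by measurable
 have lim: "AE y in lborel. (%k. x k y) ----> f y" using conv by eventually_elim (simp add: f_def convergent_LIMSEQ_iff)
 let ?C = "%y n. ennreal ((cmod (f y - rep_L2 (X n) y))^2)"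
 let ?F = "%j. ennreal (((1/4) ^ j)^2)"
 let ?G = "%y n. \<integral>\<^sup>+y. ?C y n \<partial>lborel"
 have key: "(?G y n) <= ?F j" if n: "n >= M j" for n j
 proof -
  note [measurable] = sq_integrableD(1)[OF rep_sq]
  let ?D = "%k y n. ennreal ((cmod (x k y - rep_L2 (X n) y))^2)"
  have "(?G y n) = (\<integral>\<^sup>+y. liminf (%k. ?D k y n) \<partial>lborel)"
  proof (rule nn_integral_cong_AE, use lim in eventually_elim)
   fix y assume "(%k. x k y) ----> f y"
   hence "(%k. ?D k y n) ----> ?C y n"
    by (intro tendsto_intros)
   from lim_imp_Liminf[OF sequentially_bot this] show "?C y n = liminf (%k. ?D k y n)" by simp
  qed
  also have "... <= liminf (%k. \<integral>\<^sup>+y. ?D k y n \<partial>lborel)"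
   by (rule nn_integral_liminf) measurable
  also have "... <= ?F j"
  proof (rule Liminf_le)
   have "\<forall>\<^sub>F k in sequentially. r k >= M j" using filterlim_subseq[OF sm] by (simp add: filterlim_at_top)
   thus "\<forall>\<^sub>F k in sequentially. (\<integral>\<^sup>+y. ?D k y n \<partial>lborel) <= ?F j"
   proof eventually_elim
    case (elim k)
    have "norm (X (r k) - X n) <= (1/4) ^ j" using M[OF elim n] by simp
    thus ?case unfolding x_def integrable_L2_sq[symmetric] by (intro ennreal_leI power_mono) auto
   qed
  qed simp
  finally show ?thesis .
 qed
 have d: "sq_integrable (%y. f y - rep_L2 (X n) y)" if "n >= M j" for n j
 proof -
  note [measurable] = sq_integrableD(1)[OF rep_sq]
  have "(?G y n) < \<infinity>" using key[OF that] by (auto intro: le_less_trans)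
  thus ?thesis unfolding sq_integrable_def by (auto intro!: integrableI_nonneg)
 qed
 have f: "sq_integrable f" using sq_integrable_add[OF d[OF order_refl[of "M 0"]] rep_sq[of "X (M 0)"]] by simp
 have "X ----> abs_L2 f"
 proof (rule LIMSEQ_I)
  fix e :: real assume "0 < e"
  then obtain j where j: "(1/4) ^ j < e" using real_arch_pow_inv[of e "1/4"] by auto
  have "norm (X n - abs_L2 f) < e" if n: "n >= M j" for n
  proof -
   have "abs_L2 f - X n = abs_L2 (%y. f y - rep_L2 (X n) y)" using abs_diff(1)[OF f rep_sq, of "X n"] by simp
   hence "(norm (abs_L2 f - X n))^2 = (LBINT y. (cmod (f y - rep_L2 (X n) y))^2)" using norm_abs[OF d[OF n]] by (simp add: l2n_sq)
   hence "ennreal ((norm (abs_L2 f - X n))^2) <= ?F j"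
    using key[OF n] nn_integral_eq_integral[OF sq_integrableD(2)[OF d[OF n]]] by simp
   hence "norm (abs_L2 f - X n) <= (1/4) ^ j" by (simp add: ennreal_le_iff power2_le_iff_abs_le)
   thus ?thesis using j by (simp add: norm_minus_commute)
  qed
  thus "\<exists>no. \<forall>n\<ge>no. norm (X n - abs_L2 f) < e" by blast
 qed
 thus ?thesis by (auto simp: convergent_def)
qed

instance L2 :: (finite) banach by standard (rule L2_complete)

lemma L2_dominated:
 fixes F :: "nat => real^'n => complex" and g :: "real^'n => real"
 assumes m: "!!k. bm (F k)" "bm f"
  and b: "!!k x. cmod (F k x) <= g x" and g: "lint (%x. (g x)^2)"
  and lim: "AE x in lborel. (%k. F k x) ----> f x"
 shows "sq_integrable (F k)" "sq_integrable f" "(%k. abs_L2 (F k)) ----> abs_L2 f"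
proof -
 note [measurable] = m
 have g0: "0 <= g x" for x by (rule order_trans[OF norm_ge_zero b[of 0]])
 have bf: "AE x in lborel. cmod (f x) <= g x" using lim by eventually_elim (rule tendsto_upperbound[OF tendsto_norm], auto simp: b)
 show F: "sq_integrable (F k)" for k unfolding sq_integrable_def
  using b g0 by (auto intro!: ibound[OF g] power_mono AE_I2 simp: abs_of_nonneg)
 have "AE x in lborel. norm ((cmod (f x))^2) <= norm ((g x)^2)" using bf by eventually_elim (simp add: power_mono)
 from ibound[OF g _ this] show f: "sq_integrable f" unfolding sq_integrable_def by simp
 let ?A = "%k x. cmod (F k x - f x)"
 have l0: "(%k. \<integral>x. (?A k x)^2 \<partial>lborel) ----> (\<integral>x. 0 \<partial>(lborel :: (real^'n) measure))"
 proof (rule integral_dominated_convergence[where w="%x. 4 * (g x)^2"])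
  show "lint (%x. 4 * (g x)^2)" using g by simp
  show "AE x in lborel. (%k. (?A k x)^2) ----> 0"
  proof (use lim in eventually_elim)
   fix x assume "(%k. F k x) ----> f x"
   hence "(%k. (?A k x)^2) ----> (cmod (f x - f x))\<^sup>2" by (intro tendsto_intros)
   thus "(%k. (?A k x)^2) ----> 0" by simp
  qed
  show "AE x in lborel. norm ((?A k x)^2) <= 4 * (g x)^2" for k
  proof (use bf in eventually_elim)
   fix x assume "cmod (f x) <= g x"
   hence "?A k x <= 2 * g x" using norm_triangle_ineq4[of "F k x" "f x"] b[of k x] by linarith
   from power_mono[OF this, of 2] show "norm ((?A k x)^2) <= 4 * (g x)^2" by (simp add: power_mult_distrib)
  qed
 qed auto
 let ?B = "%k. norm (abs_L2 (F k) - abs_L2 f)"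
 have "(?B k)^2 = (LBINT x. (?A k x)^2)" for k
  using norm_abs[OF abs_diff(2)[OF F f]] by (simp add: abs_diff(1)[OF F f] l2n_sq)
 hence "(%k. (?B k)^2) ----> 0" using l0 by simp
 from tendsto_real_sqrt[OF this] have "(%k. ?B k) ----> 0" by simp
 thus "(%k. abs_L2 (F k)) ----> abs_L2 f" using LIM_zero_iff tendsto_norm_zero_iff by blast
qed

lemma has_vector_derivative_L2:
 fixes f f' :: "real => real^'n => complex"
 assumes d: "0 < d"
  and der: "!!r x. \<bar>r - r0\<bar> < d ==> ((%r. f r x) hvd f' r x) (at r)"
  and sq: "!!r. sq_integrable (f r)"
  and bnd: "!!r x. \<bar>r - r0\<bar> < d ==> cmod (f' r x) <= g x"
  and m': "bm (f' r0)"
  and g: "lint (%x. (g x)^2)"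
 shows "((%r. abs_L2 (f r)) hvd abs_L2 (f' r0)) (at r0)"
proof -
 have "(%n. inverse (h n) *R (abs_L2 (f (r0 + h n)) - abs_L2 (f r0))) ----> abs_L2 (f' r0)"
  if h: "!!n. h n \<noteq> 0" "!!n. \<bar>h n\<bar> < d" "h ----> 0" for h :: "nat => real"
 proof -
  let ?s = "%n x. inverse (h n) *R (f (r0 + h n) x - f r0 x)"
  have s: "inverse (h n) *R (abs_L2 (f (r0 + h n)) - abs_L2 (f r0)) = abs_L2 (?s n)" "sq_integrable (?s n)" for n
   by (simp_all add: abs_diff[OF sq sq] abs_scaleR sq_integrable_scaleR)
  have "(%n. ?s n x) ----> f' r0 x" for x using der[of r0 x] h d unfolding has_vector_derivative_iff_sequentially[OF d] by simp
  moreover have "cmod (?s n x) <= g x" for n x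
   using mult_left_mono[OF quotient_bound[where f="%r. f r x" and g="g x" and f'="%r. f' r x" and ?r0.0=r0, OF der bnd h(2)], of "inverse \<bar>h n\<bar>" n] h(1)[of n]
   by (simp del: scaleR_right_diff_distrib add: mult.left_commute[of _ "g x"])
  ultimately show ?thesis unfolding s(1) by (intro L2_dominated(3)[OF sq_integrableD(1)[OF s(2)] m' _ g] AE_I2)
 qed
 thus ?thesis unfolding has_vector_derivative_iff_sequentially[OF d] by simp
qed

section \<open>Gaussian functions\<close>

text \<open>Polynomials times Gaussians of complex width. The class is closed under partial
  derivatives, so the conditions of \<open>schwartz\<close> on all derivatives reduce to decay
  within the class.\<close>

inductive gp :: "(real^'n => complex) => bool" where
 base: "0 < Re z ==> gp (%x. exp (- z * of_real ((x - y) \<bullet> (x - y))))"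
| coord: "gp f ==> gp (%x. of_real (x$i) * f x)"
| scale: "gp f ==> gp (%x. c * f x)"
| add: "gp f ==> gp g ==> gp (%x. f x + g x)"

lemma gaussian_line_derivative:
 fixes x y :: "real^'n" and z :: complex
 shows "((%h. exp (- z * of_real ((x + h *R axis i 1 - y) \<bullet> (x + h *R axis i 1 - y)))) has_vector_derivative
   - 2 * z * of_real ((x - y)$i) * exp (- z * of_real ((x - y) \<bullet> (x - y)))) (at 0)"
proof -
 have q: "(x + h *R axis i 1 - y) \<bullet> (x + h *R axis i 1 - y) = (x - y) \<bullet> (x - y) + 2 * h * (x - y)$i + h^2" for h
 proof -
  have "x + h *R axis i 1 - y = (x - y) + h *R axis i 1" by simp
  thus ?thesis by (simp only: inner_add_left inner_add_right) (simp add: inner_axis inner_axis' algebra_simps power2_eq_square)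
 qed
 have "((%h. - z * of_real ((x - y) \<bullet> (x - y) + 2 * h * (x - y)$i + h^2)) hvd - z * of_real (2 * (x - y)$i)) (at 0)"
  unfolding has_vector_derivative_def by (rule derivative_eq_intros refl)+ (auto simp: fun_eq_iff algebra_simps scaleR_conv_of_real)
 from has_vector_derivative_cexp[OF this] show ?thesis unfolding q by (simp add: mult_ac)
qed

lemma gp_derivative:
 assumes "gp f"
 shows "\<exists>f'. gp f' \<and> (\<forall>x. ((%h. f (x + h *R axis i 1)) hvd f' x) (at 0))" using assms
proof induction
 case (base z y)
 let ?B = "%x. exp (- z * of_real ((x - y) \<bullet> (x - y)))"
 have "gp (%x. (- 2 * z) * (of_real (x$i) * ?B x) + (2 * z * of_real (y$i)) * ?B x)"
  by (intro gp.intros base)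
 moreover have "(- 2 * z) * (of_real (x$i) * w) + (2 * z * of_real (y$i)) * w = - 2 * z * of_real ((x - y)$i) * (w :: complex)" for x w by (simp add: algebra_simps)
 ultimately have "gp (%x. - 2 * z * of_real ((x - y)$i) * ?B x)" by simp
 thus ?case using gaussian_line_derivative by blast
next
 case (coord f j)
 then obtain f' where f': "gp f'" "!!x. ((%h. f (x + h *R axis i 1)) hvd f' x) (at 0)" by blast
 let ?A = "if i = j then 1 else 0"
 have "((%h. of_real ((x + h *R axis i 1)$j) * f (x + h *R axis i 1)) has_vector_derivative
   of_real (x$j) * f' x + ?A * f x) (at 0)" for x
 proof -
  have "((%h. of_real (x$j + h * ?A)) hvd (if i = j then 1 else (0::complex))) (at 0)" unfolding has_vector_derivative_def
   by (rule derivative_eq_intros refl)+ (auto simp: fun_eq_iff algebra_simps scaleR_conv_of_real)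
  moreover have "(x + h *R axis i 1)$j = x$j + h * ?A" for h by (simp add: axis_def)
  ultimately have "((%h. of_real ((x + h *R axis i 1)$j)) hvd (if i = j then 1 else (0::complex))) (at 0)" by (simp only:)
  from has_vector_derivative_mult[OF this f'(2)] show ?thesis by simp
 qed
 thus ?case by (intro exI[of _ "%x. of_real (x$j) * f' x + ?A * f x"] conjI allI gp.intros f' coord)
next
 case (scale f c)
 then obtain f' where f': "gp f'" "!!x. ((%h. f (x + h *R axis i 1)) hvd f' x) (at 0)" by blast
 thus ?case by (intro exI[of _ "%x. c * f' x"] conjI allI gp.intros has_vector_derivative_mult_right) auto
next
 case (add f g)
 then obtain f' g' where f': "gp f'" "!!x. ((%h. f (x + h *R axis i 1)) hvd f' x) (at 0)"
  and g': "gp g'" "!!x. ((%h. g (x + h *R axis i 1)) hvd g' x) (at 0)" by blast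
 thus ?case by (intro exI[of _ "%x. f' x + g' x"] conjI allI gp.intros has_vector_derivative_add) auto
qed

lemma gp_continuous: "gp f ==> cts f" by (induction rule: gp.induct) (auto intro!: continuous_intros)

lemma gp_decay:
 fixes f :: "real^'n => complex"
 assumes "gp f"
 shows "\<exists>B. \<forall>x. norm x ^ m * cmod (f x) <= B" using assms
proof (induction arbitrary: m)
 case (base z y)
 let ?A = "%x. cmod (exp (- z * of_real ((x - y) \<bullet> (x - y))))"
 have "norm x ^ m * ?A x <= fact m * exp (norm y + 1 / (4 * Re z))" for x
 proof -
  have 1: "norm x <= norm (x - y) + norm y" using norm_triangle_ineq[of "x - y" y] by simp
  have 2: "norm (x - y) - Re z * (norm (x - y))^2 <= 1 / (4 * Re z)"
  proof -
   have "0 <= Re z * (norm (x - y) - 1 / (2 * Re z))^2" using base by simp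
   also have "... = Re z * (norm (x - y))^2 - norm (x - y) + 1 / (4 * Re z)" using base by (simp add: power2_eq_square field_simps)
   finally show ?thesis by linarith
  qed
  have "norm x ^ m * ?A x <= (fact m * exp (norm x)) * exp (- Re z * (norm (x - y))^2)"
   unfolding norm_exp_eq_Re power2_norm_eq_inner by (intro mult_mono power_le_fact_exp) auto
  also have "... = fact m * exp (norm x - Re z * (norm (x - y))^2)" by (simp add: exp_diff exp_minus field_simps)
  also have "... <= fact m * exp (norm y + 1 / (4 * Re z))" using 1 2 by (intro mult_left_mono) auto
  finally show ?thesis .
 qed
 thus ?case by blast
next
 case (coord f i)
 obtain B where B: "!!x. norm x ^ Suc m * cmod (f x) <= B" using coord(2)[of "Suc m"] by blast
 have "norm x ^ m * cmod (of_real (x$i) * f x) <= B" for x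
 proof -
  have "norm x ^ m * cmod (of_real (x$i) * f x) <= norm x ^ m * (norm x * cmod (f x))"
   unfolding norm_mult norm_of_real by (intro mult_left_mono mult_right_mono component_le_norm_cart) auto
  also have "... <= B" using B[of x] by (simp add: mult_ac)
  finally show ?thesis .
 qed
 thus ?case by blast
next
 case (scale f c)
 obtain B where B: "!!x. norm x ^ m * cmod (f x) <= B" using scale(2)[of m] by blast
 have "norm x ^ m * cmod (c * f x) <= cmod c * B" for x using mult_left_mono[OF B[of x] norm_ge_zero[of c]] by (simp add: norm_mult mult_ac)
 thus ?case by blast
next
 case (add f g)
 obtain B C where B: "!!x. norm x ^ m * cmod (f x) <= B" and C: "!!x. norm x ^ m * cmod (g x) <= C" using add(3,4)[of m] by blast
 have "norm x ^ m * cmod (f x + g x) <= B + C" for x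
 proof -
  have "norm x ^ m * cmod (f x + g x) <= norm x ^ m * cmod (f x) + norm x ^ m * cmod (g x)"
   unfolding distrib_left[symmetric] by (intro mult_left_mono norm_triangle_ineq) simp
  thus ?thesis using B[of x] C[of x] by linarith
 qed
 thus ?case by blast
qed

lemma pd_eq: "((%h. f (x + h *R axis i 1)) hvd D) (at 0) ==> pd i f x = D" unfolding pd_def by (rule vector_derivative_at)

lemma gp_pd: "gp f ==> gp (pd i f)"
proof -
 assume "gp f"
 then obtain f' where f': "gp f'" "!!x. ((%h. f (x + h *R axis i 1)) hvd f' x) (at 0)" using gp_derivative by blast
 from f'(2) have "pd i f = f'" by (intro ext pd_eq)
 with f'(1) show ?thesis by simp
qed

lemma gp_schwartz:
 fixes f :: "real^'n => complex"
 assumes "gp f"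
 shows "f \<in> schwartz"
proof -
 have g: "gp (pds is f)" for "is" by (induction "is") (auto simp: pds_def assms gp_pd)
 have d: "h differentiable (at x)" if h: "gp h" for h :: "real^'n => complex" and x
 proof -
  have "((%t. h (x + t *R axis i 1)) hvd pd i h x) (at 0)" for i x
  proof -
   obtain h' where "!!x. ((%t. h (x + t *R axis i 1)) hvd h' x) (at 0)" using gp_derivative[OF h] by blast
   thus ?thesis using pd_eq by metis
  qed
  from has_derivative_of_partials[OF this gp_continuous[OF gp_pd[OF h]]] show ?thesis by (auto simp: differentiable_def)
 qed
 show ?thesis unfolding schwartz_def using d[OF g] gp_decay[OF g] by blast
qed

lemma gp_heat:
 fixes y :: "real^'n"
 assumes "0 < Re ze"
 shows "gp (%x. heat ze (x - y))"
proof -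
 have "0 < Re (1 / (4 * ze))" using assms by (simp add: Re_complex_div_gt_0)
 from gp.scale[OF gp.base[OF this, of y], of "1 / (of_real (2 * sqrt pi) * csqrt ze) ^ CARD('n)"]
 show ?thesis unfolding heat_closed_form by simp
qed

lemma heat_line_derivative:
 fixes x y :: "real^'n"
 assumes "ze \<noteq> 0"
 shows "((%h. heat ze (x + h *R axis i 1 - y)) hvd - of_real ((x - y)$i) / (2 * ze) * heat ze (x - y)) (at 0)"
proof -
 define c where "c = 1 / (of_real (2 * sqrt pi) * csqrt ze) ^ CARD('n)"
 have e: "heat ze w = c * exp (- (1 / (4 * ze)) * of_real (w \<bullet> w))" for w :: "real^'n" unfolding heat_closed_form c_def by simp
 have "- of_real q / (2 * ze) * (c * E) = c * (- 2 * (1 / (4 * ze)) * of_real q * E)" for q :: real and E using assms by (simp add: field_simps)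
 thus ?thesis unfolding e using has_vector_derivative_mult_right[OF gaussian_line_derivative[of "1 / (4 * ze)" x i y], of c] by (simp only:)
qed

text \<open>At once the Laplacian in space and the derivative in the complex time of the heat
  kernel; that the two agree is the heat equation, see \<open>laplacian_heat\<close> and
  \<open>heat_parameter_derivative\<close>.\<close>

definition lapheat :: "complex => real^'n => complex" where
 "lapheat ze x = (of_real (x \<bullet> x) / (4 * ze\<^sup>2) - of_nat CARD('n) / (2 * ze)) * heat ze x"

lemma heat_second_line_derivative:
 fixes x y :: "real^'n"
 assumes "ze \<noteq> 0"
 shows "((%h. - of_real ((x + h *R axis i 1 - y)$i) / (2 * ze) * heat ze (x + h *R axis i 1 - y)) has_vector_derivative
  (of_real (((x - y)$i)^2) / (4 * ze^2) - 1 / (2 * ze)) * heat ze (x - y)) (at 0)"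
proof -
 have "((%h. - of_real ((x - y)$i + h) / (2 * ze)) hvd - 1 / (2 * ze)) (at 0)" unfolding has_vector_derivative_def
  by (rule derivative_eq_intros refl)+ (auto simp: assms fun_eq_iff algebra_simps scaleR_conv_of_real)
 from has_vector_derivative_mult[OF this heat_line_derivative[OF assms, of x i y]]
 have d: "((%h. - of_real ((x - y)$i + h) / (2 * ze) * heat ze (x + h *R axis i 1 - y)) has_vector_derivative
  - of_real ((x - y)$i + 0) / (2 * ze) * (- of_real ((x - y)$i) / (2 * ze) * heat ze (x - y)) + - 1 / (2 * ze) * heat ze (x + 0 *R axis i 1 - y)) (at 0)" .
 have "- of_real (q + 0) / (2 * ze) * (- of_real q / (2 * ze) * E) + - 1 / (2 * ze) * E = (of_real (q^2) / (4 * ze^2) - 1 / (2 * ze)) * E" for q :: real and E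
  using assms by (simp add: field_simps power2_eq_square)
 note this[of "(x - y)$i" "heat ze (x - y)"]
 moreover have "(x + h *R axis i 1 - y)$i = (x - y)$i + h" for h by (simp add: axis_def)
 ultimately show ?thesis using d by (simp only: scaleR_zero_left add_0_right)
qed

lemma laplacian_heat:
 fixes x y :: "real^'n"
 assumes "ze \<noteq> 0"
 shows "laplacian (%x. heat ze (x - y)) x = lapheat ze (x - y)"
proof -
 have "pd i (%x. heat ze (x - y)) = (%x. - of_real ((x - y)$i) / (2 * ze) * heat ze (x - y))" for i
  by (intro ext pd_eq heat_line_derivative assms)
 hence "laplacian (%x. heat ze (x - y)) x = (\<Sum>i\<in>UNIV. (of_real (((x - y)$i)^2) / (4 * ze^2) - 1 / (2 * ze)) * heat ze (x - y))"
  unfolding laplacian_def by (intro sum.cong refl) (simp only: pd_eq[OF heat_second_line_derivative[OF assms]])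
 also have "... = lapheat ze (x - y)" unfolding lapheat_def sum_distrib_right[symmetric] inner_vec_def
  by (simp add: sum_subtractf sum_divide_distrib[symmetric] power2_eq_square)
 finally show ?thesis .
qed

lemma heat_parameter_derivative:
 fixes x :: "real^'n"
 assumes "ze \<notin> \<real>\<^sub>\<le>\<^sub>0"
 shows "((%ze. heat ze x) has_field_derivative lapheat ze x) (at ze)"
proof -
 have z: "ze \<noteq> 0" using assms by auto
 let ?s = "complex_of_real (2 * sqrt pi)" let ?n = "CARD('n)"
 have n: "?n = Suc (?n - 1)" by simp
 have s0: "?s * csqrt ze \<noteq> 0" using z by simp
 let ?B = "%ze. ?s * csqrt ze"
 have 1: "((%ze. (?B ze) ^ ?n) has_field_derivative of_nat ?n / (2 * ze) * (?B ze) ^ ?n) (at ze)"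
 proof -
  have "((%ze. ?s * csqrt ze) has_field_derivative ?s * (inverse (2 * csqrt ze))) (at ze)"
   by (intro DERIV_cmult has_field_derivative_csqrt assms)
  from DERIV_power[OF this, of ?n]
  have d: "((%ze. (?B ze) ^ ?n) has_field_derivative of_nat ?n * (?s * (inverse (2 * csqrt ze)) * (?B ze) ^ (?n - 1))) (at ze)" by simp
  have "?s * (inverse (2 * csqrt ze)) = ?s * csqrt ze / (2 * (csqrt ze)^2)" using z by (simp add: power2_eq_square field_simps)
  hence "?s * (inverse (2 * csqrt ze)) * (?B ze) ^ (?n - 1) = (?B ze) ^ ?n / (2 * ze)"
   using power_Suc[of "?s * csqrt ze" "?n - 1"] unfolding n[symmetric] by simp
  with d show ?thesis by simp
 qed
 let ?A = "of_real (x \<bullet> x)"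
 have "((%ze. - ?A / (4 * ze)) has_field_derivative of_real (x \<bullet> x) / (4 * ze^2)) (at ze)"
  using z by (auto intro!: derivative_eq_intros simp: power2_eq_square field_simps)
 from DERIV_divide[OF DERIV_fun_exp[OF this] 1]
 have d: "((%ze. exp (- ?A / (4 * ze)) / (?B ze) ^ ?n) has_field_derivative
   (exp (- ?A / (4 * ze)) * (?A / (4 * ze^2)) * (?B ze) ^ ?n -
   exp (- ?A / (4 * ze)) * (of_nat ?n / (2 * ze) * (?B ze) ^ ?n)) /
   ((?B ze) ^ ?n * (?B ze) ^ ?n)) (at ze)" using s0 by simp
 have "(E * A * Q - E * (B * Q)) / (Q * Q) = (A - B) * (E / Q)" if "Q \<noteq> 0" for A B E Q :: complex using that by (simp add: field_simps)
 from this[of "(?B ze) ^ ?n"] d s0 show ?thesis unfolding heat_closed_form lapheat_def by (simp only: power_not_zero not_False_eq_True)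
qed

section \<open>Combinations of Gaussian packets\<close>

lemma pd_schwartz_add:
 assumes "f \<in> schwartz" "g \<in> schwartz"
 shows "pd i (%x. f x + g x) = (%x. pd i f x + pd i g x)" by (intro ext pd_eq has_vector_derivative_add schwartzD(4) assms)

lemma pd_schwartz_scale:
 assumes "f \<in> schwartz"
 shows "pd i (%x. c * f x) = (%x. c * pd i f x)" by (intro ext pd_eq has_vector_derivative_mult_right schwartzD(4) assms)

lemma laplacian_add:
 assumes "f \<in> schwartz" "g \<in> schwartz"
 shows "laplacian (%x. f x + g x) = (%x. laplacian f x + laplacian g x)"
 unfolding laplacian_def by (simp add: pd_schwartz_add schwartzD(3) assms sum.distrib)

lemma laplacian_scale:
 assumes "f \<in> schwartz"
 shows "laplacian (%x. c * f x) = (%x. c * laplacian f x)" unfolding laplacian_def by (simp add: pd_schwartz_scale schwartzD(3) assms sum_distrib_left)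

lemma pd_zero: "pd i (%x. 0) x = 0" by (rule pd_eq) simp

lemma laplacian_zero: "laplacian (%x. 0) x = 0" unfolding laplacian_def pd_zero[abs_def] by simp

lemma gp_zero: "gp (%x. 0)" using gp.scale[OF gp.base[of 1 0], of 0] by simp

lemma gp_sum: "finite I ==> (!!i. i \<in> I ==> gp (f i)) ==> gp (%x. \<Sum>i\<in>I. f i x)"
 by (induction I rule: finite_induct) (auto intro!: gp_zero gp.add)

lemma gp_laplacian: "gp f ==> gp (laplacian f)" unfolding laplacian_def[abs_def] by (intro gp_sum gp_pd finite)

lemma gp_sq: "gp f ==> sq_integrable f" using schwartz_basic(4)[OF gp_schwartz, of f] by (auto simp: l12_def sq_integrable_def)

text \<open>A triple holds a coefficient, a complex time and a centre. Working with the list lets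
  the free evolution act on these data: it shifts the complex times along the imaginary
  axis.\<close>

definition comb :: "(complex \<times> complex \<times> (real^'n)) list => real^'n => complex" where
 "comb ps x = (\<Sum>p\<leftarrow>ps. fst p * heat (fst (snd p)) (x - snd (snd p)))"

definition okc :: "(complex \<times> complex \<times> (real^'n)) list => bool" where
 "okc ps \<longleftrightarrow> (\<forall>p\<in>set ps. 0 < Re (fst (snd p)))"

definition shift :: "real => (complex \<times> complex \<times> (real^'n)) list => (complex \<times> complex \<times> (real^'n)) list" where
 "shift et ps = map (%p. (fst p, fst (snd p) + \<i> * of_real et, snd (snd p))) ps"

abbreviation combL :: "(complex \<times> complex \<times> (real^('n::finite))) list => 'n L2" where
 "combL ps \<equiv> abs_L2 (comb ps)"

lemma comb_simps [simp]:
 "comb [] = (%x. 0)" "comb (p # ps) = (%x. fst p * heat (fst (snd p)) (x - snd (snd p)) + comb ps x)" by (simp_all add: comb_def[abs_def])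

lemma comb_append: "comb (ps @ qs) = (%x. comb ps x + comb qs x)" by (simp add: comb_def[abs_def])

lemma comb_scale: "comb (map (apfst ((*) c)) ps) = (%x. c * comb ps x)" by (induction ps) (auto simp: fun_eq_iff algebra_simps)

lemma okc_simps [simp]: "okc []" "okc (p # ps) \<longleftrightarrow> 0 < Re (fst (snd p)) \<and> okc ps" "okc (ps @ qs) \<longleftrightarrow> okc ps \<and> okc qs"
 "okc (shift et ps) \<longleftrightarrow> okc ps" "okc (map (apfst f) ps) \<longleftrightarrow> okc ps" by (auto simp: okc_def shift_def)

lemma shift_simps [simp]: "shift et [] = []" "shift et (p # ps) = (fst p, fst (snd p) + \<i> * of_real et, snd (snd p)) # shift et ps"
 "shift et (ps @ qs) = shift et ps @ shift et qs" "shift et (shift et' ps) = shift (et + et') ps" "shift 0 ps = ps"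
 "shift et (map (apfst f) ps) = map (apfst f) (shift et ps)" by (induction ps) (auto simp: shift_def algebra_simps)

lemma gp_comb: "okc ps ==> gp (comb ps)" by (induction ps) (auto intro!: gp_zero gp.add gp.scale gp_heat)

lemma comb_sq: "okc ps ==> sq_integrable (comb ps)" by (rule gp_sq[OF gp_comb])

lemma combL_append: "okc ps ==> okc qs ==> combL (ps @ qs) = combL ps + combL qs" by (simp add: comb_append abs_add comb_sq)

lemma combL_scaleR: "okc ps ==> combL (map (apfst ((*) (of_real c))) ps) = c *R combL ps"
 by (simp add: comb_scale abs_scaleR comb_sq scaleR_conv_of_real)

lemma combL_Cons: "okc (p # ps) ==> combL (p # ps) = combL [p] + combL ps" using combL_append[of "[p]" ps] by simp

text \<open>The pairing of two Gaussians depends on the two parameters only through \<open>ze + cnj ze'\<close>, so it is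
 invariant under a common imaginary shift. This is the unitarity of the free evolution.\<close>
lemma bl_heat:
 fixes y y' :: "real^'n"
 assumes "0 < Re ze" "0 < Re ze'"
 shows "bl (combL [(c, ze, y)]) (cnjL (combL [(c', ze', y')])) = c * cnj c' * heat (ze + cnj ze') (y - y')"
proof -
 have s: "sq_integrable (%x. c * heat ze (x - y))" "sq_integrable (%x. c' * heat ze' (x - y'))"
  using comb_sq[of "[(c, ze, y)]"] comb_sq[of "[(c', ze', y')]"] assms by simp_all
 have "bl (combL [(c, ze, y)]) (cnjL (combL [(c', ze', y')])) = (LBINT x. c * heat ze (x - y) * cnj (c' * heat ze' (x - y')))"
  using bl_abs[OF s(1) sq_integrable_cnj[OF s(2)]] cnjL_abs[OF s(2)] by simp
 also have "... = (LBINT x. (c * cnj c') * (heat ze (y - x) * heat (cnj ze') (x - y')))"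
  using assms by (simp add: cnj_heat heat_commute[of ze _ y] mult_ac)
 also have "... = c * cnj c' * heat (ze + cnj ze') (y - y')"
 proof -
  have "ze \<noteq> 0" using assms(1) by auto
  from heat_conv(2)[OF this, of "cnj ze'" y y'] assms show ?thesis by simp
 qed
 finally show ?thesis .
qed

lemma bl_comb_shift:
 assumes "okc ps" "okc qs"
 shows "bl (combL (shift et ps)) (cnjL (combL (shift et qs))) = bl (combL ps) (cnjL (combL qs))"
proof -
 let ?B = "%p qs. bl (combL (shift et [p])) (cnjL (combL (shift et qs)))"
 have 1: "?B p qs = bl (combL [p]) (cnjL (combL qs))"
  if "okc [p]" "okc qs" for p and qs :: "(complex \<times> complex \<times> (real^'a)) list" using that(2)
 proof (induction qs)
  case Nil thus ?case by (simp add: abs_zero linear_0 bounded_linear.linear linear_cnjL bl.zero_right)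
 next
  case (Cons q qs)
  obtain c z y c' z' y' where pq: "p = (c, z, y)" "q = (c', z', y')" by (metis prod_cases3)
  have k: "okc (shift et (q # qs))" using Cons(2) by simp
  note a = bounded_linear.linear[OF linear_cnjL, THEN linear_add]
  let ?A = "bl (combL (shift et [p])) (cnjL (combL (shift et [q])))"
  have "bl (combL (shift et [p])) (cnjL (combL (shift et (q # qs)))) =
    ?A + ?B p qs"
   using combL_Cons[OF k[unfolded shift_simps]] by (simp only: shift_simps a bl.add_right)
  also have "?A = bl (combL [p]) (cnjL (combL [q]))"
  proof -
   have e: "z + \<i> * et + cnj (z' + \<i> * et) = z + cnj z'" by (simp add: algebra_simps)
   have p: "0 < Re z" "0 < Re z'" "0 < Re (z + \<i> * et)" "0 < Re (z' + \<i> * et)" using that(1) Cons(2) by (simp_all add: pq)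
   show ?thesis unfolding pq using bl_heat[OF p(3,4), of c y c' y'] bl_heat[OF p(1,2), of c y c' y'] by (simp only: shift_simps fst_conv snd_conv e)
  qed
  also have "bl (combL [p]) (cnjL (combL [q])) + ?B p qs = bl (combL [p]) (cnjL (combL (q # qs)))"
   using combL_Cons[OF Cons(2)] Cons by (simp add: a bl.add_right del: comb_simps shift_simps)
  finally show ?case .
 qed
 show ?thesis using assms(1)
 proof (induction ps)
  case Nil thus ?case by (simp add: abs_zero bl.zero_left)
 next
  case (Cons p ps)
  have k: "okc (shift et (p # ps))" using Cons(2) by simp
  have "bl (combL (shift et (p # ps))) (cnjL (combL (shift et qs))) =
    ?B p qs + bl (combL (shift et ps)) (cnjL (combL (shift et qs)))"
   using combL_Cons[OF k[unfolded shift_simps]] by (simp only: shift_simps bl.add_left)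
  also have "... = bl (combL [p]) (cnjL (combL qs)) + bl (combL ps) (cnjL (combL qs))" using Cons 1[of p qs] assms(2) by (simp del: comb_simps shift_simps)
  also have "... = bl (combL (p # ps)) (cnjL (combL qs))" using combL_Cons[OF Cons(2)] by (simp only: bl.add_left)
  finally show ?case .
 qed
qed

lemma norm_comb_shift: "okc ps ==> norm (combL (shift et ps)) = norm (combL ps)" unfolding norm_eq_sqrt_inner inner_bl by (simp add: bl_comb_shift)

lemma one_plus_power_le: "(1 + t) ^ m <= 2 ^ m * (1 + t ^ m)" if "0 <= t" for t :: real
proof -
 have "(1 + t) ^ m <= (2 * max 1 t) ^ m" using that by (intro power_mono) auto
 also have "... = 2 ^ m * max 1 t ^ m" by (simp add: power_mult_distrib)
 also have "... <= 2 ^ m * (1 + t ^ m)" using that by (intro mult_left_mono) (auto simp: max_def)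
 finally show ?thesis .
qed

text \<open>An imaginary shift leaves Re ze fixed and changes |ze| by at most |R|, so all these
  Gaussians lie below a multiple of one fixed Gaussian. This makes differentiation in time
  dominated.\<close>

lemma heat_wt:
 fixes y :: "real^'n"
 assumes z: "0 < Re ze"
 shows "\<exists>C\<ge>0. \<forall>et x. \<bar>et\<bar> <= R \<longrightarrow> (1 + norm x) ^ m * cmod (heat (ze + \<i> * of_real et) (x - y)) <= C * wt x"
proof -
 define c where "c = Re ze / (cmod ze + \<bar>R\<bar>)^2 / 4"
 have z0: "0 < cmod ze" using z by auto
 have c: "0 < c" unfolding c_def using z z0 by (intro divide_pos_pos zero_less_power add_pos_nonneg) auto
 define G where "G = (%x. exp (- complex_of_real c * of_real ((x - y) \<bullet> (x - y))))"
 have "gp G" unfolding G_def using gp.base[of "of_real c" y] c by simp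
 hence d: "\<exists>B. \<forall>x. norm x ^ m * cmod (G x) <= B" for m by (rule gp_decay)
 obtain A B where A: "0 <= A" "!!x. norm x ^ m * cmod (G x) <= A * wt x" and B: "0 <= B" "!!x. norm x ^ 0 * cmod (G x) <= B * wt x"
  using rapid_decay_wt[OF d, of m] rapid_decay_wt[OF d, of 0] by blast
 define K where "K = inverse ((2 * sqrt (pi * Re ze)) ^ CARD('n))"
 have K: "0 <= K" using z by (simp add: K_def)
 let ?A = "%et x. cmod (heat (ze + \<i> * of_real et) (x - y))"
 have h: "?A et x <= K * cmod (G x)" if "\<bar>et\<bar> <= R" for et x
 proof -
  let ?z = "ze + \<i> * of_real et"
  have r: "Re ?z = Re ze" by simp
  have l: "Re ze <= cmod ?z" using complex_Re_le_cmod[of ?z] by simp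
  have u: "cmod ?z <= cmod ze + \<bar>R\<bar>" using norm_triangle_ineq[of ze "\<i> * et"] that by (simp add: norm_mult)
  have "c <= Re ze / (cmod ?z)\<^sup>2 / 4" unfolding c_def using z l u by (intro divide_right_mono divide_left_mono power_mono mult_pos_pos zero_less_power) auto
  hence e: "exp (- (norm (x - y))\<^sup>2 * (Re ?z / (cmod ?z)\<^sup>2 / 4)) <= exp (- c * (norm (x - y))\<^sup>2)"
   unfolding r using mult_right_mono[of c "Re ze / (cmod ?z)^2 / 4" "(norm (x - y))^2"] by (simp add: mult.commute)
  have "1 / (2 * sqrt (pi * cmod ?z)) ^ CARD('n) <= K" unfolding K_def inverse_eq_divide
   using z l less_le_trans[OF z l] by (intro divide_left_mono power_mono mult_left_mono real_sqrt_le_mono mult_pos_pos zero_less_power) auto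
  from mult_mono[OF e this] have "cmod (heat ?z (x - y)) <= exp (- c * (norm (x - y))^2) * K" unfolding norm_heat by simp
  thus ?thesis unfolding G_def by (simp add: norm_exp_eq_Re power2_norm_eq_inner mult.commute)
 qed
 have "(1 + norm x) ^ m * ?A et x <= (K * 2 ^ m * (A + B)) * wt x" if "\<bar>et\<bar> <= R" for et x
 proof -
  have "(1 + norm x) ^ m * ?A et x <= (2 ^ m * (1 + norm x ^ m)) * (K * cmod (G x))"
   by (intro mult_mono one_plus_power_le h that) auto
  also have "... = K * 2 ^ m * (norm x ^ m * cmod (G x) + norm x ^ 0 * cmod (G x))" by (simp add: algebra_simps)
  also have "... <= K * 2 ^ m * (A * wt x + B * wt x)" using K by (intro mult_left_mono add_mono A B) auto
  finally show ?thesis by (simp add: algebra_simps)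
 qed
 thus ?thesis using K A B by (intro exI[of _ "K * 2 ^ m * (A + B)"]) auto
qed

lemma laplacian_comb_Cons:
 assumes "okc (p # ps)"
 shows "laplacian (comb (p # ps)) = (%x. fst p * lapheat (fst (snd p)) (x - snd (snd p)) + laplacian (comb ps) x)"
proof -
 have k: "0 < Re (fst (snd p))" "okc ps" using assms by auto
 hence z: "fst (snd p) \<noteq> 0" by auto
 note s = gp_schwartz[OF gp_heat[OF k(1), of "snd (snd p)"]]
 show ?thesis unfolding comb_simps using laplacian_add[OF gp_schwartz[OF gp.scale[OF gp_heat[OF k(1)]]] gp_schwartz[OF gp_comb[OF k(2)]], of "fst p" "snd (snd p)"]
   laplacian_scale[OF s, of "fst p"] laplacian_heat[OF z, of "snd (snd p)"] by (simp add: fun_eq_iff)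
qed

lemma pd_comb_Cons:
 assumes "okc (p # ps)"
 shows "pd i (comb (p # ps)) = (%x. fst p * (- of_real ((x - snd (snd p))$i) / (2 * fst (snd p)) * heat (fst (snd p)) (x - snd (snd p))) + pd i (comb ps) x)"
proof -
 have k: "0 < Re (fst (snd p))" "okc ps" using assms by auto
 hence z: "fst (snd p) \<noteq> 0" by auto
 note d = schwartzD(4)[OF gp_schwartz[OF gp_comb[OF k(2)]], of _ i]
 show ?thesis unfolding comb_simps by (intro ext pd_eq has_vector_derivative_add has_vector_derivative_mult_right heat_line_derivative[OF z] d)
qed

lemma comb_parameter_derivative:
 assumes "okc ps"
 shows "((%et. comb (shift et ps) x) hvd \<i> * laplacian (comb (shift et ps)) x) (at et)" using assms
proof (induction ps)
 case Nil
 show ?case by (simp add: laplacian_zero)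
next
 case (Cons p ps)
 have k: "okc (shift et (p # ps))" using Cons(2) by simp
 let ?z = "fst (snd p) + \<i> * of_real et"
 have z: "?z \<notin> \<real>\<^sub>\<le>\<^sub>0" using Cons(2) by (auto simp: complex_nonpos_Reals_iff)
 have "((%et. fst (snd p) + \<i> * et) hvd \<i>) (at et)"
  unfolding has_vector_derivative_def by (rule derivative_eq_intros refl)+ (auto simp: fun_eq_iff algebra_simps scaleR_conv_of_real)
 from field_vector_diff_chain_at[OF this heat_parameter_derivative[OF z, of "x - snd (snd p)"]]
 have "((%et. heat (fst (snd p) + \<i> * et) (x - snd (snd p))) hvd \<i> * lapheat ?z (x - snd (snd p))) (at et)"
  by (simp add: o_def)
 note has_vector_derivative_add[OF has_vector_derivative_mult_right[OF this, of "fst p"] Cons(1)]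
 moreover have "okc ps" using Cons(2) by simp
 moreover have "\<i> * laplacian (comb (shift et (p # ps))) x = fst p * (\<i> * lapheat ?z (x - snd (snd p))) + \<i> * laplacian (comb (shift et ps)) x"
  using laplacian_comb_Cons[OF k[unfolded shift_simps]] unfolding shift_simps by (simp add: algebra_simps)
 ultimately show ?case by (simp only: shift_simps comb_simps fst_conv snd_conv)
qed

lemma comb_wt:
 fixes ps :: "(complex \<times> complex \<times> (real^'n)) list"
 assumes "okc ps"
 shows "\<exists>C\<ge>0. \<forall>et x. \<bar>et\<bar> <= R \<longrightarrow> (1 + norm x) ^ m * cmod (comb (shift et ps) x) <= C * wt x \<and>
   (1 + norm x) ^ m * cmod (laplacian (comb (shift et ps)) x) <= C * wt x \<and>
   (\<forall>i. (1 + norm x) ^ m * cmod (pd i (comb (shift et ps)) x) <= C * wt x)" using assms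
proof (induction ps)
 case Nil
 show ?case by (intro exI[of _ 0]) (simp add: laplacian_zero pd_zero)
next
 case (Cons p ps)
 obtain c z y where p: "p = (c, z, y)" by (metis prod_cases3)
 have z: "0 < Re z" and ok: "okc ps" using Cons(2) by (auto simp: p)
 obtain C where C: "0 <= C" "!!et x. \<bar>et\<bar> <= R ==> (1 + norm x) ^ m * cmod (comb (shift et ps) x) <= C * wt x"
  "!!et x. \<bar>et\<bar> <= R ==> (1 + norm x) ^ m * cmod (laplacian (comb (shift et ps)) x) <= C * wt x"
  "!!et x i. \<bar>et\<bar> <= R ==> (1 + norm x) ^ m * cmod (pd i (comb (shift et ps)) x) <= C * wt x" using Cons(1)[OF ok] by blast
 \<comment> \<open>The two extra powers absorb the quadratic polynomial in front of the Gaussian in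
   \<open>lapheat\<close>.\<close>
 obtain H where H: "0 <= H" "!!et x. \<bar>et\<bar> <= R ==> (1 + norm x) ^ (m + 2) * cmod (heat (z + \<i> * et) (x - y)) <= H * wt x"
  using heat_wt[OF z, of R "m + 2" y] by blast
 define e where "e = Re z"
 let ?B = "4 * e^2"
 \<comment> \<open>The summands bound in turn the factor 1, the two terms of \<open>lapheat\<close>
   and the factor of the gradient, each relative to (1 + |x|)^2; \<open>e\<close> is a lower bound
   for the modulus of the shifted time.\<close>
 define K where "K = 1 + (1 + norm y)^2 / ?B + CARD('n) / (2 * e) + (1 + norm y) / (2 * e)"
 have e: "0 < e" using z by (simp add: e_def)
 have g: "(1 + norm x) ^ m * cmod (c * (q * h)) <= cmod c * K * H * wt x"
  if q: "cmod q <= K * (1 + norm x)^2" and h: "(1 + norm x) ^ (m + 2) * cmod h <= H * wt x" for x :: "real^'n" and q h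
 proof -
  have K: "0 <= K" unfolding K_def using e by (intro add_nonneg_nonneg divide_nonneg_nonneg) auto
  have "(1 + norm x) ^ m * cmod (c * (q * h)) = cmod c * ((1 + norm x) ^ m * (cmod q * cmod h))" by (simp add: norm_mult)
  also have "... <= cmod c * ((1 + norm x) ^ m * (K * (1 + norm x)^2 * cmod h))" by (intro mult_left_mono mult_right_mono q) auto
  also have "... = cmod c * K * ((1 + norm x) ^ (m + 2) * cmod h)" by (simp only: power_add[of _ m 2] mult_ac)
  also have "... <= cmod c * K * (H * wt x)" using h K by (intro mult_left_mono) auto
  finally show ?thesis by (simp add: mult_ac)
 qed
 show ?case
 proof (intro exI[of _ "cmod c * K * H + C"] conjI allI impI)
  show "0 <= cmod c * K * H + C" unfolding K_def using e H C by (intro add_nonneg_nonneg mult_nonneg_nonneg divide_nonneg_nonneg) auto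
  fix et x assume r: "\<bar>et\<bar> <= R"
  let ?z = "z + \<i> * of_real et" and ?h = "heat (z + \<i> * of_real et) (x - y)"
  let ?C = "shift et (p # ps)"
  have k: "okc ?C" using Cons(2) by simp
  have ez: "e <= cmod ?z" using complex_Re_le_cmod[of ?z] by (simp add: e_def)
  have x1: "norm (x - y) <= (1 + norm y) * (1 + norm x)"
  proof -
   have "(1 + norm y) * (1 + norm x) = 1 + norm x + norm y + norm y * norm x" by (simp add: algebra_simps)
   moreover have "0 <= norm y * norm x" by simp
   ultimately show ?thesis using norm_triangle_ineq4[of x y] by linarith
  qed
  have o: "1 <= (1 + norm x)^2" "1 + norm x <= (1 + norm x)^2" by (simp_all add: power2_eq_square algebra_simps)
  have add: "M * cmod (a + b) <= (u + v) * w" if "M * cmod a <= u * w" "M * cmod b <= v * w" "0 <= M" for M u v w and a b :: complex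
   using mult_left_mono[OF norm_triangle_ineq[of a b] that(3)] that by (simp add: algebra_simps)
  have n: "\<i> * et + z = ?z" by simp
  have p0: "0 <= (1 + norm x) ^ m" by simp
  have K1: "K * (1 + norm x)^2 = (1 + norm x)^2 + (1 + norm y)^2 / ?B * (1 + norm x)^2 + CARD('n) / (2 * e) * (1 + norm x)^2 + (1 + norm y) / (2 * e) * (1 + norm x)^2"
   by (simp add: K_def algebra_simps)
  have nn: "0 <= (1 + norm y)^2 / ?B * (1 + norm x)^2" "0 <= CARD('n) / (2 * e) * (1 + norm x)^2" "0 <= (1 + norm y) / (2 * e) * (1 + norm x)^2"
   using e by auto
  have q1: "cmod 1 <= K * (1 + norm x)^2" unfolding K1 norm_one using o(1) nn by linarith
  let ?A = "of_real ((x - y) \<bullet> (x - y))"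
  let ?D = "4 * ?z^2"
  have q2: "cmod (?A / ?D - of_nat CARD('n) / (2 * ?z)) <= K * (1 + norm x)^2"
  proof -
   have "cmod (?A / ?D) = (norm (x - y))^2 / (4 * (cmod ?z)^2)"
    by (simp add: norm_divide norm_mult norm_power power2_norm_eq_inner)
   also have "... <= ((1 + norm y) * (1 + norm x))^2 / ?B" using e ez x1 by (intro frac_le power_mono mult_left_mono) auto
   finally have 1: "cmod (?A / ?D) <= (1 + norm y)^2 / ?B * (1 + norm x)^2"
    by (simp add: power_mult_distrib)
   have "cmod (of_nat CARD('n) / (2 * ?z)) = CARD('n) / (2 * cmod ?z)" by (simp only: norm_divide norm_mult norm_of_nat norm_numeral)
   also have "... <= CARD('n) / (2 * e)" using e ez by (intro frac_le) auto
   also have "... <= CARD('n) / (2 * e) * (1 + norm x)^2" using mult_left_mono[OF o(1), of "CARD('n) / (2 * e)"] e by simp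
   finally have 2: "cmod (of_nat CARD('n) / (2 * ?z)) <= CARD('n) / (2 * e) * (1 + norm x)^2" .
   have 3: "0 <= (1 + norm x)^2" by simp
   show ?thesis using norm_triangle_ineq4[of "?A / ?D" "of_nat CARD('n) / (2 * ?z)"] 1 2 3 nn(3) unfolding K1 by linarith
  qed
  have q3: "cmod (- of_real ((x - y)$i) / (2 * ?z)) <= K * (1 + norm x)^2" for i
  proof -
   have "cmod (- of_real ((x - y)$i) / (2 * ?z)) = \<bar>(x - y)$i\<bar> / (2 * cmod ?z)"
    by (simp only: norm_divide norm_mult norm_minus_cancel norm_of_real norm_numeral)
   also have "... <= ((1 + norm y) * (1 + norm x)) / (2 * e)" using e ez order_trans[OF component_le_norm_cart x1] by (intro frac_le mult_left_mono) auto
   also have "... <= (1 + norm y) / (2 * e) * (1 + norm x)^2" using mult_left_mono[OF o(2), of "(1 + norm y) / (2 * e)"] e by simp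
   also have "... <= K * (1 + norm x)^2" unfolding K1 using nn o(1) by linarith
   finally show ?thesis .
  qed
  show "(1 + norm x) ^ m * cmod (comb ?C x) <= (cmod c * K * H + C) * wt x" unfolding p shift_simps comb_simps fst_conv snd_conv
   using add[OF g[OF q1 H(2)[OF r]] C(2)[OF r] p0] by simp
  show "(1 + norm x) ^ m * cmod (laplacian (comb ?C) x) <= (cmod c * K * H + C) * wt x"
   unfolding p shift_simps laplacian_comb_Cons[OF k[unfolded p shift_simps fst_conv snd_conv]] fst_conv snd_conv lapheat_def
   by (rule add[OF g[OF q2 H(2)[OF r]] C(3)[OF r] p0])
  show "(1 + norm x) ^ m * cmod (pd i (comb ?C) x) <= (cmod c * K * H + C) * wt x" for i
   unfolding p shift_simps pd_comb_Cons[OF k[unfolded p shift_simps fst_conv snd_conv]] fst_conv snd_conv by (rule add[OF g[OF q3 H(2)[OF r]] C(4)[OF r] p0])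
 qed
qed

lemma integrable_wt_sq: "lint (%x::real^'n. (C * wt x)^2)"
proof (rule ibound[of _ "%x. C^2 * wt x"])
 show "AE x in lborel. norm ((C * wt x)^2) <= norm (C^2 * wt (x :: real^'n))"
 proof (rule AE_I2)
  fix x :: "real^'n"
  have "C^2 * (wt x * wt x) <= C^2 * (wt x * 1)" using wt_le_1[of x] wt_pos[of x] by (intro mult_left_mono) auto
  thus "norm ((C * wt x)^2) <= norm (C^2 * wt x)" using wt_pos[of x] by (simp add: power_mult_distrib power2_eq_square[of "wt x"])
 qed
qed (use integrable_wt in auto)

lemma combL_derivative:
 assumes "okc ps"
 shows "((%et. combL (shift et ps)) hvd abs_L2 (%x. \<i> * laplacian (comb (shift et ps)) x)) (at et)"
proof -
 obtain C where C: "0 <= C" "!!et' x. \<bar>et'\<bar> <= \<bar>et\<bar> + 1 ==> (1 + norm x) ^ 0 * cmod (laplacian (comb (shift et' ps)) x) <= C * wt x"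
  using comb_wt[OF assms, of "\<bar>et\<bar> + 1" 0] by blast
 have m: "bm (%x. \<i> * laplacian (comb (shift et ps)) x)" using assms by (intro sq_integrableD(1) gp_sq gp.scale gp_laplacian gp_comb) simp
 show ?thesis by (rule has_vector_derivative_L2[OF zero_less_one comb_parameter_derivative[OF assms] comb_sq _ m integrable_wt_sq[of C]])
   (use assms C(2) in \<open>auto simp: norm_mult\<close>)
qed

section \<open>Density of Gaussians\<close>

definition gauss :: "('n::finite) L2 set" where "gauss = {combL ps | ps. okc ps}"

lemma gauss_0: "0 \<in> gauss" unfolding gauss_def using abs_zero by (auto intro!: exI[of _ "[]"])

lemma gauss_add: "u \<in> gauss ==> v \<in> gauss ==> u + v \<in> gauss"
 unfolding gauss_def by (clarsimp simp: combL_append[symmetric]) (metis okc_simps(3))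

lemma gauss_scale: "u \<in> gauss ==> mulL (%x. c) u \<in> gauss"
proof -
 assume "u \<in> gauss"
 then obtain ps where ps: "okc ps" "u = combL ps" by (auto simp: gauss_def)
 have "bddm (cmod c) (%x. c)" by (simp add: bddm_def)
 from mulL_abs[OF this comb_sq[OF ps(1)]] have "mulL (%x. c) u = combL (map (apfst ((*) c)) ps)" by (simp add: ps(2) comb_scale)
 thus ?thesis using ps(1) unfolding gauss_def by (auto intro!: exI[of _ "map (apfst ((*) c)) ps"])
qed

lemma gauss_scaleR: "u \<in> gauss ==> c *R u \<in> gauss"
proof -
 assume u: "u \<in> gauss"
 have "mulL (%x. of_real c) u = c *R u" using abs_scaleR[OF rep_sq, of c u] by (simp add: mulL_def scaleR_conv_of_real)
 thus ?thesis using gauss_scale[OF u, of "of_real c"] by simp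
qed

lemma cl_add: "u \<in> closure gauss ==> v \<in> closure gauss ==> u + v \<in> closure gauss"
 unfolding closure_sequential by (elim exE conjE) (metis (no_types, lifting) gauss_add tendsto_add)

lemma cl_scale: "u \<in> closure gauss ==> mulL (%x. c) u \<in> closure gauss"
proof -
 assume "u \<in> closure gauss"
 then obtain f where f: "!!n. f n \<in> gauss" "f ----> u" unfolding closure_sequential by blast
 have "bddm (cmod c) (%x. c)" by (simp add: bddm_def)
 from bounded_linear.tendsto[OF linear_mulL[OF this] f(2)] show ?thesis
  unfolding closure_sequential by (intro exI[of _ "%n. mulL (%x. c) (f n)"] conjI allI gauss_scale f(1))
qed

lemma cl_lim: "(!!n. f n \<in> closure gauss) ==> f ----> u ==> u \<in> closure gauss"
 using closed_sequentially[of "closure gauss"] by auto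

lemma cl_abs_scale:
 assumes "abs_L2 f \<in> closure gauss" "sq_integrable f"
 shows "abs_L2 (%x. c * f x) \<in> closure gauss"
proof -
 have "bddm (cmod c) (%x. c)" by (simp add: bddm_def)
 from mulL_abs[OF this assms(2)] cl_scale[OF assms(1), of c] show ?thesis by simp
qed

text \<open>The Riemann sums of the gauge integral are finite combinations, hence themselves
  elements of \<open>gauss\<close>.\<close>

lemma has_integral_in_closure:
 fixes f :: "'a::euclidean_space => ('n::finite) L2"
 assumes f: "(f has_integral I) (cbox a b)" "!!y. f y \<in> gauss"
 shows "I \<in> closure gauss" unfolding closure_approachable
proof (intro allI impI)
 fix e :: real assume "0 < e"
 from f(1)[unfolded has_integral, rule_format, OF this] obtain d where d0: "gauge d \<and>
  (\<forall>p. p tagged_division_of cbox a b \<and> d fine p \<longrightarrow> norm ((\<Sum>(x, k)\<in>p. measure lborel k *R f x) - I) < e)" by (rule exE)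
 hence d: "gauge d" "!!p. p tagged_division_of (cbox a b) ==> d fine p ==> norm ((\<Sum>(x, k)\<in>p. measure lborel k *R f x) - I) < e"
  by simp_all
 obtain p where p: "p tagged_division_of (cbox a b)" "d fine p" using fine_division_exists[OF d(1)] .
 have "(\<Sum>q\<in>S. measure lborel (snd q) *R f (fst q)) \<in> gauss" if "finite S" for S
  using that by (induction S rule: finite_induct) (auto intro!: gauss_0 gauss_add gauss_scaleR f(2))
 from this[of p] p(1) have "(\<Sum>(x, k)\<in>p. measure lborel k *R f x) \<in> gauss" by (simp add: case_prod_unfold tagged_division_of_finite)
 thus "\<exists>y\<in>gauss. dist y I < e" using d(2)[OF p] unfolding dist_norm by blast
qed

definition boxheat :: "real^'n => real^'n => real => real^'n => real" where
 "boxheat a b e y = Re (LBINT x. indicator (cbox a b) x * heat (of_real e) (y - x))"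

lemma sq_integrable_indicator:
 "A \<in> sets borel ==> A \<subseteq> cbox a b ==> sq_integrable (%x. indicator A x :: complex)"
proof -
 assume A: "A \<in> sets borel" "A \<subseteq> cbox a b"
 have "emeasure lborel A < \<infinity>" by (rule le_less_trans[OF emeasure_mono[OF A(2)] emeasure_lborel_cbox_finite]) auto
 hence "lint (indicator A :: _ => real)" using A by (intro integrable_real_indicator) simp_all
 moreover have "(cmod (indicator A x))^2 = indicator A x" for x by (auto simp: indicator_def)
 ultimately show ?thesis unfolding sq_integrable_def using A(1) by simp
qed

lemma
 fixes a b y :: "real^'n"
 assumes e: "0 < e"
 shows boxheat_bound: "\<bar>boxheat a b e y\<bar> <= 1"
  and boxheat_int: "(LBINT x. indicator (cbox a b) x * Re (heat (of_real e) (y - x))) = boxheat a b e y"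
  and integrable_boxheat: "lint (%x. indicator (cbox a b) x * heat (of_real e) (y - x))"
proof -
 note h = integrable_lborel_reflect[of "%x. cmod (heat (of_real e) x)" y] integral_lborel_reflect[of "%x. cmod (heat (of_real e) x)" y]
 let ?A = "LBINT x. cmod (heat (of_real e) (y - x))"
 let ?B = "%x. heat (of_real e) (y - x)"
 have h1: "lint (%x. cmod (?B x))" "?A = 1"
  using h integrable_norm_heat[OF e] integral_norm_heat[OF e] by auto
 let ?C = "%x. indicator (cbox a b) x"
 show i: "lint (%x. ?C x * ?B x)"
  by (rule ibound[OF h1(1)]) (auto simp: norm_mult indicator_def)
 show "(LBINT x. ?C x * Re (?B x)) = boxheat a b e y"
  unfolding boxheat_def integral_Re[OF i, symmetric] by (intro icong) (auto simp: indicator_def)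
 have "\<bar>boxheat a b e y\<bar> <= cmod (LBINT x. ?C x * ?B x)" unfolding boxheat_def by (rule abs_Re_le_cmod)
 also have "... <= (LBINT x. cmod (?C x * ?B x))" by (rule integral_norm_bound)
 also have "... <= ?A" by (rule integral_mono[OF integrable_norm[OF i] h1(1)]) (auto simp: norm_mult indicator_def)
 finally show "\<bar>boxheat a b e y\<bar> <= 1" by (simp add: h1(2))
qed

lemma boxheat_measurable [measurable]: "bm (boxheat a b e)"
proof -
 have "(%(y, x). indicator (cbox a b) x * heat e (y - x)) \<in> borel_measurable (borel \<Otimes>\<^sub>M lborel)" by measurable
 thus ?thesis unfolding boxheat_def[abs_def] by (intro measurable_compose[OF lborel.borel_measurable_lebesgue_integral borel_measurable_Re])
qed

text \<open>The approximant is the vector-valued integral I over the box of the Gaussians centred at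
  y. All inner products are explicit, so |I - w|^2 is the integral over the box of boxheat (2 e) - 2
  boxheat e + 1, which tends to 0.\<close>

lemma box_in_closure:
 fixes a b :: "real^('n::finite)"
 shows "abs_L2 (%x. indicator (cbox a b) x) \<in> closure gauss"
proof -
 let ?G = "%x. indicator (cbox a b) x"
 define w where "w = (abs_L2 (%x. ?G x) :: 'n L2)"
 let ?C = "%x. indicator (cbox a b) x :: complex"
 have sw: "sq_integrable ?C" by (rule sq_integrable_indicator[of _ a b]) auto
 define B where "B = (%x. ?G x :: real)"
 have Bi: "lint B" unfolding B_def by (intro integrable_real_indicator) (simp_all add: emeasure_lborel_cbox_finite[unfolded infinity_ennreal_def])
 let ?F = "%e y. boxheat a b (2 * e) y - 2 * boxheat a b e y + 1"
 have ex: "\<exists>I\<in>closure gauss. (norm (I - w))^2 = (LBINT y. B y * (?F e y))" if e: "0 < e" for e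
 proof -
  define h where "h = (%y. combL [(1, of_real e, y)] :: 'n L2)"
  have hg: "h y \<in> gauss" for y unfolding gauss_def h_def using e by (intro CollectI exI[of _ "[(1, of_real e, y)]"]) simp
  let ?A = "of_real (2 * e)"
  have hh: "h y \<bullet> h y' = Re (heat ?A (y - y'))" for y y' using bl_heat[of "of_real e" "of_real e" 1 y 1 y'] e unfolding inner_bl h_def by simp
  \<comment> \<open>The inner product of two of these Gaussians depends on y - y' alone, so their
    distance is an explicit continuous function.\<close>
  have cont: "continuous_on S h" for S
  proof -
   let ?B = "Re (heat ?A (0 :: real^'n))"
   have "(norm (h y - h y'))^2 = 2 * ?B - 2 * Re (heat ?A (y - y'))" for y y'
    unfolding power2_norm_eq_inner by (simp add: inner_diff_left inner_diff_right hh heat_commute[of _ y' y])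
   hence n: "norm (h y - h y') = sqrt (2 * ?B - 2 * Re (heat ?A (y - y')))" for y y'
    by (metis norm_ge_zero real_sqrt_pow2_iff real_sqrt_unique)
   have "((%y. norm (h y - h y')) \<longlongrightarrow> 0) (at y' within S)" for y'
   proof -
    let ?D = "%y. sqrt (2 * ?B - 2 * Re (heat ?A (y - y')))"
    have "cts ?D"
     by (intro continuous_intros continuous_on_heat)
    hence "(?D \<longlongrightarrow>
      sqrt (2 * ?B - 2 * Re (heat ?A (y' - y')))) (at y' within S)"
     unfolding continuous_on_def by (meson UNIV_I subset_UNIV tendsto_within_subset)
    thus ?thesis unfolding n by simp
   qed
   thus ?thesis unfolding continuous_on_def by (metis LIM_zero_cancel tendsto_norm_zero_iff)
  qed
  have int: "h integrable_on cbox a b" by (rule integrable_continuous[OF cont])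
  define I where "I = integral (cbox a b) h"
  have lin: "integral (cbox a b) (%y. h y \<bullet> v) = I \<bullet> v" for v
   unfolding I_def using integral_linear[OF int bounded_linear_inner_left[of v]] by (simp add: o_def)
  have toL: "integral (cbox a b) f = (LBINT y. B y * f y)" if "continuous_on (cbox a b) f" for f :: "real^'n => real"
   using set_borel_integral_eq_integral(2)[of "cbox a b" f] borel_integrable_compact[OF compact_cbox that]
   by (simp add: set_integrable_def set_lebesgue_integral_def B_def)
  have hw: "h y \<bullet> w = boxheat a b e y" for y
  proof -
   have ci: "cnj (indicator A x :: complex) = indicator A x" for A and x :: "real^'n" by (auto simp: indicator_def)
   have s: "sq_integrable (%x. 1 * heat e (x - y) + 0)" using comb_sq[of "[(1, of_real e, y)]"] e by simp
   have "h y \<bullet> w = Re (LBINT x. heat e (x - y) * ?G x)"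
    unfolding inner_bl h_def w_def cnjL_abs[OF sw] using bl_abs[OF s sq_integrable_cnj[OF sw]] by (simp add: ci)
   thus ?thesis unfolding boxheat_def by (simp add: heat_commute[of _ _ y] mult.commute)
  qed
  have hI: "h y \<bullet> I = boxheat a b (2 * e) y" for y
  proof -
   have "h y \<bullet> I = integral (cbox a b) (%y'. Re (heat ?A (y' - y)))" unfolding lin[symmetric] inner_commute[of _ I] hh ..
   also have "... = (LBINT x. B x * Re (heat ?A (x - y)))" by (intro toL continuous_intros continuous_on_heat)
   also have "... = boxheat a b (2 * e) y" unfolding B_def using boxheat_int[of "2 * e" a b y] e by (simp add: heat_commute[of _ y])
   finally show ?thesis .
  qed
  have cI: "continuous_on (cbox a b) (%y. h y \<bullet> v)" for v by (intro continuous_intros cont)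
  have II: "I \<bullet> I = (LBINT y. B y * boxheat a b (2 * e) y)" using lin[of I] toL[OF cI[of I]] by (simp add: hI)
  have Iw: "I \<bullet> w = (LBINT y. B y * boxheat a b e y)" using lin[of w] toL[OF cI[of w]] by (simp add: hw)
  have ww: "w \<bullet> w = (LBINT y. B y * 1)"
   unfolding w_def inner_L2.abs_eq[OF abs_rel[OF sw] abs_rel[OF sw]] B_def by (intro icong) (auto simp: indicator_def)
  have ii: "lint (%y. B y * boxheat a b e' y)" if "0 < e'" for e'
   by (rule ibound[OF Bi]) (use boxheat_bound[OF that, of a b] in \<open>auto simp: B_def indicator_def\<close>)
  have "(norm (I - w))^2 = I \<bullet> I - 2 * (I \<bullet> w) + w \<bullet> w"
   unfolding power2_norm_eq_inner by (simp add: inner_diff_left inner_diff_right inner_commute)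
  also have "... = (LBINT y. B y * boxheat a b (2 * e) y - 2 * (B y * boxheat a b e y) + B y * 1)" unfolding II Iw ww using ii[of e] ii[of "2 * e"] e Bi by simp
  finally have "(norm (I - w))^2 = (LBINT y. B y * (?F e y))" by (simp add: algebra_simps)
  moreover have "I \<in> closure gauss" using has_integral_in_closure[OF integrable_integral[OF int] hg] by (simp add: I_def)
  ultimately show ?thesis by blast
 qed
 hence "\<forall>e\<in>{0<..}. \<exists>I. I \<in> closure gauss \<and> (norm (I - w))\<^sup>2 = (LBINT y. B y * (?F e y))"
  by (simp add: Bex_def)
 from bchoice[OF this] obtain J where J0: "\<forall>e\<in>{0<..}. J e \<in> closure gauss \<and> (norm (J e - w))\<^sup>2 = (LBINT y. B y * (?F e y))"
  by (rule exE)
 hence J: "J e \<in> closure gauss" "(norm (J e - w))^2 = (LBINT y. B y * (?F e y))" if "0 < e" for e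
  using that by simp_all
 define e where "e = (%k::nat. inverse (real (Suc k)))"
 have e0: "0 < e k" for k by (simp add: e_def)
 have el: "e ----> 0" "(%k. 2 * e k) ----> 0"
  unfolding e_def by (rule LIMSEQ_inverse_real_of_nat) (rule tendsto_mult_right_zero[OF LIMSEQ_inverse_real_of_nat])
 have bh: "(%k. boxheat a b (f k) y) ----> 1" if f: "f ----> 0" "!!k. 0 < f k" and y: "y \<in> box a b" for f y
 proof -
  have "isCont ?C y"
  proof -
   have "continuous_on (box a b) ?C \<longleftrightarrow> continuous_on (box a b) (%x. 1 :: complex)"
    using box_subset_cbox[of a b] by (intro continuous_on_cong) (auto simp: indicator_def)
   thus ?thesis using y by (simp add: continuous_on_eq_continuous_at open_box)
  qed
  from heat_approximate_identity[OF _ _ this, of 1]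
  have "((%e. \<integral>x. ?G x * heat e (y - x) \<partial>lborel) \<longlongrightarrow> ?G y) (at_right 0)"
   by (simp add: indicator_def)
  moreover have "filterlim f (at_right 0) sequentially" using f by (auto simp: filterlim_at less_imp_neq[THEN not_sym] intro!: always_eventually)
  ultimately have "(%k. \<integral>x. ?G x * heat (of_real (f k)) (y - x) \<partial>lborel) ----> ?G y"
   by (rule filterlim_compose)
  from tendsto_Re[OF this] show ?thesis unfolding boxheat_def using y box_subset_cbox[of a b] by (auto simp: indicator_def)
 qed
 \<comment> \<open>Convergence of \<open>boxheat\<close> to 1 is known only in the open box; its
   boundary is a null set.\<close>
 have null: "AE y in lborel. y \<notin> cbox a b - box a b" using negligible_frontier_interval[of a b]
  by (intro AE_not_in) (auto simp: negligible_iff_null_sets null_sets_completion_iff)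
 let ?E = "%e k y. boxheat a b (2 * e k) y - 2 * boxheat a b (e k) y + 1"
 have "(%k. \<integral>y. B y * (?E e k y) \<partial>lborel) ----> (\<integral>y. 0 \<partial>(lborel :: (real^'n) measure))"
 proof (rule integral_dominated_convergence[where w="%y. 4 * B y"])
  show "AE y in lborel. (%k. B y * (?E e k y)) ----> 0" using null
  proof eventually_elim
   fix y assume y: "y \<notin> cbox a b - box a b"
   show "(%k. B y * (?E e k y)) ----> 0"
   proof (cases "y \<in> box a b")
    case True
    have "(%k. B y * (?E e k y)) ----> B y * (1 - 2 * 1 + 1)"
     by (intro tendsto_intros bh el True) (simp_all add: e0)
    thus ?thesis by simp
   next
    case False
    thus ?thesis using y by (simp add: B_def)
   qed
  qed
  show "AE y in lborel. norm (B y * (?E e k y)) <= 4 * B y" for k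
  proof (rule AE_I2)
   fix y
   have "\<bar>boxheat a b (2 * e k) y - 2 * boxheat a b (e k) y + 1\<bar> <= 4"
    using boxheat_bound[OF e0[of k], of a b y] boxheat_bound[of "2 * e k" a b y] e0[of k] by simp
   thus "norm (B y * (?E e k y)) <= 4 * B y" by (simp add: B_def indicator_def)
  qed
  have [measurable]: "bm B" unfolding B_def by simp
  show "(%y. B y * (?E e k y)) \<in> borel_measurable lborel" for k by measurable
 qed (use Bi in auto)
 hence "(%k. (norm (J (e k) - w))^2) ----> 0" by (simp add: J(2)[OF e0])
 from tendsto_real_sqrt[OF this] have "(%k. norm (J (e k) - w)) ----> 0" by simp
 hence "(%k. J (e k)) ----> w" using LIM_zero_iff tendsto_norm_zero_iff by blast
 from cl_lim[OF J(1)[OF e0] this] show ?thesis by (simp add: w_def)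
qed

text \<open>A Dynkin-system induction starting from boxes. Intersecting with a fixed box keeps the
  measure finite, so complements become differences inside that box.\<close>

lemma indicator_in_closure:
 fixes A :: "(real^('n::finite)) set"
 assumes A: "A \<in> sets borel"
 shows "abs_L2 (%x. indicator (A \<inter> cbox a b) x) \<in> closure gauss"
proof -
 let ?G = "range (%(a, b). {a..b}) :: (real^'n) set set"
 let ?B = "sigma_sets UNIV ?G"
 have A': "A \<in> ?B" using A unfolding borel_eq_atLeastAtMost by simp
 have sq: "sq_integrable (%x. indicator (A \<inter> cbox a b) x :: complex)" if "A \<in> ?B" for A
 proof -
  have "A \<in> sets borel" using that unfolding borel_eq_atLeastAtMost by simp
  thus ?thesis by (intro sq_integrable_indicator[of _ a b]) auto
 qed
 let ?C = "closure gauss"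
 let ?D = "%a b x. indicator (cbox a b) x"
 have B: "abs_L2 (%x. ?D a b x) \<in> ?C" for a b :: "real^'n" by (rule box_in_closure)
 have st: "Int_stable ?G"
 proof (rule Int_stableI)
  fix s t :: "(real^'n) set" assume "s \<in> ?G" "t \<in> ?G"
  then obtain a b c d where "s = cbox a b" "t = cbox c d" by (auto simp: interval_cbox)
  hence "\<exists>a b. s \<inter> t = cbox a b" by (auto simp: Int_interval)
  thus "s \<inter> t \<in> ?G" by (auto simp: interval_cbox)
 qed
 show ?thesis using st subset_UNIV[of ?G, folded Pow_UNIV] A'
 proof (induction rule: sigma_sets_induct_disjoint)
  case (basic A)
  then obtain c d where "A = cbox c d" by (auto simp: interval_cbox)
  hence "\<exists>e f. A \<inter> cbox a b = cbox e f" by (auto simp: Int_interval)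
  thus ?case using B by auto
 next
  case empty
  have "0 \<in> ?C" using gauss_0 closure_subset by blast
  thus ?case by (simp add: abs_zero)
 next
  case (compl A)
  have "abs_L2 (%x. ?D a b x) + abs_L2 (%x. (-1) * indicator (A \<inter> cbox a b) x :: complex) \<in> ?C"
   by (intro cl_add B cl_abs_scale compl sq)
  also have "abs_L2 (%x. ?D a b x) + abs_L2 (%x. (-1) * indicator (A \<inter> cbox a b) x :: complex) =
    abs_L2 (%x. ?D a b x - indicator (A \<inter> cbox a b) x)"
   using sq_integrable_scaleR[OF sq[OF compl(1)], of "-1"] by (subst abs_add) (auto intro!: sq_integrable_indicator[of _ a b])
  also have "(%x. ?D a b x - indicator (A \<inter> cbox a b) x :: complex) = (%x. indicator ((UNIV - A) \<inter> cbox a b) x)"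
   by (auto simp: fun_eq_iff indicator_def)
  finally show ?case .
 next
  case (union A)
  define U where "U = (%k. \<Union>i<k. A i)"
  have Us: "U k \<in> ?B" for k unfolding U_def using union(2) by (intro sigma_sets_UNION) (auto intro: countable_finite)
  let ?E = "%k a b. U k \<inter> cbox a b"
  have U: "abs_L2 (%x. indicator (?E k a b) x :: complex) \<in> ?C" for k
  proof (induction k)
   case 0
   have "0 \<in> ?C" using gauss_0 closure_subset by blast
   thus ?case by (simp add: abs_zero U_def)
  next
   case (Suc k)
   have "A i \<inter> A k = {}" if "i < k" for i using disjoint_family_onD[OF union(1), of i k] that by simp
   hence d: "U k \<inter> A k = {}" unfolding U_def UN_simps(4)[symmetric] by simp
   let ?A = "%x. indicator (U (Suc k) \<inter> cbox a b) x :: complex"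
   have "?A = (%x. indicator (?E k a b) x + indicator (A k \<inter> cbox a b) x)"
    using d by (auto simp: U_def fun_eq_iff indicator_def lessThan_Suc)
   hence "abs_L2 ?A = abs_L2 (%x. indicator (?E k a b) x) + abs_L2 (%x. indicator (A k \<inter> cbox a b) x)"
    using union(2) by (simp add: abs_add sq Us range_subsetD)
   thus ?case using cl_add[OF Suc union(3)[of k]] by simp
  qed
  have "(%k. abs_L2 (%x. indicator (?E k a b) x :: complex)) ----> abs_L2 (%x. indicator ((\<Union>i. A i) \<inter> cbox a b) x)"
  proof (rule L2_dominated(3)[where g="%x. ?D a b x"])
   show "bm (%x. indicator (?E k a b) x :: complex)" for k by (rule sq_integrableD(1)[OF sq[OF Us]])
   have "(\<Union>i. A i) \<in> ?B" using union(2) by (intro sigma_sets.Union) auto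
   thus "bm (%x. indicator ((\<Union>i. A i) \<inter> cbox a b) x :: complex)" by (rule sq_integrableD(1)[OF sq])
   show "lint (%x. (?D a b x :: real)^2)"
   proof -
    have "(cmod (?D a b x :: complex))^2 = (?D a b x)^2" for x by (cases "x \<in> cbox a b") auto
    thus ?thesis using sq_integrableD(2)[OF sq_integrable_indicator[of "cbox a b" a b]] by (simp only: cbox_borel order_refl)
   qed
   show "AE x in lborel. (%k. indicator (?E k a b) x :: complex) ----> indicator ((\<Union>i. A i) \<inter> cbox a b) x"
   proof (rule AE_I2)
    fix x
    show "(%k. indicator (?E k a b) x :: complex) ----> indicator ((\<Union>i. A i) \<inter> cbox a b) x"
    proof (cases "\<exists>i. x \<in> A i")
     case True
     then obtain i where i: "x \<in> A i" by blast
     hence "\<forall>\<^sub>F k in sequentially. indicator (?E k a b) x = (indicator ((\<Union>i. A i) \<inter> cbox a b) x :: complex)"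
      by (intro eventually_sequentiallyI[of "Suc i"]) (auto simp: U_def indicator_def Suc_le_eq)
     thus ?thesis by (rule tendsto_eventually)
    next
     case False
     thus ?thesis by (simp add: U_def indicator_def)
    qed
   qed
  qed (auto simp: indicator_def)
  from cl_lim[OF U this] show ?case .
 qed
qed

text \<open>Simple approximations of f are cut off to growing cubes, so that each level set falls
  under \<open>indicator_in_closure\<close>; domination by 2 |f| gives convergence.\<close>

theorem gauss_dense: "closure gauss = (UNIV :: ('n::finite) L2 set)"
proof -
 let ?A = "closure gauss"
 have "u \<in> ?A" for u :: "'n L2"
 proof -
  define f where "f = rep_L2 u"
  have f: "sq_integrable f" by (simp add: f_def rep_sq)
  obtain F where F: "!!i. simple_function lborel (F i)" "!!x. (%i. F i x) ----> f x" "!!i x. dist (F i x) 0 <= 2 * dist (f x) 0"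
   using borel_measurable_implies_sequence_metric[of f lborel 0] sq_integrableD(1)[OF f] by auto
  define G where "G = (%k x. (\<Sum>c\<in>range (F k). c * indicator ((F k -` {c}) \<inter> cbox (\<chi> i. - real k) (\<chi> i. real k)) x))"
  have fin: "finite (range (F k))" for k using simple_functionD(1)[OF F(1), of k] by simp
  have ms: "F k -` {c} \<in> sets borel" for k c using simple_functionD(2)[OF F(1), of k "{c}"] by simp
  have Gc: "sq_integrable (%x. \<Sum>c\<in>C. c * indicator ((F k -` {c}) \<inter> cbox (\<chi> i. - real k) (\<chi> i. real k)) x) \<and>
    abs_L2 (%x. \<Sum>c\<in>C. c * indicator ((F k -` {c}) \<inter> cbox (\<chi> i. - real k) (\<chi> i. real k)) x) \<in> ?A" if "finite C" for C k
   using that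
  proof (induction C rule: finite_induct)
   case empty
   have "0 \<in> ?A" using gauss_0 closure_subset by blast
   thus ?case by (simp add: abs_zero sq_integrable_zero)
  next
   case (insert c C)
   let ?I = "%x. indicator ((F k -` {c}) \<inter> cbox (\<chi> i. - real k) (\<chi> i. real k)) x :: complex"
   have i: "sq_integrable ?I" by (rule sq_integrable_indicator[of _ "\<chi> i. - real k" "\<chi> i. real k"]) (use ms in auto)
   have ci: "sq_integrable (%x. c * ?I x)" by (rule sq_integrable_bounded_mult(1)[OF i, of _ "cmod c"]) auto
   have "abs_L2 (%x. c * ?I x) \<in> ?A" by (rule cl_abs_scale[OF indicator_in_closure[OF ms] i])
   from cl_add[OF this conjunct2[OF insert(3)]] show ?case unfolding sum.insert[OF insert(1,2)]
    unfolding abs_add[OF ci conjunct1[OF insert(3)]] using sq_integrable_add[OF ci conjunct1[OF insert(3)]] by (rule conjI[rotated])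
  qed
  have Ge: "G k x = (if x \<in> cbox (\<chi> i. - real k) (\<chi> i. real k) then F k x else 0)" for k x
  proof -
   have "G k x = (\<Sum>c\<in>range (F k). if c = F k x then (if x \<in> cbox (\<chi> i. - real k) (\<chi> i. real k) then c else 0) else 0)"
    unfolding G_def by (intro sum.cong) (auto simp: indicator_def)
   thus ?thesis by (simp add: sum.delta'[OF fin] sum.delta[OF fin])
  qed
  have "(%k. abs_L2 (G k)) ----> abs_L2 f"
  proof (rule L2_dominated(3)[where g="%x. 2 * cmod (f x)"])
   show "bm (G k)" for k unfolding G_def using Gc[OF fin, of k] by (intro sq_integrableD(1)) simp
   show "bm f" by (rule sq_integrableD(1)[OF f])
   show "cmod (G k x) <= 2 * cmod (f x)" for k x using F(3)[of k x] by (simp add: Ge)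
   show "lint (%x. (2 * cmod (f x))\<^sup>2)" using sq_integrableD(2)[OF f] by (simp add: power_mult_distrib)
   show "AE x in lborel. (%k. G k x) ----> f x"
   proof (rule AE_I2)
    fix x :: "real^'n"
    obtain m :: nat where m: "norm x <= real m" using real_arch_simple by blast
    have "x \<in> cbox (\<chi> i. - real k) (\<chi> i. real k)" if "m <= k" for k
    proof -
     have "\<bar>x$i\<bar> <= real k" for i using component_le_norm_cart[of x i] m that by (meson of_nat_le_iff order_trans)
     thus ?thesis unfolding mem_box_cart by (auto simp: abs_le_iff minus_le_iff)
    qed
    hence "\<forall>\<^sub>F k in sequentially. F k x = G k x" by (intro eventually_sequentiallyI[of m]) (simp add: Ge)
    thus "(%k. G k x) ----> f x" by (rule Lim_transform_eventually[OF F(2)])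
   qed
  qed
  moreover have "abs_L2 (G k) \<in> ?A" for k unfolding G_def using Gc[OF fin, of k] by simp
  ultimately show ?thesis using cl_lim[of "%k. abs_L2 (G k)" "abs_L2 f"] by (simp add: f_def)
 qed
 thus ?thesis by blast
qed

section \<open>Consequences of density: extension and duality\<close>

lemma gauss_ext:
 fixes f g :: "('n::finite) L2 => 'b::t2_space"
 assumes "cts f" "cts g" "!!ps. okc ps ==> f (combL ps) = g (combL ps)"
 shows "f u = g u"
proof -
 have "closure gauss \<subseteq> {u. f u = g u}" using assms(3) by (intro closure_minimal closed_Collect_eq assms(1,2)) (auto simp: gauss_def)
 thus ?thesis using gauss_dense by auto
qed

lemma gauss_le:
 fixes f g :: "('n::finite) L2 => real"
 assumes "cts f" "cts g" "!!ps. okc ps ==> f (combL ps) <= g (combL ps)"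
 shows "f u <= g u"
proof -
 have "closure gauss \<subseteq> {u. f u <= g u}" using assms(3) by (intro closure_minimal closed_Collect_le assms(1,2)) (auto simp: gauss_def)
 thus ?thesis using gauss_dense by auto
qed

lemma bl_cnjL_self: "bl u (cnjL u) = of_real ((norm u)^2)"
proof -
 have "bl u (cnjL u) = bl (abs_L2 (rep_L2 u)) (abs_L2 (%x. cnj (rep_L2 u x)))" by (simp add: cnjL_def)
 also have "... = (LBINT x. rep_L2 u x * cnj (rep_L2 u x))" by (rule bl_abs[OF rep_sq sq_integrable_cnj[OF rep_sq]])
 also have "... = (LBINT x. of_real ((cmod (rep_L2 u x))^2))" by (simp only: complex_norm_square)
 also have "... = of_real ((l2n (rep_L2 u))^2)" by (simp add: l2n_sq del: l2n_rep of_real_power)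
 finally show ?thesis by simp
qed

text \<open>By density the bound holds for all vectors, and the choice \<open>cnjL u\<close> yields
  |u|^2 <= K |u|.\<close>

lemma norm_le_duality:
 assumes K: "0 <= K" and b: "!!ps. okc ps ==> cmod (bl u (combL ps)) <= K * norm (combL ps)"
 shows "norm u <= K"
proof -
 have "cmod (bl u (cnjL u)) <= K * norm (cnjL u)"
  by (rule gauss_le[where f="%v. cmod (bl u v)" and g="%v. K * norm v"]) (auto intro!: continuous_intros bl.continuous_on b)
 hence "norm u * norm u <= K * norm u" unfolding bl_cnjL_self by (simp add: power2_eq_square norm_mult del: of_real_mult of_real_power)
 thus ?thesis using K by (cases "norm u = 0") auto
qed

text \<open>\<open>p\<close> describes the vector \<open>G p\<close> with intended image
  \<open>H p\<close>, and different descriptions may give the same vector. The bound applied to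
  differences makes the image well defined; density and completeness do the rest.\<close>

lemma bounded_extension:
 fixes G :: "'p => 'a::real_normed_vector" and H :: "'p => 'b::banach"
 assumes add: "!!p q. p \<in> P ==> q \<in> P ==> \<exists>r\<in>P. G r = G p + G q \<and> H r = H p + H q"
  and scale: "!!c p. p \<in> P ==> \<exists>r\<in>P. G r = c *R G p \<and> H r = c *R H p"
  and bnd: "!!p. p \<in> P ==> norm (H p) <= K * norm (G p)"
  and dense: "closure (G ` P) = UNIV"
 shows "\<exists>A. bounded_linear A \<and> (\<forall>p\<in>P. A (G p) = H p)"
proof -
 have lip: "norm (H p - H q) <= K * norm (G p - G q)" if pq: "p \<in> P" "q \<in> P" for p q
 proof -
  obtain q' where q': "q' \<in> P" "G q' = (-1) *R G q" "H q' = (-1) *R H q" using scale[OF pq(2), of "-1"] by blast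
  obtain r where r: "r \<in> P" "G r = G p + G q'" "H r = H p + H q'" using add[OF pq(1) q'(1)] by blast
  show ?thesis using bnd[OF r(1)] by (simp add: r q')
 qed
 have wd: "H p = H q" if "p \<in> P" "q \<in> P" "G p = G q" for p q using lip[OF that(1,2)] that(3) by simp
 define f where "f u = H (SOME p. p \<in> P \<and> G p = u)" for u
 have f: "f (G p) = H p" if "p \<in> P" for p
 proof -
  have "(SOME q. q \<in> P \<and> G q = G p) \<in> P \<and> G (SOME q. q \<in> P \<and> G q = G p) = G p" by (rule someI[of _ p]) (simp add: that)
  thus ?thesis unfolding f_def using that wd by blast
 qed
 define L where "L = \<bar>K\<bar> + 1"
 have "dist (f u) (f v) <= L * dist u v" if uv: "u \<in> G ` P" "v \<in> G ` P" for u v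
 proof -
  obtain p q where pq: "p \<in> P" "q \<in> P" "u = G p" "v = G q" using uv by blast
  have "norm (H p - H q) <= K * norm (G p - G q)" by (rule lip[OF pq(1,2)])
  also have "... <= L * norm (G p - G q)" unfolding L_def by (intro mult_right_mono) auto
  finally show ?thesis by (simp add: pq f dist_norm)
 qed
 hence "L-lipschitz_on (G ` P) f" by (intro lipschitz_onI) (simp_all add: L_def)
 hence "uniformly_continuous_on (G ` P) f" by (rule lipschitz_on_uniformly_continuous)
 then obtain A where A: "uniformly_continuous_on (closure (G ` P)) A" "!!x. x \<in> G ` P ==> f x = A x"
  by (rule uniformly_continuous_on_extension_on_closure) blast
 have cont: "cts A" using A(1) by (simp add: dense uniformly_continuous_imp_continuous)
 have AG: "A (G p) = H p" if "p \<in> P" for p using A(2)[of "G p"] f[OF that] that by simp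
 have c2: "continuous_on S (%x. A (h x))" if "continuous_on S h" for h :: "'c::topological_space => 'a" and S
  by (rule continuous_on_compose2[OF cont that]) auto
 have ext: "g u = h u" if "cts g" "cts h" "!!p. p \<in> P ==> g (G p) = h (G p)" for g h :: "'a => 'c::t2_space" and u
 proof -
  have "closure (G ` P) \<subseteq> {u. g u = h u}" using that(3) by (intro closure_minimal closed_Collect_eq that(1,2)) auto
  thus ?thesis using dense by auto
 qed
 have add1: "A (G p + v) = A (G p) + A v" if p: "p \<in> P" for p v
 proof (rule ext[of "%v. A (G p + v)" "%v. A (G p) + A v"])
  show "A (G p + G q) = A (G p) + A (G q)" if q: "q \<in> P" for q
  proof -
   obtain r where r: "r \<in> P" "G r = G p + G q" "H r = H p + H q" using add[OF p q] by blast
   show ?thesis using AG[OF r(1)] AG p q r by simp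
  qed
 qed (intro continuous_intros c2)+
 have "A (u + v) = A u + A v" for u v by (rule ext[of "%u. A (u + v)" "%u. A u + A v"]) (intro continuous_intros c2 add1 | assumption)+
 moreover have "A (c *R u) = c *R A u" for c u
 proof (rule ext[of "%u. A (c *R u)" "%u. c *R A u"])
  show "A (c *R G p) = c *R A (G p)" if p: "p \<in> P" for p
  proof -
   obtain r where r: "r \<in> P" "G r = c *R G p" "H r = c *R H p" using scale[OF p] by blast
   show ?thesis using AG[OF r(1)] AG[OF p] r by simp
  qed
 qed (intro continuous_intros c2)+
 moreover have "norm (A u) <= norm u * K" for u
 proof -
  have "closure (G ` P) \<subseteq> {u. norm (A u) <= norm u * K}"
   using bnd by (intro closure_minimal closed_Collect_le continuous_intros c2) (auto simp: AG mult.commute)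
  thus ?thesis using dense by auto
 qed
 ultimately have "bounded_linear A" by (intro bounded_linear_intro[of A K]) auto
 thus ?thesis using AG by blast
qed

section \<open>The free evolution\<close>

text \<open>The unitary group exp(i et Laplacian), pinned down by its action on Gaussians; elapsed
  time t corresponds to \<open>et\<close> = hbar t / 2.\<close>

definition free :: "real => ('n::finite) L2 => 'n L2" where
 "free et = (SOME A. bounded_linear A \<and> (\<forall>ps. okc ps \<longrightarrow> A (combL ps) = combL (shift et ps)))"

lemma free_spec: "bounded_linear (free et :: ('n::finite) L2 => _) \<and> (\<forall>ps. okc ps \<longrightarrow> free et (combL ps) = (combL (shift et ps) :: 'n L2))"
proof -
 let ?A = "%r. combL (shift et r)"
 have a: "\<exists>r\<in>Collect okc. (combL r :: 'n L2) = combL p + combL q \<and> (?A r :: 'n L2) = ?A p + ?A q"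
  if "p \<in> Collect okc" "q \<in> Collect okc" for p q using that by (intro bexI[of _ "p @ q"]) (simp_all add: combL_append)
 have s: "\<exists>r\<in>Collect okc. (combL r :: 'n L2) = c *R combL p \<and> (?A r :: 'n L2) = c *R combL (shift et p)"
  if "p \<in> Collect okc" for c p using that by (intro bexI[of _ "map (apfst ((*) (of_real c))) p"]) (simp_all add: combL_scaleR)
 have b: "norm (?A p :: 'n L2) <= 1 * norm (combL p)" if "p \<in> Collect okc" for p using that by (simp add: norm_comb_shift)
 have "combL ` Collect okc = (gauss :: 'n L2 set)" by (auto simp: gauss_def)
 hence d: "closure (combL ` Collect okc) = (UNIV :: 'n L2 set)" by (simp add: gauss_dense)
 have "\<exists>A. bounded_linear A \<and> (\<forall>ps\<in>Collect okc. A (combL ps) = (?A ps :: 'n L2))" by (rule bounded_extension[OF a s b d])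
 hence "\<exists>A. bounded_linear A \<and> (\<forall>ps. okc ps \<longrightarrow> A (combL ps) = (?A ps :: 'n L2))" by simp
 from someI_ex[OF this] show ?thesis unfolding free_def .
qed

lemmas free_linear = free_spec[THEN conjunct1] and free_comb = free_spec[THEN conjunct2, rule_format]

lemma free_continuous: "continuous_on S f ==> continuous_on S (%x. free et (f x))" by (rule bounded_linear.continuous_on[OF free_linear])

lemma free_free: "free et (free et' u) = free (et + et') u"
 by (rule gauss_ext[where f="%u. free et (free et' u)" and g="free (et + et')"]) (auto intro!: free_continuous continuous_intros simp: free_comb)

lemma free_0 [simp]: "free 0 u = u" by (rule gauss_ext[where f="free 0" and g="%u. u"]) (auto intro!: free_continuous continuous_intros simp: free_comb)

lemma norm_free [simp]: "norm (free et u) = norm u"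
 by (rule gauss_ext[where f="%u. norm (free et u)" and g=norm]) (auto intro!: free_continuous continuous_intros simp: free_comb norm_comb_shift)

text \<open>Orbits of Gaussians are differentiable. Since every \<open>free et\<close> is an
  isometry, approximation of the vector is uniform in \<open>et\<close>, so the vectors with
  continuous orbit form a closed set.\<close>

lemma free_strongly_continuous: "cts (%et. free et u)"
proof -
 have "closed {u :: 'a L2. cts (%et. free et u)}" unfolding closed_sequential_limits
 proof (intro allI impI, elim conjE, clarsimp)
  fix f :: "nat => 'a L2" and u assume f: "\<forall>n. cts (%et. free et (f n))" "f ----> u"
  have "uniform_limit UNIV (%n et. free et (f n)) (%et. free et u) sequentially"
  proof (rule uniform_limitI)
   fix e :: real assume "0 < e"
   hence "\<forall>\<^sub>F n in sequentially. dist (f n) u < e" using f(2) by (auto simp: tendsto_iff)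
   moreover have "dist (free et (f n)) (free et u) = dist (f n) u" for et n
    unfolding dist_norm using linear_diff[OF bounded_linear.linear[OF free_linear], of et "f n" u] norm_free[of et "f n - u"] by simp
   ultimately show "\<forall>\<^sub>F n in sequentially. \<forall>et\<in>UNIV. dist (free et (f n)) (free et u) < e" by simp
  qed
  thus "cts (%et. free et u)" by (rule uniform_limit_theorem[rotated]) (use f in auto)
 qed
 moreover have "gauss \<subseteq> {u :: 'a L2. cts (%et. free et u)}"
 proof (clarsimp simp: gauss_def free_comb)
  fix ps :: "(complex \<times> complex \<times> (real^'a)) list" assume "okc ps"
  thus "cts (%et. combL (shift et ps))"
   by (intro continuous_at_imp_continuous_on ballI has_vector_derivative_continuous[OF combL_derivative])
 qed
 ultimately have "closure gauss \<subseteq> {u :: 'a L2. cts (%et. free et u)}" by (rule closure_minimal[rotated])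
 thus ?thesis using gauss_dense by auto
qed

section \<open>The Hamilton--Jacobi equation for the approximate kernel\<close>

text \<open>Polynomial growth, uniform over the times in \<open>I\<close>: derivatives of the kernel
  grow in x - y. The weight is a product so that Schwartz functions of x and of y can compensate it
  separately.\<close>

definition pg :: "real set => nat => (real => (real^'n) \<times> (real^'n) => complex) => bool" where
 "pg I p g \<longleftrightarrow> (\<exists>K\<ge>0. \<forall>ta\<in>I. \<forall>z. cmod (g ta z) <= K * ((1 + norm (fst z)) * (1 + norm (snd z))) ^ p)"

lemma weight_ge_1: "1 <= (1 + norm x) * (1 + norm y)" using mult_mono[of 1 "1 + norm x" 1 "1 + norm y"] by simp

lemma pg_mono: "pg I p g ==> p <= q ==> pg I q g" unfolding pg_def by (meson mult_left_mono order_trans power_increasing weight_ge_1)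

lemma pg_add: "pg I p f ==> pg I p g ==> pg I p (%ta z. f ta z + g ta z)"
proof -
 assume "pg I p f" "pg I p g"
 then obtain K L where K: "0 <= K" "0 <= L"
  "!!ta z. ta \<in> I ==> cmod (f ta z) <= K * ((1 + norm (fst z)) * (1 + norm (snd z))) ^ p"
  "!!ta z. ta \<in> I ==> cmod (g ta z) <= L * ((1 + norm (fst z)) * (1 + norm (snd z))) ^ p" unfolding pg_def by blast
 have "cmod (f ta z + g ta z) <= (K + L) * ((1 + norm (fst z)) * (1 + norm (snd z))) ^ p" if "ta \<in> I" for ta z
  unfolding distrib_right[of K L] by (rule norm_triangle_le[OF add_mono[OF K(3)[OF that] K(4)[OF that]]])
 thus ?thesis unfolding pg_def using K by (intro exI[of _ "K + L"]) simp
qed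

lemma pg_mult: "pg I p f ==> pg I q g ==> pg I (p + q) (%ta z. f ta z * g ta z)"
proof -
 assume "pg I p f" "pg I q g"
 then obtain K L where K: "0 <= K" "0 <= L"
  "!!ta z. ta \<in> I ==> cmod (f ta z) <= K * ((1 + norm (fst z)) * (1 + norm (snd z))) ^ p"
  "!!ta z. ta \<in> I ==> cmod (g ta z) <= L * ((1 + norm (fst z)) * (1 + norm (snd z))) ^ q" unfolding pg_def by blast
 have "cmod (f ta z * g ta z) <= K * L * ((1 + norm (fst z)) * (1 + norm (snd z))) ^ (p + q)" if "ta \<in> I" for ta z
  using mult_mono[OF K(3)[OF that, of z] K(4)[OF that, of z]] K(1,2) by (simp add: norm_mult power_add mult_ac)
 thus ?thesis unfolding pg_def using K by (intro exI[of _ "K * L"]) simp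
qed

lemma pg_const:
 assumes "continuous_on I c" "compact I"
 shows "pg I 0 (%ta z. c ta)"
proof -
 have "bounded (c ` I)" by (intro compact_imp_bounded compact_continuous_image assms)
 then obtain K where K: "!!ta. ta \<in> I ==> cmod (c ta) <= K" unfolding bounded_iff by blast
 hence "!!ta. ta \<in> I ==> cmod (c ta) <= \<bar>K\<bar>" by (meson abs_ge_self order_trans)
 thus ?thesis unfolding pg_def by (intro exI[of _ "\<bar>K\<bar>"]) simp
qed

lemma pg_bounded: "(!!z. cmod (g z) <= K) ==> pg I 0 (%ta. g)"
 unfolding pg_def by (intro exI[of _ "\<bar>K\<bar>"]) (auto intro: order_trans[OF _ abs_ge_self])

lemma pg_sum: "finite J ==> (!!j. j \<in> J ==> pg I p (f j)) ==> pg I p (%ta z. \<Sum>j\<in>J. f j ta z)"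
proof (induction J rule: finite_induct)
 case empty thus ?case unfolding pg_def by (intro exI[of _ 0]) simp
qed (simp add: pg_add)

lemma pg_diff_coord: "pg I 1 (%ta z. of_real ((fst z - snd z)$i))" "pg I 2 (%ta z. of_real ((fst z - snd z) \<bullet> (fst z - snd z)))"
proof -
 have n: "norm (x - y) <= (1 + norm x) * (1 + norm y)" for x y :: "real^'n"
 proof -
  have "(1 + norm x) * (1 + norm y) = 1 + norm x + norm y + norm x * norm y" by (simp add: algebra_simps)
  moreover have "0 <= norm x * norm y" by simp
  ultimately show ?thesis using norm_triangle_ineq4[of x y] by linarith
 qed
 show "pg I 1 (%ta z. of_real ((fst z - snd z)$i))" unfolding pg_def
  by (intro exI[of _ 1]) (auto simp del: vector_minus_component intro: order_trans[OF component_le_norm_cart n])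
 show "pg I 2 (%ta z. of_real ((fst z - snd z) \<bullet> (fst z - snd z)))" unfolding pg_def power2_norm_eq_inner[symmetric]
  using power_mono[OF n norm_ge_zero, of _ _ 2] by (intro exI[of _ 1]) (simp only: norm_of_real abs_power2 abs_of_nonneg zero_le_power2 zero_le_one mult_1_left, blast)
qed

lemma poly_weight_integrable:
 fixes k :: "(real^'n) \<times> (real^'n) => complex"
 assumes K: "0 <= K" "!!z. cmod (k z) <= K * ((1 + norm (fst z)) * (1 + norm (snd z)))^2"
  and f: "0 <= C" "!!y. (1 + norm y)^2 * cmod (f y) <= C * wt y" and q: "0 <= C'" "!!x. (1 + norm x)^2 * cmod (q x) <= C' * wt x"
 shows "cmod (k z * (f (snd z) * q (fst z))) <= K * C * C' * (wt (snd z) * wt (fst z))"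
  and "lint (%z :: (real^'n) \<times> (real^'n). K * C * C' * (wt (snd z) * wt (fst z)))"
  and "bm k ==> bm f ==> bm q ==>
   lint (%z. k z * (f (snd z) * q (fst z)))"
proof -
 show b: "cmod (k z * (f (snd z) * q (fst z))) <= K * C * C' * (wt (snd z) * wt (fst z))" for z
 proof -
  have "cmod (k z * (f (snd z) * q (fst z))) <= K * ((1 + norm (fst z)) * (1 + norm (snd z)))^2 * (cmod (f (snd z)) * cmod (q (fst z)))"
   unfolding norm_mult by (intro mult_right_mono K(2)) simp
  also have "... = K * (((1 + norm (snd z))^2 * cmod (f (snd z))) * ((1 + norm (fst z))^2 * cmod (q (fst z))))" by (simp only: power_mult_distrib mult_ac)
  also have "... <= K * ((C * wt (snd z)) * (C' * wt (fst z)))"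
   using wt_pos[of "snd z"] by (intro mult_left_mono mult_mono f q K(1)) (auto intro!: mult_nonneg_nonneg simp: f(1) less_imp_le)
  finally show ?thesis by (simp only: mult_ac)
 qed
 show i: "lint (%z :: (real^'n) \<times> (real^'n). K * C * C' * (wt (snd z) * wt (fst z)))"
  using integrable_tensor[OF integrable_wt integrable_wt] by (intro integrable_mult_right) (simp add: mult.commute case_prod_unfold)
 show "lint (%z. k z * (f (snd z) * q (fst z)))"
  if [measurable]: "bm k" "bm f" "bm q"
 proof (rule ibound[OF i])
  have [measurable]: "bm (fst :: (real^'n) \<times> (real^'n) => _)" "bm (snd :: (real^'n) \<times> (real^'n) => _)"
   by (auto intro!: borel_measurable_continuous_onI continuous_intros)
  show "(%z. k z * (f (snd z) * q (fst z))) \<in> borel_measurable lborel" by measurable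
 qed (auto intro!: order_trans[OF b abs_ge_self])
qed

lemma schwartz_wt2: "f \<in> schwartz ==> \<exists>C\<ge>0. \<forall>x. (1 + norm x)^2 * cmod (f x) <= C * wt x"
proof -
 assume f: "f \<in> schwartz"
 obtain A B where A: "0 <= A" "!!x. norm x ^ 2 * cmod (f x) <= A * wt x" and B: "0 <= B" "!!x. norm x ^ 0 * cmod (f x) <= B * wt x"
  using schwartzD(2)[OF f, of 2] schwartzD(2)[OF f, of 0] by blast
 have "(1 + norm x)^2 * cmod (f x) <= 4 * (A + B) * wt x" for x
  using mult_right_mono[OF one_plus_power_le[OF norm_ge_zero[of x], of 2] norm_ge_zero[of "f x"]] A(2)[of x] B(2)[of x] by (simp add: algebra_simps)
 thus ?thesis using A B by (intro exI[of _ "4 * (A + B)"]) simp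
qed

lemma pg_integrable:
 fixes k :: "(real^'n) \<times> (real^'n) => complex"
 assumes k: "cts k" "pg {r} 2 (%_. k)" and f: "f \<in> schwartz" and p: "p \<in> schwartz"
 shows "lint (%z. k z * (f (snd z) * p (fst z)))"
proof -
 obtain K where K: "0 <= K" "!!z. cmod (k z) <= K * ((1 + norm (fst z)) * (1 + norm (snd z)))^2" using k(2) unfolding pg_def by blast
 obtain C where C: "0 <= C" "!!x. (1 + norm x)^2 * cmod (f x) <= C * wt x" using schwartz_wt2[OF f] by blast
 obtain C' where C': "0 <= C'" "!!x. (1 + norm x)^2 * cmod (p x) <= C' * wt x" using schwartz_wt2[OF p] by blast
 show ?thesis by (rule poly_weight_integrable(3)[OF K C C']) (use schwartz_basic(2) f p borel_measurable_continuous_onI[OF k(1)] in auto)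
qed

text \<open>Two integrations by parts at once: the difference of the integrands is the derivative in
  x_i of k1 f q - k0 f d_i q, to which \<open>integral_partial_derivative_zero\<close>
  applies.\<close>

lemma green_identity:
 fixes k0 k1 k2 :: "(real^'n) \<times> (real^'n) => complex"
 assumes d: "!!x y. ((%h. k0 (x + h *R axis i 1, y)) hvd k1 (x, y)) (at 0)"
   "!!x y. ((%h. k1 (x + h *R axis i 1, y)) hvd k2 (x, y)) (at 0)"
  and c: "cts k0" "cts k1" "cts k2"
  and b: "pg {r} 2 (%_. k0)" "pg {r} 2 (%_. k1)" "pg {r} 2 (%_. k2)"
  and f: "f \<in> schwartz" and q: "q \<in> schwartz"
 shows "(LBINT z. k2 z * (f (snd z) * q (fst z))) = (LBINT z. k0 z * (f (snd z) * pd i (pd i q) (fst z)))"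
proof -
 note I = pg_integrable[OF _ _ f]
 note q' = schwartzD(3)[OF q, of i] note q'' = schwartzD(3)[OF q', of i]
 define F where "F = (%z. k1 z * (f (snd z) * q (fst z)) - k0 z * (f (snd z) * pd i q (fst z)))"
 define F' where "F' = (%z. k2 z * (f (snd z) * q (fst z)) - k0 z * (f (snd z) * pd i (pd i q) (fst z)))"
 have "(LBINT z. F' z) = 0"
 proof (rule integral_partial_derivative_zero[where e="(axis i 1, 0)" and F=F])
  fix z :: "(real^'n) \<times> (real^'n)"
  obtain x y where z: "z = (x, y)" by fastforce
  note s = schwartzD(4)[OF q, of x i] schwartzD(4)[OF q', of x i]
  have "((%h. k1 (x + h *R axis i 1, y) * (f y * q (x + h *R axis i 1)) - k0 (x + h *R axis i 1, y) * (f y * pd i q (x + h *R axis i 1)))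
   hvd (k1 (x + 0 *R axis i 1, y) * (f y * pd i q x) + k2 (x, y) * (f y * q (x + 0 *R axis i 1))) -
    (k0 (x + 0 *R axis i 1, y) * (f y * pd i (pd i q) x) + k1 (x, y) * (f y * pd i q (x + 0 *R axis i 1)))) (at 0)"
   by (intro has_vector_derivative_diff has_vector_derivative_mult has_vector_derivative_mult_right s d)
  thus "((%h. F (z + h *R (axis i 1, 0))) hvd F' z) (at 0)" unfolding F_def F'_def z by (simp add: algebra_simps)
 next
  note cs = schwartzD(1)[OF f] schwartzD(1)[OF q] schwartzD(1)[OF q']  schwartzD(1)[OF q'']
  show "cts F'" unfolding F'_def
   by (intro continuous_intros c continuous_on_compose2[OF cs(1)] continuous_on_compose2[OF cs(2)] continuous_on_compose2[OF cs(4)]) auto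
  show "lint F" unfolding F_def by (rule Bochner_Integration.integrable_diff[OF I[OF c(2) b(2) q] I[OF c(1) b(1) q']])
  show "lint F'" unfolding F'_def by (rule Bochner_Integration.integrable_diff[OF I[OF c(3) b(3) q] I[OF c(1) b(1) q'']])
 qed
 thus ?thesis unfolding F'_def using Bochner_Integration.integral_diff[OF I[OF c(3) b(3) q] I[OF c(1) b(1) q'']] by simp
qed

section \<open>The approximate kernel and its defect\<close>

context potential
begin

definition dW :: "real => real => nat => 'n => (real^'n) \<times> (real^'n) => complex" where
 "dW hbar s k i z = pd i (%x. aW hbar s k (x, snd z)) (fst z)"

definition ddW :: "real => real => nat => 'n => (real^'n) \<times> (real^'n) => complex" where
 "ddW hbar s k i z = pd i (%x. dW hbar s k i (x, snd z)) (fst z)"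

lemma laplacian_aW: "laplacian (%x. aW hbar s k (x, y)) x = (\<Sum>i\<in>UNIV. ddW hbar s k i (x, y))" unfolding laplacian_def ddW_def dW_def[abs_def] by simp

lemma transport:
 assumes k: "1 <= k" "k <= N" and h: "0 < hbar" "hbar <= 1"
 shows "of_nat k * aW hbar s k (x, y) + (\<Sum>i\<in>UNIV. of_real ((x - y)$i) * dW hbar s k i (x, y)) = aF hbar s k (x, y)"
proof -
 obtain B where "good (2 * N - 2 * (k - 1)) B (aF hbar s k)" using W_good[of thesis] k h by blast
 moreover obtain m where m: "2 * N - 2 * (k - 1) = Suc m" using k by (cases "2 * N - 2 * (k - 1)") auto
 ultimately have "good (Suc m) B (aF hbar s k)" by simp
 then obtain a' where a': "!!i. good m B (a' i)"
  "!!i x y. ((%h. aF hbar s k (x + h *R axis i 1, y)) hvd a' i (x, y)) (at 0)"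
  and c: "ccls B (aF hbar s k)" by (metis goodE good_ccls)
 obtain j where j: "k = Suc j" using k(1) by (cases k) auto
 have W: "aW hbar s k = segint j (aF hbar s k)" using aW_Suc[of B hbar s j] c by (simp add: j)
 have "dW hbar s k i (x, y) = segint (Suc j) (a' i) (x, y)" for i unfolding dW_def fst_conv snd_conv W by (rule pd_eq segint_derivative c good_ccls a')+
 thus ?thesis using transport_equation[OF c good_ccls[OF a'(1)] a'(2), of j x y] unfolding W by (simp add: j)
qed

end

text \<open>The initial time and hbar are frozen. Two derivatives of each W_k are kept, as the
  Schroedinger operator applied to the kernel requires.\<close>

locale slice = potential V N D B0 for V :: "real => real^('n::finite) => real" and N D B0 +
 fixes B hbar s :: real
 assumes h: "0 < hbar" "hbar <= 1" and B: "0 <= B" and Wg: "!!k. k <= N ==> good 2 B (aW hbar s k)"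
begin

abbreviation "W \<equiv> aW hbar s"

lemma good_dW: "k <= N ==> good 1 B (dW hbar s k i)" using good_pd(1)[of 1 B "W k" i] Wg[of k] by (simp add: dW_def[abs_def] numeral_2_eq_2)

lemma good_ddW: "k <= N ==> good 0 B (ddW hbar s k i)" using good_pd(1)[of 0 B "dW hbar s k i" i] good_dW[of k i] by (simp add: ddW_def[abs_def])

lemma W_derivative: "k <= N ==> ((%h. W k (x + h *R axis i 1, y)) hvd dW hbar s k i (x, y)) (at 0)"
 using good_pd(2)[of 1 B "W k" x i y] Wg[of k] by (simp add: dW_def numeral_2_eq_2)

lemma dW_derivative: "k <= N ==> ((%h. dW hbar s k i (x + h *R axis i 1, y)) hvd ddW hbar s k i (x, y)) (at 0)"
 using good_pd(2)[of 0 B "dW hbar s k i" x i y] good_dW[of k i] by (simp add: ddW_def)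

text \<open>\<open>ta\<close> is the elapsed time and \<open>ph\<close> the action beyond |x - y|^2
  / (2 ta); \<open>dph\<close>, \<open>ddph\<close> and \<open>pht\<close> are its derivatives.
  \<open>q1\<close>, \<open>q2\<close> and \<open>qt\<close> multiply \<open>kern\<close> in its
  first and second space derivatives and its time derivative. \<open>Vs\<close> is the Taylor
  polynomial of the potential at time s, and \<open>rm\<close> collects the terms of order at least
  N left over by the recursion.\<close>

definition "ph ta z = (\<Sum>k=1..N. W k z * of_real (ta ^ k))"
definition "dph i ta z = (\<Sum>k=1..N. dW hbar s k i z * of_real (ta ^ k))"
definition "ddph i ta z = (\<Sum>k=1..N. ddW hbar s k i z * of_real (ta ^ k))"
definition "pht ta z = (\<Sum>k=1..N. W k z * of_real (real k * ta ^ (k - 1)))"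
definition zt :: "real => complex" where "zt ta = \<i> * of_real (hbar * ta / 2)"
definition "kern ta z = heat (zt ta) (fst z - snd z) * exp (\<i> / of_real hbar * ph ta z)"
definition "q1 i ta z = - of_real ((fst z - snd z)$i) / (2 * zt ta) + \<i> / of_real hbar * dph i ta z"
definition "q2 i ta z = q1 i ta z * q1 i ta z + (- 1 / (2 * zt ta) + \<i> / of_real hbar * ddph i ta z)"
definition "qt ta z = \<i> * of_real (hbar / 2) * (of_real ((fst z - snd z) \<bullet> (fst z - snd z)) / (4 * (zt ta)\<^sup>2) - of_nat CARD('n) / (2 * zt ta))
 + \<i> / of_real hbar * pht ta z"
definition "Vs ta x = (\<Sum>k<N. ta ^ k / fact k * D k (%_. 0) s x)"
definition "rm ta z = - (1 / 2) * (\<Sum>p\<in>{p \<in> {1..N} \<times> {1..N}. N <= fst p + snd p}. (\<Sum>i\<in>UNIV. dW hbar s (fst p) i z * dW hbar s (snd p) i z) * of_real (ta ^ (fst p + snd p)))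
 + \<i> * of_real hbar / 2 * ((\<Sum>i\<in>UNIV. ddW hbar s N i z) * of_real (ta ^ N))"

lemma zt_nonzero: "0 < ta ==> zt ta \<noteq> 0" using h by (simp add: zt_def)

lemma transport_sum:
 assumes "0 < ta"
 shows "pht ta (x, y) + (\<Sum>i\<in>UNIV. of_real ((x - y)$i) * dph i ta (x, y)) / of_real ta = (\<Sum>k=1..N. aF hbar s k (x, y) * of_real (ta ^ (k - 1)))"
proof -
 let ?A = "%i. of_real ((x - y)$i)"
 let ?B = "%k. of_real (ta ^ (k - 1))"
 have "(\<Sum>i\<in>UNIV. ?A i * dph i ta (x, y)) / ta = (\<Sum>i\<in>UNIV. \<Sum>k=1..N. ?A i * dW hbar s k i (x, y) * ?B k)"
  unfolding dph_def sum_divide_distrib sum_distrib_left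
 proof (intro sum.cong refl)
  fix i :: 'n and k assume "k \<in> {1..N}"
  hence "ta ^ k = ta * ta ^ (k - 1)" by (cases k) auto
  thus "?A i * (dW hbar s k i (x, y) * of_real (ta ^ k)) / ta = ?A i * dW hbar s k i (x, y) * ?B k"
   using assms by (simp del: vector_minus_component)
 qed
 also have "... = (\<Sum>k=1..N. (\<Sum>i\<in>UNIV. ?A i * dW hbar s k i (x, y)) * ?B k)"
  unfolding sum_distrib_right by (rule sum.swap)
 finally have "pht ta (x, y) + (\<Sum>i\<in>UNIV. ?A i * dph i ta (x, y)) / ta =
  (\<Sum>k=1..N. (of_nat k * W k (x, y) + (\<Sum>i\<in>UNIV. ?A i * dW hbar s k i (x, y))) * ?B k)"
  unfolding pht_def distrib_right sum.distrib by (simp add: mult_ac)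
 also have "... = (\<Sum>k=1..N. aF hbar s k (x, y) * ?B k)" by (intro sum.cong refl arg_cong2[where f="(*)"] transport h) auto
 finally show ?thesis .
qed

text \<open>Comparison of powers of \<open>ta\<close>: the transport equations cancel every power
  below N except the Taylor coefficients of the potential. What survives are the gradient products
  with j + l >= N and the Laplacian of W_N.\<close>

lemma hamilton_jacobi:
 assumes t: "0 < ta"
 shows "- pht ta z - (\<Sum>i\<in>UNIV. of_real ((fst z - snd z)$i) * dph i ta z) / of_real ta - (1 / 2) * (\<Sum>i\<in>UNIV. dph i ta z * dph i ta z)
  + \<i> * of_real hbar / 2 * (\<Sum>i\<in>UNIV. ddph i ta z) = of_real (Vs ta (fst z)) + rm ta z"
proof -
 obtain x y where z: "z = (x, y)" by fastforce
 define g where "g = (%p. (\<Sum>i\<in>UNIV. dW hbar s (fst p) i z * dW hbar s (snd p) i z) * of_real (ta ^ (fst p + snd p)))"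
 define L where "L = (%k. (\<Sum>i\<in>UNIV. ddW hbar s k i z) * of_real (ta ^ k))"
 have L0: "L 0 = 0" unfolding L_def ddW_def dW_def[abs_def] aW_0 by (simp add: pd_zero)
 let ?B = "\<Sum>i\<in>UNIV. dph i ta z * dph i ta z"
 have 1: "?B = (\<Sum>p\<in>{p \<in> {1..N} \<times> {1..N}. fst p + snd p < N}. g p) + (\<Sum>p\<in>{p \<in> {1..N} \<times> {1..N}. N <= fst p + snd p}. g p)"
 proof -
  have "?B = (\<Sum>i\<in>UNIV. \<Sum>p\<in>{1..N} \<times> {1..N}. dW hbar s (fst p) i z * dW hbar s (snd p) i z * of_real (ta ^ (fst p + snd p)))"
   unfolding dph_def sum_product sum.cartesian_product by (intro sum.cong refl) (auto simp: power_add)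
  also have "... = (\<Sum>p\<in>{1..N} \<times> {1..N}. g p)" unfolding g_def sum_distrib_right by (rule sum.swap)
  also have "{1..N} \<times> {1..N} = {p \<in> {1..N} \<times> {1..N}. fst p + snd p < N} \<union> {p \<in> {1..N} \<times> {1..N}. N <= fst p + snd p}" by auto
  also have "(\<Sum>p\<in>.... g p) = (\<Sum>p\<in>{p \<in> {1..N} \<times> {1..N}. fst p + snd p < N}. g p) + (\<Sum>p\<in>{p \<in> {1..N} \<times> {1..N}. N <= fst p + snd p}. g p)"
   by (rule sum.union_disjoint) auto
  finally show ?thesis .
 qed
 \<comment> \<open>For j + l < N the restriction j, l <= N is automatic, so grouping by the sum
   gives exactly \<open>pairs m\<close>.\<close>
 have 2: "(\<Sum>m<N. \<Sum>p\<in>pairs m. g p) = (\<Sum>p\<in>{p \<in> {1..N} \<times> {1..N}. fst p + snd p < N}. g p)"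
 proof -
  have "{p \<in> {p \<in> {1..N} \<times> {1..N}. fst p + snd p < N}. fst p + snd p = m} = pairs m" if "m < N" for m using that by (auto simp: pairs_def)
  thus ?thesis by (subst sum.group[where T="{..<N}" and g="%p. fst p + snd p", symmetric]) (auto intro!: sum.cong)
 qed
 have 3: "(\<Sum>i\<in>UNIV. ddph i ta z) = (\<Sum>k<N. L k) + L N"
 proof -
  have "(\<Sum>i\<in>UNIV. ddph i ta z) = (\<Sum>k=1..N. L k)" unfolding ddph_def L_def sum_distrib_right by (rule sum.swap)
  also have "... = (\<Sum>k\<le>N. L k)" using L0 sum.atLeast_Suc_atMost[of 0 N L] by (simp add: atMost_atLeast0)
  finally show ?thesis by (simp add: lessThan_Suc_atMost[symmetric])
 qed
 let ?A = "\<Sum>k=1..N. aF hbar s k z * of_real (ta ^ (k - 1))"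
 have 4: "?A = (\<Sum>m<N. - (1 / 2) * (\<Sum>p\<in>pairs m. g p) - of_real (ta ^ m / fact m * D m (%_. 0) s x) + \<i> * hbar / 2 * L m)"
 proof -
  have "?A = (\<Sum>m<N. aF hbar s (Suc m) z * of_real (ta ^ m))"
   by (rule sum.reindex_bij_witness[of _ Suc "%k. k - 1"]) auto
  also have "... = (\<Sum>m<N. - (1 / 2) * (\<Sum>p\<in>pairs m. g p) - of_real (ta ^ m / fact m * D m (%_. 0) s x) + \<i> * hbar / 2 * L m)"
  proof (intro sum.cong refl)
   fix m assume m: "m \<in> {..<N}"
   have e1: "(\<Sum>p\<in>pairs m. g p) = (\<Sum>p\<in>pairs m. \<Sum>i\<in>UNIV. dW hbar s (fst p) i z * dW hbar s (snd p) i z) * of_real (ta ^ m)"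
    unfolding g_def sum_distrib_right by (intro sum.cong refl) (auto simp: pairs_def)
   have e2: "aF hbar s (Suc m) z = - (1 / 2) * (\<Sum>p\<in>pairs m. \<Sum>i\<in>UNIV. dW hbar s (fst p) i z * dW hbar s (snd p) i z)
     - of_real (1 / fact m * D m (%_. 0) s x) + \<i> * hbar / 2 * (\<Sum>i\<in>UNIV. ddW hbar s m i z)"
    using m by (subst aF_Suc) (auto simp: dW_def z laplacian_aW)
   show "aF hbar s (Suc m) z * of_real (ta ^ m) = - (1 / 2) * (\<Sum>p\<in>pairs m. g p) - of_real (ta ^ m / fact m * D m (%_. 0) s x) + \<i> * hbar / 2 * L m"
    unfolding e1 e2 L_def by (simp add: algebra_simps)
  qed
  finally show ?thesis .
 qed
 have 5: "pht ta z + (\<Sum>i\<in>UNIV. of_real ((fst z - snd z)$i) * dph i ta z) / ta = - (1 / 2) * (\<Sum>m<N. \<Sum>p\<in>pairs m. g p) - of_real (Vs ta x) + \<i> * hbar / 2 * (\<Sum>k<N. L k)"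
  using transport_sum[OF t, of x y] 4 unfolding Vs_def z by (simp add: sum.distrib sum_subtractf sum_distrib_left sum_negf)
 have R: "rm ta z = - (1 / 2) * (\<Sum>p\<in>{p \<in> {1..N} \<times> {1..N}. N <= fst p + snd p}. g p) + \<i> * hbar / 2 * L N"
  unfolding rm_def g_def L_def ..
 have "- (p + q) - (1 / 2) * (a + b) + c * (l + l') = v + (- (1 / 2) * b + c * l')" if "p + q = - (1 / 2) * a - v + c * l" for p q a b c l l' v :: complex
  unfolding that by (simp add: algebra_simps)
 from this[OF 5[unfolded 2]] show ?thesis unfolding 1 3 R by (simp add: z)
qed

text \<open>The singular terms in |x - y|^2 / ta^2 and 1 / ta cancel because the heat factor solves
  the free equation. The cross term in the square of \<open>q1\<close> supplies (x - y) . grad ph /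
  ta, the transport part of the Hamilton-Jacobi equation.\<close>

lemma schroedinger_defect:
 assumes t: "0 < ta"
 shows "\<i> * of_real hbar * qt ta z + of_real (hbar^2 / 2) * (\<Sum>i\<in>UNIV. q2 i ta z) = of_real (Vs ta (fst z)) + rm ta z"
proof -
 define d where "d = (%i. (fst z - snd z)$i)"
 have dd: "(\<Sum>i\<in>UNIV. of_real (d i) * of_real (d i)) = (of_real ((fst z - snd z) \<bullet> (fst z - snd z)) :: complex)" unfolding d_def inner_vec_def by simp
 have z: "zt ta = \<i> * hbar * ta / 2" by (simp add: zt_def)
 have n0: "of_real hbar \<noteq> (0 :: complex)" "of_real ta \<noteq> (0 :: complex)" using h t by auto
 let ?A = "of_real (hbar^2 / 2)"
 have q: "?A * q2 i ta z = ?A * (of_real (d i) * of_real (d i) / (4 * (zt ta)^2) - 1 / (2 * zt ta))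
   - of_real (d i) * dph i ta z / ta - (1 / 2) * (dph i ta z * dph i ta z) + \<i> * hbar / 2 * ddph i ta z" for i
  unfolding q2_def q1_def z d_def[symmetric] using n0 by (simp add: field_simps power2_eq_square)
 let ?B = "of_real ((fst z - snd z) \<bullet> (fst z - snd z)) / (4 * (zt ta)^2) - of_nat CARD('n) / (2 * zt ta)"
 have s: "?A * (\<Sum>i\<in>UNIV. q2 i ta z) = ?A * ?B
   - (\<Sum>i\<in>UNIV. of_real (d i) * dph i ta z) / ta - (1 / 2) * (\<Sum>i\<in>UNIV. dph i ta z * dph i ta z) + \<i> * hbar / 2 * (\<Sum>i\<in>UNIV. ddph i ta z)"
  unfolding sum_distrib_left[of _ "%i. q2 i ta z"] q dd[symmetric]
  by (simp add: sum.distrib sum_subtractf sum_distrib_left sum_divide_distrib right_diff_distrib)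
 define A where "A = ?A * ?B"
 have e: "\<i> * hbar * (\<i> * of_real (hbar / 2) * X + \<i> / hbar * P) = - (?A * X) - P" for X P
  using n0 by (simp add: field_simps power2_eq_square)
 have qq: "\<i> * hbar * qt ta z = - A - pht ta z" unfolding qt_def e A_def ..
 have c: "- a - p + (a - s' - q' + l') = - p - s' - q' + l'" for a p s' q' l' :: complex by simp
 show ?thesis unfolding qq s A_def[symmetric] c using hamilton_jacobi[OF t, of z] unfolding d_def .
qed

end

lemma pg_exp: "pg I 0 g ==> pg I 0 (%ta z. exp (g ta z))"
proof -
 assume "pg I 0 g"
 then obtain K where K: "!!ta z. ta \<in> I ==> cmod (g ta z) <= K" unfolding pg_def by auto
 have "cmod (exp (g ta z)) <= exp K" if "ta \<in> I" for ta z using complex_Re_le_cmod[of "g ta z"] K[OF that, of z] by (simp add: norm_exp_eq_Re)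
 thus ?thesis unfolding pg_def by (intro exI[of _ "exp K"]) simp
qed

context slice
begin

lemma ph_derivative: "((%h. ph ta (x + h *R axis i 1, y)) hvd dph i ta (x, y)) (at 0)"
 unfolding ph_def dph_def by (intro has_vector_derivative_sum has_vector_derivative_mult_left W_derivative) simp

lemma dph_derivative: "((%h. dph i ta (x + h *R axis i 1, y)) hvd ddph i ta (x, y)) (at 0)"
 unfolding dph_def ddph_def by (intro has_vector_derivative_sum has_vector_derivative_mult_left dW_derivative) simp

lemma kern_dx:
 assumes "0 < ta"
 shows "((%h. kern ta (x + h *R axis i 1, y)) hvd q1 i ta (x, y) * kern ta (x, y)) (at 0)"
 using has_vector_derivative_mult[OF heat_line_derivative[OF zt_nonzero[OF assms], of x i y]
   has_vector_derivative_cexp[OF has_vector_derivative_mult_right[OF ph_derivative[of ta x i y], of "\<i> / of_real hbar"]]]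
 unfolding kern_def q1_def by (simp add: algebra_simps)

lemma kern_dxx:
 assumes "0 < ta"
 shows "((%h. q1 i ta (x + h *R axis i 1, y) * kern ta (x + h *R axis i 1, y)) hvd q2 i ta (x, y) * kern ta (x, y)) (at 0)"
proof -
 have "((%h. - of_real ((x - y)$i + h) / (2 * zt ta)) hvd - 1 / (2 * zt ta)) (at 0)" unfolding has_vector_derivative_def
  by (rule derivative_eq_intros refl)+ (auto simp: zt_nonzero[OF assms] fun_eq_iff algebra_simps scaleR_conv_of_real)
 moreover have "(x + h *R axis i 1 - y)$i = (x - y)$i + h" for h by (simp add: axis_def)
 ultimately have "((%h. q1 i ta (x + h *R axis i 1, y)) hvd - 1 / (2 * zt ta) + \<i> / hbar * ddph i ta (x, y)) (at 0)"
  unfolding q1_def fst_conv snd_conv by (intro has_vector_derivative_add has_vector_derivative_mult_right dph_derivative) (simp only:)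
 from has_vector_derivative_mult[OF this kern_dx[OF assms, of x i y]] show ?thesis unfolding q2_def by (simp add: distrib_right mult.assoc)
qed

lemma kern_dt:
 assumes "0 < ta"
 shows "((%ta. kern ta z) hvd qt ta z * kern ta z) (at ta)"
proof -
 have z: "zt ta \<notin> \<real>\<^sub>\<le>\<^sub>0" using assms h by (simp add: zt_def complex_nonpos_Reals_iff)
 have "(zt hvd \<i> * of_real (hbar / 2)) (at ta)"
  unfolding zt_def[abs_def] by (intro has_vector_derivative_mult_right has_vector_derivative_of_real)
   (auto intro!: derivative_eq_intros simp: has_real_derivative_iff_has_vector_derivative[symmetric])
 from field_vector_diff_chain_at[OF this heat_parameter_derivative[OF z, of "fst z - snd z"]]
 have 1: "((%ta. heat (zt ta) (fst z - snd z)) hvd \<i> * of_real (hbar / 2) * lapheat (zt ta) (fst z - snd z)) (at ta)"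
  by (simp add: o_def)
 have "((%ta. W k z * of_real (ta ^ k)) hvd W k z * of_real (real k * ta ^ (k - 1))) (at ta)" for k
  by (intro has_vector_derivative_mult_right has_vector_derivative_of_real) (auto intro!: derivative_eq_intros simp: has_real_derivative_iff_has_vector_derivative[symmetric])
 hence "((%ta. ph ta z) hvd pht ta z) (at ta)" unfolding ph_def pht_def by (intro has_vector_derivative_sum)
 from has_vector_derivative_mult[OF 1 has_vector_derivative_cexp[OF has_vector_derivative_mult_right[OF this, of "\<i> / of_real hbar"]]]
 show ?thesis unfolding kern_def qt_def lapheat_def by (simp add: algebra_simps)
qed

lemma ccls_W: "k <= N ==> ccls B (W k)" "k <= N ==> ccls B (dW hbar s k i)" "k <= N ==> ccls B (ddW hbar s k i)"
 using good_ccls Wg good_dW good_ddW by blast+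

lemmas continuous_W = ccls_W[THEN ccls_def[THEN iffD1, THEN conjunct1]]

lemma kern_continuous: "cts (kern ta)" "cts (q1 i ta)" "cts (q2 i ta)" "cts (qt ta)"
proof -
 have p: "cts (ph ta)" "cts (dph i ta)" "cts (ddph i ta)" "cts (pht ta)"
  unfolding ph_def[abs_def] dph_def[abs_def] ddph_def[abs_def] pht_def[abs_def] by (intro continuous_intros continuous_W; simp)+
 show "cts (kern ta)" "cts (q1 i ta)" "cts (q2 i ta)" "cts (qt ta)"
  unfolding kern_def[abs_def] q1_def[abs_def] q2_def[abs_def] qt_def[abs_def] divide_inverse by (intro continuous_intros continuous_on_heat p)+
qed

lemma kern_pg:
 assumes a: "0 < a"
 shows "pg {a..b} 2 kern" "pg {a..b} 2 (%ta z. q1 i ta z * kern ta z)" "pg {a..b} 2 (%ta z. q2 i ta z * kern ta z)" "pg {a..b} 2 (%ta z. qt ta z * kern ta z)"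
proof -
 have c: "pg {a..b} 0 (%ta z. c ta)" if "continuous_on {a..b} c" for c :: "real => complex" by (rule pg_const[OF that compact_Icc])
 have m: "pg {a..b} p (%ta z. c ta * g ta z)" if "continuous_on {a..b} c" "pg {a..b} p g" for c :: "real => complex" and g :: "_ => (real^'n) \<times> (real^'n) => _" and p
  using pg_mult[OF c[OF that(1)] that(2)] by simp
 have zc: "continuous_on {a..b} (%ta. 1 / (2 * zt ta))" "continuous_on {a..b} (%ta. 1 / (4 * (zt ta)^2))"
  using zt_nonzero a unfolding zt_def by (intro continuous_intros; fastforce simp: h less_imp_neq[THEN not_sym])+
 have s: "pg {a..b} 0 (%ta z. \<Sum>k=1..N. g k z * of_real (p k ta))" if "!!k. k <= N ==> ccls B (g k)" "!!k. continuous_on {a..b} (p k)" for g :: "nat => (real^'n) \<times> (real^'n) => complex" and p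
 proof (intro pg_sum)
  fix k assume "k \<in> {1..N}"
  hence "pg {a..b} 0 (%ta. g k)" by (intro pg_bounded[of _ B] ccls_bound that) simp
  from m[OF _ this, of "%ta. of_real (p k ta)"] show "pg {a..b} 0 (%ta z. g k z * of_real (p k ta))"
   using that(2)[of k] by (simp add: mult.commute continuous_on_of_real)
 qed simp
 have p: "pg {a..b} 0 ph" "pg {a..b} 0 (dph i)" "pg {a..b} 0 (ddph i)" "pg {a..b} 0 pht"
  unfolding ph_def[abs_def] dph_def[abs_def] ddph_def[abs_def] pht_def[abs_def] by (intro s ccls_W continuous_intros; assumption)+
 let ?A = "2 * sqrt (pi * (hbar * a / 2))"
 have "pg {a..b} 0 (%ta (z :: (real^'n) \<times> (real^'n)). heat (zt ta) (fst z - snd z))" unfolding pg_def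
 proof (intro exI[of _ "1 / ?A ^ CARD('n)"] conjI ballI allI)
  fix ta and z :: "(real^'n) \<times> (real^'n)" assume t: "ta \<in> {a..b}"
  hence n: "cmod (zt ta) = hbar * ta / 2" using h a by (simp add: zt_def norm_mult)
  have "1 / (2 * sqrt (pi * (hbar * ta / 2))) ^ CARD('n) <= 1 / ?A ^ CARD('n)"
   using t h a by (intro divide_left_mono power_mono mult_left_mono real_sqrt_le_mono mult_pos_pos zero_less_power) auto
  thus "cmod (heat (zt ta) (fst z - snd z)) <= 1 / ?A ^ CARD('n) * ((1 + norm (fst z)) * (1 + norm (snd z))) ^ 0"
   unfolding norm_heat n by (simp add: zt_def)
 qed (use h a in simp)
 from pg_mult[OF this pg_exp[OF m[OF continuous_on_const p(1)]]] have k: "pg {a..b} 0 kern" unfolding kern_def[abs_def] by (simp only: add_0_left)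
 have q1: "pg {a..b} 1 (q1 i)"
 proof -
  have "pg {a..b} 1 (%ta z. - (1 / (2 * zt ta)) * of_real ((fst z - snd z)$i) + \<i> / hbar * dph i ta z)"
   by (intro pg_add m[OF continuous_on_const] m[OF continuous_on_minus[OF zc(1)]] pg_diff_coord pg_mono[OF p(2), of 1]) simp
  moreover have "- (1 / (2 * zt ta)) * d + X = - d / (2 * zt ta) + X" for ta d X by simp
  ultimately show ?thesis unfolding q1_def[abs_def] by (simp only:)
 qed
 have q2: "pg {a..b} 2 (q2 i)"
 proof -
  have "pg {a..b} 2 (%ta z. q1 i ta z * q1 i ta z + (- (1 / (2 * zt ta)) + \<i> / hbar * ddph i ta z))"
   by (intro pg_add pg_mult[OF q1 q1, unfolded one_add_one] m[OF continuous_on_const] pg_mono[OF c[OF continuous_on_minus[OF zc(1)]], of 2] pg_mono[OF p(3), of 2]) auto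
  thus ?thesis unfolding q2_def[abs_def] minus_divide_left .
 qed
 have qt: "pg {a..b} 2 qt"
 proof -
  have "pg {a..b} 2 (%ta z. \<i> * of_real (hbar / 2) * (1 / (4 * (zt ta)^2) * of_real ((fst z - snd z) \<bullet> (fst z - snd z)) + - of_nat CARD('n) * (1 / (2 * zt ta))) + \<i> / hbar * pht ta z)"
   by (intro pg_add m[OF continuous_on_const] m[OF zc(2)] pg_diff_coord pg_mono[OF c, of _ 2] pg_mono[OF p(4)] continuous_on_mult continuous_on_const zc) auto
  thus ?thesis unfolding qt_def[abs_def] by simp
 qed
 show "pg {a..b} 2 kern" by (rule pg_mono[OF k]) simp
 show "pg {a..b} 2 (%ta z. q1 i ta z * kern ta z)" using pg_mono[OF pg_mult[OF q1 k], of 2] by simp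
 show "pg {a..b} 2 (%ta z. q2 i ta z * kern ta z)" "pg {a..b} 2 (%ta z. qt ta z * kern ta z)"
  using pg_mult[OF q2 k] pg_mult[OF qt k] by simp_all
qed

abbreviation "wave t ps r \<equiv> comb (shift (hbar / 2 * (t - r)) ps)"

text \<open>The test function is the free wave equal to \<open>comb ps\<close> at time t. Its time
  derivative carries a Laplacian, which \<open>green_identity\<close> moves to the kernel, and
  \<open>schroedinger_defect\<close> evaluates the result; no differential operator is left.\<close>

lemma kern_pairing_derivative:
 assumes ps: "okc ps" and f: "f \<in> schwartz" and r: "s < r"
 shows "\<exists>F'. ((%r. \<integral>z. kern (r - s) z * (f (snd z) * wave t ps r (fst z)) \<partial>lborel) hvd F') (at r) \<and>
  \<i> * of_real hbar * F' = (LBINT z. (of_real (Vs (r - s) (fst z)) + rm (r - s) z) * (kern (r - s) z * (f (snd z) * wave t ps r (fst z))))"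
proof -
 define c where "c = hbar / 2"
 define d where "d = (r - s) / 2"
 have d: "0 < d" using r by (simp add: d_def)
 have ok: "okc (shift et ps)" for et using ps by simp
 have sw: "wave t ps r' \<in> schwartz" for r' by (rule gp_schwartz[OF gp_comb[OF ok]])
 have sl: "laplacian (wave t ps r') \<in> schwartz" for r' by (rule gp_schwartz[OF gp_laplacian[OF gp_comb[OF ok]]])
 have kc: "cts (%z. qt ta z * kern ta z)" "cts (%z. q2 i ta z * kern ta z)" "cts (%z. q1 i ta z * kern ta z)" for ta i
  by (intro continuous_intros kern_continuous)+
 let ?F = "%z r. f (snd z) * wave t ps r (fst z)"
 have pr: "pg {ta} 2 (%_. g ta)" if "pg {a..b} 2 g" "ta \<in> {a..b}" for a b ta and g :: "real => (real^'n) \<times> (real^'n) => complex"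
  using that unfolding pg_def by blast
 let ?f = "%r z. kern (r - s) z * (f (snd z) * wave t ps r (fst z))"
 let ?f' = "%r z. qt (r - s) z * kern (r - s) z * (?F z r) + (- \<i> * c) * (kern (r - s) z * (f (snd z) * laplacian (wave t ps r) (fst z)))"
 have near: "r' - s \<in> {d..3 * d}" if "\<bar>r' - r\<bar> < d" for r' proof -
  have "r' - r < d" "r - r' < d" using that by auto
  thus ?thesis unfolding d_def atLeastAtMost_iff by (simp add: field_simps)
 qed
 obtain K1 where K1: "0 <= K1" "!!ta z. ta \<in> {d..3 * d} ==> cmod (kern ta z) <= K1 * ((1 + norm (fst z)) * (1 + norm (snd z)))^2"
  using kern_pg(1)[OF d, of "3 * d"] unfolding pg_def by blast
 obtain K2 where K2: "0 <= K2" "!!ta z. ta \<in> {d..3 * d} ==> cmod (qt ta z * kern ta z) <= K2 * ((1 + norm (fst z)) * (1 + norm (snd z)))^2"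
  using kern_pg(4)[OF d, of "3 * d"] unfolding pg_def by blast
 obtain Cf where Cf: "0 <= Cf" "!!y. (1 + norm y)^2 * cmod (f y) <= Cf * wt y" using schwartz_wt2[OF f] by blast
 let ?D = "\<bar>t - r\<bar> + d"
 obtain Cp where Cp: "0 <= Cp" "!!et x. \<bar>et\<bar> <= \<bar>c\<bar> * ?D ==> (1 + norm x)\<^sup>2 * cmod (comb (shift et ps) x) <= Cp * wt x"
  "!!et x. \<bar>et\<bar> <= \<bar>c\<bar> * ?D ==> (1 + norm x)\<^sup>2 * cmod (laplacian (comb (shift et ps)) x) <= Cp * wt x"
  using comb_wt[OF ps, of "\<bar>c\<bar> * ?D" 2] by blast
 have en: "\<bar>hbar / 2 * (t - r')\<bar> <= \<bar>c\<bar> * ?D" if "\<bar>r' - r\<bar> < d" for r'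
  unfolding abs_mult c_def[symmetric] using that by (intro mult_left_mono) auto
 let ?g = "%z :: (real^'n) \<times> (real^'n). K2 * Cf * Cp * (wt (snd z) * wt (fst z)) + \<bar>c\<bar> * (K1 * Cf * Cp * (wt (snd z) * wt (fst z)))"
 have der: "((%r. \<integral>z. ?f r z \<partial>lborel) hvd (LBINT z. ?f' r z)) (at r)"
 proof (rule has_vector_derivative_integral(1)[OF d, where g="?g"])
  fix r' assume r': "\<bar>r' - r\<bar> < d"
  hence p: "0 < r' - s" using near[OF r'] d by auto
  show "lint (?f r')" by (rule pg_integrable[OF kern_continuous(1) pr[OF kern_pg(1)[OF d] near[OF r']] f sw])
  fix z :: "(real^'n) \<times> (real^'n)"
  have "((%r. r - s) hvd 1) (at r')" unfolding has_vector_derivative_def by (rule derivative_eq_intros refl)+ auto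
  from vector_diff_chain_at[OF this kern_dt[OF p, of z]]
  have 1: "((%r. kern (r - s) z) hvd qt (r' - s) z * kern (r' - s) z) (at r')" by (simp add: o_def)
  have "((%r. hbar / 2 * (t - r)) hvd - c) (at r')"
   unfolding has_vector_derivative_def c_def by (rule derivative_eq_intros refl)+ (auto simp: algebra_simps)
  from vector_diff_chain_at[OF this comb_parameter_derivative[OF ps, of "fst z"]]
  have 2: "((%r. wave t ps r (fst z)) hvd (- c) *R (\<i> * laplacian (wave t ps r') (fst z))) (at r')" by (simp add: o_def)
  show "((%r. ?f r z) hvd ?f' r' z) (at r')" using has_vector_derivative_mult[OF 1 has_vector_derivative_mult_right[OF 2, of "f (snd z)"]]
   by (simp add: scaleR_conv_of_real algebra_simps)
  let ?E = "wt (snd z) * wt (fst z)"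
  have b1: "cmod (qt (r' - s) z * kern (r' - s) z * (f (snd z) * wave t ps r' (fst z))) <= K2 * Cf * Cp * ?E"
   by (rule poly_weight_integrable(1)[OF K2(1) K2(2)[OF near[OF r']] Cf Cp(1) Cp(2)[OF en[OF r']]])
  let ?C = "kern (r' - s) z * (f (snd z) * laplacian (wave t ps r') (fst z))"
  have b2: "cmod ?C <= K1 * Cf * Cp * ?E"
   by (rule poly_weight_integrable(1)[OF K1(1) K1(2)[OF near[OF r']] Cf Cp(1) Cp(3)[OF en[OF r']]])
  have "cmod ((- \<i> * c) * ?C) <= \<bar>c\<bar> * (K1 * Cf * Cp * ?E)"
   using mult_left_mono[OF b2, of "\<bar>c\<bar>"] by (simp only: norm_mult norm_minus_cancel norm_ii norm_of_real mult_1_left abs_ge_zero)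
  from norm_triangle_le[OF add_mono[OF b1 this]] show "cmod (?f' r' z) <= ?g z" .
 next
  have "lint (%z :: (real^'n) \<times> (real^'n). wt (snd z) * wt (fst z))"
   using integrable_tensor[OF integrable_wt integrable_wt] by (simp add: mult.commute case_prod_unfold)
  thus "lint ?g" by (intro Bochner_Integration.integrable_add integrable_mult_right)
 qed
 let ?ta = "r - s"
 have p: "0 < ?ta" "?ta \<in> {d..3 * d}" using near[of r] d r by auto
 have it: "lint (%z. qt ?ta z * kern ?ta z * (?F z r))"
  by (rule pg_integrable[OF kc(1) pr[OF kern_pg(4)[OF d] p(2)] f sw])
 have i2: "lint (%z. q2 i ?ta z * kern ?ta z * (?F z r))" for i
  by (rule pg_integrable[OF kc(2) pr[OF kern_pg(3)[OF d] p(2)] f sw])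
 have i0: "lint (%z. kern ?ta z * (f (snd z) * g (fst z)))" if "g \<in> schwartz" for g
  by (rule pg_integrable[OF kern_continuous(1) pr[OF kern_pg(1)[OF d] p(2)] f that])
 let ?A = "LBINT z. kern ?ta z * (f (snd z) * laplacian (wave t ps r) (fst z))"
 let ?B = "\<Sum>i\<in>UNIV. \<integral>z. q2 i ?ta z * kern ?ta z * (f (snd z) * wave t ps r (fst z)) \<partial>lborel"
 have lap: "?A = ?B"
 proof -
  have "?A = (\<Sum>i\<in>UNIV. \<integral>z. kern ?ta z * (f (snd z) * pd i (pd i (wave t ps r)) (fst z)) \<partial>lborel)"
   unfolding laplacian_def sum_distrib_left by (rule Bochner_Integration.integral_sum[OF i0]) (intro schwartzD(3) sw)
  also have "... = ?B"
   by (intro sum.cong refl, rule green_identity[symmetric, OF kern_dx[OF p(1)] kern_dxx[OF p(1)] kern_continuous(1) kc(3) kc(2)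
     pr[OF kern_pg(1)[OF d] p(2)] pr[OF kern_pg(2)[OF d] p(2)] pr[OF kern_pg(3)[OF d] p(2)] f sw])
  finally show ?thesis .
 qed
 have "\<i> * hbar * (LBINT z. ?f' r z) =
   \<i> * hbar * (LBINT z. qt ?ta z * kern ?ta z * (?F z r)) +
   of_real (hbar^2 / 2) * (\<Sum>i\<in>UNIV. \<integral>z. q2 i ?ta z * kern ?ta z * (?F z r) \<partial>lborel)"
  using it i0[OF sl[of r]] unfolding lap[symmetric] by (simp add: c_def distrib_left power2_eq_square algebra_simps)
 also have "... = (LBINT z. \<i> * hbar * (qt ?ta z * kern ?ta z * (?F z r)) +
   of_real (hbar^2 / 2) * (\<Sum>i\<in>UNIV. q2 i ?ta z * kern ?ta z * (?F z r)))" using it i2 by simp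
 also have "... = (LBINT z. (of_real (Vs ?ta (fst z)) + rm ?ta z) * (kern ?ta z * (?F z r)))"
  unfolding schroedinger_defect[OF p(1), symmetric] by (simp add: sum_distrib_left sum_distrib_right algebra_simps)
 finally show ?thesis using der by blast
qed

end

section \<open>The approximate propagator on \<open>L\<^sup>2\<close>\<close>

text \<open>Testing with the conjugate of p cut off to a ball gives |h|^2 <= K |h|. Boundedness of p
  makes this test function admissible, and monotone convergence removes the cut-off.\<close>

lemma sq_integrable_duality:
 fixes p :: "real^'n => complex"
 assumes m[measurable]: "bm p" and b: "!!x. cmod (p x) <= M" and K: "0 <= K"
  and d: "!!h. l12 h ==> cmod (LBINT x. p x * h x) <= K * l2n h"
 shows "sq_integrable p" "l2n p <= K"
proof -
 let ?I = "%k x. indicator (cball 0 (real k)) x :: real"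
 have g: "lint (%x. ?I k x * (cmod (p x))^2) \<and> (LBINT x. ?I k x * (cmod (p x))^2) <= K^2" for k
 proof -
  define h where "h x = complex_of_real (?I k x) * cnj (p x)" for x
  have M: "0 <= M" by (rule order_trans[OF norm_ge_zero b[of 0]])
  have i: "lint (?I k)" by (intro integrable_real_indicator) (simp_all add: emeasure_lborel_cball_finite[unfolded infinity_ennreal_def])
  have "lint h" unfolding h_def
   by (rule ibound[of _ "%x. M * ?I k x"]) (use i b M in \<open>auto simp: norm_mult indicator_def\<close>)
  moreover have e: "(cmod (h x))^2 = ?I k x * (cmod (p x))^2" for x by (simp add: h_def norm_mult power_mult_distrib indicator_def)
  moreover have i2: "lint (%x. ?I k x * (cmod (p x))^2)"
   by (rule ibound[of _ "%x. M^2 * ?I k x"]) (use i b M in \<open>auto simp: indicator_def intro!: power_mono\<close>)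
  ultimately have h: "l12 h" by (simp add: l12_def)
  have "p x * h x = of_real ((cmod (h x))^2)" for x unfolding e using complex_norm_square[of "p x"] by (simp add: h_def mult_ac)
  hence "(LBINT x. p x * h x) = of_real ((l2n h)^2)" by (simp only: integral_complex_of_real l2n_sq)
  hence "l2n h * l2n h <= K * l2n h" using d[OF h] by (simp only: norm_of_real abs_power2) (simp only: power2_eq_square)
  hence "l2n h <= K" using K l2n_nonneg[of h] by (cases "l2n h = 0") auto
  from power_mono[OF this l2n_nonneg, of 2] show ?thesis using i2 by (simp add: l2n_sq e)
 qed
 let ?B = "%x. %k. ?I k x * (cmod (p x))^2"
 have lim: "AE x in lborel. (?B x) ----> (cmod (p x))\<^sup>2"
 proof (rule AE_I2)
  fix x :: "real^'n"
  obtain k0 :: nat where "norm x <= k0" using real_arch_simple by blast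
  hence "\<forall>\<^sub>F k in sequentially. ?I k x * (cmod (p x))^2 = (cmod (p x))^2"
   by (intro eventually_sequentiallyI[of k0]) (auto simp: indicator_def)
  thus "(?B x) ----> (cmod (p x))\<^sup>2" by (rule tendsto_eventually)
 qed
 have mono: "AE x in lborel. mono (?B x)" by (intro AE_I2 monoI mult_right_mono) (auto simp: indicator_def)
 let ?A = "%k. \<integral>x. ?I k x * (cmod (p x))^2 \<partial>lborel"
 have inc: "incseq ?A"
  by (intro monoI integral_mono) (use g in \<open>auto simp: indicator_def\<close>)
 have gK: "\<forall>k. (LBINT x. ?I k x * (cmod (p x))^2) <= K^2" using g by (intro allI) (rule conjunct2)
 obtain L where L: "?A ----> L" by (rule incseq_convergent[OF inc gK])
 have LK: "L <= K^2" by (rule LIMSEQ_le_const2[OF L]) (use gK in blast)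
 have "(%x. (cmod (p x))^2) \<in> borel_measurable lborel" by measurable
 note mc = integrable_monotone_convergence[OF conjunct1[OF g] mono lim L this] integral_monotone_convergence[OF conjunct1[OF g] mono lim L this]
 show "sq_integrable p" using mc(1) by (simp add: sq_integrable_def)
 have "(l2n p)^2 <= K^2" using mc(2) LK by (simp add: l2n_sq)
 thus "l2n p <= K" using K by (rule power2_le_imp_le)
qed

lemma l12_sq: "l12 f ==> sq_integrable f" by (auto simp: l12_def sq_integrable_def)

lemma l12_add: "l12 f ==> l12 g ==> l12 (%x. f x + g x)"
 using sq_integrable_add[OF l12_sq l12_sq, of f g] by (auto simp: l12_def sq_integrable_def)

lemma l12_scale: "l12 f ==> l12 (%x. c * f x)" by (rule l12_bounded_mult(1)[of _ _ "cmod c"]) auto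

context slice
begin

text \<open>\<open>Am T * ta\<close> bounds \<open>ph ta\<close> in the class: N terms, each with
  ta^k <= ta max(1, T)^N. \<open>CK T\<close> is the constant of
  \<open>cls_kernel_bound\<close>.\<close>

definition "Am T = real N * B * max 1 T ^ N"
definition "CK T = exp (2 * pi * CARD('n)) * max 1 (sqrt (2 * pi * T)) ^ CARD('n)"

lemma CK_pos: "0 < CK T" unfolding CK_def by (intro mult_pos_pos zero_less_power) auto

lemma Am_nonneg: "0 <= Am T" unfolding Am_def using B by simp

lemma tau_le: "0 < ta ==> ta <= T * hbar ==> ta <= max 1 T"
proof -
 assume t: "0 < ta" "ta <= T * hbar"
 hence "0 < T * hbar" by linarith
 hence "0 <= T" using h by (simp add: zero_less_mult_iff)
 hence "T * hbar <= T * 1" using h by (intro mult_left_mono) auto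
 thus ?thesis using t by linarith
qed

text \<open>Division of the phase by hbar is affordable because ta <= T hbar. The bound also tends
  to 0 with \<open>ta\<close>, that is, the amplitude tends to 1.\<close>

lemma ccls_exp_ph:
 assumes t: "0 < ta" "ta <= T * hbar"
 shows "ccls (exp (Am T * ta / hbar) - 1) (%z. exp (\<i> / of_real hbar * ph ta z) - 1)"
proof -
 note tm = tau_le[OF t]
 have k: "\<bar>ta ^ k\<bar> <= ta * max 1 T ^ N" if "k \<in> {1..N}" for k
 proof -
  have "ta ^ k = ta * ta ^ (k - 1)" using that by (cases k) auto
  also have "... <= ta * max 1 T ^ (k - 1)" using t tm by (intro mult_left_mono power_mono) auto
  also have "... <= ta * max 1 T ^ N" using t that by (intro mult_left_mono power_increasing) auto
  finally show ?thesis using t by simp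
 qed
 let ?A = "\<Sum>k=1..N. \<bar>ta ^ k\<bar> * B"
 have "good 0 (\<Sum>k=1..N. cmod (of_real (ta ^ k)) * B) (%z. \<Sum>k=1..N. of_real (ta ^ k) * W k z)"
  by (intro good_sum good_scale) (auto intro!: ccls_W)
 hence "ccls ?A (ph ta)" unfolding ph_def[abs_def] by (simp only: good.simps norm_of_real mult.commute)
 from ccls_scale[OF this, of "\<i> / of_real hbar"] have c: "ccls (?A / hbar) (%z. \<i> / hbar * ph ta z)"
  using h by (simp add: norm_divide)
 have "?A <= (\<Sum>k=1..N. ta * max 1 T ^ N * B)" by (intro sum_mono mult_right_mono k B)
 also have "... = Am T * ta" by (simp add: Am_def mult_ac)
 finally have "?A / hbar <= Am T * ta / hbar" using h by (simp add: divide_right_mono)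
 from ccls_exp[OF ccls_mono[OF c this]] show ?thesis .
qed

lemma norm_heat_zt: "cmod (heat (zt ta) (x :: real^'n)) = 1 / (2 * sqrt (pi * cmod (zt ta))) ^ CARD('n)" unfolding norm_heat by (simp add: zt_def)

lemma heat_bound:
 fixes f g :: "real^'n => complex"
 assumes t: "0 < ta" "ta <= T * hbar" and a: "ccls b a" and f: "l12 f" and g: "l12 g"
 shows "cmod (LBINT z. heat (zt ta) (fst z - snd z) * a z * (f (snd z) * g (fst z))) <= CK T * b * l2n f * l2n g"
proof -
 have T: "0 <= T"
 proof (rule ccontr)
  assume "\<not> 0 <= T"
  hence "T * hbar < 0" using h by (intro mult_neg_pos) auto
  thus False using t by simp
 qed
 have "hbar * ta <= 1 * ta" using t h by (intro mult_right_mono) auto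
 also have "... <= T * hbar" using t by simp
 also have "... <= T" using T h mult_left_mono[of hbar 1 T] by simp
 finally have l: "hbar * ta <= T" .
 have p: "0 < hbar * ta" using t h by simp
 show ?thesis using cls_kernel_bound[OF p l _ f g, of b a] a unfolding zt_def CK_def ccls_def by auto
qed

lemma kern_bound:
 assumes t: "0 < ta" "ta <= T * hbar" and a: "ccls b a" and f: "l12 f" and g: "l12 g"
 shows "cmod (LBINT z. kern ta z * a z * (f (snd z) * g (fst z))) <= CK T * exp (Am T * T) * b * l2n f * l2n g"
proof -
 let ?A = "%z. exp (\<i> / of_real hbar * ph ta z)"
 have "ccls (exp (Am T * ta / hbar)) ?A" using ccls_add[OF ccls_exp_ph[OF t] ccls_one] by simp
 moreover have "exp (Am T * ta / hbar) <= exp (Am T * T)" using mult_left_mono[OF t(2) Am_nonneg[of T]] h by (simp add: field_simps)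
 ultimately have "ccls (exp (Am T * T)) ?A" by (rule ccls_mono)
 from heat_bound[OF t ccls_mult[OF this a] f g] show ?thesis by (simp add: kern_def mult_ac)
qed

text \<open>Comparison with the free kernel provides the initial condition: although the kernel is
  singular at \<open>ta\<close> = 0, its difference to the free one vanishes there as a form on
  L^2.\<close>

lemma kern_small:
 assumes t: "0 < ta" "ta <= T * hbar" and f: "l12 f" and g: "l12 g"
 shows "cmod ((LBINT z. kern ta z * (f (snd z) * g (fst z))) - (LBINT z. heat (zt ta) (fst z - snd z) * (f (snd z) * g (fst z))))
  <= CK T * (exp (Am T * ta / hbar) - 1) * l2n f * l2n g"
  and "lint (%z. kern ta z * (f (snd z) * g (fst z)))"
  and "lint (%z. heat (zt ta) (fst z - snd z) * (f (snd z) * g (fst z)))"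
proof -
 define H where "H = 1 / (2 * sqrt (pi * cmod (zt ta))) ^ CARD('n)"
 have H: "cmod (heat (zt ta) x) <= H" for x :: "real^'n" by (simp only: norm_heat_zt H_def)
 let ?C = "%z. heat (zt ta) (fst z - snd z)"
 have c: "cts (%z :: (real^'n) \<times> (real^'n). ?C z)" by (intro continuous_on_heat continuous_intros)
 have I: "lint (%z. ?C z * a z * (f (snd z) * g (fst z)))" if a: "ccls b a" for a b
 proof (rule integrable_kernel[OF l12D(1)[OF f] l12D(1)[OF g], where B="\<bar>H\<bar> * b"])
  show "bm (%z. ?C z * a z)" using a unfolding ccls_def by (intro borel_measurable_continuous_onI continuous_intros c) simp
  show "cmod (?C z * a z) <= \<bar>H\<bar> * b" for z
   unfolding norm_mult by (intro mult_mono ccls_bound[OF a] order_trans[OF H abs_ge_self]) auto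
 qed
 note e = ccls_exp_ph[OF t]
 show i2: "lint (%z. ?C z * (f (snd z) * g (fst z)))" using I[OF ccls_one] by simp
 show i1: "lint (%z. kern ta z * (f (snd z) * g (fst z)))" using I[OF ccls_add[OF e ccls_one]] by (simp add: kern_def)
 let ?A = "LBINT z. kern ta z * (f (snd z) * g (fst z))"
 let ?B = "LBINT z. heat (zt ta) (fst z - snd z) * (f (snd z) * g (fst z))"
 have "?A - ?B
  = (LBINT z. ?C z * (exp (\<i> / hbar * ph ta z) - 1) * (f (snd z) * g (fst z)))"
  unfolding Bochner_Integration.integral_diff[OF i1 i2, symmetric] by (simp add: kern_def algebra_simps)
 thus "cmod (?A - ?B)
  <= CK T * (exp (Am T * ta / hbar) - 1) * l2n f * l2n g" using heat_bound[OF t e f g] by simp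
qed

text \<open>The semigroup law of the heat kernel: integrating the free kernel against a Gaussian in
  x shifts the complex time of the latter by i hbar ta / 2.\<close>

lemma heat_pairing:
 fixes ps :: "(complex \<times> complex \<times> (real^'n)) list"
 assumes t: "0 < ta" "ta <= T * hbar" and f: "l12 f" and ps: "okc ps"
 shows "(LBINT z. heat (zt ta) (fst z - snd z) * (f (snd z) * comb ps (fst z))) = (LBINT y. f y * comb (shift (hbar * ta / 2) ps) y)"
proof -
 let ?A = "%x y. heat (zt ta) (x - y)"
 have c: "(LBINT x. ?A x y * comb ps x) = comb (shift (hbar * ta / 2) ps) y \<and> lint (%x. ?A x y * comb ps x)" for y
  using ps
 proof (induction ps)
  case (Cons p ps)
  have z: "zt ta \<noteq> 0" "0 <= Re (zt ta)" using zt_nonzero[OF t(1)] by (simp_all add: zt_def)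
  have "0 < Re (fst (snd p))" using Cons(2) by simp
  note hc = heat_conv[OF z this, of y "snd (snd p)", unfolded heat_commute[of "zt ta" y]]
  have "(LBINT x. fst p * (?A x y * heat (fst (snd p)) (x - snd (snd p))) + ?A x y * comb ps x)
   = fst p * heat (zt ta + fst (snd p)) (y - snd (snd p)) + comb (shift (hbar * ta / 2) ps) y" using Cons hc by simp
  moreover have "lint (%x. fst p * (?A x y * heat (fst (snd p)) (x - snd (snd p))) + ?A x y * comb ps x)"
   using Cons hc by simp
  ultimately show ?case by (simp add: zt_def distrib_left mult_ac add.commute)
 qed simp
 have g: "l12 (comb ps)" by (rule schwartz_basic(4)[OF gp_schwartz[OF gp_comb[OF ps]]])
 note i = kern_small(3)[OF t f g]
 have "(LBINT z. heat (zt ta) (fst z - snd z) * (f (snd z) * comb ps (fst z))) = (LBINT y. (LBINT x. ?A x y * (f y * comb ps x)))"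
  using lborel_pair.integral_snd[of "%x y. ?A x y * (f y * comb ps x)"] i by (simp add: lborel_prod case_prod_unfold)
 also have "... = (LBINT y. f y * (LBINT x. ?A x y * comb ps x))" by (simp add: mult.left_commute)
 finally show ?thesis using c by simp
qed

definition "op ta f x = (LBINT y. kern ta (x, y) * f y)"

lemma op_pairing:
 assumes t: "0 < ta" "ta <= T * hbar" and f: "l12 f" and g: "l12 g"
 shows "(LBINT x. op ta f x * g x) = (LBINT z. kern ta z * (f (snd z) * g (fst z)))"
proof -
 have "(LBINT z. kern ta z * (f (snd z) * g (fst z))) = (LBINT x. (LBINT y. kern ta (x, y) * (f y * g x)))"
  using lborel_pair.integral_fst'[of "%z. kern ta z * (f (snd z) * g (fst z))"] kern_small(2)[OF t f g] by (simp add: lborel_prod)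
 thus ?thesis unfolding op_def by (simp add: mult.assoc[symmetric])
qed

lemma op_basic:
 assumes t: "0 < ta" "ta <= T * hbar" and f: "l12 f"
 shows "sq_integrable (op ta f)" "l2n (op ta f) <= CK T * exp (Am T * T) * l2n f" "lint (%y. kern ta (x, y) * f y)"
proof -
 note [measurable] = l12D(3)[OF f] borel_measurable_continuous_onI[OF kern_continuous(1)]
 obtain M where M: "!!z. cmod (kern ta z) <= M"
 proof -
  have "cmod (exp (\<i> / hbar * ph ta z)) <= exp (Am T * ta / hbar)" for z using ccls_bound[OF ccls_add[OF ccls_exp_ph[OF t] ccls_one], of z] by simp
  hence "cmod (kern ta z) <= 1 / (2 * sqrt (pi * cmod (zt ta))) ^ CARD('n) * exp (Am T * ta / hbar)" for z
   unfolding kern_def norm_mult norm_heat_zt by (intro mult_left_mono) auto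
  thus thesis by (rule that)
 qed
 have i: "lint (%y. kern ta (x, y) * f y)" for x
 proof (rule ibound[of _ "%y. M * cmod (f y)"])
  show "(%y. kern ta (x, y) * f y) \<in> borel_measurable lborel" by measurable
  show "AE y in lborel. norm (kern ta (x, y) * f y) <= norm (M * cmod (f y))"
   unfolding norm_mult by (intro AE_I2 mult_mono) (auto intro: order_trans[OF M abs_ge_self])
 qed (use l12D(1)[OF f] in auto)
 thus "lint (%y. kern ta (x, y) * f y)" .
 have m: "op ta f \<in> borel_measurable borel"
 proof -
  have [measurable]: "bm (snd :: (real^'n) \<times> (real^'n) => _)" by (intro borel_measurable_continuous_onI continuous_intros)
  have "bm (%z. kern ta z * f (snd z))" by measurable
  hence "(%(x, y). kern ta (x, y) * f y) \<in> borel_measurable (borel \<Otimes>\<^sub>M lborel)"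
   unfolding borel_prod[symmetric] case_prod_unfold prod.collapse by (subst measurable_cong_sets[OF sets_pair_measure_cong[OF refl sets_lborel] refl])
  thus ?thesis unfolding op_def[abs_def] by (rule lborel.borel_measurable_lebesgue_integral)
 qed
 have b: "cmod (op ta f x) <= M * (LBINT y. cmod (f y))" for x
 proof -
  have "cmod (op ta f x) <= (LBINT y. cmod (kern ta (x, y) * f y))" unfolding op_def by (rule integral_norm_bound)
  also have "... <= (LBINT y. M * cmod (f y))"
   by (rule integral_mono[OF integrable_norm[OF i]]) (use l12D(1)[OF f] M in \<open>auto simp: norm_mult intro!: mult_right_mono\<close>)
  finally show ?thesis by simp
 qed
 have K: "0 <= CK T * exp (Am T * T) * l2n f" using CK_pos[of T] l2n_nonneg[of f] by simp
 have d: "cmod (LBINT x. op ta f x * h x) <= CK T * exp (Am T * T) * l2n f * l2n h" if "l12 h" for h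
  using kern_bound[OF t ccls_one f that] op_pairing[OF t f that] by simp
 show "sq_integrable (op ta f)" "l2n (op ta f) <= CK T * exp (Am T * T) * l2n f"
  by (rule sq_integrable_duality(1)[OF m b K d], assumption) (rule sq_integrable_duality(2)[OF m b K d])
qed

text \<open>\<open>bounded_extension\<close> on the functions in \<open>l12\<close> gives an
  operator with the defining property. Any other candidate agrees with it on Gaussians, which are
  Schwartz functions and dense, so the definite description is resolved.\<close>

lemma approx_propagator_op:
 assumes t: "s < t" "t - s <= T * hbar"
 shows "bounded_linear (approx_propagator N hbar V t s)" "!!f. l12 f ==> approx_propagator N hbar V t s (abs_L2 f) = abs_L2 (op (t - s) f)"
proof -
 have ta: "0 < t - s" "t - s <= T * hbar" using t by auto
 note ob = op_basic[OF ta]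
 let ?B = "%r. abs_L2 (op (t - s) r)"
 have "closure (abs_L2 ` Collect l12) = (UNIV :: 'n L2 set)"
 proof -
  have "gauss \<subseteq> (abs_L2 ` Collect l12 :: 'n L2 set)" unfolding gauss_def using schwartz_basic(4)[OF gp_schwartz[OF gp_comb]] by auto
  from closure_mono[OF this] show ?thesis using gauss_dense by auto
 qed
 moreover have "\<exists>r\<in>Collect l12. (abs_L2 r :: 'n L2) = abs_L2 p + abs_L2 q \<and> (?B r :: 'n L2) = ?B p + ?B q"
  if "p \<in> Collect l12" "q \<in> Collect l12" for p q
 proof (intro bexI conjI)
  show "(%x. p x + q x) \<in> Collect l12" using that l12_add by auto
  have "op (t - s) (%x. p x + q x) = (%x. op (t - s) p x + op (t - s) q x)" using ob(3) that by (simp add: op_def[abs_def] distrib_left)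
  thus "(abs_L2 (op (t - s) (%x. p x + q x)) :: 'n L2) = ?B p + ?B q" using ob(1) that by (simp add: abs_add)
 qed (use that in \<open>simp add: abs_add l12_sq\<close>)
 moreover have "\<exists>r\<in>Collect l12. (abs_L2 r :: 'n L2) = c *R abs_L2 p \<and> (?B r :: 'n L2) = c *R abs_L2 (op (t - s) p)"
  if "p \<in> Collect l12" for c p
 proof (intro bexI conjI)
  show "(%x. of_real c * p x) \<in> Collect l12" using that l12_scale by auto
  have "op (t - s) (%x. of_real c * p x) = (%x. of_real c * op (t - s) p x)" by (simp add: op_def[abs_def] mult.left_commute)
  thus "(abs_L2 (op (t - s) (%x. of_real c * p x)) :: 'n L2) = c *R abs_L2 (op (t - s) p)"
   using ob(1) that by (simp add: abs_scaleR scaleR_conv_of_real)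
 qed (use that in \<open>simp add: abs_scaleR scaleR_conv_of_real l12_sq\<close>)
 moreover have "norm (?B p :: 'n L2) <= (CK T * exp (Am T * T)) * norm (abs_L2 p)" if "p \<in> Collect l12" for p
  using ob(1,2)[of p] that by (simp add: norm_abs l12_sq)
 ultimately have "\<exists>A. bounded_linear A \<and> (\<forall>f\<in>Collect l12. A (abs_L2 f) = (?B f :: 'n L2))" by (intro bounded_extension)
 then obtain A :: "'n L2 => 'n L2" where A: "bounded_linear A" "!!f. l12 f ==> A (abs_L2 f) = ?B f" by auto
 have e: "approx_propagator_schwartz N hbar V t s f = op (t - s) f" for f
 proof
  fix x
  define l where "l = hbar * (t - s)"
  have l: "0 < l" using ta h by (simp add: l_def)
  let ?A = "approx_propagator_schwartz N hbar V t s f x"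
  let ?C = "%x y. of_real ((norm (x - y))^2 / 2)"
  have "exp (\<i> / hbar * action N hbar V t s x y) = exp (\<i> / l * ?C x y) * exp (\<i> / hbar * ph (t - s) (x, y))" for y
  proof -
   have "\<i> / hbar * of_real ((norm (x - y))^2 / (2 * (t - s))) = \<i> / l * ?C x y"
    using ta h by (simp add: l_def field_simps)
   thus ?thesis unfolding action_def ph_def by (simp only: distrib_left exp_add aW_def fst_conv snd_conv)
  qed
  moreover have "2 * pi * (t - s) * hbar = 2 * pi * l" by (simp add: l_def)
  ultimately have "?A = (LBINT y. 1 / (of_real ((2 * pi * l) powr (real CARD('n) / 2)) * exp (\<i> * of_real (pi * real CARD('n) / 4))) *
    (exp (\<i> / l * ?C x y) * exp (\<i> / hbar * ph (t - s) (x, y)) * f y))"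
   unfolding approx_propagator_schwartz_def by (simp only: integral_mult_right_zero)
  also have "... = op (t - s) f x" unfolding op_def kern_def zt_def l_def[symmetric] heat_imaginary[OF l] by (simp add: mult_ac)
  finally show "?A = op (t - s) f x" .
 qed
 have "approx_propagator N hbar V t s = A" unfolding approx_propagator_def e
 proof (rule the_equality)
  show "bounded_linear A \<and> (\<forall>f\<in>schwartz. AE x in lborel. rep_L2 (A (abs_L2 f)) x = op (t - s) f x)"
  proof (intro conjI ballI A(1))
   fix f :: "real^'n => complex" assume "f \<in> schwartz"
   hence f: "l12 f" by (rule schwartz_basic(4))
   show "AE x in lborel. rep_L2 (A (abs_L2 f)) x = op (t - s) f x" unfolding A(2)[OF f] by (rule rep_abs[OF ob(1)[OF f]])
  qed
  fix A' assume A': "bounded_linear A' \<and> (\<forall>f\<in>schwartz. AE x in lborel. rep_L2 (A' (abs_L2 f)) x = op (t - s) f x)"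
  show "A' = A"
  proof
   fix u show "A' u = A u"
   proof (rule gauss_ext[of A' A])
    fix ps :: "(complex \<times> complex \<times> (real^'n)) list" assume ps: "okc ps"
    note f = gp_schwartz[OF gp_comb[OF ps]]
    have "abs_L2 (rep_L2 (A' (combL ps))) = abs_L2 (op (t - s) (comb ps))" using A' f by (intro abs_eqI rep_sq ob(1) schwartz_basic(4)) auto
    thus "A' (combL ps) = A (combL ps)" by (simp add: A(2)[OF schwartz_basic(4)[OF f]])
   qed (use A A' linear_continuous_on in auto)
  qed
 qed
 thus "bounded_linear (approx_propagator N hbar V t s)" "!!f. l12 f ==> approx_propagator N hbar V t s (abs_L2 f) = ?B f"
  using A by auto
qed

end

section \<open>The Schroedinger equation\<close>

text \<open>A product rule for u continuous in norm but differentiable only against a fixed vector.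
  The difference quotient is split so that the increment of u meets \<open>si r\<close>, while the
  increment of \<open>si\<close> meets u (r + h).\<close>

lemma weak_product:
 assumes u: "isCont u r" and d: "((%r'. bl (u r') (si r)) hvd D) (at r)" and p: "(si hvd si') (at r)"
 shows "((%r. bl (u r) (si r)) hvd D + bl (u r) si') (at r)"
proof -
 note * = has_vector_derivative_iff_sequentially[OF zero_less_one]
 have "(%n. inverse (h n) *R (bl (u (r + h n)) (si (r + h n)) - bl (u r) (si r))) ----> D + bl (u r) si'"
  if h: "\<forall>n. h n \<noteq> 0 \<and> \<bar>h n\<bar> < 1" "h ----> 0" for h :: "nat => real"
 proof -
  have e: "inverse (h n) *R (bl (u (r + h n)) (si (r + h n)) - bl (u r) (si r)) = inverse (h n) *R (bl (u (r + h n)) (si r) - bl (u r) (si r))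
    + bl (u (r + h n)) (inverse (h n) *R (si (r + h n) - si r))" for n by (simp add: bl.scaleR_right bl.diff_right scaleR_right_diff_distrib)
  have "(%n. r + h n) ----> r" using tendsto_add[OF tendsto_const h(2), of r] by simp
  from isCont_tendsto_compose[OF u this] show ?thesis using d[unfolded *] p[unfolded *] h unfolding e by (intro tendsto_add bl.tendsto) auto
 qed
 thus ?thesis unfolding * by blast
qed

text \<open>The functions \<open>r \<mapsto> combL (shift (c * (t - r)) ps)\<close> are free waves which form a dense set at the time \<open>r = t\<close>,
 so a bound for the pairings with them gives a bound for the norm at the time \<open>t\<close>.\<close>
lemma gronwall_dual:
 fixes d :: "real => ('n::finite) L2"
 assumes st: "s < t1" and C: "0 < C" and K: "0 <= K" and bd: "!!r. s < r ==> r <= t1 ==> norm (d r) <= M"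
  and lim: "!!t ps. okc ps ==> ((%r. bl (d r) (combL (shift (c * (t - r)) ps))) \<longlongrightarrow> 0) (at_right s)"
  and der: "!!t ps r. okc ps ==> s < r ==> r <= t1 ==> \<exists>D. ((%r. bl (d r) (combL (shift (c * (t - r)) ps))) hvd D) (at r)
   \<and> cmod D <= (C * norm (d r) + K) * norm (combL ps)"
 shows "norm (d t1) <= 2 * K * (t1 - s) * exp (2 * C * (t1 - s))"
proof -
 let ?C = "%r. 2 * C * (r - s)"
 \<comment> \<open>The supremum in the weight exp(- 2 C (r - s)). Since the rate is twice the
   constant C, the integrated term contributes only m / 2 and can be absorbed.\<close>
 define m where "m = (SUP r\<in>{s<..t1}. norm (d r) * exp (- (?C r)))"
 have M: "0 <= M" using order_trans[OF norm_ge_zero bd[of t1]] st by simp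
 have bdd: "bdd_above ((%r. norm (d r) * exp (- (?C r))) ` {s<..t1})"
 proof (rule bdd_aboveI2)
  fix r assume r: "r \<in> {s<..t1}"
  have "norm (d r) * exp (- (?C r)) <= M * 1" using r C M bd[of r] by (intro mult_mono) auto
  thus "norm (d r) * exp (- (?C r)) <= M" by simp
 qed
 have dm: "norm (d r) <= m * exp (?C r)" if "s < r" "r <= t1" for r
 proof -
  have "norm (d r) * exp (- (?C r)) <= m" unfolding m_def by (rule cSUP_upper[OF _ bdd]) (use that in auto)
  from mult_right_mono[OF this exp_ge_zero[of "2 * C * (r - s)"]] show ?thesis by (simp only: mult.assoc exp_add[symmetric]) simp
 qed
 have m0: "0 <= m" using order_trans[OF norm_ge_zero dm[of t1]] st by (simp add: zero_le_mult_iff)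
 have key: "norm (d t) <= m / 2 * exp (?C t) + K * (t1 - s)" if t: "s < t" "t <= t1" for t
 proof (rule norm_le_duality)
  show "0 <= m / 2 * exp (?C t) + K * (t1 - s)" using m0 K st by simp
  fix ps :: "(complex \<times> complex \<times> (real^'n)) list" assume ps: "okc ps"
  define fi where "fi r = bl (d r) (combL (shift (c * (t - r)) ps))" for r
  let ?A = "norm (combL ps)"
  obtain D where D: "!!r. s < r ==> r <= t1 ==> (fi hvd D r) (at r)"
   "!!r. s < r ==> r <= t1 ==> cmod (D r) <= (C * norm (d r) + K) * ?A"
   using der[OF ps, of _ t] unfolding fi_def[symmetric] by metis
  \<comment> \<open>Only the pairings are known to tend to 0 at s; assigning the value 0 there makes
    the scalar function continuous on the closed interval.\<close>
  define g where "g r = (if r <= s then 0 else fi r)" for r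
  have gd: "(g hvd D r) (at r)" if "s < r" "r <= t1" for r
   by (rule has_vector_derivative_transform_within_open[OF D(1)[OF that], of "{s<..}"]) (use that in \<open>auto simp: g_def\<close>)
  have gc: "continuous_on {s..t} g" unfolding continuous_on_eq_continuous_within
  proof
   fix r assume r: "r \<in> {s..t}"
   show "continuous (at r within {s..t}) g"
   proof (cases "r = s")
    case True
    have "(g \<longlongrightarrow> 0) (at_right s)" by (rule Lim_transform_eventually[OF lim[OF ps, of t]]) (auto simp: g_def fi_def eventually_at_filter)
    thus ?thesis unfolding True continuous_within at_within_Icc_at_right[OF t(1)] by (simp add: g_def)
   next
    case False
    thus ?thesis using has_vector_derivative_continuous[OF gd[of r]] r t continuous_at_imp_continuous_at_within by auto
   qed
  qed
  define P where "P r = (m / 2 * exp (?C r) + K * r) * ?A" for r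
  let ?B = "m / 2 * exp (2 * C * (t - s)) + K * (t1 - s)"
  have "norm (g t - g s) <= P t - P s"
  proof (rule differentiable_bound_general[OF t(1) gc])
   show "continuous_on {s..t} P" unfolding P_def by (intro continuous_intros)
   fix r assume r: "s < r" "r < t"
   show "(g hvd D r) (at r)" using gd r t by simp
   show "(P hvd (m * C * exp (?C r) + K) * ?A) (at r)"
    unfolding P_def has_real_derivative_iff_has_vector_derivative[symmetric] by (auto intro!: derivative_eq_intros)
   have "C * norm (d r) + K <= m * C * exp (?C r) + K" using mult_left_mono[OF dm[of r], of C] C r t by (simp add: mult_ac)
   thus "norm (D r) <= (m * C * exp (?C r) + K) * ?A"
    using D(2)[of r] r t by (meson less_le_trans less_imp_le mult_right_mono norm_ge_zero order_trans)
  qed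
  also have "P t - P s = (m / 2 * exp (?C t) + K * (t - s) - m / 2) * ?A" by (simp add: P_def algebra_simps)
  also have "... <= ?B * ?A"
   using m0 K t mult_left_mono[of "t - s" "t1 - s" K] by (intro mult_right_mono) auto
  finally show "cmod (bl (d t) (combL ps)) <= ?B * ?A" using t by (simp add: g_def fi_def)
 qed
 have "m <= m / 2 + K * (t1 - s)" unfolding m_def
 proof (rule cSUP_least, fold m_def)
  fix r assume r: "r \<in> {s<..t1}"
  have "norm (d r) * exp (- (?C r)) <= (m / 2 * exp (?C r) + K * (t1 - s)) * exp (- (?C r))"
   using key[of r] r by (intro mult_right_mono) auto
  also have "... = m / 2 + K * (t1 - s) * exp (- (?C r))" by (simp only: distrib_right mult.assoc exp_add[symmetric]) simp
  also have "... <= m / 2 + K * (t1 - s) * 1" using r C K st by (intro add_left_mono mult_left_mono) auto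
  finally show "norm (d r) * exp (- (?C r)) <= m / 2 + K * (t1 - s)" by simp
 qed (use st in auto)
 hence "m <= 2 * K * (t1 - s)" by simp
 from order_trans[OF dm[OF st order_refl] mult_right_mono[OF this exp_ge_zero]] show ?thesis .
qed

text \<open>Conjugation maps the complex time to its conjugate and thus reverses the free evolution.
  Together with the invariance in \<open>bl_comb_shift\<close> this gives symmetry for the pairing
  without conjugation.\<close>

lemma free_adjoint: "bl (free et u) w = bl u (free et w)" for u w :: "('n::finite) L2"
proof -
 define cj where "cj = map (%p :: complex \<times> complex \<times> (real^'n). (cnj (fst p), cnj (fst (snd p)), snd (snd p)))"
 have ok: "okc (cj qs) \<longleftrightarrow> okc qs" for qs by (auto simp: cj_def okc_def)
 have cb: "comb (cj qs) = (%x. cnj (comb qs x))" if "okc qs" for qs using that by (induction qs) (auto simp: cj_def cnj_heat)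
 have cL: "cnjL (combL (cj qs)) = combL qs" if "okc qs" for qs using cnjL_abs[OF comb_sq, of "cj qs"] that ok by (simp add: cb)
 have sh: "shift et (cj qs) = cj (shift (- et) qs)" for qs by (simp add: shift_def cj_def)
 have comb: "bl (free et (combL ps)) (combL qs) = bl (combL ps) (free et (combL qs))" if "okc ps" "okc qs" for ps qs :: "(complex \<times> complex \<times> (real^'n)) list"
  using bl_comb_shift[of ps "cj (shift et qs)" et] that ok cL[of qs] cL[of "shift et qs"] by (simp add: sh free_comb)
 have 1: "bl (free et (combL ps)) w = bl (combL ps) (free et w)" if ps: "okc ps" for ps :: "(complex \<times> complex \<times> (real^'n)) list" and w :: "'n L2"
  by (rule gauss_ext[where f="%w. bl (free et (combL ps)) w" and g="%w. bl (combL ps) (free et w)"])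
   (auto intro!: bl.continuous_on continuous_intros free_continuous comb[OF ps])
 show ?thesis by (rule gauss_ext[where f="%u. bl (free et u) w" and g="%u. bl u (free et w)"])
   (auto intro!: bl.continuous_on continuous_intros free_continuous 1)
qed

text \<open>\<open>green_identity\<close> concerns functions of two variables; adding a variable y
  weighted by a Gaussian of integral 1 brings the identity into that form.\<close>

lemma laplacian_symmetric:
 fixes f p :: "real^'n => complex"
 assumes f: "f \<in> schwartz" and p: "p \<in> schwartz"
 shows "(LBINT x. f x * laplacian p x) = (LBINT x. laplacian f x * p x)"
proof -
 define G :: "real^'n => complex" where "G = heat 1"
 have G: "G \<in> schwartz" using gp_schwartz[OF gp_heat[of 1 0]] by (simp add: G_def)
 have G1: "integral\<^sup>L lborel G = 1" unfolding G_def by (rule integral_heat) simp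
 have I: "lint (%x. a x * b x)" if "a \<in> schwartz" "b \<in> schwartz" for a b :: "real^'n => complex"
  using that by (intro integrable_l2_mult l12_sq schwartz_basic(4))
 have T: "(LBINT z. a (fst z) * (G (snd z) * b (fst z))) = (LBINT x. a x * b x)" if "a \<in> schwartz" "b \<in> schwartz" for a b :: "real^'n => complex"
  using integral_tensor[OF schwartz_basic(1)[OF G] I[OF that]] G1 by (simp add: case_prod_unfold mult_ac)
 have k: "cts (%z :: (real^'n) \<times> (real^'n). a (fst z)) \<and> pg {0} 2 (%_. %z :: (real^'n) \<times> (real^'n). a (fst z))" if a: "a \<in> schwartz" for a
 proof -
  obtain M where "!!x. cmod (a x) <= M" using schwartz_basic(3)[OF a] by blast
  hence "pg {0} 0 (%_. %z :: (real^'n) \<times> (real^'n). a (fst z))" by (rule pg_bounded)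
  from pg_mono[OF this, of 2] continuous_on_compose2[OF schwartzD(1)[OF a] continuous_on_fst[OF continuous_on_id]] show ?thesis by simp
 qed
 have "(LBINT x. pd i (pd i f) x * p x) = (LBINT x. f x * pd i (pd i p) x)" for i
 proof -
  note f' = schwartzD(3)[OF f, of i] note f'' = schwartzD(3)[OF f', of i] note p'' = schwartzD(3)[OF schwartzD(3)[OF p, of i], of i]
  show ?thesis unfolding T[OF f'' p, symmetric] T[OF f p'', symmetric]
   by (rule green_identity[where ?k1.0="%z. pd i f (fst z)"]) (use k[OF f] k[OF f'] k[OF f''] G p schwartzD(4)[OF f] schwartzD(4)[OF f'] in auto)
 qed
 moreover have "pd i (pd i a) \<in> schwartz" if "a \<in> schwartz" for a :: "real^'n => complex" and i by (intro schwartzD(3) that)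
 ultimately show ?thesis unfolding laplacian_def sum_distrib_left sum_distrib_right using f p by (simp add: Bochner_Integration.integral_sum I)
qed

lemma antiderivative:
 fixes g :: "real => 'b::banach"
 assumes "cts g"
 shows "\<exists>J. J s = 0 \<and> (\<forall>t. (J hvd g t) (at t))"
proof -
 define J where "J t = (if s <= t then integral {s..t} g else - integral {t..s} g)" for t
 have "(J hvd g t) (at t)" for t
 proof -
  define a b where "a = min s t - 1" and "b = max s t + 1"
  have ab: "a < s" "s < b" "a < t" "t < b" by (auto simp: a_def b_def)
  have gi: "g integrable_on {x..y}" for x y by (intro integrable_continuous_real continuous_on_subset[OF assms]) auto
  have e: "integral {a..r} g - integral {a..s} g = J r" if "r \<in> {a<..<b}" for r
   using that ab Henstock_Kurzweil_Integration.integral_combine[of a s r g] Henstock_Kurzweil_Integration.integral_combine[of a r s g] gi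
   by (auto simp: J_def algebra_simps)
  have "((%r. integral {a..r} g) hvd g t) (at t within {a..b})"
   by (rule integral_has_vector_derivative) (use ab in \<open>auto intro: continuous_on_subset[OF assms]\<close>)
  hence "((%r. integral {a..r} g) hvd g t) (at t)" unfolding at_within_Icc_at[OF ab(3,4)] .
  from has_vector_derivative_diff[OF this has_vector_derivative_const[of "integral {a..s} g"]]
  have "((%r. integral {a..r} g - integral {a..s} g) hvd g t) (at t)" by simp
  thus ?thesis by (rule has_vector_derivative_transform_within_open[OF _ open_greaterThanLessThan _ e]) (use ab in simp)
 qed
 thus ?thesis by (intro exI[of _ J] conjI allI) (simp add: J_def)
qed

lemma zero_derivative_constant:
 fixes f :: "real => 'b::real_normed_vector"
 assumes "!!t. (f hvd 0) (at t)"
 shows "f t = f s" using has_vector_derivative_zero_constant[of UNIV f] assms by (metis UNIV_I convex_UNIV)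

lemma l12_laplacian: "f \<in> schwartz ==> l12 (laplacian f)"
proof -
 assume f: "f \<in> schwartz"
 have "l12 (%x. \<Sum>i\<in>S. pd i (pd i f) x)" for S
 proof (induction S rule: infinite_finite_induct)
  case (insert i S) thus ?case using l12_add[OF schwartz_basic(4)[OF schwartzD(3)[OF schwartzD(3)[OF f]], of i i]] by simp
 qed (simp_all add: l12_def)
 from this[of UNIV] show ?thesis unfolding laplacian_def[abs_def] .
qed

text \<open>For a general Schwartz function the pairings with Gaussians can be differentiated by
  moving the evolution to the Gaussian. This identifies the orbit with \<open>fi\<close> plus an
  antiderivative of a norm-continuous function, which is differentiable in norm.\<close>

lemma free_derivative:
 fixes fi :: "real^('n::finite) => complex"
 assumes fi: "fi \<in> schwartz"
 shows "((%et. free et (abs_L2 fi)) hvd free et (abs_L2 (%x. \<i> * laplacian fi x))) (at et)"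
proof -
 let ?w = "abs_L2 (%x. \<i> * laplacian fi x) :: 'n L2"
 have ls: "sq_integrable (%x. \<i> * laplacian f x)" "sq_integrable f" if "f \<in> schwartz" for f :: "real^'n => complex"
  using l12_laplacian[OF that] schwartz_basic(4)[OF that] by (auto intro: l12_sq l12_scale)
 obtain J where J: "J 0 = 0" "!!t. (J hvd free t ?w) (at t)" using antiderivative[OF free_strongly_continuous, of 0 ?w] by blast
 have e: "free et (abs_L2 fi) = abs_L2 fi + J et" for et
 proof -
  let ?A = "free et (abs_L2 fi) - (abs_L2 fi + J et)"
  have "norm ?A <= 0"
  proof (rule norm_le_duality)
   fix ps :: "(complex \<times> complex \<times> (real^'n)) list" assume ps: "okc ps"
   let ?h = "%et. bl (abs_L2 fi) (combL (shift et ps)) - bl (J et) (combL ps)"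
   have "(?h hvd 0) (at r)" for r
   proof -
    have okr: "okc (shift r ps)" using ps by simp
    note c = gp_schwartz[OF gp_comb[OF okr]]
    have "bl (abs_L2 fi) (abs_L2 (%x. \<i> * laplacian (comb (shift r ps)) x)) = bl ?w (combL (shift r ps))"
     using bl_abs[OF ls(2)[OF fi] ls(1)[OF c]] bl_abs[OF ls(1)[OF fi] ls(2)[OF c]] laplacian_symmetric[OF fi c]
     by (simp add: mult.assoc mult.left_commute[of _ \<i>])
    also have "... = bl (free r ?w) (combL ps)" by (simp add: free_adjoint free_comb[OF ps])
    finally show ?thesis
     using has_vector_derivative_diff[OF bounded_linear.has_vector_derivative[OF bl.bounded_linear_right combL_derivative[OF ps, of r], of "abs_L2 fi"]
       bounded_linear.has_vector_derivative[OF bl.bounded_linear_left J(2)[of r], of "combL ps"]] by simp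
   qed
   from zero_derivative_constant[OF this, of et 0] show "cmod (bl ?A (combL ps)) <= 0 * norm (combL ps)"
    by (simp add: J(1) bl.diff_left bl.add_left free_adjoint free_comb[OF ps] bl.zero_left diff_eq_eq)
  qed simp
  thus ?thesis by simp
 qed
 show ?thesis unfolding e using has_vector_derivative_add[OF has_vector_derivative_const[of "abs_L2 fi"] J(2)[of et]] by simp
qed

lemma free_jointly_continuous:
 assumes "cts e" "cts w"
 shows "cts (%x. free (e x) (w x))" unfolding continuous_on_def
proof
 fix x0
 have 1: "((%x. norm (w x - w x0)) \<longlongrightarrow> 0) (at x0)" using assms(2) by (intro tendsto_norm_zero LIM_zero) (auto simp: continuous_on_def)
 let ?A = "free (e x0) (w x0)"
 let ?B = "%x. free (e x) (w x0) - ?A"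
 have "cts (%x. free (e x) (w x0))" by (rule continuous_on_compose2[OF free_strongly_continuous assms(1)]) auto
 hence "((%x. norm (?B x)) \<longlongrightarrow> 0) (at x0)"
  by (intro tendsto_norm_zero LIM_zero) (auto simp: continuous_on_def)
 from tendsto_add[OF 1 this] have z: "((%x. norm (w x - w x0) + norm (?B x)) \<longlongrightarrow> 0) (at x0)" by simp
 have "norm (free (e x) (w x) - ?A) <= norm (w x - w x0) + norm (?B x)" for x
 proof -
  have "free (e x) (w x) - ?A = free (e x) (w x - w x0) + (?B x)"
   unfolding linear_diff[OF bounded_linear.linear[OF free_linear]] by simp
  thus ?thesis using norm_triangle_ineq norm_free by metis
 qed
 hence "((%x. free (e x) (w x) - ?A) \<longlongrightarrow> 0) (at x0)" by (intro Lim_null_comparison[OF _ z] always_eventually) blast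
 thus "((%x. free (e x) (w x)) \<longlongrightarrow> ?A) (at x0 within UNIV)" by (simp add: LIM_zero_iff)
qed

text \<open>Integration preserves the exponential rate and gains 1 / L; this gain makes the map in
  \<open>interaction_picture\<close> a contraction.\<close>

lemma exp_bound:
 fixes J :: "real => 'b::real_normed_vector"
 assumes J: "J s = 0" "!!t. (J hvd g t) (at t)" and L: "0 < L" and c: "0 <= c" and g: "!!r. norm (g r) <= c * exp (L * \<bar>r - s\<bar>)"
 shows "norm (J t) <= c / L * exp (L * \<bar>t - s\<bar>)"
proof -
 have cont: "continuous_on S J" for S by (intro continuous_at_imp_continuous_on ballI has_vector_derivative_continuous[OF J(2)])
 let ?A = "%sg b. exp (L * sg * (b - s))"
 \<comment> \<open>\<open>sg\<close> is the sign of r - s, so that one argument treats the intervals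
   on both sides of s.\<close>
 have bound: "norm (J b - J a) <= c / L * (sg * ?A sg b) - c / L * (sg * ?A sg a)"
  if ab: "a < b" and sg: "sg = 1 \<or> sg = - 1" "!!r. a < r ==> r < b ==> \<bar>r - s\<bar> = sg * (r - s)" for a b sg
 proof (rule differentiable_bound_general[OF ab cont])
  show "continuous_on {a..b} (%r. c / L * (sg * ?A sg r))" by (intro continuous_intros)
  fix r assume r: "a < r" "r < b"
  show "(J hvd g r) (at r)" by (rule J(2))
  show "((%r. c / L * (sg * ?A sg r)) hvd c * ?A sg r) (at r)"
   unfolding has_real_derivative_iff_has_vector_derivative[symmetric] using L sg(1) by (auto intro!: derivative_eq_intros)
  show "norm (g r) <= c * ?A sg r" using g[of r] sg(2)[OF r] by (simp add: mult.assoc)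
 qed
 have p: "0 <= c / L" using c L by simp
 consider "s < t" | "s = t" | "t < s" by linarith
 thus ?thesis
 proof cases
  case 1 thus ?thesis using bound[of s t 1] J(1) p by (simp add: algebra_simps)
 next
  case 2 thus ?thesis using J(1) p by simp
 next
  case 3 thus ?thesis using bound[of t s "-1"] J(1) p by (simp add: algebra_simps)
 qed
qed

lemma bilinear_vector_derivative:
 assumes "bounded_bilinear b" "(f hvd f') (at x)" "(g hvd g') (at x)"
 shows "((%x. b (f x) (g x)) hvd b (f x) g' + b f' (g x)) (at x)"
proof -
 interpret bounded_bilinear b by fact
 show ?thesis using FDERIV[OF assms(2,3)[unfolded has_vector_derivative_def]]
  unfolding has_vector_derivative_def by (simp add: scaleR_left scaleR_right scaleR_right_distrib)
qed

lemma free_inner: "free a x \<bullet> free a y = x \<bullet> y" unfolding dot_norm linear_add[OF bounded_linear.linear[OF free_linear], symmetric] norm_free ..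

lemma bl_abs_scale:
 assumes "sq_integrable f"
 shows "bl u (abs_L2 (%x. c * f x)) = c * bl u (abs_L2 f)"
proof -
 have "sq_integrable (%x. c * f x)" by (rule sq_integrable_bounded_mult(1)[OF assms, of _ "cmod c"]) auto
 from bl_abs[OF rep_sq this, of u] bl_abs[OF rep_sq assms, of u] show ?thesis by (simp add: mult.left_commute)
qed

section \<open>Existence, uniqueness and unitarity of the exact propagator\<close>

context potential
begin

text \<open>As N >= 1, the first time derivative of the potential is bounded by \<open>B0\<close>.
  The Lipschitz bound, uniform in x, makes the multiplication operator continuous in time in
  operator norm.\<close>

lemma V_bound: "\<bar>V t x\<bar> <= B0" and V_measurable [measurable]: "bm (V t)"
 and V_lipschitz: "\<bar>V t x - V t' x\<bar> <= B0 * \<bar>t - t'\<bar>"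
proof -
 have c: "ccls B0 (%z. of_real (V t (fst z)))" using Dcls[of 0 "%_. 0" t] by (simp add: D0)
 show "\<bar>V t x\<bar> <= B0" using ccls_bound[OF c, of "(x, x)"] by simp
 have "cts (%z :: (real^'n) \<times> (real^'n). V t (fst z))"
  using c continuous_on_Re[of UNIV "%z :: (real^'n) \<times> (real^'n). complex_of_real (V t (fst z))"] by (simp add: ccls_def)
 from continuous_on_compose2[OF this, of UNIV "%x. (x, 0)"] have "cts (V t)" by (simp add: continuous_on_Pair)
 thus "bm (V t)" by (intro borel_measurable_continuous_onI) simp
 have d: "((%ta. V ta x) hvd D 1 (%_. 0) r x) (at r)" for r
  using Dt[of 0 "%_. 0" x r] N by (simp add: D0 has_real_derivative_iff_has_vector_derivative)
 have "norm (D 1 (%_. 0) r x) <= B0" for r using ccls_bound[OF Dcls[of 1 "%_. 0" r], of "(x, x)"] N by simp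
 from quotient_bound[OF d this, where ?r0.0=t' and d="\<bar>t - t'\<bar> + 1" and h="t - t'"] show "\<bar>V t x - V t' x\<bar> <= B0 * \<bar>t - t'\<bar>" by simp
qed

definition pot :: "real => real => 'n L2 => 'n L2" where
 "pot hbar r = mulL (%x. - \<i> / of_real hbar * of_real (V r x))"

lemma pot_bddm: "0 < hbar ==> bddm (B0 / hbar) (%x. - \<i> / of_real hbar * of_real (V r x))"
 unfolding bddm_def using V_bound[of r] by (auto simp: norm_mult norm_divide divide_right_mono)

lemma norm_pot: "0 < hbar ==> norm (pot hbar r u) <= B0 / hbar * norm u" unfolding pot_def by (rule norm_mulL[OF pot_bddm])

lemma pot_linear: "0 < hbar ==> bounded_linear (pot hbar r)" unfolding pot_def by (rule linear_mulL[OF pot_bddm])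

lemma pot_lipschitz:
 assumes h: "0 < hbar"
 shows "norm (pot hbar r u - pot hbar r' u) <= B0 / hbar * \<bar>r - r'\<bar> * norm u"
proof -
 let ?m = "%x. - \<i> / of_real hbar * of_real (V r x - V r' x)"
 have m: "?m \<in> borel_measurable borel" by measurable
 have b: "cmod (?m x) <= B0 / hbar * \<bar>r - r'\<bar>" for x using V_lipschitz[of r x r'] h by (simp add: norm_mult norm_divide divide_right_mono del: of_real_diff)
 have "pot hbar r u - pot hbar r' u = abs_L2 (%x. ?m x * rep_L2 u x)"
  unfolding pot_def mulL_def abs_diff(1)[OF bddm_sq[OF pot_bddm[OF h] rep_sq] bddm_sq[OF pot_bddm[OF h] rep_sq]] by (simp add: algebra_simps)
 thus ?thesis using sq_integrable_bounded_mult[OF rep_sq m b, of u] by (simp add: norm_abs)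
qed

lemma pot_continuous:
 assumes h: "0 < hbar" and w: "cts w"
 shows "cts (%r. pot hbar r (w r))" unfolding continuous_on_def
proof
 fix r0 :: real
 have wt: "(w \<longlongrightarrow> w r0) (at r0)" using w by (auto simp: continuous_on_def)
 let ?A = "%r. B0 / hbar * norm (w r - w r0) + B0 / hbar * \<bar>r - r0\<bar> * norm (w r0)"
 have "(?A \<longlongrightarrow> B0 / hbar * norm (w r0 - w r0) + B0 / hbar * \<bar>r0 - r0\<bar> * norm (w r0)) (at r0)"
  by (intro tendsto_intros wt)
 hence z: "(?A \<longlongrightarrow> 0) (at r0)" by simp
 let ?B = "pot hbar r0 (w r0)"
 have "norm (pot hbar r (w r) - ?B) <= B0 / hbar * norm (w r - w r0) + B0 / hbar * \<bar>r - r0\<bar> * norm (w r0)" for r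
 proof -
  have "pot hbar r (w r) - ?B = pot hbar r (w r - w r0) + (pot hbar r (w r0) - ?B)"
   unfolding linear_diff[OF bounded_linear.linear[OF pot_linear[OF h]]] by simp
  thus ?thesis by (simp only: norm_triangle_mono[OF norm_pot[OF h] pot_lipschitz[OF h]])
 qed
 hence "((%r. pot hbar r (w r) - ?B) \<longlongrightarrow> 0) (at r0)" by (intro Lim_null_comparison[OF _ z] always_eventually) blast
 thus "((%r. pot hbar r (w r)) \<longlongrightarrow> ?B) (at r0 within UNIV)" by (simp add: LIM_zero_iff)
qed

lemma pot_skew: "0 < hbar ==> w \<bullet> pot hbar r w = 0"
proof -
 assume h: "0 < hbar"
 have "abs_L2 (rep_L2 w) \<bullet> pot hbar r w = (LBINT x. rep_L2 w x \<bullet> (- \<i> / hbar * of_real (V r x) * rep_L2 w x))"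
  unfolding pot_def mulL_def by (rule inner_L2.abs_eq[OF abs_rel[OF rep_sq] abs_rel[OF bddm_sq[OF pot_bddm[OF h] rep_sq]]])
 also have "... = 0"
 proof -
  have "z \<bullet> (- \<i> / of_real hbar * of_real v * z) = 0" for z v using h by (simp add: inner_complex_def Re_divide_of_real Im_divide_of_real)
  thus ?thesis by simp
 qed
 finally show ?thesis by simp
qed

text \<open>The equation in the interaction picture; it is solved by a contraction in a space of continuous
 functions of exponential growth.\<close>
lemma interaction_picture:
 assumes h: "0 < hbar"
 shows "\<exists>v. v s = u0 \<and> (\<forall>t. (v hvd free (hbar / 2 * (s - t)) (pot hbar t (free (hbar / 2 * (t - s)) (v t)))) (at t))"
proof -
 define ham where "ham t u = free (hbar / 2 * (s - t)) (pot hbar t (free (hbar / 2 * (t - s)) u))" for t u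
 define C where "C = B0 / hbar + 1"
 have C: "0 < C" "B0 / hbar <= C" using B0_nonneg h by (auto simp: C_def add_nonneg_pos)
 \<comment> \<open>The transformed generator is bounded by C, and the weight grows at rate 2 C, so
   integration gains 1 / (2 C) and the contraction constant is 1 / 2 on the whole time axis.\<close>
 let ?B = "%t. exp (2 * C * \<bar>t - s\<bar>)"
 define e where "e t = ?B t" for t
 have e0: "0 < e t" for t by (simp add: e_def)
 have ec: "cts e" unfolding e_def[abs_def] by (intro continuous_intros)
 have hn: "norm (ham t u) <= C * norm u" for t u
  unfolding ham_def norm_free using norm_pot[OF h, of t "free (hbar / 2 * (t - s)) u"] mult_right_mono[OF C(2) norm_ge_zero[of u]] by simp
 have hc: "cts (%t. ham t (w t))" if "cts w" for w
  unfolding ham_def by (intro free_jointly_continuous pot_continuous h that continuous_intros)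
 have hd: "ham t u - ham t w = ham t (u - w)" for t u w
  unfolding ham_def by (simp add: linear_diff[OF bounded_linear.linear[OF free_linear]] linear_diff[OF bounded_linear.linear[OF pot_linear[OF h]]])
 \<comment> \<open>The unknown is written as \<open>e\<close> times a bounded continuous function w,
   which lives in a complete space; \<open>G\<close> is the right-hand side in terms of w.\<close>
 define G where "G w t = ham t (e t *R apply_bcontfun w t)" for w t
 have Gc: "cts (G w)" for w unfolding G_def[abs_def] by (intro hc continuous_intros ec) auto
 have "\<exists>J. J s = 0 \<and> (\<forall>t. (J hvd G w t) (at t))" for w by (rule antiderivative[OF Gc])
 then obtain J where J0: "!!w. J w s = 0" and J: "!!w t. (J w hvd G w t) (at t)" by (metis choice)
 have Jb: "norm (J w t - J w' t) <= dist w w' / 2 * e t" for w w' t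
 proof -
  have "norm (G w r - G w' r) <= (C * dist w w') * ?B r" for r
  proof -
   let ?A = "apply_bcontfun w r - apply_bcontfun w' r"
   have "G w r - G w' r = ham r (e r *R ?A)" unfolding G_def hd scaleR_diff_right ..
   hence "norm (G w r - G w' r) <= C * (e r * norm ?A)"
    using hn[of r "e r *R ?A"] e0[of r] by simp
   also have "... <= C * (e r * dist w w')" using C e0[of r] dist_bounded[of w r w'] by (intro mult_left_mono) (auto simp: dist_norm[symmetric])
   finally show ?thesis by (simp add: e_def mult_ac)
  qed
  hence "norm (J w t - J w' t) <= (C * dist w w') / (2 * C) * ?B t"
   by (intro exp_bound[where J="%t. J w t - J w' t" and g="%t. G w t - G w' t"] has_vector_derivative_diff J) (use C(1) in \<open>auto simp: J0\<close>)
  thus ?thesis using C(1) by (simp add: e_def)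
 qed
 define Ph where "Ph w t = inverse (e t) *R (u0 + J w t)" for w t
 have "Ph w \<in> bcontfun" for w
 proof (rule bcontfun_normI)
  have "cts (J w)" by (intro continuous_at_imp_continuous_on ballI has_vector_derivative_continuous[OF J])
  thus "cts (Ph w)" unfolding Ph_def[abs_def] using e0 by (intro continuous_intros ec) (auto simp: less_imp_neq[THEN not_sym])
  fix t
  have e1: "1 <= e t" unfolding e_def using C(1) by simp
  have G0: "G 0 r = 0" for r unfolding G_def using hn[of r 0] by simp
  have "norm (J 0 t) <= 0 / 1 * exp (1 * \<bar>t - s\<bar>)" by (rule exp_bound[OF J0 J zero_less_one order_refl]) (simp add: G0)
  hence "J 0 t = 0" by simp
  hence "norm (J w t) <= norm w / 2 * e t" using Jb[of w t 0] by (simp add: dist_norm)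
  hence "norm (u0 + J w t) <= (norm u0 + norm w / 2) * e t"
   using norm_triangle_ineq[of u0 "J w t"] mult_left_mono[OF e1 norm_ge_zero[of u0]] by (simp add: distrib_right)
  thus "norm (Ph w t) <= norm u0 + norm w / 2"
   using e0[of t] by (simp add: Ph_def pos_divide_le_eq divide_inverse_commute[symmetric] del: scaleR_right_distrib)
 qed
 hence Ph: "apply_bcontfun (Bcontfun (Ph w)) = Ph w" for w by (simp add: Bcontfun_inverse)
 have "\<exists>!w. Bcontfun (Ph w) = w"
 proof (rule banach_fix_type[of "1 / 2"])
  have "dist (apply_bcontfun (Bcontfun (Ph w)) t) (apply_bcontfun (Bcontfun (Ph w')) t) <= 1 / 2 * dist w w'" for w w' t
  proof -
   have "dist (Ph w t) (Ph w' t) = inverse (e t) * norm (J w t - J w' t)" unfolding dist_norm Ph_def scaleR_diff_right[symmetric] using e0[of t] by simp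
   also have "... <= inverse (e t) * (dist w w' / 2 * e t)" using e0[of t] by (intro mult_left_mono Jb) simp
   finally show ?thesis unfolding Ph using e0[of t] by (simp add: field_simps)
  qed
  thus "\<forall>w w'. dist (Bcontfun (Ph w)) (Bcontfun (Ph w')) <= 1 / 2 * dist w w'" by (intro allI dist_bound)
 qed simp_all
 then obtain w where w: "Bcontfun (Ph w) = w" by blast
 have v: "e t *R apply_bcontfun w t = u0 + J w t" for t using Ph[of w] e0[of t] unfolding w by (simp add: Ph_def)
 have "((%t. u0 + J w t) hvd ham t (u0 + J w t)) (at t)" for t
  using has_vector_derivative_add[OF has_vector_derivative_const[of u0] J[of w t]] by (simp add: G_def v)
 thus ?thesis unfolding ham_def by (intro exI[of _ "%t. u0 + J w t"]) (simp add: J0)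
qed

text \<open>The generator transposed to the test function. It has the same form as the generator
  itself, since both the Laplacian and the potential are symmetric for \<open>bl\<close>.\<close>

definition gen :: "real => (real^'n => complex) => real => real^'n => complex" where
 "gen hbar fi t x = of_real (hbar / 2) * (\<i> * laplacian fi x) + - \<i> / of_real hbar * of_real (V t x) * fi x"

definition weak_sol :: "real => (real => 'n L2) => bool" where
 "weak_sol hbar u \<longleftrightarrow> cts u \<and>
   (\<forall>fi\<in>schwartz. \<forall>t. ((%ta. bl (u ta) (abs_L2 fi)) hvd bl (u t) (abs_L2 (gen hbar fi t))) (at t))"

lemma
 assumes h: "0 < hbar" and fi: "fi \<in> schwartz"
 shows gen_sq: "sq_integrable (gen hbar fi t)"
  and bl_gen: "bl u (abs_L2 (gen hbar fi t)) = (hbar / 2) *R bl u (abs_L2 (%x. \<i> * laplacian fi x)) + bl (pot hbar t u) (abs_L2 fi)"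
proof -
 note a = l12_laplacian[OF fi]
 note l = l12_sq[OF l12_scale[OF a, of \<i>]] l12_sq[OF l12_scale[OF l12_scale[OF a, of \<i>], of "of_real (hbar / 2)"]] l12_sq[OF schwartz_basic(4)[OF fi]]
 note p = bddm_sq[OF pot_bddm[OF h] l(3), of t]
 show "sq_integrable (gen hbar fi t)" unfolding gen_def[abs_def] by (rule sq_integrable_add[OF l(2) p])
 show "bl u (abs_L2 (gen hbar fi t)) = (hbar / 2) *R bl u (abs_L2 (%x. \<i> * laplacian fi x)) + bl (pot hbar t u) (abs_L2 fi)"
  unfolding gen_def[abs_def] abs_add[OF l(2) p, symmetric] bl.add_right bl_abs_scale[OF l(1)]
   mulL_abs[OF pot_bddm[OF h] l(3), symmetric] pot_def bl_mulL[OF pot_bddm[OF h]] by (simp add: scaleR_conv_of_real)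
qed

lemma solution_iff:
 assumes h: "0 < hbar"
 shows "schrodinger_solution hbar V s u0 u \<longleftrightarrow> weak_sol hbar u \<and> u s = u0"
proof -
 let ?A = "%fi t. %x. - of_real (hbar^2 / 2) * laplacian fi x + of_real (V t x) * fi x"
 have "(\<exists>D. ((%ta. l2_pairing (u ta) fi) hvd D) (at t) \<and>
    \<i> * hbar * D = l2_pairing (u t) (?A fi t)) \<longleftrightarrow>
   ((%ta. bl (u ta) (abs_L2 fi)) hvd bl (u t) (abs_L2 (gen hbar fi t))) (at t)" if fi: "fi \<in> schwartz" for fi t
 proof -
  have g: "(?A fi t) = (%x. \<i> * hbar * gen hbar fi t x)"
   using h by (auto simp: gen_def fun_eq_iff field_simps power2_eq_square)
  have s: "sq_integrable (%x. \<i> * hbar * gen hbar fi t x)"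
   by (rule sq_integrable_bounded_mult(1)[OF gen_sq[OF h fi], of _ hbar]) (use h in \<open>auto simp: norm_mult\<close>)
  have "sq_integrable fi" using fi by (intro l12_sq schwartz_basic(4))
  thus ?thesis unfolding g l2_pairing_abs[OF s] bl_abs_scale[OF gen_sq[OF h fi]] using h by (simp add: l2_pairing_abs)
 qed
 thus ?thesis unfolding schrodinger_solution_def weak_sol_def by auto
qed

text \<open>The interaction picture is undone with \<open>free\<close>. The norm is conserved
  because multiplication by - i V / hbar is skew for a real potential and \<open>free\<close> is
  isometric.\<close>

lemma weak_sol_exists:
 assumes h: "0 < hbar"
 shows "\<exists>u. weak_sol hbar u \<and> u s = u0 \<and> (\<forall>t. norm (u t) = norm u0)"
proof -
 let ?A = "%t. hbar / 2 * (t - s)"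
 obtain v where v: "v s = u0" "!!t. (v hvd free (hbar / 2 * (s - t)) (pot hbar t (free (?A t) (v t)))) (at t)"
  using interaction_picture[OF h] by blast
 have vc: "cts v" by (intro continuous_at_imp_continuous_on ballI has_vector_derivative_continuous[OF v(2)])
 have n: "norm (v t) = norm u0" for t
 proof -
  have "((%t. v t \<bullet> v t) hvd 0) (at t)" for t
  proof -
   let ?w = "free (hbar / 2 * (t - s)) (v t)"
   have z: "hbar / 2 * (s - t) + hbar / 2 * (t - s) = 0" by (simp only: distrib_left[symmetric]) simp
   have "?w \<bullet> pot hbar t ?w = v t \<bullet> free (hbar / 2 * (s - t)) (pot hbar t ?w)"
    using free_inner[of "hbar / 2 * (s - t)" ?w "pot hbar t ?w"] unfolding free_free z free_0 by simp
   thus ?thesis using bilinear_vector_derivative[OF bounded_bilinear_inner v(2) v(2), of t] pot_skew[OF h] by (simp add: inner_commute)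
  qed
  from zero_derivative_constant[OF this, of t s] show ?thesis by (simp add: norm_eq_sqrt_inner v(1))
 qed
 define u where "u t = free (?A t) (v t)" for t
 have "weak_sol hbar u" unfolding weak_sol_def
 proof (intro conjI ballI allI)
  show "cts u" unfolding u_def by (intro free_jointly_continuous vc continuous_intros)
  fix fi :: "real^'n => complex" and t assume fi: "fi \<in> schwartz"
  have "((%t. hbar / 2 * (t - s)) hvd hbar / 2) (at t)"
   unfolding has_real_derivative_iff_has_vector_derivative[symmetric] by (auto intro!: derivative_eq_intros)
  from vector_diff_chain_at[OF this free_derivative[OF fi]]
  have "((%t. free (?A t) (abs_L2 fi)) hvd (hbar / 2) *R free (?A t) (abs_L2 (%x. \<i> * laplacian fi x))) (at t)"
   by (simp add: o_def)
  from bilinear_vector_derivative[OF bounded_bilinear_bl v(2) this]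
  have "((%t. bl (u t) (abs_L2 fi)) hvd (hbar / 2) *R bl (u t) (abs_L2 (%x. \<i> * laplacian fi x))
    + bl (free (?A t) (free (hbar / 2 * (s - t)) (pot hbar t (u t)))) (abs_L2 fi)) (at t)" unfolding u_def by (simp only: free_adjoint bl.scaleR_right)
  thus "((%t. bl (u t) (abs_L2 fi)) hvd bl (u t) (abs_L2 (gen hbar fi t))) (at t)"
   unfolding bl_gen[OF h fi] free_free by (simp only: distrib_left[symmetric]) simp
 qed
 thus ?thesis using n by (intro exI[of _ u]) (simp add: u_def v(1))
qed

lemma weak_sol_add:
 assumes h: "0 < hbar" and u: "weak_sol hbar u" "weak_sol hbar v"
 shows "weak_sol hbar (%t. u t + c *R v t)" unfolding weak_sol_def bl.add_left bl.scaleR_left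
 using u unfolding weak_sol_def by (auto intro!: continuous_intros has_vector_derivative_add bounded_linear.has_vector_derivative[OF bounded_linear_scaleR_right])

text \<open>The motion of the free wave cancels the Laplacian contained in \<open>gen\<close>; what
  remains is the bounded potential term, which \<open>gronwall_dual\<close> can handle.\<close>

lemma weak_sol_pairing:
 assumes h: "0 < hbar" and u: "weak_sol hbar u" and ps: "okc ps"
 shows "((%r. bl (u r) (combL (shift (hbar / 2 * (t - r)) ps))) has_vector_derivative
   bl (pot hbar r (u r)) (combL (shift (hbar / 2 * (t - r)) ps))) (at r)"
proof -
 let ?p = "%r. comb (shift (hbar / 2 * (t - r)) ps)"
 have s: "?p r \<in> schwartz" by (rule gp_schwartz[OF gp_comb]) (simp add: ps)
 have "((%r. hbar / 2 * (t - r)) hvd - (hbar / 2)) (at r)"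
  unfolding has_real_derivative_iff_has_vector_derivative[symmetric] by (auto intro!: derivative_eq_intros)
 from vector_diff_chain_at[OF this combL_derivative[OF ps]]
 have "((%r. abs_L2 (?p r)) hvd (- (hbar / 2)) *R abs_L2 (%x. \<i> * laplacian (?p r) x)) (at r)" by (simp add: o_def)
 moreover have "isCont u r" using u by (simp add: weak_sol_def continuous_on_eq_continuous_at)
 moreover have "((%r'. bl (u r') (abs_L2 (?p r))) hvd bl (u r) (abs_L2 (gen hbar (?p r) r))) (at r)" using u s unfolding weak_sol_def by blast
 ultimately have "((%r. bl (u r) (abs_L2 (?p r))) hvd bl (u r) (abs_L2 (gen hbar (?p r) r)) + bl (u r) ((- (hbar / 2)) *R abs_L2 (%x. \<i> * laplacian (?p r) x))) (at r)"
  by (intro weak_product)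
 thus ?thesis unfolding bl_gen[OF h s] bl.scaleR_right by simp
qed

text \<open>This is \<open>gronwall_dual\<close> with inhomogeneity 0, applied to a solution with
  vanishing initial value.\<close>

lemma weak_sol_unique:
 assumes h: "0 < hbar" and u: "weak_sol hbar u" and z: "u s = 0"
 shows "u t = 0"
proof (cases "t = s")
 case False
 \<comment> \<open>\<open>gronwall_dual\<close> runs forward in time; reflection at s by the sign
   \<open>sg\<close> covers the times before s.\<close>
 define sg where "sg = sgn (t - s)"
 have sg: "\<bar>sg\<bar> = 1" "sg * sg = 1" using False by (auto simp: sg_def sgn_if)
 define t1 where "t1 = s + \<bar>t - s\<bar>"
 define d where "d r = u (s + sg * (r - s))" for r
 have uc: "continuous_on S u" for S using u continuous_on_subset unfolding weak_sol_def by blast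
 have dc: "continuous_on S d" for S unfolding d_def by (rule continuous_on_compose2[OF uc[of UNIV]]) (auto intro!: continuous_intros)
 have "bounded (d ` {s..t1})" by (intro compact_imp_bounded compact_continuous_image dc compact_Icc)
 then obtain M where M: "!!r. r \<in> {s..t1} ==> norm (d r) <= M" unfolding bounded_iff by blast
 define C where "C = B0 / hbar + 1"
 have C: "0 < C" "B0 / hbar <= C" using B0_nonneg h by (auto simp: C_def add_nonneg_pos)
 let ?B = "%t' r ps. combL (shift (sg * (hbar / 2) * (t' - r)) ps)"
 let ?C = "%r. pot hbar (s + sg * (r - s)) (d r)"
 have der: "((%r. bl (d r) (?B t' r ps)) has_vector_derivative
   sg *R bl (?C r) (?B t' r ps)) (at r)" if ps: "okc ps" for ps t' r
 proof -
  have "((%r. s + sg * (r - s)) hvd sg) (at r)"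
   unfolding has_real_derivative_iff_has_vector_derivative[symmetric] by (auto intro!: derivative_eq_intros)
  from vector_diff_chain_at[OF this weak_sol_pairing[OF h u ps, of "s + sg * (t' - s)"]]
  have "((%r. bl (d r) (combL (shift (hbar / 2 * (s + sg * (t' - s) - (s + sg * (r - s)))) ps))) has_vector_derivative
   sg *R bl (?C r) (combL (shift (hbar / 2 * (s + sg * (t' - s) - (s + sg * (r - s)))) ps))) (at r)"
   by (simp add: o_def d_def)
  moreover have "hbar / 2 * (s + sg * (t' - s) - (s + sg * (r - s))) = sg * (hbar / 2) * (t' - r)" for r by (simp add: algebra_simps)
  ultimately show ?thesis by (simp only:)
 qed
 have "norm (d t1) <= 2 * 0 * (t1 - s) * exp (2 * C * (t1 - s))"
 proof (rule gronwall_dual[OF _ C(1) order_refl])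
  show "s < t1" using False by (simp add: t1_def)
  show "norm (d r) <= M" if "s < r" "r <= t1" for r using M that by simp
  fix t' r and ps :: "(complex \<times> complex \<times> (real^'n)) list" assume ps: "okc ps"
  have "((%r. bl (d r) (?B t' r ps)) \<longlongrightarrow> bl (d s) (combL (shift (sg * (hbar / 2) * (t' - s)) ps))) (at s)"
   using has_vector_derivative_continuous[OF der[OF ps, of t' s]] by (simp add: isCont_def)
  thus "((%r. bl (d r) (?B t' r ps)) \<longlongrightarrow> 0) (at_right s)"
   using z by (auto simp: d_def bl.zero_left intro: tendsto_within_subset)
  let ?A = "combL (shift (sg * (hbar / 2) * (t' - r)) ps)"
  have "cmod (bl (?C r) (?A)) <= (C * norm (d r)) * norm (combL ps)"
   using norm_bl[of "?C r" "?A"]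
    mult_right_mono[OF order_trans[OF norm_pot[OF h] mult_right_mono[OF C(2) norm_ge_zero]] norm_ge_zero, of "s + sg * (r - s)" "d r" "combL ps"]
   by (simp add: norm_comb_shift[OF ps])
  thus "\<exists>D. ((%r. bl (d r) (?B t' r ps)) hvd D) (at r) \<and> cmod D <= (C * norm (d r) + 0) * norm (combL ps)"
   using der[OF ps, of t' r] sg(1) by (intro exI conjI) (assumption, simp)
 qed
 moreover have "sg * (t1 - s) = t - s" by (simp add: sg_def t1_def sgn_mult_abs)
 ultimately show ?thesis by (simp add: d_def)
qed (use z in simp)

lemma propagator_eq:
 assumes h: "0 < hbar" and u: "weak_sol hbar u"
 shows "propagator hbar V t s (u s) = u t"
proof -
 have "(THE u'. schrodinger_solution hbar V s (u s) u') = u"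
 proof (rule the_equality, unfold solution_iff[OF h])
  fix u' assume u': "weak_sol hbar u' \<and> u' s = u s"
  have "u' r = u r" for r using weak_sol_unique[OF h weak_sol_add[OF h conjunct1[OF u'] u, of "-1"], of s r] u' by simp
  thus "u' = u" by blast
 qed (use u in simp)
 thus ?thesis by (simp add: propagator_def)
qed

lemma propagator_solution:
 assumes h: "0 < hbar"
 shows "weak_sol hbar (%t. propagator hbar V t s u0)" "propagator hbar V s s u0 = u0" "norm (propagator hbar V t s u0) = norm u0"
proof -
 obtain u where u: "weak_sol hbar u" "u s = u0" "!!t. norm (u t) = norm u0" using weak_sol_exists[OF h] by blast
 have "propagator hbar V t s u0 = u t" for t using propagator_eq[OF h u(1), of t s] u(2) by simp
 thus "weak_sol hbar (%t. propagator hbar V t s u0)" "propagator hbar V s s u0 = u0" "norm (propagator hbar V t s u0) = norm u0" using u by simp_all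
qed

lemma propagator_linear:
 assumes h: "0 < hbar"
 shows "bounded_linear (propagator hbar V t s)"
proof (rule bounded_linear_intro[where K=1])
 have a: "propagator hbar V t s (u + c *R v) = propagator hbar V t s u + c *R propagator hbar V t s v" for u v c
  using propagator_eq[OF h weak_sol_add[OF h propagator_solution(1)[OF h] propagator_solution(1)[OF h]], of t s s u c s v] by (simp add: propagator_solution(2)[OF h])
 show "propagator hbar V t s (u + v) = propagator hbar V t s u + propagator hbar V t s v" for u v using a[of u 1 v] by simp
 have "norm (propagator hbar V t s 0) = 0" by (simp add: propagator_solution(3)[OF h])
 thus "propagator hbar V t s (c *R v) = c *R propagator hbar V t s v" for c v using a[of 0 c v] by simp
qed (simp add: propagator_solution(3)[OF h])

end

section \<open>The error estimate\<close>

context slice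
begin

text \<open>At most N^2 pairs (j, l), each a sum over the coordinates of products bounded by B^2,
  with surplus power ta^(j + l - N) at most max(1, T)^N. The last summand comes from the Laplacian
  of W_N.\<close>

definition "Cr T = real N ^ 2 * (real CARD('n) * (B * B)) * max 1 T ^ N + real CARD('n) * B"

lemma rm_ccls:
 assumes t: "0 < ta" "ta <= T * hbar"
 shows "ccls (Cr T * ta ^ N) (rm ta)"
proof -
 let ?P = "{p \<in> {1..N} \<times> {1..N}. N <= fst p + snd p}"
 let ?n = "real CARD('n)"
 have fin: "finite ?P" by simp
 have nt: "cmod (of_real (ta ^ k)) = ta ^ k" for k using t by (simp only: norm_of_real abs_of_nonneg zero_le_power less_imp_le)
 have "card ?P <= card ({1..N} \<times> {1..N})" by (rule card_mono) auto
 hence cP: "real (card ?P) <= real N ^ 2" by (simp add: power2_eq_square flip: of_nat_mult)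
 define g where "g p = cmod (of_real (ta ^ (fst p + snd p))) * (\<Sum>i\<in>(UNIV :: 'n set). B * B)" for p :: "nat \<times> nat"
 let ?C = "\<Sum>p\<in>?P. g p"
 have 1: "ccls ?C (%z. \<Sum>p\<in>?P. of_real (ta ^ (fst p + snd p)) * (\<Sum>i\<in>UNIV. dW hbar s (fst p) i z * dW hbar s (snd p) i z))"
  unfolding good.simps(1)[symmetric] g_def by (rule good_sum[OF fin], rule good_scale, rule good_sum) (auto intro!: ccls_mult ccls_W)
 let ?A = "cmod (of_real (ta ^ N)) * (\<Sum>i\<in>(UNIV :: 'n set). B)"
 have 2: "ccls ?A (%z. of_real (ta ^ N) * (\<Sum>i\<in>UNIV. ddW hbar s N i z))"
  unfolding good.simps(1)[symmetric] by (rule good_scale, rule good_sum) (auto intro!: ccls_W)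
 let ?D = "cmod (\<i> * of_real hbar / 2)"
 have c: "ccls (cmod (- (1 / 2)) * ?C + ?D * ?A) (rm ta)"
  using ccls_add[OF ccls_scale[OF 1, of "- (1 / 2)"] ccls_scale[OF 2, of "\<i> * of_real hbar / 2"]]
  unfolding rm_def[abs_def] by (simp only: mult.commute[of "of_real (ta ^ _)"])
 have gp: "g p <= ?n * (B * B) * max 1 T ^ N * ta ^ N" if "p \<in> ?P" for p
 proof -
  have "ta ^ (fst p + snd p) = ta ^ N * ta ^ (fst p + snd p - N)" using that by (simp add: power_add[symmetric])
  also have "... <= ta ^ N * max 1 T ^ (fst p + snd p - N)" using t tau_le[OF t] by (intro mult_left_mono power_mono) auto
  also have "... <= ta ^ N * max 1 T ^ N" using t that by (intro mult_left_mono power_increasing) auto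
  finally have "ta ^ (fst p + snd p) <= ta ^ N * max 1 T ^ N" .
  hence "g p <= ta ^ N * max 1 T ^ N * (\<Sum>i\<in>(UNIV :: 'n set). B * B)" unfolding g_def nt using B by (intro mult_right_mono sum_nonneg) auto
  thus ?thesis by (simp add: mult_ac)
 qed
 have g0: "0 <= g p" for p unfolding g_def using B by (intro mult_nonneg_nonneg sum_nonneg) auto
 let ?B = "?n * (B * B) * max 1 T ^ N * ta ^ N"
 have "cmod (- (1 / 2)) * ?C <= (\<Sum>p\<in>?P. g p)" using sum_nonneg[of ?P g] g0 by simp
 also have "... <= (\<Sum>p\<in>?P. ?n * (B * B) * max 1 T ^ N * ta ^ N)" by (rule sum_mono[OF gp])
 also have "... = real (card ?P) * ?B" by simp
 also have "... <= real N ^ 2 * ?B" using t B by (intro mult_right_mono cP) auto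
 finally have a: "cmod (- (1 / 2)) * ?C <= real N ^ 2 * ?B" .
 have "?D <= 1" using h by (simp add: norm_divide norm_mult)
 from mult_right_mono[OF this, of "cmod (of_real (ta ^ N)) * (\<Sum>i\<in>(UNIV :: 'n set). B)"]
 have "?D * ?A <= ?n * B * ta ^ N" unfolding nt using B t by (simp add: mult_ac)
 from ccls_mono[OF c add_mono[OF a this]] show ?thesis by (simp add: Cr_def algebra_simps)
qed

lemma Vs_error:
 assumes "0 < ta"
 shows "\<bar>Vs ta x - V (s + ta) x\<bar> <= B0 * ta ^ N"
proof -
 obtain r where r: "V (s + ta) x = (\<Sum>m<N. (D m (%_. 0) s x / fact m) * (s + ta - s) ^ m) + (D N (%_. 0) r x / fact N) * (s + ta - s) ^ N"
  using Taylor_up[of N "%m t. D m (%_. 0) t x" "%t. V t x" s "s + ta" s] N assms Dt[of _ "%_. 0" x] by (auto simp: D0)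
 have f: "1 <= (fact N :: real)" by (rule fact_ge_1)
 have "\<bar>D N (%_. 0) r x\<bar> <= B0" using ccls_bound[OF Dcls[of N "%_. 0" r], of "(x, x)"] by simp
 hence "\<bar>D N (%_. 0) r x\<bar> / fact N <= B0 / 1" using f by (intro frac_le) auto
 from mult_right_mono[OF this, of "ta ^ N"] show ?thesis unfolding r Vs_def using assms by (simp add: mult_ac abs_mult)
qed

definition "K1 T = CK T * exp (Am T * T) * (B0 + Cr T)"
text \<open>The horizon is doubled in \<open>K1\<close> so that the estimates hold on both sides of
  the final time, where a two-sided derivative is taken. The exponential is Gronwall's with constant
  (B0 + 1) / hbar, positive even if \<open>B0\<close> is 0, over a time of at most T hbar.\<close>

definition "Err T = 2 * K1 (2 * T) * exp (2 * (B0 + 1) * T)"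

lemma K1_nonneg: "0 <= K1 T" unfolding K1_def Cr_def using CK_pos[of T] B B0_nonneg by simp

text \<open>\<open>Vs\<close> + \<open>rm\<close> is split into V, the Taylor error
  \<open>Vs\<close> - V, and \<open>rm\<close>. The first part is the exact potential term acting on
  the approximate solution; the other two carry the factor (r - s)^N.\<close>

lemma defect_derivative:
 assumes r: "s < r" "r - s <= T * hbar" and f: "f \<in> schwartz" and ps: "okc ps" and w: "w = abs_L2 (op (r - s) f)"
  and F': "\<i> * of_real hbar * F' = (LBINT z. (of_real (Vs (r - s) (fst z)) + rm (r - s) z) * (kern (r - s) z * (f (snd z) * wave t ps r (fst z))))"
 shows "cmod (F' - bl (pot hbar r w) (combL (shift (hbar / 2 * (t - r)) ps))) <= K1 T * (r - s) ^ N / hbar * l2n f * norm (combL ps)"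
proof -
 let ?ta = "r - s" and ?p = "wave t ps r" and ?c = "CK T * exp (Am T * T)"
 have ta: "0 < ?ta" "?ta <= T * hbar" using r by auto
 have lf: "l12 f" by (rule schwartz_basic(4)[OF f])
 have lp: "l12 ?p" by (rule schwartz_basic(4)[OF gp_schwartz[OF gp_comb]]) (simp add: ps)
 have pn: "l2n ?p = norm (combL ps)" using norm_abs[OF l12_sq[OF lp]] norm_comb_shift[OF ps] by simp
 define g where "g x = of_real (Vs ?ta x - V r x) * ?p x" for x
 have [measurable]: "Vs ?ta \<in> borel_measurable borel"
 proof -
  have "bm (%x. Re (of_real (D k (%_. 0) s (fst (x, 0 :: real^'n)))))" if "k < N" for k
  proof -
   have "cts (%z :: (real^'n) \<times> (real^'n). D k (%_. 0) s (fst z))"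
    using Dcls[of k "%_. 0" s] that continuous_on_Re[of UNIV "%z :: (real^'n) \<times> (real^'n). complex_of_real (D k (%_. 0) s (fst z))"] by (simp add: ccls_def)
   from continuous_on_compose2[OF this, of UNIV "%x. (x, 0)"] show ?thesis by (intro borel_measurable_continuous_onI) (simp add: continuous_on_Pair)
  qed
  thus ?thesis unfolding Vs_def[abs_def] by (intro borel_measurable_sum borel_measurable_times) auto
 qed
 have "bm (%x. complex_of_real (Vs ?ta x - V r x))" by measurable
 moreover have "cmod (of_real (Vs ?ta x - V r x)) <= B0 * ?ta ^ N" for x
  using Vs_error[OF ta(1), of x] by (simp only: norm_of_real add.commute[of s] diff_add_cancel)
 ultimately have lg: "l12 g" "l2n g <= B0 * ?ta ^ N * l2n ?p" unfolding g_def by (rule l12_bounded_mult[OF lp])+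
 have lV: "l12 (%x. of_real (V r x) * ?p x)" by (rule l12_bounded_mult(1)[OF lp, of _ B0]) (use V_bound in auto)
 have iV: "lint (%z. kern ?ta z * (f (snd z) * (of_real (V r (fst z)) * ?p (fst z))))"
  and ig: "lint (%z. kern ?ta z * (f (snd z) * g (fst z)))" by (rule kern_small(2)[OF ta lf lV] kern_small(2)[OF ta lf lg(1)])+
 let ?F = "%z. rm ?ta z * (kern ?ta z * (f (snd z) * ?p (fst z)))"
 let ?G = "Cr T * ?ta ^ N"
 let ?I = "%z. kern ?ta z * (f (snd z) * ?p (fst z))"
 have ir: "lint ?F"
 proof (rule ibound[OF integrable_mult_right[OF kern_small(2)[OF ta lf lp], of "of_real ?G"]])
  note rc = rm_ccls[OF ta]
  have "rm ?ta \<in> borel_measurable borel" using rc unfolding ccls_def by (intro borel_measurable_continuous_onI) simp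
  thus "?F \<in> borel_measurable lborel"
   using borel_measurable_integrable[OF kern_small(2)[OF ta lf lp]] by simp
  show "AE z in lborel. norm (rm ?ta z * (?I z)) <= norm (of_real ?G * (?I z))"
   unfolding norm_mult[of "rm _ _"] norm_mult[of "of_real (Cr T * _)"] norm_of_real
   by (intro AE_I2 mult_right_mono order_trans[OF ccls_bound[OF rc] abs_ge_self] norm_ge_zero)
 qed
 let ?A = "bl (pot hbar r w) (combL (shift (hbar / 2 * (t - r)) ps))"
 let ?D = "LBINT z. kern ?ta z * (f (snd z) * (of_real (V r (fst z)) * ?p (fst z)))"
 let ?E = "LBINT x. op ?ta f x * (- \<i> / of_real hbar * of_real (V r x) * ?p x)"
 have "?D = (LBINT x. op ?ta f x * (of_real (V r x) * ?p x))"
  by (rule op_pairing[OF ta lf lV, symmetric])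
 also have "... = \<i> * hbar * ?E"
  unfolding integral_mult_right_zero[symmetric] using h by (intro icong refl) (simp add: field_simps)
 also have "?E = ?A"
  unfolding pot_def bl_mulL[OF pot_bddm[OF h(1)]] mulL_abs[OF pot_bddm[OF h(1)] l12_sq[OF lp]] w
  by (rule bl_abs[OF op_basic(1)[OF ta lf] bddm_sq[OF pot_bddm[OF h(1)] l12_sq[OF lp]], symmetric])
 finally have V: "?D = \<i> * hbar * ?A" .
 let ?B = "LBINT z. kern ?ta z * (f (snd z) * g (fst z))"
 let ?C = "LBINT z. rm ?ta z * (kern ?ta z * (f (snd z) * ?p (fst z)))"
 let ?H = "B0 * ?ta ^ N * l2n ?p"
 have "\<i> * hbar * F' = (LBINT z. kern ?ta z * (f (snd z) * (of_real (V r (fst z)) * ?p (fst z))) + kern ?ta z * (f (snd z) * g (fst z)) + rm ?ta z * (?I z))"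
  unfolding F' g_def by (intro icong refl) (simp add: algebra_simps)
 also have "... = \<i> * hbar * ?A + (?B + ?C)"
  unfolding V[symmetric] using iV ig ir by simp
 finally have "\<i> * hbar * (F' - ?A) = ?B + ?C"
  by (simp add: right_diff_distrib)
 hence "hbar * cmod (F' - ?A) = cmod (?B + ?C)"
  using h arg_cong[of _ _ cmod] norm_mult[of "\<i> * of_real hbar" "F' - ?A"]
  by (simp only: norm_mult norm_ii norm_of_real mult_1_left abs_of_pos)
 also have "... <= ?c * 1 * l2n f * ?H + ?c * ?G * l2n f * l2n ?p"
 proof (rule norm_triangle_le[OF add_mono])
  have "cmod ?B <= ?c * 1 * l2n f * l2n g" using kern_bound[OF ta ccls_one lf lg(1)] by simp
  also have "... <= ?c * 1 * l2n f * ?H" using CK_pos[of T] l2n_nonneg[of f] by (intro mult_left_mono lg(2)) simp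
  finally show "cmod ?B <= ?c * 1 * l2n f * ?H" .
  show "cmod ?C <= ?c * ?G * l2n f * l2n ?p"
   using kern_bound[OF ta rm_ccls[OF ta] lf lp] by (simp add: mult.assoc mult.left_commute)
 qed
 also have "... = K1 T * ?ta ^ N * l2n f * norm (combL ps)" unfolding pn K1_def by (simp add: algebra_simps)
 finally show ?thesis using h by (simp add: field_simps)
qed

text \<open>\<open>gronwall_dual\<close> for the difference of the two evolutions. As r tends to s
  both pairings approach the same limit: the exact one by continuity, the approximate one by
  \<open>kern_small\<close> and \<open>heat_pairing\<close>.\<close>

lemma short_time_error_comb:
 assumes T: "0 < T" and t1: "s < t1" "t1 - s <= T * hbar" and qs: "okc qs"
 shows "norm (approx_propagator N hbar V t1 s (combL qs) - propagator hbar V t1 s (combL qs)) <= Err T * (t1 - s) ^ Suc N / hbar * norm (combL qs)"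
proof -
 let ?f = "comb qs" and ?T = "2 * T"
 have f: "?f \<in> schwartz" by (rule gp_schwartz[OF gp_comb[OF qs]])
 have lf: "l12 ?f" by (rule schwartz_basic(4)[OF f])
 let ?A = "norm (combL qs)"
 have fn: "l2n ?f = ?A" using norm_abs[OF l12_sq[OF lf]] by simp
 have Th: "T * hbar < ?T * hbar" using T h by simp
 define E where "E r = abs_L2 (op (r - s) ?f)" for r
 define U where "U r = propagator hbar V r s (combL qs)" for r
 have near: "0 < r - s" "r - s <= ?T * hbar" if "s < r" "r < s + ?T * hbar" for r using that by auto
 have near1: "r < s + ?T * hbar" if "r <= t1" for r using that t1 Th by linarith
 have wU: "weak_sol hbar U" "U s = combL qs" "!!r. norm (U r) = ?A" unfolding U_def by (rule propagator_solution[OF h(1)])+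
 have lp: "l12 (wave t ps r)" if "okc ps" for t ps r by (rule schwartz_basic(4)[OF gp_schwartz[OF gp_comb]]) (simp add: that)
 let ?F = "%t r ps. combL (shift (hbar / 2 * (t - r)) ps)"
 have blE: "bl (E r) (?F t r ps) = (LBINT z. kern (r - s) z * (?f (snd z) * wave t ps r (fst z)))"
  if "s < r" "r < s + ?T * hbar" "okc ps" for r t ps unfolding E_def bl_abs[OF op_basic(1)[OF near[OF that(1,2)] lf] l12_sq[OF lp[OF that(3)]]]
  by (rule op_pairing[OF near[OF that(1,2)] lf lp[OF that(3)]])
 let ?M = "CK ?T * exp (Am ?T * ?T)"
 have "norm (E t1 - U t1) <= 2 * (K1 ?T * (t1 - s) ^ N / hbar * ?A) * (t1 - s) * exp (2 * ((B0 + 1) / hbar) * (t1 - s))"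
 proof (rule gronwall_dual[OF t1(1), where c="hbar / 2" and d="%r. E r - U r" and M="?M * l2n ?f + ?A"])
  show "0 < (B0 + 1) / hbar" using B0_nonneg h by simp
  show "0 <= K1 ?T * (t1 - s) ^ N / hbar * ?A" using K1_nonneg[of ?T] t1 h by simp
  show "norm (E r - U r) <= ?M * l2n ?f + ?A" if "s < r" "r <= t1" for r
  proof -
   note n = near[OF that(1) near1[OF that(2)]]
   have "norm (E r) <= ?M * l2n ?f" unfolding E_def norm_abs[OF op_basic(1)[OF n lf]] by (rule op_basic(2)[OF n lf])
   thus ?thesis using norm_triangle_ineq4[of "E r" "U r"] wU(3)[of r] by simp
  qed
  fix t and ps :: "(complex \<times> complex \<times> (real^'n)) list" assume ps: "okc ps"
  define b where "b = bl (combL qs) (combL (shift (hbar / 2 * (t - s)) ps))"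
  let ?B = "norm (combL ps)"
  have small: "cmod (bl (E r) (?F t r ps) - b) <= CK ?T * (exp (Am ?T * (r - s) / hbar) - 1) * l2n ?f * ?B"
   if r: "s < r" "r < s + ?T * hbar" for r
  proof -
   note n = near[OF r]
   have "shift (hbar * (r - s) / 2) (shift (hbar / 2 * (t - r)) ps) = shift (hbar / 2 * (t - s)) ps" by (simp add: algebra_simps diff_divide_distrib)
   hence "(LBINT z. heat (zt (r - s)) (fst z - snd z) * (?f (snd z) * wave t ps r (fst z))) = b"
    using heat_pairing[OF n lf, of "shift (hbar / 2 * (t - r)) ps"] ps bl_abs[OF l12_sq[OF lf] l12_sq[OF lp[OF ps, of t s]]] by (simp add: b_def)
   moreover have "l2n (wave t ps r) = ?B" using norm_abs[OF l12_sq[OF lp[OF ps]], of t r] norm_comb_shift[OF ps] by simp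
   ultimately show ?thesis using kern_small(1)[OF n lf lp[OF ps, of t r]] unfolding blE[OF r ps] by simp
  qed
  let ?E = "%r. CK ?T * (exp (Am ?T * (r - s) / hbar) - 1) * l2n ?f * ?B"
  have "(?E \<longlongrightarrow> CK ?T * (exp (Am ?T * (s - s) / hbar) - 1) * l2n ?f * ?B) (at_right s)"
   using h by (intro tendsto_intros) auto
  hence z: "(?E \<longlongrightarrow> 0) (at_right s)" by simp
  have "\<forall>\<^sub>F r in at_right s. s < r \<and> r < s + ?T * hbar" using eventually_at_right_real[of s "s + ?T * hbar"] T h by simp
  hence "((%r. bl (E r) (?F t r ps) - b) \<longlongrightarrow> 0) (at_right s)"
   by (intro Lim_null_comparison[OF _ z], elim eventually_mono) (rule small; simp)
  moreover have "((%r. bl (U r) (?F t r ps) - b) \<longlongrightarrow> 0) (at_right s)"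
  proof (rule LIM_zero)
   let ?C = "(%r. bl (U r) (combL (shift (hbar / 2 * (t - r)) ps))) \<longlongrightarrow> b"
   have "?C (at s)"
    using has_vector_derivative_continuous[OF weak_sol_pairing[OF h(1) wU(1) ps, of t s]] by (simp add: isCont_def wU(2) b_def)
   thus "?C (at_right s)" by (rule tendsto_within_subset) simp
  qed
  ultimately show "((%r. bl (E r - U r) (?F t r ps)) \<longlongrightarrow> 0) (at_right s)"
   using tendsto_diff[of "%r. bl (E r) (?F t r ps) - b" 0 "at_right s"] by (simp add: bl.diff_left) fastforce
  fix r assume r: "s < r" "r <= t1"
  note r' = r(1) near1[OF r(2)]
  let ?p = "combL (shift (hbar / 2 * (t - r)) ps)"
  obtain F' where F': "((%r. \<integral>z. kern (r - s) z * (?f (snd z) * wave t ps r (fst z)) \<partial>lborel) hvd F') (at r)"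
   "\<i> * hbar * F' = (LBINT z. (of_real (Vs (r - s) (fst z)) + rm (r - s) z) * (kern (r - s) z * (?f (snd z) * wave t ps r (fst z))))"
   using kern_pairing_derivative[OF ps f r(1), of t] by blast
  have dE: "((%r. bl (E r) (?F t r ps)) hvd F') (at r)"
   by (rule has_vector_derivative_transform_within_open[OF F'(1) open_greaterThanLessThan[of s "s + ?T * hbar"]]) (use r' blE ps in auto)
  have pn: "norm ?p = ?B" by (rule norm_comb_shift[OF ps])
  let ?D = "(B0 + 1) / hbar * norm (E r - U r) + K1 ?T * (t1 - s) ^ N / hbar * ?A"
  have "cmod (F' - bl (pot hbar r (U r)) ?p) <= cmod (bl (pot hbar r (E r - U r)) ?p) + cmod (F' - bl (pot hbar r (E r)) ?p)"
   using norm_triangle_ineq[of "bl (pot hbar r (E r - U r)) ?p" "F' - bl (pot hbar r (E r)) ?p"]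
   by (simp add: linear_diff[OF bounded_linear.linear[OF pot_linear[OF h(1)]]] bl.diff_left)
  also have "... <= B0 / hbar * norm (E r - U r) * ?B + K1 ?T * (r - s) ^ N / hbar * l2n ?f * ?B"
   by (intro add_mono order_trans[OF norm_bl[of _ ?p, unfolded pn] mult_right_mono[OF norm_pot[OF h(1)]]]
     defect_derivative[OF r(1) near(2)[OF r'] f ps E_def F'(2)]) simp
  also have "... <= ?D * ?B" unfolding fn distrib_right
   using r h K1_nonneg[of ?T] by (intro add_mono mult_right_mono mult_left_mono divide_right_mono power_mono) auto
  finally have "cmod (F' - bl (pot hbar r (U r)) ?p) <= ?D * ?B" .
  thus "\<exists>D. ((%r. bl (E r - U r) (?F t r ps)) hvd D) (at r) \<and>
    cmod D <= ((B0 + 1) / hbar * norm (E r - U r) + K1 ?T * (t1 - s) ^ N / hbar * ?A) * ?B"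
   using has_vector_derivative_diff[OF dE weak_sol_pairing[OF h(1) wU(1) ps, of t r]] unfolding bl.diff_left by blast
 qed
 also have "... <= 2 * (K1 ?T * (t1 - s) ^ N / hbar * ?A) * (t1 - s) * exp (2 * (B0 + 1) * T)"
 proof (rule mult_left_mono)
  have "(t1 - s) / hbar <= T" using t1 h by (simp add: field_simps)
  from mult_left_mono[OF this, of "2 * (B0 + 1)"] B0_nonneg show "exp (2 * ((B0 + 1) / hbar) * (t1 - s)) <= exp (2 * (B0 + 1) * T)" by simp
 qed (use K1_nonneg[of ?T] t1 h in simp)
 also have "... = Err T * (t1 - s) ^ Suc N / hbar * ?A" by (simp add: Err_def mult_ac)
 finally show ?thesis using approx_propagator_op(2)[OF t1 lf] by (simp add: E_def U_def)
qed

lemma short_time_error: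
 assumes "0 < T" "s < t1" "t1 - s <= T * hbar"
 shows "norm (approx_propagator N hbar V t1 s u - propagator hbar V t1 s u) <= Err T * (t1 - s) ^ Suc N / hbar * norm u"
proof (rule gauss_le[where f="%u. norm (approx_propagator N hbar V t1 s u - propagator hbar V t1 s u)" and g="%u. Err T * (t1 - s) ^ Suc N / hbar * norm u"])
 show "cts (%u. norm (approx_propagator N hbar V t1 s u - propagator hbar V t1 s u))"
  by (intro continuous_on_norm continuous_on_diff linear_continuous_on approx_propagator_op(1)[OF assms(2,3)] propagator_linear[OF h(1)])
 show "cts (%u :: 'n L2. Err T * (t1 - s) ^ Suc N / hbar * norm u)" by (intro continuous_intros)
qed (rule short_time_error_comb[OF assms])

end

text \<open>The approximate steps need not be contractions, so the norm of their product is bounded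
  by that of the exact evolution plus the error accumulated so far, together exp(S) |u|. The
  recursion closes by 1 + de <= exp(de).\<close>

lemma (in potential) composed_error:
 assumes h: "0 < hbar" and C: "0 <= C"
  and E: "!!j. j < L ==> bounded_linear (approx_propagator N hbar V (\<Omega> (Suc j)) (\<Omega> j))"
  and err: "!!j u. j < L ==> norm (approx_propagator N hbar V (\<Omega> (Suc j)) (\<Omega> j) u - propagator hbar V (\<Omega> (Suc j)) (\<Omega> j) u) <= de j * norm u"
  and de: "!!j. 0 <= de j"
 shows "bounded_linear (composed_propagator N hbar V \<Omega> L) \<and> (\<forall>u. norm (composed_propagator N hbar V \<Omega> L u - propagator hbar V (\<Omega> L) (\<Omega> 0) u) <= (exp (\<Sum>j<L. de j) - 1) * norm u)"
 using E err
proof (induction L)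
 case 0
 thus ?case by (simp add: propagator_solution(2)[OF h] id_def)
next
 case (Suc L)
 let ?c = "composed_propagator N hbar V \<Omega> L" and ?S = "\<Sum>j<L. de j"
 let ?A = "approx_propagator N hbar V (\<Omega> (Suc L)) (\<Omega> L)" and ?U = "propagator hbar V (\<Omega> (Suc L)) (\<Omega> L)"
 have IH: "bounded_linear ?c" "!!u. norm (?c u - propagator hbar V (\<Omega> L) (\<Omega> 0) u) <= (exp ?S - 1) * norm u" using Suc by auto
 let ?D = "%u. propagator hbar V (\<Omega> (Suc L)) (\<Omega> 0) u"
 have "norm (?A (?c u) - ?D u) <= (exp (?S + de L) - 1) * norm u" for u
 proof -
  let ?B = "propagator hbar V (\<Omega> L) (\<Omega> 0) u"
  have co: "?U (?B) = ?D u"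
   by (rule propagator_eq[OF h propagator_solution(1)[OF h]])
  let ?C = "?A (?c u) - ?U (?c u)"
  have "?A (?c u) - ?D u = ?C + ?U (?c u - ?B)"
   unfolding linear_diff[OF bounded_linear.linear[OF propagator_linear[OF h]]] co by simp
  hence "norm (?A (?c u) - ?D u) <= norm ?C + norm (?c u - ?B)"
   using norm_triangle_ineq[of "?A (?c u) - ?U (?c u)" "?U (?c u - ?B)"] by (simp only: propagator_solution(3)[OF h])
  also have "norm ?C <= de L * norm (?c u)" by (rule Suc(3)) simp
  also have "norm (?c u) <= exp ?S * norm u"
   using norm_triangle_sub[of "?c u" "?B"] IH(2)[of u] propagator_solution(3)[OF h] by (simp add: left_diff_distrib)
  finally have "norm (?A (?c u) - ?D u) <= de L * (exp ?S * norm u) + (exp ?S - 1) * norm u"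
   using IH(2)[of u] de[of L] by (simp add: mult_left_mono)
  also have "... = (exp ?S * (1 + de L) - 1) * norm u" by (simp add: algebra_simps)
  also have "... <= (exp ?S * exp (de L) - 1) * norm u" by (intro mult_right_mono diff_right_mono mult_left_mono exp_ge_add_one_self) auto
  finally show ?thesis by (simp add: exp_add)
 qed
 moreover have "bounded_linear (?A \<circ> ?c)" using bounded_linear_compose[OF Suc(2) IH(1)] by (simp add: o_def)
 ultimately show ?case by (simp add: o_def)
qed

lemma subdivision_steps:
 assumes "is_subdivision \<Omega> L s t"
 shows "!!j. j < L ==> \<Omega> j < \<Omega> (Suc j)" "!!j. j < L ==> \<Omega> (Suc j) - \<Omega> j <= mesh \<Omega> L" "mesh \<Omega> L <= t - s"
  "(\<Sum>j<L. \<Omega> (Suc j) - \<Omega> j) = t - s"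
proof -
 have L: "1 <= L" and e: "\<Omega> 0 = s" "\<Omega> L = t" and st: "!!j. j \<in> {1..L} ==> \<Omega> (j - 1) < \<Omega> j"
  using assms by (auto simp: is_subdivision_def)
 show s: "\<Omega> j < \<Omega> (Suc j)" if "j < L" for j using st[of "Suc j"] that by simp
 show "\<Omega> (Suc j) - \<Omega> j <= mesh \<Omega> L" if "j < L" for j
  unfolding mesh_def using cSUP_upper[of "Suc j" "{1..L}" "%j. \<Omega> j - \<Omega> (j - 1)"] that by simp
 show sum: "(\<Sum>j<L. \<Omega> (Suc j) - \<Omega> j) = t - s" unfolding sum_lessThan_telescope e ..
 show "mesh \<Omega> L <= t - s" unfolding mesh_def
 proof (rule cSUP_least)
  fix j assume j: "j \<in> {1..L}"
  have "\<Omega> (Suc (j - 1)) - \<Omega> (j - 1) <= (\<Sum>j<L. \<Omega> (Suc j) - \<Omega> j)"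
   by (rule member_le_sum) (use j s in \<open>auto intro: less_imp_le\<close>)
  thus "\<Omega> j - \<Omega> (j - 1) <= t - s" using j sum by simp
 qed (use L in simp)
qed

theorem theorem1p1:
  fixes g :: "real^'n \<Rightarrow> complex" and V :: "real \<Rightarrow> real^'n \<Rightarrow> real" and N :: nat
  assumes "g \<in> schwartz" and "g \<noteq> (\<lambda>x. 0)"
    and "1 \<le> N"
    and "admissible_potential g N V"
  shows "\<forall>T>0. \<exists>C>0. \<forall>hbar s t \<Omega> L.
           0 < hbar \<and> hbar \<le> 1 \<and> s < t \<and> t - s \<le> T * hbar \<and> is_subdivision \<Omega> L s t \<longrightarrow>
             bounded_linear (\<lambda>u. composed_propagator N hbar V \<Omega> L u - propagator hbar V t s u) \<and>
             onorm (\<lambda>u. composed_propagator N hbar V \<Omega> L u - propagator hbar V t s u)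
               \<le> C * mesh \<Omega> L ^ N"
proof (intro allI impI)
 fix T :: real assume T: "0 < T"
 obtain D B0 where "potential V N D B0" using admissible_imp_potential[OF assms] by blast
 then interpret potential V N D B0 .
 obtain B where B: "0 <= B" "!!k s hbar. k <= N ==> 0 < hbar ==> hbar <= 1 ==> good (2 * N - 2 * (k - 1)) B (aW hbar s k)"
  using W_good[of thesis] by blast
 have sl: "slice V N D B0 B hbar s" if "0 < hbar" "hbar <= 1" for hbar s
 proof (unfold_locales)
  show "good 2 B (aW hbar s k)" if "k <= N" for k by (rule good_le[OF B(2)]) (use that N \<open>0 < hbar\<close> \<open>hbar <= 1\<close> in auto)
 qed (use that B(1) in auto)
 \<comment> \<open>\<open>Err\<close> depends on N, \<open>B\<close>, \<open>B0\<close>, the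
   dimension and T, but not on the initial time or hbar; the instance hbar = 1, s = 0 names a
   constant valid for all of them.\<close>
 interpret S1: slice V N D B0 B 1 0 by (rule sl) auto
 define K where "K = S1.Err T + 1"
 have K: "0 < K" "S1.Err T <= K" unfolding K_def S1.Err_def using S1.K1_nonneg[of "2 * T"] by (auto intro: add_nonneg_pos)
 \<comment> \<open>From exp(x) - 1 <= x exp(x) with x <= K T omega^N; in the exponential omega is
   replaced by T, which is possible because omega <= T hbar and hbar <= 1.\<close>
 define C where "C = K * T * exp (K * T * T ^ N)"
 let ?B = "%hbar. composed_propagator N hbar V"
 show "\<exists>C>0. \<forall>hbar s t \<Omega> L. 0 < hbar \<and> hbar <= 1 \<and> s < t \<and> t - s <= T * hbar \<and> is_subdivision \<Omega> L s t \<longrightarrow>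
   bounded_linear (%u. ?B hbar \<Omega> L u - propagator hbar V t s u) \<and>
   onorm (%u. ?B hbar \<Omega> L u - propagator hbar V t s u) <= C * mesh \<Omega> L ^ N"
 proof (intro exI[of _ C] conjI allI impI, goal_cases)
  case 1 show ?case using K T by (simp add: C_def)
 next
  have main: "bounded_linear (%u. ?B hbar \<Omega> L u - propagator hbar V t s u) \<and>
    onorm (%u. ?B hbar \<Omega> L u - propagator hbar V t s u) <= C * mesh \<Omega> L ^ N"
   if a: "0 < hbar \<and> hbar <= 1 \<and> s < t \<and> t - s <= T * hbar \<and> is_subdivision \<Omega> L s t" for hbar s t \<Omega> L
  proof -
   have h: "0 < hbar" "hbar <= 1" and st: "s < t" "t - s <= T * hbar" and sub: "is_subdivision \<Omega> L s t" using a by auto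
   note step = subdivision_steps[OF sub]
   define om where "om = mesh \<Omega> L"
   \<comment> \<open>The absolute value makes the step errors nonnegative also for indices beyond
     the subdivision, as \<open>composed_error\<close> demands.\<close>
   define d where "d j = \<bar>\<Omega> (Suc j) - \<Omega> j\<bar>" for j
   have e: "\<Omega> 0 = s" "\<Omega> L = t" "0 < L" using sub by (auto simp: is_subdivision_def)
   have w: "0 < om" "om <= T * hbar" using step(1,2)[of 0] step(3) e(3) st by (auto simp: om_def)
   have "T * hbar <= T * 1" using h T by (intro mult_left_mono) auto
   with w(2) have wT: "om <= T" by linarith
   have dj: "d j = \<Omega> (Suc j) - \<Omega> j" "d j <= om" "0 <= d j" if "j < L" for j using step(1,2)[OF that] by (auto simp: d_def om_def)
   have jT: "\<Omega> (Suc j) - \<Omega> j <= T * hbar" if "j < L" for j using step(2)[OF that] w by (simp add: om_def)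
   define de where "de j = K * d j ^ Suc N / hbar" for j
   have c: "bounded_linear (?B hbar \<Omega> L) \<and> (\<forall>u. norm (?B hbar \<Omega> L u - propagator hbar V (\<Omega> L) (\<Omega> 0) u) <= (exp (\<Sum>j<L. de j) - 1) * norm u)"
   proof (rule composed_error[OF h(1)])
    fix j and u :: "'n L2" assume j: "j < L"
    interpret S: slice V N D B0 B hbar "\<Omega> j" by (rule sl[OF h])
    show "bounded_linear (approx_propagator N hbar V (\<Omega> (Suc j)) (\<Omega> j))" by (rule S.approx_propagator_op[OF step(1)[OF j] jT[OF j]])
    have "S1.Err T * (\<Omega> (Suc j) - \<Omega> j) ^ Suc N / hbar * norm u <= de j * norm u"
     unfolding de_def dj(1)[OF j] using K(2) step(1)[OF j] h by (intro mult_right_mono divide_right_mono) auto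
    thus "norm (approx_propagator N hbar V (\<Omega> (Suc j)) (\<Omega> j) u - propagator hbar V (\<Omega> (Suc j)) (\<Omega> j) u) <= de j * norm u"
     using S.short_time_error[OF T step(1)[OF j] jT[OF j], of u] by simp
   qed (use K h in \<open>auto simp: de_def d_def\<close>)
   let ?S = "\<Sum>j<L. de j"
   have "?S <= (\<Sum>j<L. K * om ^ N / hbar * d j)"
   proof (rule sum_mono)
    fix j assume "j \<in> {..<L}"
    hence "d j ^ N <= om ^ N" "0 <= d j" using dj[of j] by (auto intro: power_mono)
    from mult_right_mono[OF this] have "d j ^ Suc N <= om ^ N * d j" by (simp add: mult.commute)
    from mult_left_mono[OF this, of "K / hbar"] show "de j <= K * om ^ N / hbar * d j" using K h by (simp add: de_def mult_ac)
   qed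
   also have "... = K * om ^ N / hbar * (t - s)"
    unfolding step(4)[symmetric] sum_distrib_left[symmetric] by (intro arg_cong2[where f="(*)"] refl sum.cong) (simp add: dj(1))
   also have "... = K * om ^ N * ((t - s) / hbar)" by simp
   also have "... <= K * om ^ N * T" using K w st h by (intro mult_left_mono) (auto simp: field_simps)
   finally have S: "?S <= K * T * om ^ N" by (simp add: mult_ac)
   also have "... <= K * T * T ^ N" using K T w wT by (intro mult_left_mono power_mono) auto
   finally have S2: "?S <= K * T * T ^ N" .
   have S0: "0 <= ?S" using K h by (intro sum_nonneg) (simp add: de_def d_def)
   have "exp ?S - 1 = exp ?S * (1 - exp (- ?S))" by (simp add: right_diff_distrib exp_add[symmetric])
   also have "... <= exp ?S * ?S" using exp_ge_add_one_self[of "- ?S"] by (intro mult_left_mono) auto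
   also have "... <= exp (K * T * T ^ N) * (K * T * om ^ N)" using S S2 S0 by (intro mult_mono) auto
   finally have x: "exp ?S - 1 <= C * om ^ N" by (simp add: C_def mult_ac)
   show ?thesis
   proof
    show "bounded_linear (%u. ?B hbar \<Omega> L u - propagator hbar V t s u)"
     using c propagator_linear[OF h(1)] by (intro bounded_linear_sub) auto
    show "onorm (%u. ?B hbar \<Omega> L u - propagator hbar V t s u) <= C * mesh \<Omega> L ^ N"
    proof (rule onorm_bound)
     show "0 <= C * mesh \<Omega> L ^ N" using K T w by (simp add: C_def om_def)
     fix u
     let ?A = "norm (composed_propagator N hbar V \<Omega> L u - propagator hbar V t s u)"
     have "?A <= (exp ?S - 1) * norm u" using c by (simp add: e)
     also have "... <= C * om ^ N * norm u" by (intro mult_right_mono x) simp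
     finally show "?A <= C * mesh \<Omega> L ^ N * norm u" by (simp add: om_def)
    qed
   qed
  qed
  case (2 hbar s t \<Omega> L) thus ?case using main by blast
  case (3 hbar s t \<Omega> L) thus ?case using main by blast
 qed
qed

end
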